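(* Let $m,n\ge 3$ be integers with $m+n=N+1\ge 8$ and let $a_\star>0$ be a constant. Let $\Sigma$ be one of the two minimal hypersurfaces $\Sigma^+_{m,n},\Sigma^-_{m,n}\subset\mathbb{R}^{N+1}$. Then there exists $\delta_*>0$ small such that, for every $0<\delta\le\delta_*$, the equation $$\delta\big(\Delta_\Sigma w+|A_\Sigma|^2 w\big)=2a_\star e^{-\sqrt2\, w}\quad\text{on }\Sigma$$ has a smooth solution $w:\Sigma\to\mathbb{R}$ which is $O(m)\times O(n)$-invariant.
   Context: Points of $\mathbb{R}^{N+1}=\mathbb{R}^m\times\mathbb{R}^n$ are written $(x,y)$. The Lawson cone is $C_{m,n}=\{(x,y):|x|^2=\frac{m-1}{n-1}|y|^2\}$, and $E^+_{m,n}=\{|x|^2<\frac{m-1}{n-1}|y|^2\}$, $E^-_{m,n}=\{|x|^2>\frac{m-1}{n-1}|y|^2\}$ are the two components of its complement. For $m,n\ge3$, $m+n\ge8$, it is known that there are two unique minimal hypersurfaces $\Sigma^\pm_{m,n}\subset E^\pm_{m,n}$ which are asymptotic to $C_{m,n}$ at infinity (outside a ball they are normal graphs over $C_{m,n}$ of a function decaying at infinity) and have distance $1$ from the origin; they are smooth and invariant under the action of $O(m)\times O(n)$. $\Delta_\Sigma$ is the Laplace-Beltrami operator of $\Sigma$ and $|A_\Sigma|$ is the norm of its second fundamental form. A function on $\Sigma$ is $O(m)\times O(n)$-invariant if it is invariant under the action of $O(m)\times O(n)$ on $\mathbb{R}^m\times\mathbb{R}^n$. *)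

theory Defs
  imports "HOL-Analysis.Analysis"
begin

section \<open>Smooth maps\<close>

text \<open>Intended for open \<open>U\<close>; in finite dimension, continuity of all directional
  derivatives of order up to \<open>k\<close> is the same as being of class \<open>C\<^sup>k\<close>.\<close>

primrec Ck_on :: "nat \<Rightarrow> 'a::euclidean_space set \<Rightarrow> ('a \<Rightarrow> 'b::real_normed_vector) \<Rightarrow> bool" where
  "Ck_on 0 U f \<longleftrightarrow> continuous_on U f"
| "Ck_on (Suc k) U f \<longleftrightarrow>
     (\<forall>x\<in>U. f differentiable (at x)) \<and> (\<forall>v. Ck_on k U (\<lambda>x. frechet_derivative f (at x) v))"

text \<open>Smoothness of a map on an arbitrary subset of Euclidean space (in particular on an
  embedded hypersurface), in the sense of local smooth extensions to open sets.\<close>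

definition smooth_fun_on :: "'a::euclidean_space set \<Rightarrow> ('a \<Rightarrow> 'b::real_normed_vector) \<Rightarrow> bool" where
  "smooth_fun_on S f \<longleftrightarrow>
     (\<forall>p\<in>S. \<exists>U g. open U \<and> p \<in> U \<and> (\<forall>k. Ck_on k U g) \<and> (\<forall>q\<in>S \<inter> U. f q = g q))"


section \<open>Geometry of embedded hypersurfaces\<close>

text \<open>No boundary is allowed, but \<open>S\<close> need not be closed in the ambient space.\<close>

definition smooth_hypersurface :: "'a::euclidean_space set \<Rightarrow> bool" where
  "smooth_hypersurface S \<longleftrightarrow>
     (\<forall>p\<in>S. \<exists>U (f :: 'a \<Rightarrow> real). open U \<and> p \<in> U \<and> (\<forall>k. Ck_on k U f) \<and>
        (\<forall>q\<in>U. \<exists>v. frechet_derivative f (at q) v \<noteq> 0) \<and> S \<inter> U = {q \<in> U. f q = 0})"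

definition tangent_space :: "'a::euclidean_space set \<Rightarrow> 'a \<Rightarrow> 'a set" where
  "tangent_space S p =
     {v. \<exists>\<gamma> :: real \<Rightarrow> 'a. (\<forall>t. \<gamma> t \<in> S) \<and> \<gamma> 0 = p \<and> (\<gamma> has_vector_derivative v) (at 0)}"

text \<open>The derivative of a map given on \<open>S\<close> is taken as a derivative within \<open>S\<close>. It is not
  unique as a linear map on the ambient space, but its values on tangent vectors are; below
  \<open>frechet_derivative F (at p within S)\<close> is only ever applied to tangent vectors.\<close>

lemma has_derivative_within_unique_on_tangent_space:
  assumes "(F has_derivative D1) (at p within S)" "(F has_derivative D2) (at p within S)"
    and "v \<in> tangent_space S p"
  shows "D1 v = D2 v"
proof -
  obtain \<gamma> :: "real \<Rightarrow> 'a" where g: "\<And>t. \<gamma> t \<in> S" "\<gamma> 0 = p" "(\<gamma> has_vector_derivative v) (at 0)"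
    using assms(3) unfolding tangent_space_def by blast
  have d: "((\<lambda>t. F (\<gamma> t)) has_derivative (\<lambda>h. D (h *\<^sub>R v))) (at 0)"
    if "(F has_derivative D) (at p within S)" for D
  proof (rule has_derivative_in_compose[of \<gamma> "\<lambda>h. h *\<^sub>R v" 0 UNIV F D])
    show "(\<gamma> has_derivative (\<lambda>h. h *\<^sub>R v)) (at 0)"
      using g(3) by (simp add: has_vector_derivative_def)
    show "(F has_derivative D) (at (\<gamma> 0) within range \<gamma>)"
      using that g by (auto intro: has_derivative_subset)
  qed
  have "(\<lambda>h. D1 (h *\<^sub>R v)) = (\<lambda>h::real. D2 (h *\<^sub>R v))"
    using d[OF assms(1)] d[OF assms(2)] by (rule has_derivative_unique)
  then have "D1 (1 *\<^sub>R v) = D2 (1 *\<^sub>R v)" by meson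
  then show ?thesis by simp
qed

text \<open>An arbitrarily chosen orthonormal basis of the tangent space; it is only used in
  basis-independent sums.\<close>

definition tangent_onb :: "'a::euclidean_space set \<Rightarrow> 'a \<Rightarrow> 'a set" where
  "tangent_onb S p =
     (SOME B. pairwise orthogonal B \<and> (\<forall>e\<in>B. norm e = 1) \<and> span B = tangent_space S p)"

definition surface_gradient ::
  "'a::euclidean_space set \<Rightarrow> ('a \<Rightarrow> real) \<Rightarrow> 'a \<Rightarrow> 'a" where
  "surface_gradient S w p =
     (\<Sum>e\<in>tangent_onb S p. frechet_derivative w (at p within S) e *\<^sub>R e)"

definition surface_divergence ::
  "'a::euclidean_space set \<Rightarrow> ('a \<Rightarrow> 'a) \<Rightarrow> 'a \<Rightarrow> real" where
  "surface_divergence S X p =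
     (\<Sum>e\<in>tangent_onb S p. frechet_derivative X (at p within S) e \<bullet> e)"

definition laplace_beltrami ::
  "'a::euclidean_space set \<Rightarrow> ('a \<Rightarrow> real) \<Rightarrow> 'a \<Rightarrow> real" where
  "laplace_beltrami S w p = surface_divergence S (surface_gradient S w) p"

definition unit_normal_field :: "'a::euclidean_space set \<Rightarrow> ('a \<Rightarrow> 'a) \<Rightarrow> bool" where
  "unit_normal_field S \<nu> \<longleftrightarrow> smooth_fun_on S \<nu> \<and>
     (\<forall>q\<in>S. norm (\<nu> q) = 1 \<and> (\<forall>v\<in>tangent_space S q. \<nu> q \<bullet> v = 0))"

text \<open>A unit normal field near \<open>p\<close>, hence determined near \<open>p\<close> up to sign. The quantities used
  later (vanishing of the mean curvature, norm of the second fundamental form) do not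
  depend on that sign.\<close>

definition local_unit_normal :: "'a::euclidean_space set \<Rightarrow> 'a \<Rightarrow> 'a \<Rightarrow> 'a" where
  "local_unit_normal S p =
     (SOME \<nu>. \<exists>U. open U \<and> p \<in> U \<and> unit_normal_field (S \<inter> U) \<nu>)"

definition second_fundamental_form ::
  "'a::euclidean_space set \<Rightarrow> 'a \<Rightarrow> 'a \<Rightarrow> 'a \<Rightarrow> real" where
  "second_fundamental_form S p u v =
     - (frechet_derivative (local_unit_normal S p) (at p within S) u \<bullet> v)"

definition second_fundamental_form_norm :: "'a::euclidean_space set \<Rightarrow> 'a \<Rightarrow> real" where
  "second_fundamental_form_norm S p =
     sqrt (\<Sum>e\<in>tangent_onb S p. \<Sum>e'\<in>tangent_onb S p. (second_fundamental_form S p e e')\<^sup>2)"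

definition mean_curvature :: "'a::euclidean_space set \<Rightarrow> 'a \<Rightarrow> real" where
  "mean_curvature S p = (\<Sum>e\<in>tangent_onb S p. second_fundamental_form S p e e)"

text \<open>Minimal hypersurfaces are understood to be properly embedded (closed, without boundary).\<close>

definition minimal_hypersurface :: "'a::euclidean_space set \<Rightarrow> bool" where
  "minimal_hypersurface S \<longleftrightarrow>
     smooth_hypersurface S \<and> closed S \<and> (\<forall>p\<in>S. mean_curvature S p = 0)"

text \<open>\<open>S\<close> is, outside a ball, a normal graph over \<open>C\<close> of a function decaying at infinity. The part
  of \<open>C\<close> near the origin is left out, since \<open>C\<close> may be singular there.\<close>

definition asymptotic_at_infinity :: "'a::euclidean_space set \<Rightarrow> 'a set \<Rightarrow> bool" where
  "asymptotic_at_infinity S C \<longleftrightarrow>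
     (\<exists>\<rho>>0. \<exists>R>0. \<exists>\<nu> (\<phi> :: 'a \<Rightarrow> real).
        unit_normal_field (C - cball 0 \<rho>) \<nu> \<and> smooth_fun_on (C - cball 0 \<rho>) \<phi> \<and>
        (\<phi> \<longlongrightarrow> 0) (inf at_infinity (principal C)) \<and>
        S - cball 0 R = (\<lambda>p. p + \<phi> p *\<^sub>R \<nu> p) ` (C - cball 0 \<rho>) - cball 0 R)"


section \<open>The Lawson cones and the associated minimal hypersurfaces\<close>

definition lawson_cone :: "((real^'m) \<times> (real^'n)) set" where
  "lawson_cone = {(x, y).
     (norm x)\<^sup>2 = (real CARD('m) - 1) / (real CARD('n) - 1) * (norm y)\<^sup>2}"

definition lawson_plus :: "((real^'m) \<times> (real^'n)) set" where
  "lawson_plus = {(x, y).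
     (norm x)\<^sup>2 < (real CARD('m) - 1) / (real CARD('n) - 1) * (norm y)\<^sup>2}"

definition lawson_minus :: "((real^'m) \<times> (real^'n)) set" where
  "lawson_minus = {(x, y).
     (norm x)\<^sup>2 > (real CARD('m) - 1) / (real CARD('n) - 1) * (norm y)\<^sup>2}"

definition O_invariant_set :: "((real^'m) \<times> (real^'n)) set \<Rightarrow> bool" where
  "O_invariant_set S \<longleftrightarrow>
     (\<forall>f g. orthogonal_transformation f \<longrightarrow> orthogonal_transformation g \<longrightarrow>
        map_prod f g ` S = S)"

definition O_invariant_fun_on ::
  "((real^'m) \<times> (real^'n)) set \<Rightarrow> ((real^'m) \<times> (real^'n) \<Rightarrow> real) \<Rightarrow> bool" where
  "O_invariant_fun_on S w \<longleftrightarrow>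
     (\<forall>f g. orthogonal_transformation f \<longrightarrow> orthogonal_transformation g \<longrightarrow>
        (\<forall>p\<in>S. w (map_prod f g p) = w p))"

text \<open>For \<open>E = lawson_plus\<close> and \<open>E = lawson_minus\<close> (and dimensions \<open>m, n \<ge> 3\<close>, \<open>m + n \<ge> 8\<close>)
  the first four conditions are known to characterise a unique hypersurface,
  \<open>\<Sigma>\<^sup>+\<close> resp. \<open>\<Sigma>\<^sup>-\<close>; that it is invariant is also known, by uniqueness, and is recorded
  here as part of the description.\<close>

definition lawson_hypersurface ::
  "((real^'m) \<times> (real^'n)) set \<Rightarrow> ((real^'m) \<times> (real^'n)) set \<Rightarrow> bool" where
  "lawson_hypersurface E S \<longleftrightarrow>
     minimal_hypersurface S \<and> S \<subseteq> E \<and> asymptotic_at_infinity S lawson_cone \<and>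
     infdist 0 S = 1 \<and> O_invariant_set S"

end

theory Submission
  imports Defs
begin

text \<open>The solution is sought in the form \<open>w = F(|p|\<^sup>2)\<close>, which is automatically invariant. On a minimal
  hypersurface of dimension \<open>N\<close> the Laplacian of such a function is \<open>G F'' + 2 N F'\<close>, where \<open>G\<close> is the
  squared length of the gradient of \<open>|p|\<^sup>2\<close> along \<open>S\<close>. By invariance \<open>S\<close> is determined by its profile
  curve in a quarter plane, and every sphere \<open>|p|\<^sup>2 = H\<close> with \<open>H \<ge> 1\<close> meets this curve in exactly one
  point. For large \<open>H\<close> this follows from the asymptotics; it persists when \<open>H\<close> decreases, because by
  minimality every critical point of \<open>|p|\<^sup>2\<close> on the curve is a nondegenerate minimum, and one off the
  axis would double the levels just above it. Hence \<open>G\<close> and \<open>|A|\<^sup>2\<close> are smooth functions of \<open>H \<ge> 1\<close>, and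
  the equation becomes \<open>G F'' + 2 N F' + |A|\<^sup>2 F = (2 a / \<delta>) exp (- \<surd>2 F)\<close>, which is singular at
  \<open>H = 1\<close>, a simple zero of \<open>G\<close>. It is solved with \<open>F(1) = 0\<close> as a Volterra equation; the sign of the
  exponential term yields an energy estimate that prevents blow-up, for every \<open>\<delta> > 0\<close>.\<close>

section \<open>Smooth functions of one and several variables\<close>

text \<open>The variable \<open>H = |p|^2\<close> is chosen because its Laplacian on a minimal
  hypersurface of dimension \<open>N\<close> is the constant \<open>2 N\<close>, so only the unit
  normal enters the coefficient \<open>G\<close>. The profile curve is never treated as a solution
  of a differential equation. Minimality is used through one comparison principle: where a function
  on \<open>S\<close> has a local minimum, its ambient Hessian has nonnegative trace over the
  tangent space. Each property of the curve rests on a suitable comparison function: the square of a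
  plane coordinate minus \<open>|q|^2\<close> at a critical point, multiples of
  \<open>|P1 q|^2\<close> on the axis, a logarithmically corrected distance difference at infinity.
  The level \<open>H = 1\<close> is degenerate in two ways. On \<open>S\<close> the distance is a
  smooth coordinate only through \<open>|P1 q|^2\<close>, which calls for a calculus of one-sided
  derivatives and of even functions. In the equation the coefficient \<open>G\<close> vanishes with
  slope \<open>4 N / m1\<close>. The ratio of \<open>2 N\<close> to this slope is
  \<open>m1 / 2 > 1\<close>: it is the exponent in the integral formula for \<open>F'\<close>, and
  it lets the damping term dominate the growth of \<open>G\<close> in the energy near the singular
  point.\<close>

lemma Ck_on_SucD:
  assumes "Ck_on (Suc k) U f" "x \<in> U"
  shows "(f has_derivative frechet_derivative f (at x)) (at x)"
  using assms by (simp add: frechet_derivative_works)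

lemma Ck_on_Suc_frechet: "Ck_on (Suc k) U f \<Longrightarrow> Ck_on k U (\<lambda>x. frechet_derivative f (at x) v)"
  by simp

lemma Ck_on_cong:
  assumes "open U" "\<And>x. x \<in> U \<Longrightarrow> f x = g x"
  shows "Ck_on k U f \<longleftrightarrow> Ck_on k U g"
  using assms(2)
proof (induction k arbitrary: f g)
  case 0
  then show ?case using continuous_on_cong[OF refl, of U f g] by auto
next
  case (Suc k)
  have d: "(f has_derivative D) (at x) \<longleftrightarrow> (g has_derivative D) (at x)" if "x \<in> U" for x D
  proof
    assume "(f has_derivative D) (at x)"
    then show "(g has_derivative D) (at x)"
      using has_derivative_transform_within_open[OF _ assms(1) that, of f D UNIV g] Suc.prems by auto
  next
    assume "(g has_derivative D) (at x)"
    then show "(f has_derivative D) (at x)"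
      using has_derivative_transform_within_open[OF _ assms(1) that, of g D UNIV f] Suc.prems by auto
  qed
  have 1: "f differentiable (at x) \<longleftrightarrow> g differentiable (at x)" if "x \<in> U" for x
    using d[OF that] by (auto simp: differentiable_def)
  have 2: "frechet_derivative f (at x) = frechet_derivative g (at x)" if "x \<in> U" for x
    using d[OF that] by (simp add: frechet_derivative_def)
  have "Ck_on k U (\<lambda>x. frechet_derivative f (at x) v) \<longleftrightarrow> Ck_on k U (\<lambda>x. frechet_derivative g (at x) v)" for v
    by (rule Suc.IH) (simp add: 2)
  with 1 show ?case by simp
qed

lemma Ck_on_SucI:
  assumes "open U" "\<And>x. x \<in> U \<Longrightarrow> (f has_derivative D x) (at x)" "\<And>v. Ck_on k U (\<lambda>x. D x v)"
  shows "Ck_on (Suc k) U f"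
proof -
  have "frechet_derivative f (at x) = D x" if "x \<in> U" for x
    using assms(2)[OF that] frechet_derivative_at by metis
  then have "Ck_on k U (\<lambda>x. frechet_derivative f (at x) v)" for v
    using Ck_on_cong[OF assms(1), of "\<lambda>x. frechet_derivative f (at x) v" "\<lambda>x. D x v" k] assms(3) by simp
  then show ?thesis using assms(2) by (auto simp: differentiable_def)
qed

lemma Ck_on_continuous: "Ck_on k U f \<Longrightarrow> continuous_on U f"
  by (cases k) (auto intro!: continuous_at_imp_continuous_on differentiable_imp_continuous_within)

lemma Ck_on_Suc_imp: "Ck_on (Suc k) U f \<Longrightarrow> Ck_on k U f"
proof (induction k arbitrary: f)
  case 0
  then show ?case using Ck_on_continuous[OF 0] by simp
next
  case (Suc k)
  have "Ck_on k U (\<lambda>x. frechet_derivative f (at x) v)" for v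
    by (rule Suc.IH[OF Ck_on_Suc_frechet[OF Suc.prems]])
  then show ?case using Ck_on_SucD[OF Suc.prems] unfolding Ck_on.simps differentiable_def by blast
qed

lemma Ck_on_subset: "Ck_on k U f \<Longrightarrow> V \<subseteq> U \<Longrightarrow> Ck_on k V f"
  by (induction k arbitrary: f) (auto intro: continuous_on_subset)

lemma Ck_on_const [simp]: "open U \<Longrightarrow> Ck_on k U (\<lambda>x. c)"
  by (induction k arbitrary: c) auto

lemma Ck_on_linear:
  assumes "open U" "bounded_linear f"
  shows "Ck_on k U f"
proof (cases k)
  case 0
  then show ?thesis using assms by (simp add: linear_continuous_on)
next
  case (Suc j)
  show ?thesis unfolding Suc
    by (rule Ck_on_SucI[OF assms(1), where D = "\<lambda>_. f"]) (use assms in \<open>auto intro: bounded_linear_imp_has_derivative\<close>)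
qed

lemma Ck_on_add:
  assumes "open U" "Ck_on k U f" "Ck_on k U g"
  shows "Ck_on k U (\<lambda>x. f x + g x)"
  using assms(2,3)
proof (induction k arbitrary: f g)
  case 0
  then show ?case by (simp add: continuous_on_add)
next
  case (Suc k)
  show ?case
    by (rule Ck_on_SucI[OF assms(1), where D = "\<lambda>x v. frechet_derivative f (at x) v + frechet_derivative g (at x) v"])
      (use Suc in \<open>auto intro!: has_derivative_add Ck_on_SucD Suc.IH\<close>)
qed

lemma Ck_on_sum:
  assumes "open U" "\<And>i. i \<in> I \<Longrightarrow> Ck_on k U (f i)"
  shows "Ck_on k U (\<lambda>x. \<Sum>i\<in>I. f i x)"
  using assms(2)
  by (induction I rule: infinite_finite_induct) (auto intro: Ck_on_add assms(1) Ck_on_const[OF assms(1)])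

lemma Ck_on_bilinear:
  fixes f :: "'a::euclidean_space \<Rightarrow> 'b::real_normed_vector" and g :: "'a \<Rightarrow> 'c::real_normed_vector"
  assumes "bounded_bilinear p" "open U" "Ck_on k U f" "Ck_on k U g"
  shows "Ck_on k U (\<lambda>x. p (f x) (g x))"
  using assms(3,4)
proof (induction k arbitrary: f g)
  case 0
  then show ?case using bounded_bilinear.continuous_on[OF assms(1)] by simp
next
  case (Suc k)
  show ?case
  proof (rule Ck_on_SucI[OF assms(2)])
    show "((\<lambda>x. p (f x) (g x)) has_derivative (\<lambda>v. p (f x) (frechet_derivative g (at x) v) + p (frechet_derivative f (at x) v) (g x))) (at x)"
      if "x \<in> U" for x
      using bounded_bilinear.FDERIV[OF assms(1) Ck_on_SucD[OF Suc.prems(1) that] Ck_on_SucD[OF Suc.prems(2) that]] .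
    show "Ck_on k U (\<lambda>x. p (f x) (frechet_derivative g (at x) v) + p (frechet_derivative f (at x) v) (g x))" for v
      by (intro Ck_on_add[OF assms(2)] Suc.IH) (use Suc.prems Ck_on_Suc_imp in auto)
  qed
qed

lemmas Ck_on_scaleR = Ck_on_bilinear[OF bounded_bilinear_scaleR]
lemmas Ck_on_mult = Ck_on_bilinear[OF bounded_bilinear_mult]
lemmas Ck_on_inner = Ck_on_bilinear[OF bounded_bilinear_inner]

lemma Ck_on_minus: "open U \<Longrightarrow> Ck_on k U f \<Longrightarrow> Ck_on k U (\<lambda>x. - f x)"
  using Ck_on_scaleR[of U k "\<lambda>_. - 1" f] by simp

lemma Ck_on_diff: "open U \<Longrightarrow> Ck_on k U f \<Longrightarrow> Ck_on k U g \<Longrightarrow> Ck_on k U (\<lambda>x. f x - g x)"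
  using Ck_on_add[of U k f "\<lambda>x. - g x"] by (simp add: Ck_on_minus)

lemma linear_expand_Basis:
  fixes x :: "'a::euclidean_space"
  assumes "linear L"
  shows "L x = (\<Sum>b\<in>Basis. (x \<bullet> b) *\<^sub>R L b)"
proof -
  have "L (\<Sum>b\<in>Basis. (x \<bullet> b) *\<^sub>R b) = (\<Sum>b\<in>Basis. (x \<bullet> b) *\<^sub>R L b)"
    by (simp only: linear_sum[OF assms] linear_cmul[OF assms])
  then show ?thesis by (simp add: euclidean_representation)
qed

lemma frechet_derivative_expand:
  fixes f :: "'a::euclidean_space \<Rightarrow> 'b::real_normed_vector"
  assumes "f differentiable net"
  shows "frechet_derivative f net v = (\<Sum>b\<in>Basis. (v \<bullet> b) *\<^sub>R frechet_derivative f net b)"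
  by (rule linear_expand_Basis[OF linear_frechet_derivative[OF assms]])

text \<open>\<open>Ck_on\<close> controls derivatives in fixed directions only. A direction that
  moves with the point is expanded in the standard basis, which leaves a finite sum of
  products.\<close>

lemma Ck_on_frechet_derivative:
  assumes "open U" "Ck_on (Suc k) U f" "Ck_on k U g"
  shows "Ck_on k U (\<lambda>x. frechet_derivative f (at x) (g x))"
proof -
  have "Ck_on k U (\<lambda>x. \<Sum>b\<in>Basis. (g x \<bullet> b) *\<^sub>R frechet_derivative f (at x) b)"
    by (intro Ck_on_sum[OF assms(1)] Ck_on_scaleR[OF assms(1)] Ck_on_inner[OF assms(1)] assms(3) Ck_on_const[OF assms(1)])
      (use assms(2) in auto)
  moreover have "frechet_derivative f (at x) (g x) = (\<Sum>b\<in>Basis. (g x \<bullet> b) *\<^sub>R frechet_derivative f (at x) b)"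
    if "x \<in> U" for x
    using frechet_derivative_expand[of f "at x" "g x"] assms(2) that by simp
  ultimately show ?thesis
    using Ck_on_cong[OF assms(1), of "\<lambda>x. frechet_derivative f (at x) (g x)"
        "\<lambda>x. \<Sum>b\<in>Basis. (g x \<bullet> b) *\<^sub>R frechet_derivative f (at x) b" k] by blast
qed

text \<open>Derivatives are taken within \<open>I\<close>, hence are one-sided at the end points of an interval.\<close>

primrec Cw :: "nat \<Rightarrow> real set \<Rightarrow> (real \<Rightarrow> 'b::real_normed_vector) \<Rightarrow> bool" where
  "Cw 0 I f \<longleftrightarrow> continuous_on I f"
| "Cw (Suc k) I f \<longleftrightarrow> (\<exists>f'. (\<forall>x\<in>I. (f has_vector_derivative f' x) (at x within I)) \<and> Cw k I f')"

lemma Cw_SucE: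
  assumes "Cw (Suc k) I f"
  obtains f' where "\<And>x. x \<in> I \<Longrightarrow> (f has_vector_derivative f' x) (at x within I)" "Cw k I f'"
  using assms by auto

lemma Cw_SucI:
  assumes "\<And>x. x \<in> I \<Longrightarrow> (f has_vector_derivative f' x) (at x within I)" "Cw k I f'"
  shows "Cw (Suc k) I f"
  using assms by auto

lemma Cw_cong: "(\<And>x. x \<in> I \<Longrightarrow> f x = g x) \<Longrightarrow> Cw k I f \<longleftrightarrow> Cw k I g"
proof (cases k)
  assume eq: "\<And>x. x \<in> I \<Longrightarrow> f x = g x"
  {
    case 0
    show ?thesis unfolding 0 using continuous_on_cong[OF refl eq] by simp
  next
    case (Suc j)
    have "(f has_vector_derivative d) (at x within I) \<longleftrightarrow> (g has_vector_derivative d) (at x within I)" if "x \<in> I" for x d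
      using that eq has_vector_derivative_transform[OF that, of g f d] has_vector_derivative_transform[OF that, of f g d] by metis
    then show ?thesis unfolding Suc Cw.simps by blast
  }
qed

lemma Cw_continuous: "Cw k I f \<Longrightarrow> continuous_on I f"
  by (cases k) (auto simp: continuous_on_eq_continuous_within intro: has_vector_derivative_continuous)

lemma Cw_Suc_imp: "Cw (Suc k) I f \<Longrightarrow> Cw k I f"
proof (induction k arbitrary: f)
  case 0
  then show ?case using Cw_continuous[OF 0] by simp
next
  case (Suc k)
  from Suc.prems obtain f' where "\<And>x. x\<in>I \<Longrightarrow> (f has_vector_derivative f' x) (at x within I)" "Cw (Suc k) I f'"
    by (rule Cw_SucE) blast
  with Suc.IH show ?case by (intro Cw_SucI[where f' = f']) auto
qed

lemma Cw_subset: "Cw k I f \<Longrightarrow> J \<subseteq> I \<Longrightarrow> Cw k J f"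
proof (induction k arbitrary: f)
  case 0
  then show ?case by (auto intro: continuous_on_subset)
next
  case (Suc k)
  from Suc.prems(1) obtain f' where f': "\<And>x. x\<in>I \<Longrightarrow> (f has_vector_derivative f' x) (at x within I)" "Cw k I f'"
    by (rule Cw_SucE) blast
  show ?case
    by (rule Cw_SucI[where f' = f']) (use f' Suc in \<open>auto intro: has_vector_derivative_within_subset\<close>)
qed

lemma Cw_const [simp]: "Cw k I (\<lambda>x. c)"
  by (induction k arbitrary: c) (auto intro!: exI[of _ "\<lambda>_. 0"])

lemma Cw_id [simp]: "Cw k I (\<lambda>x. x)"
  by (cases k) (auto intro!: exI[of _ "\<lambda>_. 1"] continuous_on_id derivative_eq_intros)

lemma Cw_add: "Cw k I f \<Longrightarrow> Cw k I g \<Longrightarrow> Cw k I (\<lambda>x. f x + g x)"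
proof (induction k arbitrary: f g)
  case 0
  then show ?case by (auto intro: continuous_on_add)
next
  case (Suc k)
  from Suc.prems(1) obtain f' where f: "\<And>x. x\<in>I \<Longrightarrow> (f has_vector_derivative f' x) (at x within I)" "Cw k I f'"
    by (rule Cw_SucE) blast
  from Suc.prems(2) obtain g' where g: "\<And>x. x\<in>I \<Longrightarrow> (g has_vector_derivative g' x) (at x within I)" "Cw k I g'"
    by (rule Cw_SucE) blast
  show ?case
    by (rule Cw_SucI[where f' = "\<lambda>x. f' x + g' x"]) (use f g Suc.IH in \<open>auto intro: has_vector_derivative_add\<close>)
qed

lemma Cw_bilinear:
  assumes "bounded_bilinear p"
  shows "Cw k I f \<Longrightarrow> Cw k I g \<Longrightarrow> Cw k I (\<lambda>x. p (f x) (g x))"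
proof (induction k arbitrary: f g)
  case 0
  then show ?case using bounded_bilinear.continuous_on[OF assms] by simp
next
  case (Suc k)
  from Suc.prems(1) obtain f' where f: "\<And>x. x\<in>I \<Longrightarrow> (f has_vector_derivative f' x) (at x within I)" "Cw k I f'"
    by (rule Cw_SucE) blast
  from Suc.prems(2) obtain g' where g: "\<And>x. x\<in>I \<Longrightarrow> (g has_vector_derivative g' x) (at x within I)" "Cw k I g'"
    by (rule Cw_SucE) blast
  have "Cw k I f" "Cw k I g" using Suc.prems Cw_Suc_imp by blast+
  then show ?case
    by (intro Cw_SucI[where f' = "\<lambda>x. p (f x) (g' x) + p (f' x) (g x)"] Cw_add Suc.IH f(2) g(2)
        bounded_bilinear.has_vector_derivative[OF assms] f(1) g(1))
qed

lemmas Cw_scaleR = Cw_bilinear[OF bounded_bilinear_scaleR]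
lemmas Cw_mult = Cw_bilinear[OF bounded_bilinear_mult]
lemmas Cw_inner = Cw_bilinear[OF bounded_bilinear_inner]

lemma Cw_minus: "Cw k I f \<Longrightarrow> Cw k I (\<lambda>x. - f x)"
  using Cw_scaleR[of k I "\<lambda>_. - 1" f] by simp

lemma Cw_diff: "Cw k I f \<Longrightarrow> Cw k I g \<Longrightarrow> Cw k I (\<lambda>x. f x - g x)"
  using Cw_add[of k I f "\<lambda>x. - g x"] by (simp add: Cw_minus)

lemma Cw_sum:
  "(\<And>i. i \<in> A \<Longrightarrow> Cw k I (f i)) \<Longrightarrow> Cw k I (\<lambda>x. \<Sum>i\<in>A. f i x)"
  by (induction A rule: infinite_finite_induct) (auto intro: Cw_add)

lemma Cw_compose_real:
  fixes g :: "real \<Rightarrow> 'b::real_normed_vector"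
  shows "Cw k J g \<Longrightarrow> Cw k I f \<Longrightarrow> f ` I \<subseteq> J \<Longrightarrow> Cw k I (\<lambda>x. g (f x))"
proof (induction k arbitrary: g)
  case 0
  then show ?case by (auto intro: continuous_on_compose2)
next
  case (Suc k)
  from Suc.prems(1) obtain g' where g: "\<And>x. x\<in>J \<Longrightarrow> (g has_vector_derivative g' x) (at x within J)" "Cw k J g'"
    by (rule Cw_SucE) blast
  from Suc.prems(2) obtain f' where f: "\<And>x. x\<in>I \<Longrightarrow> (f has_vector_derivative f' x) (at x within I)" "Cw k I f'"
    by (rule Cw_SucE) blast
  note * = g f
  have "((\<lambda>x. g (f x)) has_vector_derivative f' x *\<^sub>R g' (f x)) (at x within I)" if "x \<in> I" for x
  proof -
    have "(g has_vector_derivative g' (f x)) (at (f x) within f ` I)"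
      using *(1) that Suc.prems(3) has_vector_derivative_within_subset by blast
    then show ?thesis using vector_diff_chain_within[OF *(3)[OF that]] by (simp add: o_def)
  qed
  moreover have "Cw k I (\<lambda>x. f' x *\<^sub>R g' (f x))"
    by (intro Cw_scaleR *(4) Suc.IH[OF *(2)] Cw_Suc_imp[OF Suc.prems(2)] Suc.prems(3))
  ultimately show ?case by (rule Cw_SucI)
qed

lemma Cw_compose_Ck:
  fixes f :: "'a::euclidean_space \<Rightarrow> 'b::real_normed_vector"
  shows "Ck_on k U f \<Longrightarrow> Cw k I s \<Longrightarrow> s ` I \<subseteq> U \<Longrightarrow> Cw k I (\<lambda>x. f (s x))"
proof (induction k arbitrary: f)
  case 0
  then show ?case by (auto intro: continuous_on_compose2)
next
  case (Suc k)
  from Suc.prems(2) obtain s' where s: "\<And>x. x\<in>I \<Longrightarrow> (s has_vector_derivative s' x) (at x within I)" "Cw k I s'"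
    by (rule Cw_SucE) blast
  have "((\<lambda>x. f (s x)) has_vector_derivative (\<Sum>b\<in>Basis. (s' x \<bullet> b) *\<^sub>R frechet_derivative f (at (s x)) b)) (at x within I)"
    if "x \<in> I" for x
  proof -
    have sx: "s x \<in> U" using that Suc.prems by auto
    have "(f has_derivative frechet_derivative f (at (s x))) (at (s x) within s ` I)"
      using Ck_on_SucD[OF Suc.prems(1) sx] has_derivative_at_withinI by blast
    from vector_derivative_diff_chain_within[OF s(1)[OF that] this]
    show ?thesis using frechet_derivative_expand[of f "at (s x)" "s' x"] Suc.prems(1) sx by (simp add: o_def)
  qed
  moreover have "Cw k I (\<lambda>x. (\<Sum>b\<in>Basis. (s' x \<bullet> b) *\<^sub>R frechet_derivative f (at (s x)) b))"
    by (intro Cw_sum Cw_scaleR Cw_inner s Cw_const Suc.IH Ck_on_Suc_frechet[OF Suc.prems(1)] Cw_Suc_imp[OF Suc.prems(2)] Suc.prems(3))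
  ultimately show ?case by (rule Cw_SucI)
qed

text \<open>The outer function has derivatives within \<open>I\<close> only. Since \<open>g\<close>
  takes its values in \<open>I\<close>, this is enough even at points that \<open>g\<close> sends to
  an end point of \<open>I\<close>, as happens for \<open>|P1 q|^2\<close> on the axis.\<close>

lemma Ck_compose_Cw:
  fixes F :: "real \<Rightarrow> 'b::real_normed_vector" and g :: "'a::euclidean_space \<Rightarrow> real"
  assumes "open U"
  shows "Cw k I F \<Longrightarrow> Ck_on k U g \<Longrightarrow> g ` U \<subseteq> I \<Longrightarrow> Ck_on k U (\<lambda>x. F (g x))"
proof (induction k arbitrary: F)
  case 0
  then show ?case by (auto intro: continuous_on_compose2)
next
  case (Suc k)
  from Suc.prems(1) obtain F' where F: "\<And>x. x\<in>I \<Longrightarrow> (F has_vector_derivative F' x) (at x within I)" "Cw k I F'"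
    by (rule Cw_SucE) blast
  show ?case
  proof (rule Ck_on_SucI[OF assms])
    show "((\<lambda>x. F (g x)) has_derivative (\<lambda>v. frechet_derivative g (at x) v *\<^sub>R F' (g x))) (at x)" if "x \<in> U" for x
    proof -
      have "(F has_derivative (\<lambda>h. h *\<^sub>R F' (g x))) (at (g x) within g ` U)"
        using F(1)[of "g x"] that Suc.prems(3) has_derivative_subset unfolding has_vector_derivative_def by blast
      from has_derivative_in_compose[OF has_derivative_at_withinI[OF Ck_on_SucD[OF Suc.prems(2) that]] this]
      show ?thesis using at_within_open[OF that assms] by simp
    qed
    show "Ck_on k U (\<lambda>x. frechet_derivative g (at x) v *\<^sub>R F' (g x))" for v
      by (intro Ck_on_scaleR[OF assms] Suc.IH F(2) Ck_on_Suc_frechet[OF Suc.prems(2)] Ck_on_Suc_imp[OF Suc.prems(2)] Suc.prems(3))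
  qed
qed

text \<open>Derivatives within \<open>I\<close> are unique when no point is isolated, so the locally
  given derivatives agree with one global function and the induction can proceed.\<close>

lemma Cw_locally:
  assumes "\<And>x. x \<in> I \<Longrightarrow> at x within I \<noteq> bot" "\<And>x. x \<in> I \<Longrightarrow> \<exists>J. open J \<and> x \<in> J \<and> Cw k (I \<inter> J) f"
  shows "Cw k I f"
  using assms(2)
proof (induction k arbitrary: f)
  case 0
  show ?case unfolding Cw.simps continuous_on_eq_continuous_within
  proof
    fix x assume x: "x \<in> I"
    then obtain J where J: "open J" "x \<in> J" "continuous_on (I \<inter> J) f" using 0 by auto
    then have "continuous (at x within (I \<inter> J)) f" using x by (simp add: continuous_on_eq_continuous_within)
    then show "continuous (at x within I) f"
      using at_within_nhd[OF J(2,1), of "I \<inter> J" I] by (simp add: Int_assoc)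
  qed
next
  case (Suc k)
  have eqw: "at x within (I \<inter> J) = at x within I" if "open J" "x \<in> J" for x J
    by (rule at_within_nhd[OF that(2,1)]) auto
  define f' where "f' x = vector_derivative f (at x within I)" for x
  have ex: "\<exists>J. open J \<and> x \<in> J \<and> (\<forall>y\<in>I \<inter> J. (f has_vector_derivative f' y) (at y within I)) \<and> Cw k (I \<inter> J) f'"
    if x: "x \<in> I" for x
  proof -
    from Suc.prems[OF x] obtain J g where J: "open J" "x \<in> J" 
      "\<And>y. y\<in>I \<inter> J \<Longrightarrow> (f has_vector_derivative g y) (at y within (I \<inter> J))" "Cw k (I \<inter> J) g"
      by (auto simp del: Cw.simps elim!: Cw_SucE)
    have d: "(f has_vector_derivative g y) (at y within I)" if "y \<in> I \<inter> J" for y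
      using J(3)[OF that] eqw[of J y] J that by auto
    then have "f' y = g y" if "y \<in> I \<inter> J" for y
      unfolding f'_def using that assms(1) vector_derivative_within by blast
    then show ?thesis using J d Cw_cong[of "I \<inter> J" f' g k] by auto
  qed
  have "Cw k I f'" by (rule Suc.IH) (use ex in blast)
  moreover have "(f has_vector_derivative f' y) (at y within I)" if "y \<in> I" for y using ex[OF that] that by blast
  ultimately show ?case by (intro Cw_SucI)
qed

lemma Cw_exp: "Cw k I (exp :: real \<Rightarrow> real)"
  by (induction k) (auto intro!: exI[of _ exp] continuous_intros derivative_eq_intros
      simp flip: has_real_derivative_iff_has_vector_derivative)

lemma Cw_powr: "I \<subseteq> {0<..} \<Longrightarrow> Cw k I (\<lambda>x::real. c * x powr a)"
proof (induction k arbitrary: a c)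
  case 0
  then show ?case by (auto intro!: continuous_intros)
next
  case (Suc k)
  show ?case
  proof (rule Cw_SucI[OF _ Suc.IH[OF Suc.prems]])
    fix x assume "x \<in> I"
    then have "x > 0" using Suc.prems by auto
    then show "((\<lambda>x. c * x powr a) has_vector_derivative (c * a) * x powr (a - 1)) (at x within I)"
      unfolding has_real_derivative_iff_has_vector_derivative[symmetric]
      by (auto intro!: derivative_eq_intros)
  qed
qed

lemma Cw_exp_compose: "Cw k I f \<Longrightarrow> Cw k I (\<lambda>x. exp (f x :: real))"
  by (rule Cw_compose_real[OF Cw_exp[of k UNIV]]) auto

lemma Cw_inverse:
  assumes "Cw k I f" "\<And>x. x \<in> I \<Longrightarrow> (f x :: real) > 0"
  shows "Cw k I (\<lambda>x. inverse (f x))"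
proof -
  have "Cw k I (\<lambda>x. 1 * f x powr (-1))"
    by (rule Cw_compose_real[OF Cw_powr[of "{0<..}"] assms(1)]) (use assms(2) in auto)
  then show ?thesis
    using Cw_cong[of I "\<lambda>x. 1 * f x powr (-1)" "\<lambda>x. inverse (f x)" k] assms(2)
    by (force simp add: powr_minus less_imp_le)
qed

lemma Cw_divide:
  assumes "Cw k I g" "Cw k I f" "\<And>x. x \<in> I \<Longrightarrow> (f x :: real) > 0"
  shows "Cw k I (\<lambda>x. g x / f x)"
  using Cw_mult[OF assms(1) Cw_inverse[OF assms(2,3)]] by (simp add: divide_inverse)

lemma Ck_on_powr:
  assumes "open U" "Ck_on k U f" "\<And>x. x \<in> U \<Longrightarrow> (f x :: real) > 0"
  shows "Ck_on k U (\<lambda>x. f x powr a)"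
  using Ck_compose_Cw[OF assms(1) Cw_powr[of "{0<..}" k 1 a] assms(2)] assms(3) by force

section \<open>Weighted averages and even functions\<close>

text \<open>Constant weight gives the quotient in Hadamard's lemma. A power weight gives the
  solution operator of a linear equation with a singular point at 0.\<close>

definition average :: "(real \<Rightarrow> real) \<Rightarrow> (real \<Rightarrow> real) \<Rightarrow> real \<Rightarrow> real" where
  "average \<kappa> g z = integral {0..1} (\<lambda>\<theta>. \<kappa> \<theta> * g (\<theta> * z))"

lemma scaled_mem: 
  assumes "convex I" "(0::real) \<in> I" "z \<in> I" "\<theta> \<in> {0..1}"
  shows "\<theta> * z \<in> I"
  using convexD_alt[OF assms(1,2,3), of \<theta>] assms(4) by simp

lemma continuous_on_average_integrand:
  fixes \<kappa> g :: "real \<Rightarrow> real"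
  assumes "convex I" "(0::real) \<in> I" "continuous_on {0..1} \<kappa>" "continuous_on I g"
  shows "continuous_on (I \<times> {0..1}) (\<lambda>(z, \<theta>). \<kappa> \<theta> * g (\<theta> * z))"
proof -
  have "continuous_on (I \<times> {0..1}) (\<lambda>x. g (snd x * fst x))"
    by (rule continuous_on_compose2[OF assms(4)]) (auto intro!: continuous_intros scaled_mem[OF assms(1,2)])
  moreover have "continuous_on (I \<times> {0..1}) (\<lambda>x. \<kappa> (snd x))"
    by (rule continuous_on_compose2[OF assms(3)]) (auto intro!: continuous_intros)
  ultimately show ?thesis unfolding split_beta using continuous_on_mult by blast
qed

lemma integrable_average:
  fixes \<kappa> g :: "real \<Rightarrow> real"
  assumes "convex I" "(0::real) \<in> I" "continuous_on {0..1} \<kappa>" "continuous_on I g" "z \<in> I"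
  shows "(\<lambda>\<theta>. \<kappa> \<theta> * g (\<theta> * z)) integrable_on {0..1}"
proof -
  have "continuous_on {0..1} (\<lambda>\<theta>. g (\<theta> * z))"
    by (rule continuous_on_compose2[OF assms(4)]) (use scaled_mem[OF assms(1,2,5)] in \<open>auto intro!: continuous_intros\<close>)
  then show ?thesis by (intro integrable_continuous_real) (rule continuous_on_mult[OF assms(3)])
qed

text \<open>Differentiation under the integral sign produces a factor \<open>\<theta>\<close>, which
  is absorbed into the weight; hence the induction runs over all continuous weights at once.\<close>

lemma Cw_average:
  assumes "convex I" "(0::real) \<in> I"
  shows "continuous_on {0..1} \<kappa> \<Longrightarrow> Cw k I g \<Longrightarrow> Cw k I (average \<kappa> g)"
proof (induction k arbitrary: \<kappa> g)
  case 0
  have "continuous_on I (\<lambda>z. integral (cbox 0 1) (\<lambda>\<theta>. \<kappa> \<theta> * g (\<theta> * z)))"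
    by (rule integral_continuous_on_param) 
      (use continuous_on_average_integrand[OF assms, of \<kappa> g] 0 in simp)
  then show ?case by (simp add: average_def[abs_def])
next
  case (Suc k)
  from Suc.prems(2) obtain g' where g: "\<And>x. x\<in>I \<Longrightarrow> (g has_vector_derivative g' x) (at x within I)" "Cw k I g'"
    by (rule Cw_SucE) blast
  have cg: "continuous_on I g" "continuous_on I g'" using Suc.prems(2) g(2) Cw_continuous by blast+
  have c2: "continuous_on {0..1} (\<lambda>\<theta>. \<theta> * \<kappa> \<theta>)" using Suc.prems(1) by (intro continuous_intros)
  show ?case
  proof (rule Cw_SucI[OF _ Suc.IH[OF c2 g(2)]])
    fix z assume z: "z \<in> I"
    have "((\<lambda>z. integral (cbox 0 1) (\<lambda>\<theta>. \<kappa> \<theta> * g (\<theta> * z))) has_vector_derivative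
       integral (cbox 0 1) (\<lambda>\<theta>. (\<theta> * \<kappa> \<theta>) * g' (\<theta> * z))) (at z within I)"
    proof (rule leibniz_rule_vector_derivative[OF _ _ _ z assms(1)])
      fix x \<theta> :: real assume x: "x \<in> I" "\<theta> \<in> cbox 0 1"
      have "\<theta> * x \<in> I" using scaled_mem[OF assms x(1)] x(2) by auto
      then have "(g has_vector_derivative g' (\<theta> * x)) (at (\<theta> * x) within (\<lambda>z. \<theta> * z) ` I)"
        using g(1) has_vector_derivative_within_subset scaled_mem[OF assms] x(2) 
        by (metis (no_types, lifting) box_real(2) image_subsetI)
      moreover have "((\<lambda>z. \<theta> * z) has_vector_derivative \<theta>) (at x within I)"
        by (auto intro!: derivative_eq_intros simp flip: has_real_derivative_iff_has_vector_derivative)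
      ultimately have "((\<lambda>z. g (\<theta> * z)) has_vector_derivative \<theta> *\<^sub>R g' (\<theta> * x)) (at x within I)"
        using vector_diff_chain_within[of "\<lambda>z. \<theta> * z" \<theta> x I g] by (simp add: o_def)
      from has_vector_derivative_mult_right[OF this, of "\<kappa> \<theta>"]
      show "((\<lambda>z. \<kappa> \<theta> * g (\<theta> * z)) has_vector_derivative \<theta> * \<kappa> \<theta> * g' (\<theta> * x)) (at x within I)"
        by (simp add: mult_ac)
    next
      fix x assume "x \<in> I"
      then show "(\<lambda>\<theta>. \<kappa> \<theta> * g (\<theta> * x)) integrable_on cbox 0 1"
        using integrable_average[OF assms Suc.prems(1) cg(1)] by simp
    next
      show "continuous_on (I \<times> cbox 0 1) (\<lambda>(x, \<theta>). \<theta> * \<kappa> \<theta> * g' (\<theta> * x))"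
        using continuous_on_average_integrand[OF assms c2 cg(2)] by simp
    qed
    then show "(average \<kappa> g has_vector_derivative average (\<lambda>\<theta>. \<theta> * \<kappa> \<theta>) g' z) (at z within I)"
      by (simp add: average_def[abs_def])
  qed
qed

text \<open>The fundamental theorem along the segment from 0 to \<open>z\<close>. Together with
  \<open>Cw_average\<close> it divides a function vanishing at 0 by the variable, and the quotient
  is smooth up to 0.\<close>

lemma Hadamard:
  assumes "convex I" "(0::real) \<in> I" "\<And>x. x\<in>I \<Longrightarrow> (g has_vector_derivative g' x) (at x within I)" "continuous_on I g'" "z \<in> I"
  shows "g z = g 0 + z * average (\<lambda>_. 1) g' z"
proof -
  have "((\<lambda>\<theta>. z * g' (\<theta> * z)) has_integral g (1 * z) - g (0 * z)) {0..1}"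
  proof (rule fundamental_theorem_of_calculus)
    fix \<theta> :: real assume t: "\<theta> \<in> {0..1}"
    have m: "(\<lambda>\<theta>. \<theta> * z) ` {0..1} \<subseteq> I" using scaled_mem[OF assms(1,2,5)] by auto
    have "(g has_vector_derivative g' (\<theta> * z)) (at (\<theta> * z) within (\<lambda>\<theta>. \<theta> * z) ` {0..1})"
      using assms(3) has_vector_derivative_within_subset[OF _ m] m t by blast
    moreover have "((\<lambda>\<theta>. \<theta> * z) has_vector_derivative z) (at \<theta> within {0..1})"
      by (auto intro!: derivative_eq_intros simp flip: has_real_derivative_iff_has_vector_derivative)
    ultimately show "((\<lambda>\<theta>. g (\<theta> * z)) has_vector_derivative z * g' (\<theta> * z)) (at \<theta> within {0..1})"
      using vector_diff_chain_within[of "\<lambda>\<theta>. \<theta> * z" z \<theta> "{0..1}" g] by (simp add: o_def)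
  qed auto
  then have "integral {0..1} (\<lambda>\<theta>. z * g' (\<theta> * z)) = g z - g 0" by (metis integral_unique mult_1 mult_zero_left)
  then show ?thesis by (simp add: average_def)
qed

lemma interval_at_within_neq_bot:
  fixes I :: "real set"
  assumes "convex I" "a \<in> I" "b \<in> I" "a < b" "x \<in> I"
  shows "at x within I \<noteq> bot"
proof -
  have "connected I" using assms(1) convex_connected by blast
  then have "x islimpt I"
    by (rule connected_imp_perfect) (use assms in auto)
  then show ?thesis by (simp add: trivial_limit_within)
qed

text \<open>Whitney's theorem on even functions. The derivative of \<open>u\<close> is odd, hence
  equal to \<open>x * q x\<close> with \<open>q\<close> smooth and even, and the derivative of
  \<open>u (sqrt a)\<close> is \<open>q (sqrt a) / 2\<close>. The induction is therefore over all
  even functions.\<close>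

lemma even_Cw_sqrt:
  assumes "\<epsilon> > 0"
  shows "\<lbrakk>\<forall>j. Cw j {-\<epsilon><..<\<epsilon>} u; \<forall>x\<in>{-\<epsilon><..<\<epsilon>}. u (- x) = (u x::real)\<rbrakk> \<Longrightarrow> Cw k {0..<\<epsilon>\<^sup>2} (\<lambda>a. u (sqrt a))"
proof (induction k arbitrary: u)
  case 0
  have sq: "sqrt a < \<epsilon>" if "a < \<epsilon>\<^sup>2" for a using that assms real_sqrt_less_mono[OF that] by simp
  have "continuous_on {0..<\<epsilon>\<^sup>2} (\<lambda>a. u (sqrt a))"
  proof (rule continuous_on_compose2[of "{-\<epsilon><..<\<epsilon>}" u])
    show "continuous_on {-\<epsilon><..<\<epsilon>} u" using 0 Cw_continuous by blast
    show "sqrt ` {0..<\<epsilon>\<^sup>2} \<subseteq> {-\<epsilon><..<\<epsilon>}"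
    proof clarsimp
      fix a :: real assume "0 \<le> a" "a < \<epsilon>\<^sup>2"
      moreover have "0 \<le> sqrt a" using \<open>0 \<le> a\<close> by simp
      ultimately show "- \<epsilon> < sqrt a \<and> sqrt a < \<epsilon>" using sq[of a] assms by linarith
    qed
  qed (auto intro!: continuous_intros)
  then show ?case by simp
next
  case (Suc k)
  let ?I = "{-\<epsilon><..<\<epsilon>}"
  have sq: "sqrt a \<in> ?I" if "a \<in> {0..<\<epsilon>\<^sup>2}" for a
  proof -
    have "0 \<le> sqrt a" "sqrt a < \<epsilon>" using that assms real_sqrt_less_mono[of a "\<epsilon>\<^sup>2"] by auto
    then show ?thesis using assms unfolding greaterThanLessThan_iff by linarith
  qed
  have o: "open ?I" by simp
  define u1 where "u1 x = vector_derivative u (at x)" for x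
  define u2 where "u2 x = vector_derivative u1 (at x)" for x
  have d1: "(u has_vector_derivative u1 x) (at x)" and C1: "Cw j ?I u1" if "x \<in> ?I" for x j
  proof -
    obtain f' where f': "\<And>y. y\<in>?I \<Longrightarrow> (u has_vector_derivative f' y) (at y within ?I)" "Cw j ?I f'"
      using Suc.prems(1) Cw_SucE by blast
    have e: "(u has_vector_derivative f' y) (at y)" if "y \<in> ?I" for y
      using f'(1)[OF that] at_within_open[OF that o] by simp
    then have eq: "u1 y = f' y" if "y \<in> ?I" for y using that vector_derivative_at u1_def by metis
    show "(u has_vector_derivative u1 x) (at x)" using e eq that by simp
    show "Cw j ?I u1" using Cw_cong[of ?I u1 f' j] eq f'(2) by blast
  qed
  have d2: "(u1 has_vector_derivative u2 x) (at x)" and C2: "Cw j ?I u2" if "x \<in> ?I" for x j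
  proof -
    from C1[OF that, of "Suc j"]
    obtain f' where f': "\<And>y. y\<in>?I \<Longrightarrow> (u1 has_vector_derivative f' y) (at y within ?I)" "Cw j ?I f'"
      by (rule Cw_SucE) blast
    have e: "(u1 has_vector_derivative f' y) (at y)" if "y \<in> ?I" for y
      using f'(1)[OF that] at_within_open[OF that o] by simp
    then have eq: "u2 y = f' y" if "y \<in> ?I" for y using that vector_derivative_at u2_def by metis
    show "(u1 has_vector_derivative u2 x) (at x)" using e eq that by simp
    show "Cw j ?I u2" using Cw_cong[of ?I u2 f' j] eq f'(2) by blast
  qed
  have odd1: "u1 (- x) = - u1 x" if "x \<in> ?I" for x
  proof -
    have "((\<lambda>x. - x) has_vector_derivative (-1)) (at x)"
      by (auto intro!: derivative_eq_intros)
    from vector_diff_chain_at[OF this, of u "u1 (-x)"] d1[of "-x"] that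
    have "((\<lambda>x. u (- x)) has_vector_derivative - u1 (- x)) (at x)" by (simp add: o_def)
    then have "(u has_vector_derivative - u1 (- x)) (at x)"
      by (rule has_vector_derivative_transform_within_open[OF _ o that]) (use Suc.prems(2) in auto)
    then show ?thesis using d1[OF that] vector_derivative_unique_at by fastforce
  qed
  have even2: "u2 (- x) = u2 x" if "x \<in> ?I" for x
  proof -
    have "((\<lambda>x. - x) has_vector_derivative (-1)) (at x)"
      by (auto intro!: derivative_eq_intros)
    from vector_diff_chain_at[OF this, of u1 "u2 (-x)"] d2[of "-x"] that
    have "((\<lambda>x. u1 (- x)) has_vector_derivative - u2 (- x)) (at x)" by (simp add: o_def)
    then have "((\<lambda>x. - u1 (- x)) has_vector_derivative u2 (- x)) (at x)"
      using has_vector_derivative_minus by fastforce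
    then have "(u1 has_vector_derivative u2 (- x)) (at x)"
      by (rule has_vector_derivative_transform_within_open[OF _ o that]) (use odd1 in auto)
    then show ?thesis using d2[OF that] vector_derivative_unique_at by fastforce
  qed
  define q where "q = average (\<lambda>_. 1) u2"
  have I0: "convex ?I" "0 \<in> ?I" using assms by auto
  have Cq: "Cw j ?I q" for j unfolding q_def by (rule Cw_average[OF I0]) (use C2[OF I0(2)] in auto)
  have evq: "q (- x) = q x" if "x \<in> ?I" for x
    unfolding q_def average_def
  proof (rule integral_cong)
    fix \<theta> :: real assume "\<theta> \<in> {0..1}"
    then have "\<theta> * x \<in> ?I" using scaled_mem[OF I0 that] by auto
    then show "1 * u2 (\<theta> * - x) = 1 * u2 (\<theta> * x)" using even2[of "\<theta> * x"] by simp
  qed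
  have u1q: "u1 x = x * q x" if "x \<in> ?I" for x
  proof -
    have "u1 x = u1 0 + x * q x" unfolding q_def
      by (rule Hadamard[OF I0 _ _ that]) (use d2 C2[OF I0(2), of 0] in \<open>auto intro: has_vector_derivative_at_within\<close>)
    moreover have "u1 0 = 0" using odd1[OF I0(2)] by simp
    ultimately show ?thesis by simp
  qed
  define v where "v = (\<lambda>a. q (sqrt a) / 2)"
  have CQ: "Cw k {0..<\<epsilon>\<^sup>2} (\<lambda>a. q (sqrt a))" by (rule Suc.IH) (use Cq evq in auto)
  then have Cv: "Cw k {0..<\<epsilon>\<^sup>2} v" unfolding v_def using Cw_mult[OF CQ Cw_const[of _ _ "1/2"]] by simp
  have contv: "continuous_on {0..<\<epsilon>\<^sup>2} v" using Cw_continuous[OF Cv] .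
  \<comment> \<open>The square root is not differentiable at 0. The integral form holds up to the
    end point and yields the one-sided derivative there.\<close>
  have key: "u (sqrt a) = u 0 + integral {0..a} v" if "a \<in> {0..<\<epsilon>\<^sup>2}" for a
  proof -
    have sub: "{0..a} \<subseteq> {0..<\<epsilon>\<^sup>2}" using that by auto
    have "(v has_integral u (sqrt a) - u (sqrt 0)) {0..a}"
    proof (rule fundamental_theorem_of_calculus_interior)
      show "0 \<le> a" using that by auto
      show "continuous_on {0..a} (\<lambda>x. u (sqrt x))"
        by (rule continuous_on_compose2[of ?I u]) (use Suc.prems(1) Cw_continuous sq sub in \<open>auto intro!: continuous_intros simp del: greaterThanLessThan_iff\<close>)
      fix x assume x: "x \<in> {0<..<a}"
      then have "x \<in> {0..<\<epsilon>\<^sup>2}" using that by auto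
      then have xi: "sqrt x \<in> ?I" by (rule sq)
      have "((\<lambda>x. sqrt x) has_vector_derivative inverse (sqrt x) / 2) (at x)"
        unfolding has_real_derivative_iff_has_vector_derivative[symmetric]
        by (rule DERIV_real_sqrt) (use x in auto)
      from vector_diff_chain_at[OF this d1[OF xi]]
      have "((\<lambda>x. u (sqrt x)) has_vector_derivative (inverse (sqrt x) / 2) * u1 (sqrt x)) (at x)" by (simp add: o_def)
      moreover have "(inverse (sqrt x) / 2) * u1 (sqrt x) = v x" using x u1q[OF xi] by (simp add: v_def field_simps)
      ultimately show "((\<lambda>x. u (sqrt x)) has_vector_derivative v x) (at x)" by simp
    qed
    then show ?thesis by (simp add: integral_unique)
  qed
  show ?case
  proof (rule Cw_SucI[OF _ Cv])
    fix a assume a: "a \<in> {0..<\<epsilon>\<^sup>2}"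
    then obtain b where b: "a < b" "b < \<epsilon>\<^sup>2" using dense by auto
    have "((\<lambda>x. integral {0..x} v) has_vector_derivative v a) (at a within {0..b})"
      by (rule integral_has_vector_derivative) (use contv a b in \<open>auto intro: continuous_on_subset\<close>)
    then have "((\<lambda>x. u 0 + integral {0..x} v) has_vector_derivative v a) (at a within {0..b})"
      using has_vector_derivative_add[OF has_vector_derivative_const] by fastforce
    moreover have "at a within {0..<\<epsilon>\<^sup>2} = at a within {0..b}"
      by (rule at_within_nhd[of a "{..<b}"]) (use a b in auto)
    ultimately have "((\<lambda>x. u 0 + integral {0..x} v) has_vector_derivative v a) (at a within {0..<\<epsilon>\<^sup>2})" by simp
    then show "((\<lambda>a. u (sqrt a)) has_vector_derivative v a) (at a within {0..<\<epsilon>\<^sup>2})"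
      by (rule has_vector_derivative_transform[rotated -1]) (use a key in auto)
  qed
qed

section \<open>Inverse and implicit functions\<close>

lemma has_derivative_inverse_within:
  fixes f g :: "real \<Rightarrow> real"
  assumes f: "(f has_real_derivative d) (at x within I)" and d: "d \<noteq> 0" and x: "x \<in> I"
    and g: "continuous (at (f x) within J) g" "\<And>y. y \<in> J \<Longrightarrow> g y \<in> I" "\<And>y. y \<in> J \<Longrightarrow> f (g y) = y" "g (f x) = x"
  shows "(g has_real_derivative inverse d) (at (f x) within J)"
proof -
  have q: "((\<lambda>y. (f y - f x) / (y - x)) \<longlongrightarrow> d) (at x within I)" using f by (simp add: has_field_derivative_iff)
  have gl: "filterlim g (at x within I) (at (f x) within J)"
    unfolding filterlim_at
  proof
    show "(g \<longlongrightarrow> x) (at (f x) within J)" using g(1,4) by (simp add: continuous_within)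
    show "\<forall>\<^sub>F y in at (f x) within J. g y \<in> I \<and> g y \<noteq> x"
      unfolding eventually_at_filter
    proof (rule always_eventually, intro allI impI)
      fix y assume "y \<noteq> f x" "y \<in> J"
      then show "g y \<in> I \<and> g y \<noteq> x" using g(2,3)[of y] by metis
    qed
  qed
  have "((\<lambda>y. (f (g y) - f x) / (g y - x)) \<longlongrightarrow> d) (at (f x) within J)"
    using filterlim_compose[OF q gl] .
  then have "((\<lambda>y. inverse ((f (g y) - f x) / (g y - x))) \<longlongrightarrow> inverse d) (at (f x) within J)"
    by (rule tendsto_inverse[OF _ d])
  moreover have "\<forall>\<^sub>F y in at (f x) within J. inverse ((f (g y) - f x) / (g y - x)) = (g y - g (f x)) / (y - f x)"
    unfolding eventually_at_filter
  proof (rule always_eventually, intro allI impI)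
    fix y assume "y \<noteq> f x" "y \<in> J"
    then show "inverse ((f (g y) - f x) / (g y - x)) = (g y - g (f x)) / (y - f x)"
      using g(3)[of y] g(4) by simp
  qed
  ultimately show ?thesis
    unfolding has_field_derivative_iff by (rule Lim_transform_eventually)
qed

text \<open>The derivative of \<open>g\<close> is the inverse of \<open>f' (g y)\<close>, so each
  order of smoothness of \<open>g\<close> gives the next one.\<close>

lemma Cw_inverse_function:
  fixes f :: "real \<Rightarrow> real"
  assumes f: "\<And>x. x \<in> I \<Longrightarrow> (f has_real_derivative f' x) (at x within I)" "\<forall>j. Cw j I f'" "\<And>x. x \<in> I \<Longrightarrow> f' x > 0"
    and g: "continuous_on J g" "\<And>y. y \<in> J \<Longrightarrow> g y \<in> I" "\<And>y. y \<in> J \<Longrightarrow> f (g y) = y" "\<And>x. x \<in> I \<Longrightarrow> f x \<in> J \<Longrightarrow> g (f x) = x"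
  shows "Cw k J g"
proof (induction k)
  case 0
  then show ?case using g(1) by simp
next
  case (Suc k)
  show ?case
  proof (rule Cw_SucI)
    fix y assume y: "y \<in> J"
    have "(g has_real_derivative inverse (f' (g y))) (at (f (g y)) within J)"
      by (rule has_derivative_inverse_within[OF f(1)[OF g(2)[OF y]]])
        (use f(3)[OF g(2)[OF y]] g y in \<open>auto simp: continuous_on_eq_continuous_within\<close>)
    then show "(g has_vector_derivative inverse (f' (g y))) (at y within J)"
      using g(3)[OF y] by (simp flip: has_real_derivative_iff_has_vector_derivative)
  next
    show "Cw k J (\<lambda>y. inverse (f' (g y)))"
      by (intro Cw_inverse Cw_compose_real[OF f(2)[rule_format] Suc]) (use f(3) g(2) in auto)
  qed
qed

text \<open>On a small square \<open>K\<close> is strictly increasing in the second variable, so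
  each vertical segment carries exactly one zero by the intermediate value theorem. Higher
  smoothness is read off from the formula for the derivative of \<open>\<phi>\<close>, by induction
  on the order.\<close>

lemma implicit_function:
  fixes K :: "real \<times> real \<Rightarrow> real"
  assumes "open W" "\<forall>j. Ck_on j W K" "(a, b) \<in> W" "K (a, b) = 0" "frechet_derivative K (at (a, b)) (0, 1) > 0"
  obtains \<epsilon> \<delta> \<phi> where "\<epsilon> > 0" "\<delta> > 0" "\<And>k. Cw k {a-\<epsilon><..<a+\<epsilon>} \<phi>" "\<phi> a = b"
    "\<And>x y. \<bar>x - a\<bar> < \<epsilon> \<Longrightarrow> \<bar>y - b\<bar> < \<delta> \<Longrightarrow> (x, y) \<in> W \<and> (K (x, y) = 0 \<longleftrightarrow> y = \<phi> x)"
    "\<And>x. \<bar>x - a\<bar> < \<epsilon> \<Longrightarrow> \<bar>\<phi> x - b\<bar> < \<delta>"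
    "\<And>x. \<bar>x - a\<bar> < \<epsilon> \<Longrightarrow> (\<phi> has_real_derivative
        - frechet_derivative K (at (x, \<phi> x)) (1, 0) / frechet_derivative K (at (x, \<phi> x)) (0, 1)) (at x)"
proof -
  define Kx where "Kx p = frechet_derivative K (at p) (1, 0)" for p
  define Ky where "Ky p = frechet_derivative K (at p) (0, 1)" for p
  have CKx: "Ck_on j W Kx" and CKy: "Ck_on j W Ky" for j
    using Ck_on_Suc_frechet[of j W K] assms(2) unfolding Kx_def Ky_def by blast+
  have contK: "continuous_on W K" using assms(2) Ck_on_continuous by blast
  have dK: "(K has_derivative (\<lambda>v. fst v * Kx p + snd v * Ky p)) (at p)" if "p \<in> W" for p
  proof -
    have D: "(K has_derivative frechet_derivative K (at p)) (at p)"
      using Ck_on_SucD[of 0 W K] assms(2) that by blast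
    have l: "linear (frechet_derivative K (at p))" using D has_derivative_linear by blast
    have "frechet_derivative K (at p) v = fst v * Kx p + snd v * Ky p" for v
    proof -
      have "v = fst v *\<^sub>R (1, 0) + snd v *\<^sub>R (0, 1)" by (simp add: prod_eq_iff)
      then have "frechet_derivative K (at p) v = frechet_derivative K (at p) (fst v *\<^sub>R (1, 0) + snd v *\<^sub>R (0, 1))" by simp
      also have "\<dots> = fst v * Kx p + snd v * Ky p"
        unfolding linear_add[OF l] linear_cmul[OF l] Kx_def Ky_def by simp
      finally show ?thesis .
    qed
    then have "frechet_derivative K (at p) = (\<lambda>v. fst v * Kx p + snd v * Ky p)" by (rule ext)
    then show ?thesis using D by simp
  qed
  obtain r where r: "r > 0" "\<And>x y. \<bar>x - a\<bar> \<le> r \<Longrightarrow> \<bar>y - b\<bar> \<le> r \<Longrightarrow> (x, y) \<in> W \<and> Ky (x, y) > 0"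
  proof -
    have "open (W \<inter> Ky -` {0<..})"
      by (rule continuous_open_preimage[OF Ck_on_continuous[OF CKy] assms(1)]) simp
    moreover have "W \<inter> Ky -` {0<..} = {p \<in> W. Ky p > 0}" by auto
    ultimately have "open {p \<in> W. Ky p > 0}" by simp
    moreover have "(a, b) \<in> {p \<in> W. Ky p > 0}" using assms(3,5) by (simp add: Ky_def)
    ultimately obtain e where e: "e > 0" "ball (a, b) e \<subseteq> {p \<in> W. Ky p > 0}" using open_contains_ball by blast
    have "(x, y) \<in> ball (a, b) e" if "\<bar>x - a\<bar> \<le> e/3" "\<bar>y - b\<bar> \<le> e/3" for x y
    proof -
      have "dist (a, b) (x, y) \<le> dist a x + dist b y" by (simp add: dist_prod_def sqrt_sum_squares_le_sum)
      also have "\<dots> < e" using that e(1) unfolding dist_real_def by linarith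
      finally show ?thesis by simp
    qed
    then have "(x, y) \<in> W \<and> Ky (x, y) > 0" if "\<bar>x - a\<bar> \<le> e/3" "\<bar>y - b\<bar> \<le> e/3" for x y
      using that e(2) by blast
    then show thesis using e(1) by (intro that[of "e/3"]) auto
  qed
  have mono: "K (x, y1) < K (x, y2)" if "\<bar>x - a\<bar> \<le> r" "\<bar>y1 - b\<bar> \<le> r" "\<bar>y2 - b\<bar> \<le> r" "y1 < y2" for x y1 y2
  proof (rule DERIV_pos_imp_increasing[OF that(4)])
    fix y assume y: "y1 \<le> y" "y \<le> y2"
    then have w: "(x, y) \<in> W" "Ky (x, y) > 0" using r(2)[of x y] that by auto
    have "((\<lambda>y. (x, y)) has_derivative (\<lambda>h. (0, h))) (at y)" by (auto intro!: derivative_eq_intros)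
    from diff_chain_at[OF this dK[OF w(1)]]
    have "((\<lambda>y. K (x, y)) has_real_derivative Ky (x, y)) (at y)"
    proof -
      have "(\<lambda>h. h * Ky (x, y)) = (*) (Ky (x, y))" by (auto simp: fun_eq_iff)
      with \<open>((K \<circ> Pair x) has_derivative (\<lambda>v. fst v * Kx (x, y) + snd v * Ky (x, y)) \<circ> (\<lambda>h. (0, h))) (at y)\<close>
      show ?thesis by (simp add: o_def has_field_derivative_def)
    qed
    then show "\<exists>d. ((\<lambda>y. K (x, y)) has_real_derivative d) (at y) \<and> 0 < d" using w by blast
  qed
  have m: "K (a, b - r) < 0" "K (a, b + r) > 0" using mono[of a "b - r" b] mono[of a b "b + r"] r(1) assms(4) by auto
  obtain \<epsilon> where e: "\<epsilon> > 0" "\<epsilon> \<le> r" "\<And>x. \<bar>x - a\<bar> < \<epsilon> \<Longrightarrow> K (x, b - r) < 0 \<and> K (x, b + r) > 0"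
  proof -
    have c: "continuous_on {a-r..a+r} (\<lambda>x. K (x, b - r))" "continuous_on {a-r..a+r} (\<lambda>x. K (x, b + r))"
      using r(1) by (auto intro!: continuous_on_compose2[OF contK] continuous_intros r(2)[THEN conjunct1])
    have "\<forall>\<^sub>F x in at a within {a-r..a+r}. K (x, b - r) < 0" "\<forall>\<^sub>F x in at a within {a-r..a+r}. K (x, b + r) > 0"
      using order_tendstoD(2)[OF c(1)[unfolded continuous_on_def, rule_format, of a] m(1)]
        order_tendstoD(1)[OF c(2)[unfolded continuous_on_def, rule_format, of a] m(2)] r(1) by auto
    then have "\<forall>\<^sub>F x in at a within {a-r..a+r}. K (x, b - r) < 0 \<and> K (x, b + r) > 0" by (rule eventually_conj)
    then obtain d where d: "d > 0" "\<And>x. x \<in> {a-r..a+r} \<Longrightarrow> x \<noteq> a \<Longrightarrow> dist x a < d \<Longrightarrow> K (x, b - r) < 0 \<and> K (x, b + r) > 0"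
      unfolding eventually_at by blast
    show thesis
    proof (rule that[of "min d r"])
      fix x assume "\<bar>x - a\<bar> < min d r"
      then show "K (x, b - r) < 0 \<and> K (x, b + r) > 0"
        using d(2)[of x] m unfolding dist_real_def by (cases "x = a") (simp, force)
    qed (use d r in auto)
  qed
  define \<phi> where "\<phi> x = (THE y. \<bar>y - b\<bar> < r \<and> K (x, y) = 0)" for x
  have phi: "\<bar>\<phi> x - b\<bar> < r \<and> K (x, \<phi> x) = 0" and phiu: "\<And>y. \<bar>y - b\<bar> < r \<Longrightarrow> K (x, y) = 0 \<Longrightarrow> y = \<phi> x"
    if x: "\<bar>x - a\<bar> < \<epsilon>" for x
  proof -
    have "continuous_on {b-r..b+r} (\<lambda>y. K (x, y))"
      using x e(2) by (auto intro!: continuous_on_compose2[OF contK] continuous_intros r(2)[THEN conjunct1])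
    then obtain y where y: "b - r \<le> y" "y \<le> b + r" "K (x, y) = 0"
      using IVT'[of "\<lambda>y. K (x, y)" "b - r" 0 "b + r"] e(3)[OF x] r(1) by (auto simp: less_imp_le)
    then have "\<bar>y - b\<bar> < r" using e(3)[OF x] by (cases "y = b - r \<or> y = b + r") auto
    moreover have "y' = y" if "\<bar>y' - b\<bar> < r" "K (x, y') = 0" for y'
      using mono[of x y y'] mono[of x y' y] x e(2) y that \<open>\<bar>y - b\<bar> < r\<close> by (cases y y' rule: linorder_cases) linarith+
    ultimately have ex1: "\<exists>!y. \<bar>y - b\<bar> < r \<and> K (x, y) = 0" using y by blast
    show "\<bar>\<phi> x - b\<bar> < r \<and> K (x, \<phi> x) = 0" unfolding \<phi>_def by (rule theI'[OF ex1])
    show "y = \<phi> x" if "\<bar>y - b\<bar> < r" "K (x, y) = 0" for y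
      using ex1 that \<open>\<bar>\<phi> x - b\<bar> < r \<and> K (x, \<phi> x) = 0\<close> by blast
  qed
  let ?I = "{a-\<epsilon><..<a+\<epsilon>}"
  have I: "x \<in> ?I \<longleftrightarrow> \<bar>x - a\<bar> < \<epsilon>" for x by auto
  have pW: "(x, \<phi> x) \<in> W" "Ky (x, \<phi> x) > 0" if "\<bar>x - a\<bar> < \<epsilon>" for x
    using r(2)[of x "\<phi> x"] phi[OF that] that e(2) by auto
  \<comment> \<open>Continuity comes from signs: a negative value of \<open>K\<close> just below the
    zero, or a positive one just above, persists for nearby first arguments and confines
    \<open>\<phi>\<close>.\<close>
  have isc: "isCont \<phi> x" if x: "\<bar>x - a\<bar> < \<epsilon>" for x
    unfolding isCont_def
  proof (rule order_tendstoI)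
    have pos: "\<forall>\<^sub>F z in at x. \<bar>z - a\<bar> < \<epsilon> \<and> P z"
      if "\<forall>\<^sub>F z in at x. P z" for P
    proof -
      have "\<forall>\<^sub>F z in at x. z \<in> ?I" by (rule eventually_at_in_open') (use x I in auto)
      then have "\<forall>\<^sub>F z in at x. \<bar>z - a\<bar> < \<epsilon>" by (simp only: I)
      then show ?thesis using that by (rule eventually_conj)
    qed
    have ck: "isCont (\<lambda>z. K (z, y)) x" if y: "\<bar>y - b\<bar> < r" for y
    proof -
      have "(x, y) \<in> W" using r(2)[of x y] x e(2) y by auto
      then have "isCont K (x, y)" using contK assms(1) continuous_on_eq_continuous_at by blast
      then show ?thesis by (intro isCont_o2[where f = "\<lambda>z. (z, y)" and g = K]) (auto intro!: continuous_intros)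
    qed
    fix y
    {
      assume y: "y < \<phi> x"
      have "max y (b - r) < \<phi> x" using y phi[OF x] by auto
      then obtain y' where "max y (b - r) < y'" "y' < \<phi> x" using dense by blast
      then have y': "y \<le> y'" "\<bar>y' - b\<bar> < r" "y' < \<phi> x" using phi[OF x] by auto
      then have "K (x, y') < 0" using mono[of x y' "\<phi> x"] phi[OF x] x e(2) by auto
      then have "\<forall>\<^sub>F z in at x. K (z, y') < 0" using order_tendstoD(2)[OF ck[OF y'(2), unfolded isCont_def]] by blast
      from pos[OF this] show "\<forall>\<^sub>F z in at x. y < \<phi> z"
      proof (rule eventually_mono)
        fix z assume z: "\<bar>z - a\<bar> < \<epsilon> \<and> K (z, y') < 0"
        then have "y' < \<phi> z" using mono[of z "\<phi> z" y'] phi[of z] y'(2) e(2) by (cases "\<phi> z" y' rule: linorder_cases) auto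
        then show "y < \<phi> z" using y' by simp
      qed
    next
      assume y: "\<phi> x < y"
      have "\<phi> x < min y (b + r)" using y phi[OF x] by auto
      then obtain y' where "y' < min y (b + r)" "\<phi> x < y'" using dense by blast
      then have y': "y' \<le> y" "\<bar>y' - b\<bar> < r" "\<phi> x < y'" using phi[OF x] by auto
      then have "K (x, y') > 0" using mono[of x "\<phi> x" y'] phi[OF x] x e(2) by auto
      then have "\<forall>\<^sub>F z in at x. K (z, y') > 0" using order_tendstoD(1)[OF ck[OF y'(2), unfolded isCont_def]] by blast
      from pos[OF this] show "\<forall>\<^sub>F z in at x. \<phi> z < y"
      proof (rule eventually_mono)
        fix z assume z: "\<bar>z - a\<bar> < \<epsilon> \<and> K (z, y') > 0"
        then have "\<phi> z < y'" using mono[of z y' "\<phi> z"] phi[of z] y'(2) e(2) by (cases "\<phi> z" y' rule: linorder_cases) auto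
        then show "\<phi> z < y" using y' by simp
      qed
    }
  qed
  have deriv: "(\<phi> has_real_derivative - Kx (x, \<phi> x) / Ky (x, \<phi> x)) (at x)" if x: "\<bar>x - a\<bar> < \<epsilon>" for x
  proof -
    let ?p = "(x, \<phi> x)"
    \<comment> \<open>The line below is \<open>K\<close> made linear in the second variable near the graph; it turns the
      differentiability of \<open>K\<close> at one point into that of \<open>\<phi>\<close>.\<close>
    define c where "c = Ky ?p"
    have c: "c > 0" using pW[OF x] c_def by simp
    define E where "E q = (if q = ?p then 0 else \<bar>K q - K ?p - (fst (q - ?p) * Kx ?p + snd (q - ?p) * c)\<bar> / norm (q - ?p))" for q
    have E0: "((\<lambda>q. E q) \<longlongrightarrow> 0) (at ?p)"
    proof -
      have "((\<lambda>q. norm (K q - K ?p - (fst (q - ?p) * Kx ?p + snd (q - ?p) * c)) / norm (q - ?p)) \<longlongrightarrow> 0) (at ?p)"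
        using dK[OF pW(1)[OF x]] unfolding has_derivative_iff_norm c_def by blast
      then show ?thesis
      proof (rule Lim_transform_eventually)
        have "E q = norm (K q - K ?p - (fst (q - ?p) * Kx ?p + snd (q - ?p) * c)) / norm (q - ?p)" if "q \<noteq> ?p" for q
          using that by (simp only: E_def if_False real_norm_def)
        then show "\<forall>\<^sub>F q in at ?p. norm (K q - K ?p - (fst (q - ?p) * Kx ?p + snd (q - ?p) * c)) / norm (q - ?p) = E q"
          unfolding eventually_at_filter by (intro always_eventually) metis
      qed
    qed
    have Ep: "E ?p = 0" by (simp add: E_def)
    have "isCont E ?p" using E0 unfolding isCont_def Ep .
    moreover have "isCont (\<lambda>z. (z, \<phi> z)) x" using isc[OF x] by (intro continuous_intros) auto
    ultimately have "isCont (\<lambda>z. E (z, \<phi> z)) x" by (rule isCont_o2[rotated])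
    then have El: "((\<lambda>z. E (z, \<phi> z)) \<longlongrightarrow> 0) (at x)" unfolding isCont_def Ep .
    \<comment> \<open>Once \<open>E\<close> is below \<open>c / 2\<close>, the increment of
      \<open>\<phi>\<close> is at most \<open>M - 1\<close> times that of the argument, so
      \<open>M\<close> bounds the ratio of \<open>norm (?q - ?p)\<close> to
      \<open>\<bar>z - x\<bar>\<close>.\<close>
    define M where "M = 1 + 2 * (\<bar>Kx ?p\<bar> + c) / c"
    have ev: "\<forall>\<^sub>F z in at x. E (z, \<phi> z) < c / 2 \<and> \<bar>z - a\<bar> < \<epsilon>"
    proof (rule eventually_conj)
      show "\<forall>\<^sub>F z in at x. E (z, \<phi> z) < c / 2" using order_tendstoD(2)[OF El, of "c/2"] c by simp
      have "\<forall>\<^sub>F z in at x. z \<in> ?I" by (rule eventually_at_in_open') (use x I in auto)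
      then show "\<forall>\<^sub>F z in at x. \<bar>z - a\<bar> < \<epsilon>" by (simp only: I)
    qed
    have bound: "\<bar>(\<phi> z - \<phi> x) / (z - x) - (- Kx ?p / c)\<bar> \<le> E (z, \<phi> z) * M / c"
      if z: "E (z, \<phi> z) < c / 2" "\<bar>z - a\<bar> < \<epsilon>" "z \<noteq> x" for z
    proof -
      let ?q = "(z, \<phi> z)"
      have ne: "norm (?q - ?p) > 0" using z(3) unfolding zero_less_norm_iff by (simp add: zero_prod_def)
      have kz: "K ?q = 0" "K ?p = 0" using phi[OF z(2)] phi[OF x] by auto
      have e1: "\<bar>(z - x) * Kx ?p + (\<phi> z - \<phi> x) * c\<bar> = E ?q * norm (?q - ?p)"
      proof -
        have "?q \<noteq> ?p" using z(3) by simp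
        then have "E ?q = \<bar>0 - 0 - (fst (?q - ?p) * Kx ?p + snd (?q - ?p) * c)\<bar> / norm (?q - ?p)"
          by (simp only: E_def if_False kz)
        then have "E ?q * norm (?q - ?p) = \<bar>0 - 0 - (fst (?q - ?p) * Kx ?p + snd (?q - ?p) * c)\<bar>"
          using ne by (metis nonzero_eq_divide_eq less_irrefl)
        then show ?thesis by simp
      qed
      have n: "norm (?q - ?p) \<le> \<bar>z - x\<bar> + \<bar>\<phi> z - \<phi> x\<bar>"
        by (simp add: norm_prod_def sqrt_sum_squares_le_sum_abs)
      have E1: "E ?q \<ge> 0" by (simp add: E_def)
      have "\<bar>\<phi> z - \<phi> x\<bar> * c = \<bar>(\<phi> z - \<phi> x) * c\<bar>" using c by (simp add: abs_mult)
      also have "\<dots> \<le> \<bar>(z - x) * Kx ?p + (\<phi> z - \<phi> x) * c\<bar> + \<bar>(z - x) * Kx ?p\<bar>" by linarith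
      also have "\<dots> \<le> (c/2) * (\<bar>z - x\<bar> + \<bar>\<phi> z - \<phi> x\<bar>) + \<bar>z - x\<bar> * \<bar>Kx ?p\<bar>"
        unfolding e1 abs_mult using mult_mono[OF less_imp_le[OF z(1)] n] c E1 by simp
      finally have "\<bar>\<phi> z - \<phi> x\<bar> * (c/2) \<le> \<bar>z - x\<bar> * (c/2 + \<bar>Kx ?p\<bar>)" by (simp add: algebra_simps)
      then have "\<bar>\<phi> z - \<phi> x\<bar> \<le> \<bar>z - x\<bar> * (c/2 + \<bar>Kx ?p\<bar>) / (c/2)" using c by (simp add: pos_le_divide_eq)
      also have "\<dots> \<le> \<bar>z - x\<bar> * (M - 1)" using c unfolding M_def by (simp add: field_simps mult_left_mono)
      finally have n2: "norm (?q - ?p) \<le> M * \<bar>z - x\<bar>" using n by (simp add: algebra_simps)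
      have "\<bar>(\<phi> z - \<phi> x) / (z - x) - (- Kx ?p / c)\<bar> = \<bar>(z - x) * Kx ?p + (\<phi> z - \<phi> x) * c\<bar> / (\<bar>z - x\<bar> * c)"
      proof -
        have "(\<phi> z - \<phi> x) / (z - x) - (- Kx ?p / c) = ((z - x) * Kx ?p + (\<phi> z - \<phi> x) * c) / ((z - x) * c)"
          using z(3) c by (simp add: field_simps)
        then show ?thesis using c by (simp add: abs_mult)
      qed
      also have "\<dots> \<le> E ?q * (M * \<bar>z - x\<bar>) / (\<bar>z - x\<bar> * c)"
        unfolding e1 using n2 E1 c by (intro divide_right_mono mult_left_mono) auto
      also have "\<dots> = E ?q * M / c" using z(3) by simp
      finally show ?thesis .
    qed
    have "((\<lambda>z. E (z, \<phi> z) * M / c) \<longlongrightarrow> 0) (at x)"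
      using tendsto_divide[OF tendsto_mult[OF El tendsto_const[of M]] tendsto_const[of c]] c by simp
    moreover have "\<forall>\<^sub>F z in at x. norm ((\<phi> z - \<phi> x) / (z - x) - (- Kx ?p / c)) \<le> E (z, \<phi> z) * M / c"
    proof -
      have "\<forall>\<^sub>F z in at x. z \<noteq> x" by (simp add: eventually_at_filter)
      with ev show ?thesis by eventually_elim (use bound in auto)
    qed
    ultimately have "((\<lambda>z. (\<phi> z - \<phi> x) / (z - x) - (- Kx ?p / c)) \<longlongrightarrow> 0) (at x)"
      by (rule Lim_null_comparison[rotated])
    then have "((\<lambda>z. (\<phi> z - \<phi> x) / (z - x)) \<longlongrightarrow> - Kx ?p / c) (at x)" by (rule LIM_zero_cancel)
    then show ?thesis unfolding has_field_derivative_iff c_def .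
  qed
  have C: "Cw k ?I \<phi>" for k
  proof (induction k)
    case 0
    have "continuous_on ?I \<phi>" by (intro continuous_at_imp_continuous_on ballI isc) (simp only: I)
    then show ?case by simp
  next
    case (Suc k)
    have Cp: "Cw k ?I (\<lambda>x. (x, \<phi> x))"
    proof -
      have "Cw k ?I (\<lambda>x. x *\<^sub>R (1::real, 0::real) + \<phi> x *\<^sub>R (0::real, 1::real))"
        by (intro Cw_add Cw_scaleR Cw_id Cw_const Suc)
      then show ?thesis by simp
    qed
    show ?case
    proof (rule Cw_SucI)
      fix x assume "x \<in> ?I"
      then have "\<bar>x - a\<bar> < \<epsilon>" by (simp only: I)
      then show "(\<phi> has_vector_derivative - Kx (x, \<phi> x) / Ky (x, \<phi> x)) (at x within ?I)"
        unfolding has_real_derivative_iff_has_vector_derivative[symmetric]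
        by (rule has_field_derivative_at_within[OF deriv])
    next
      have sub: "(\<lambda>x. (x, \<phi> x)) ` ?I \<subseteq> W" by (intro image_subsetI pW(1)) (simp only: I)
      have A: "Cw k ?I (\<lambda>x. - Kx (x, \<phi> x))" by (rule Cw_minus[OF Cw_compose_Ck[OF CKx Cp sub]])
      have B: "Cw k ?I (\<lambda>x. Ky (x, \<phi> x))" by (rule Cw_compose_Ck[OF CKy Cp sub])
      show "Cw k ?I (\<lambda>x. - Kx (x, \<phi> x) / Ky (x, \<phi> x))"
      proof (rule Cw_divide[OF A B])
        fix x assume "x \<in> ?I"
        then have "\<bar>x - a\<bar> < \<epsilon>" by (simp only: I)
        then show "0 < Ky (x, \<phi> x)" by (rule pW(2))
      qed
    qed
  qed
  show thesis
  proof (rule that[of \<epsilon> r \<phi>])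
    show "\<phi> a = b" using phiu[of a b] e(1) r(1) assms(4) by simp
    show "(x, y) \<in> W \<and> (K (x, y) = 0 \<longleftrightarrow> y = \<phi> x)" if "\<bar>x - a\<bar> < \<epsilon>" "\<bar>y - b\<bar> < r" for x y
    proof -
      have "(x, y) \<in> W" using r(2)[of x y] that e(2) by simp
      then show ?thesis using phi[OF that(1)] phiu[OF that] by blast
    qed
    show "\<epsilon> > 0" "r > 0" by fact+
    show "Cw k ?I \<phi>" for k by (rule C)
    show "\<bar>\<phi> x - b\<bar> < r" if "\<bar>x - a\<bar> < \<epsilon>" for x using phi[OF that] by simp
    show "(\<phi> has_real_derivative - frechet_derivative K (at (x, \<phi> x)) (1, 0) / frechet_derivative K (at (x, \<phi> x)) (0, 1)) (at x)"
      if "\<bar>x - a\<bar> < \<epsilon>" for x using deriv[OF that] by (simp add: Kx_def Ky_def)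
  qed
qed

section \<open>Local geometry of hypersurfaces\<close>

definition grad :: "('a::euclidean_space \<Rightarrow> real) \<Rightarrow> 'a \<Rightarrow> 'a" where
  "grad f x = (\<Sum>b\<in>Basis. frechet_derivative f (at x) b *\<^sub>R b)"

lemma frechet_derivative_grad:
  assumes "f differentiable (at x)"
  shows "frechet_derivative f (at x) v = grad f x \<bullet> v"
  unfolding frechet_derivative_expand[OF assms, of v] grad_def inner_sum_left
  by (simp add: inner_commute mult.commute)

lemma has_derivative_grad:
  assumes "f differentiable (at x)"
  shows "(f has_derivative (\<lambda>v. grad f x \<bullet> v)) (at x)"
proof -
  have "frechet_derivative f (at x) = (\<lambda>v. grad f x \<bullet> v)" using frechet_derivative_grad[OF assms] by (rule ext)
  then show ?thesis using assms by (simp add: frechet_derivative_works)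
qed

lemma Ck_on_grad:
  assumes "open U" "Ck_on (Suc k) U f"
  shows "Ck_on k U (grad f)"
  unfolding grad_def[abs_def]
  by (intro Ck_on_sum[OF assms(1)] Ck_on_scaleR[OF assms(1)] Ck_on_const[OF assms(1)] Ck_on_Suc_frechet[OF assms(2)])

definition defining_function :: "'a::euclidean_space set \<Rightarrow> 'a set \<Rightarrow> ('a \<Rightarrow> real) \<Rightarrow> bool" where
  "defining_function S U f \<longleftrightarrow> open U \<and> (\<forall>k. Ck_on k U f) \<and> (\<forall>q\<in>U. grad f q \<noteq> 0) \<and> S \<inter> U = {q \<in> U. f q = 0}"

lemma hypersurface_defining_function:
  assumes "smooth_hypersurface S" "p \<in> S"
  obtains U f where "p \<in> U" "defining_function S U f"
proof -
  obtain U f where U: "open U" "p \<in> U" "\<forall>k. Ck_on k U (f :: 'a \<Rightarrow> real)"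
    "\<forall>q\<in>U. \<exists>v. frechet_derivative f (at q) v \<noteq> 0" "S \<inter> U = {q \<in> U. f q = 0}"
    using bspec[OF assms(1)[unfolded smooth_hypersurface_def] assms(2)] by blast
  have "grad f q \<noteq> 0" if "q \<in> U" for q
  proof -
    have "f differentiable (at q)" using U(3)[rule_format, of 1] that by simp
    then show ?thesis using U(4) that frechet_derivative_grad by (metis inner_zero_left)
  qed
  then show thesis using U by (intro that) (auto simp: defining_function_def)
qed

lemma defining_functionD:
  assumes "defining_function S U f"
  shows "open U" "Ck_on k U f" "q \<in> U \<Longrightarrow> grad f q \<noteq> 0" "q \<in> U \<Longrightarrow> q \<in> S \<longleftrightarrow> f q = 0"
    "q \<in> U \<Longrightarrow> (f has_derivative (\<lambda>v. grad f q \<bullet> v)) (at q)" "Ck_on k U (grad f)"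
proof -
  show o: "open U" and C: "Ck_on k U f" and "q \<in> U \<Longrightarrow> grad f q \<noteq> 0" for k
    using assms by (auto simp: defining_function_def)
  show "q \<in> U \<Longrightarrow> q \<in> S \<longleftrightarrow> f q = 0" using assms unfolding defining_function_def by blast
  show "(f has_derivative (\<lambda>v. grad f q \<bullet> v)) (at q)" if "q \<in> U"
    by (rule has_derivative_grad) (use C[of 1] that in simp)
  show "Ck_on k U (grad f)" by (rule Ck_on_grad[OF o C])
qed

lemma defining_function_Int:
  assumes "defining_function S U f" "open V"
  shows "defining_function (S \<inter> V) (U \<inter> V) f" "defining_function S (U \<inter> V) f"
  using assms Ck_on_subset[of _ U f "U \<inter> V"] unfolding defining_function_def by blast+

section \<open>Tangent spaces of level sets\<close>

lemma tangent_space_subset_kernel: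
  assumes "\<And>q. q \<in> S \<Longrightarrow> q \<in> U \<Longrightarrow> f q = 0" "open U" "p \<in> U" "p \<in> S" "(f has_derivative (\<lambda>v. n \<bullet> v)) (at p)" "v \<in> tangent_space S p"
  shows "(n::'a::euclidean_space) \<bullet> v = (0::real)"
proof -
  obtain \<gamma> :: "real \<Rightarrow> 'a" where g: "\<And>t. \<gamma> t \<in> S" "\<gamma> 0 = p" "(\<gamma> has_vector_derivative v) (at 0)"
    using assms(6) unfolding tangent_space_def by blast
  have "isCont \<gamma> 0" using g(3) has_vector_derivative_continuous by blast
  then have "\<forall>\<^sub>F t in nhds 0. \<gamma> t \<in> U"
    using g(2) assms(2,3) unfolding isCont_def tendsto_def eventually_nhds_conv_at by simp
  then have ev: "\<forall>\<^sub>F t in nhds 0. f (\<gamma> t) = 0" by eventually_elim (use assms(1) g(1) in blast)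
  have "(f has_derivative (\<lambda>v. n \<bullet> v)) (at (\<gamma> 0))" using assms(5) g(2) by simp
  from vector_derivative_diff_chain_within[OF g(3) has_derivative_at_withinI[OF this]]
  have "((\<lambda>t. f (\<gamma> t)) has_vector_derivative (n \<bullet> v)) (at 0)" by (simp add: o_def)
  then have 1: "((\<lambda>t. f (\<gamma> t)) has_real_derivative (n \<bullet> v)) (at 0)" by (simp add: has_real_derivative_iff_has_vector_derivative)
  have "((\<lambda>t. f (\<gamma> t)) has_real_derivative 0) (at 0)"
    using DERIV_cong_ev[OF refl ev refl] DERIV_const by blast
  with 1 show ?thesis by (rule DERIV_unique)
qed

text \<open>Near \<open>p\<close> the function differs little from its linear part, so along the
  normal line through \<open>p + t *\<^sub>R v\<close> it changes sign between the offsets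
  \<open>- \<epsilon> * \<bar>t\<bar>\<close> and \<open>\<epsilon> * \<bar>t\<bar>\<close>. The
  zero set is thus reached from a tangent line by a correction of order o(t).\<close>

lemma zero_near_tangent:
  fixes f :: "'a::euclidean_space \<Rightarrow> real"
  assumes "open U" "p \<in> U" "continuous_on U f" "f p = 0" "(f has_derivative (\<lambda>v. n \<bullet> v)) (at p)" "n \<noteq> 0" "n \<bullet> v = 0" "\<epsilon> > 0"
  shows "\<exists>\<delta>>0. \<forall>t. \<bar>t\<bar> < \<delta> \<and> t \<noteq> 0 \<longrightarrow> (\<exists>s. \<bar>s\<bar> \<le> \<epsilon> * \<bar>t\<bar> \<and> p + t *\<^sub>R v + s *\<^sub>R n \<in> U \<and> f (p + t *\<^sub>R v + s *\<^sub>R n) = 0)"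
proof -
  \<comment> \<open>\<open>C - 1\<close> bounds the displacement divided by
    \<open>\<bar>t\<bar>\<close>; the extra 1 makes the error estimate strict. The constant
    \<open>e\<close> is fixed so that \<open>e * \<bar>t\<bar> * C\<close> is the change
    \<open>\<epsilon> * \<bar>t\<bar> * (n \<bullet> n)\<close> of the linear part.\<close>
  define C where "C = norm v + \<epsilon> * norm n + 1"
  have C: "C > 0" using assms(8) by (simp add: C_def add_nonneg_pos)
  define e where "e = \<epsilon> * (n \<bullet> n) / C"
  have nn: "n \<bullet> n > 0" using assms(6) by simp
  have e: "e > 0" using nn C assms(8) by (simp add: e_def)
  obtain d1 where d1: "d1 > 0" "\<And>y. norm (y - p) < d1 \<Longrightarrow> norm (f y - f p - n \<bullet> (y - p)) \<le> e * norm (y - p)"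
    using assms(5) e unfolding has_derivative_at_alt by blast
  obtain d2 where d2: "d2 > 0" "ball p d2 \<subseteq> U" using assms(1,2) open_contains_ball by blast
  define \<delta> where "\<delta> = min d1 d2 / C"
  have "\<delta> > 0" using d1 d2 C by (simp add: \<delta>_def)
  moreover have "\<exists>s. \<bar>s\<bar> \<le> \<epsilon> * \<bar>t\<bar> \<and> p + t *\<^sub>R v + s *\<^sub>R n \<in> U \<and> f (p + t *\<^sub>R v + s *\<^sub>R n) = 0"
    if t: "\<bar>t\<bar> < \<delta>" "t \<noteq> 0" for t
  proof -
    have nb: "norm (t *\<^sub>R v + s *\<^sub>R n) \<le> \<bar>t\<bar> * (C - 1)" if "\<bar>s\<bar> \<le> \<epsilon> * \<bar>t\<bar>" for s
    proof -
      have "norm (t *\<^sub>R v + s *\<^sub>R n) \<le> \<bar>t\<bar> * norm v + \<bar>s\<bar> * norm n" using norm_triangle_ineq[of "t *\<^sub>R v" "s *\<^sub>R n"] by simp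
      also have "\<dots> \<le> \<bar>t\<bar> * norm v + (\<epsilon> * \<bar>t\<bar>) * norm n" using that by (intro add_left_mono mult_right_mono) auto
      finally show ?thesis by (simp add: C_def algebra_simps)
    qed
    have "\<bar>t\<bar> * C < min d1 d2" using t(1) C by (simp add: \<delta>_def pos_less_divide_eq)
    then have small: "norm (t *\<^sub>R v + s *\<^sub>R n) < d1" "norm (t *\<^sub>R v + s *\<^sub>R n) < d2" if "\<bar>s\<bar> \<le> \<epsilon> * \<bar>t\<bar>" for s
      using nb[OF that] t(2) by (auto simp: algebra_simps)
    have inU: "p + t *\<^sub>R v + s *\<^sub>R n \<in> U" if "\<bar>s\<bar> \<le> \<epsilon> * \<bar>t\<bar>" for s
    proof -
      have "dist p (p + t *\<^sub>R v + s *\<^sub>R n) = norm (t *\<^sub>R v + s *\<^sub>R n)"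
        unfolding dist_norm by (metis add.assoc add_diff_cancel_left' norm_minus_commute)
      then show ?thesis using small(2)[OF that] d2(2) by auto
    qed
    define \<psi> where "\<psi> s = f (p + t *\<^sub>R v + s *\<^sub>R n)" for s
    have est: "\<bar>\<psi> s - s * (n \<bullet> n)\<bar> < \<epsilon> * \<bar>t\<bar> * (n \<bullet> n)" if "\<bar>s\<bar> \<le> \<epsilon> * \<bar>t\<bar>" for s
    proof -
      let ?y = "p + t *\<^sub>R v + s *\<^sub>R n"
      have y: "?y - p = t *\<^sub>R v + s *\<^sub>R n" by simp
      have "\<bar>\<psi> s - s * (n \<bullet> n)\<bar> = norm (f ?y - f p - n \<bullet> (?y - p))"
        unfolding y using assms(4,7) by (simp add: \<psi>_def inner_add_right)
      also have "\<dots> \<le> e * norm (t *\<^sub>R v + s *\<^sub>R n)" using d1(2)[of ?y] small(1)[OF that] unfolding y by blast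
      also have "\<dots> \<le> e * (\<bar>t\<bar> * (C - 1))" using nb[OF that] e by (intro mult_left_mono) auto
      also have "\<dots> < e * (\<bar>t\<bar> * C)" using e t(2) by (intro mult_strict_left_mono) auto
      also have "\<dots> = \<epsilon> * \<bar>t\<bar> * (n \<bullet> n)" using C by (simp add: e_def)
      finally show ?thesis .
    qed
    let ?a = "\<epsilon> * \<bar>t\<bar>"
    have a: "?a \<ge> 0" using assms(8) by simp
    have "\<psi> (- ?a) \<le> 0" using est[of "- ?a"] a by (simp add: algebra_simps abs_less_iff)
    moreover have "0 \<le> \<psi> ?a" using est[of ?a] a by (simp add: algebra_simps abs_less_iff)
    moreover have "continuous_on {- ?a..?a} \<psi>" unfolding \<psi>_def
      by (rule continuous_on_compose2[OF assms(3)]) (auto intro!: continuous_intros inU)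
    ultimately obtain s where "- ?a \<le> s" "s \<le> ?a" "\<psi> s = 0" using IVT'[of \<psi> "- ?a" 0 ?a] a by auto
    then show ?thesis using inU[of s] unfolding \<psi>_def by (intro exI[of _ s]) auto
  qed
  ultimately show ?thesis by blast
qed

text \<open>The curves in \<open>tangent_space\<close> must stay in \<open>S\<close> for all times
  but need a derivative only at time 0. So a tangent vector is realised by a curve selected
  pointwise, with no regularity elsewhere: the point on the tangent line is pushed to
  \<open>S\<close> along the normal by a nearly minimal amount, and sits at \<open>p\<close> where
  no such point exists.\<close>

lemma tangent_space_level:
  assumes "defining_function S U f" "p \<in> S" "p \<in> U"
  shows "tangent_space S p = {v. grad f p \<bullet> v = 0}"
proof (intro equalityI subsetI)
  note df = defining_functionD[OF assms(1)]
  fix v assume "v \<in> tangent_space S p"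
  then show "v \<in> {v. grad f p \<bullet> v = 0}"
    using tangent_space_subset_kernel[OF _ df(1) assms(3,2) df(5)[OF assms(3)]] df(4) by blast
next
  note df = defining_functionD[OF assms(1)]
  define n where "n = grad f p"
  have n: "n \<noteq> 0" using df(3)[OF assms(3)] by (simp add: n_def)
  fix v assume "v \<in> {v. grad f p \<bullet> v = 0}"
  then have nv: "n \<bullet> v = 0" by (simp add: n_def)
  have f0: "f p = 0" using df(4) assms by blast
  define Z where "Z t = {s. p + t *\<^sub>R v + s *\<^sub>R n \<in> S}" for t
  define m where "m t = Inf (abs ` Z t)" for t
  \<comment> \<open>The infimum need not be attained; the slack \<open>t\<^sup>2\<close> is of lower
    order than \<open>t\<close> and does not affect the derivative at 0.\<close>
  define s where "s t = (SOME s. s \<in> Z t \<and> \<bar>s\<bar> < m t + t\<^sup>2)" for t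
  have s: "s t \<in> Z t \<and> \<bar>s t\<bar> < m t + t\<^sup>2" if "Z t \<noteq> {}" "t \<noteq> 0" for t
  proof -
    have "Inf (abs ` Z t) < m t + t\<^sup>2" using that(2) by (simp add: m_def)
    then have "\<exists>x\<in>abs ` Z t. x < m t + t\<^sup>2" using that(1) by (intro cInf_lessD) auto
    then have "\<exists>s. s \<in> Z t \<and> \<bar>s\<bar> < m t + t\<^sup>2" by blast
    then show ?thesis unfolding s_def by (rule someI_ex)
  qed
  define \<gamma> where "\<gamma> t = (if t = 0 \<or> Z t = {} then p else p + t *\<^sub>R v + s t *\<^sub>R n)" for t
  have "\<gamma> t \<in> S" for t using s[of t] assms(2) by (auto simp: \<gamma>_def Z_def)
  moreover have "\<gamma> 0 = p" by (simp add: \<gamma>_def)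
  moreover have "(\<gamma> has_vector_derivative v) (at 0)"
    unfolding has_vector_derivative_def has_derivative_at_alt
  proof (intro conjI allI impI)
    fix e :: real assume e: "0 < e"
    define \<epsilon> where "\<epsilon> = e / (2 * norm n)"
    have eps: "\<epsilon> > 0" using e n by (simp add: \<epsilon>_def)
    obtain \<delta> where d: "\<delta> > 0" "\<And>t. \<bar>t\<bar> < \<delta> \<Longrightarrow> t \<noteq> 0 \<Longrightarrow> \<exists>s. \<bar>s\<bar> \<le> \<epsilon> * \<bar>t\<bar> \<and> p + t *\<^sub>R v + s *\<^sub>R n \<in> U \<and> f (p + t *\<^sub>R v + s *\<^sub>R n) = 0"
      using zero_near_tangent[OF df(1) assms(3) Ck_on_continuous[OF df(2)] f0 df(5)[OF assms(3), folded n_def] n nv eps] by blast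
    have "norm (\<gamma> t - \<gamma> 0 - (t - 0) *\<^sub>R v) \<le> e * norm (t - 0)" if t: "norm (t - 0) < min \<delta> \<epsilon>" for t
    proof (cases "t = 0")
      case False
      obtain s' where s': "\<bar>s'\<bar> \<le> \<epsilon> * \<bar>t\<bar>" "p + t *\<^sub>R v + s' *\<^sub>R n \<in> U" "f (p + t *\<^sub>R v + s' *\<^sub>R n) = 0"
        using d(2)[of t] t False by auto
      then have Z: "s' \<in> Z t" using df(4) by (simp add: Z_def)
      then have "m t \<le> \<bar>s'\<bar>" unfolding m_def by (intro cInf_lower) (auto intro!: bdd_belowI[of _ 0])
      moreover have "Z t \<noteq> {}" using Z by blast
      ultimately have "\<bar>s t\<bar> \<le> \<epsilon> * \<bar>t\<bar> + t\<^sup>2" using conjunct2[OF s[OF _ False]] s'(1) by fastforce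
      also have "t\<^sup>2 \<le> \<epsilon> * \<bar>t\<bar>"
      proof -
        have "t\<^sup>2 = \<bar>t\<bar> * \<bar>t\<bar>" by (simp add: power2_eq_square)
        also have "\<dots> \<le> \<epsilon> * \<bar>t\<bar>" using t by (intro mult_right_mono) auto
        finally show ?thesis .
      qed
      finally have "\<bar>s t\<bar> \<le> 2 * \<epsilon> * \<bar>t\<bar>" by simp
      then have "\<bar>s t\<bar> * norm n \<le> 2 * \<epsilon> * \<bar>t\<bar> * norm n" by (rule mult_right_mono) simp
      also have "\<dots> = e * \<bar>t\<bar>" using n by (simp add: \<epsilon>_def)
      finally have "norm (s t *\<^sub>R n) \<le> e * \<bar>t\<bar>" by simp
      moreover have "\<gamma> t - \<gamma> 0 - (t - 0) *\<^sub>R v = s t *\<^sub>R n" using False Z by (auto simp: \<gamma>_def)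
      ultimately show ?thesis by simp
    qed (simp add: \<gamma>_def)
    then show "\<exists>d>0. \<forall>t. norm (t - 0) < d \<longrightarrow> norm (\<gamma> t - \<gamma> 0 - (t - 0) *\<^sub>R v) \<le> e * norm (t - 0)"
      using d(1) eps by (intro exI[of _ "min \<delta> \<epsilon>"]) auto
  qed (rule bounded_linear_scaleR_left)
  ultimately show "v \<in> tangent_space S p" unfolding tangent_space_def by blast
qed

section \<open>Unit normals\<close>

definition unit_normal :: "'a::euclidean_space set \<Rightarrow> 'a \<Rightarrow> 'a \<Rightarrow> bool" where
  "unit_normal S p \<nu> \<longleftrightarrow> norm \<nu> = 1 \<and> (\<forall>v\<in>tangent_space S p. \<nu> \<bullet> v = 0)"

text \<open>The normalised gradient, written with \<open>powr\<close> so that smoothness follows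
  from \<open>Ck_on_powr\<close>.\<close>

definition nrm :: "('a::euclidean_space \<Rightarrow> real) \<Rightarrow> 'a \<Rightarrow> 'a" where
  "nrm f q = (grad f q \<bullet> grad f q) powr (-1/2) *\<^sub>R grad f q"

lemma Ck_on_nrm_factor:
  assumes "defining_function S U f"
  shows "Ck_on k U (\<lambda>q. (grad f q \<bullet> grad f q) powr (-1/2))"
  by (rule Ck_on_powr) (use defining_functionD[OF assms] in \<open>auto intro: Ck_on_inner\<close>)

lemma Ck_on_nrm:
  assumes "defining_function S U f"
  shows "Ck_on k U (nrm f)"
  unfolding nrm_def[abs_def]
  by (rule Ck_on_scaleR[OF _ Ck_on_nrm_factor[OF assms]]) (use defining_functionD[OF assms] in auto)

lemma norm_nrm: "grad f q \<noteq> 0 \<Longrightarrow> norm (nrm f q) = 1"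
  by (simp add: nrm_def powr_minus_divide powr_half_sqrt norm_eq_sqrt_inner)

lemma unit_normal_nrm:
  assumes "defining_function S U f" "q \<in> S" "q \<in> U"
  shows "unit_normal S q (nrm f q)"
  using tangent_space_level[OF assms] norm_nrm defining_functionD(3)[OF assms(1,3)]
  by (auto simp: unit_normal_def nrm_def)

lemma orthogonal_complement_line:
  fixes n \<nu> :: "'a::euclidean_space"
  assumes "n \<noteq> 0" "\<And>v. n \<bullet> v = 0 \<Longrightarrow> \<nu> \<bullet> v = 0"
  shows "\<nu> = ((\<nu> \<bullet> n) / (n \<bullet> n)) *\<^sub>R n"
proof -
  define v where "v = \<nu> - ((\<nu> \<bullet> n) / (n \<bullet> n)) *\<^sub>R n"
  have nv: "n \<bullet> v = 0" using assms(1) by (simp add: v_def inner_diff_right inner_commute)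
  then have "\<nu> \<bullet> v = 0" by (rule assms(2))
  then have "v \<bullet> v = 0" using nv by (simp add: v_def inner_diff_left)
  then show ?thesis by (simp add: v_def)
qed

lemma unit_normal_tangent_space:
  assumes "smooth_hypersurface S" "p \<in> S" "unit_normal S p \<nu>"
  shows "tangent_space S p = {v. \<nu> \<bullet> v = 0}"
proof -
  obtain U f where U: "p \<in> U" "defining_function S U f" using hypersurface_defining_function[OF assms(1,2)] .
  define n where "n = grad f p"
  have T: "tangent_space S p = {v. n \<bullet> v = 0}" unfolding n_def by (rule tangent_space_level[OF U(2) assms(2) U(1)])
  have n: "n \<noteq> 0" using defining_functionD(3)[OF U(2,1)] by (simp add: n_def)
  have "\<nu> = ((\<nu> \<bullet> n) / (n \<bullet> n)) *\<^sub>R n"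
    by (rule orthogonal_complement_line[OF n]) (use assms(3) T in \<open>auto simp: unit_normal_def\<close>)
  moreover have "\<nu> \<noteq> 0" using assms(3) by (auto simp: unit_normal_def)
  ultimately obtain c where "\<nu> = c *\<^sub>R n" "c \<noteq> 0" by (metis scaleR_zero_left)
  then show ?thesis using T by simp
qed

lemma unit_normal_unique:
  assumes "smooth_hypersurface S" "p \<in> S" "unit_normal S p \<nu>" "unit_normal S p \<nu>'"
  shows "\<nu>' = (\<nu>' \<bullet> \<nu>) *\<^sub>R \<nu>" "\<bar>\<nu>' \<bullet> \<nu>\<bar> = 1"
proof -
  have n: "norm \<nu> = 1" "norm \<nu>' = 1" using assms(3,4) by (auto simp: unit_normal_def)
  then have 1: "\<nu> \<bullet> \<nu> = 1" "\<nu> \<noteq> 0" by (auto simp: norm_eq_1)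
  have "\<nu>' = ((\<nu>' \<bullet> \<nu>) / (\<nu> \<bullet> \<nu>)) *\<^sub>R \<nu>"
    by (rule orthogonal_complement_line[OF 1(2)])
      (use assms(4) unit_normal_tangent_space[OF assms(1-3)] in \<open>auto simp: unit_normal_def\<close>)
  then show eq: "\<nu>' = (\<nu>' \<bullet> \<nu>) *\<^sub>R \<nu>" using 1 by simp
  have "norm \<nu>' = \<bar>\<nu>' \<bullet> \<nu>\<bar> * norm \<nu>" by (subst eq) simp
  then show "\<bar>\<nu>' \<bullet> \<nu>\<bar> = 1" using n by simp
qed

lemma unit_normal_square_unique:
  assumes "smooth_hypersurface S" "p \<in> S" "unit_normal S p \<nu>" "unit_normal S p \<nu>'"
  shows "(x \<bullet> \<nu>')\<^sup>2 = (x \<bullet> \<nu>)\<^sup>2"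
proof -
  have "x \<bullet> \<nu>' = (\<nu>' \<bullet> \<nu>) * (x \<bullet> \<nu>)" by (subst unit_normal_unique(1)[OF assms]) simp
  then have "(x \<bullet> \<nu>')\<^sup>2 = (\<nu>' \<bullet> \<nu>)\<^sup>2 * (x \<bullet> \<nu>)\<^sup>2" by (simp add: power_mult_distrib)
  moreover have "(\<nu>' \<bullet> \<nu>)\<^sup>2 = 1" using unit_normal_unique(2)[OF assms] by (metis abs_1 power2_abs one_power2)
  ultimately show ?thesis by simp
qed

lemma unit_normal_exists:
  assumes "smooth_hypersurface S" "p \<in> S"
  obtains \<nu> where "unit_normal S p \<nu>"
  using hypersurface_defining_function[OF assms] unit_normal_nrm assms(2) by metis

section \<open>Traces over orthonormal tangent bases\<close>

definition completing_onb :: "'a::euclidean_space set \<Rightarrow> 'a \<Rightarrow> bool" where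
  "completing_onb B \<nu> \<longleftrightarrow> pairwise orthogonal B \<and> (\<forall>e\<in>B. norm e = 1) \<and> span B = {v. \<nu> \<bullet> v = 0} \<and> norm \<nu> = 1"

lemma tangent_onb_completing:
  assumes "smooth_hypersurface S" "p \<in> S" "unit_normal S p \<nu>"
  shows "completing_onb (tangent_onb S p) \<nu>"
proof -
  have T: "tangent_space S p = {v. \<nu> \<bullet> v = 0}" by (rule unit_normal_tangent_space[OF assms])
  obtain B where "pairwise orthogonal B" "\<And>e. e \<in> B \<Longrightarrow> norm e = 1" "span B = {v. \<nu> \<bullet> v = 0}"
    using orthonormal_basis_subspace[OF subspace_hyperplane[of \<nu>]] by metis
  then have "\<exists>B. pairwise orthogonal B \<and> (\<forall>e\<in>B. norm e = 1) \<and> span B = tangent_space S p" using T by blast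
  from someI_ex[OF this, folded tangent_onb_def] show ?thesis
    using T assms(3) by (simp add: completing_onb_def unit_normal_def)
qed

context
  fixes B :: "'a::euclidean_space set" and \<nu> :: 'a
  assumes onb: "completing_onb B \<nu>"
begin

lemma onb_finite: "finite B"
  using onb pairwise_orthogonal_imp_finite unfolding completing_onb_def by blast

lemma onb_orth: "e \<in> B \<Longrightarrow> \<nu> \<bullet> e = 0"
  using onb span_base[of e B] unfolding completing_onb_def by blast

lemma onb_inner: "e \<in> B \<Longrightarrow> e' \<in> B \<Longrightarrow> e \<bullet> e' = (if e = e' then 1 else 0)"
  using onb unfolding completing_onb_def pairwise_def orthogonal_def by (auto simp: norm_eq_1)

lemma onb_expand: "x = (\<Sum>e\<in>B. (x \<bullet> e) *\<^sub>R e) + (x \<bullet> \<nu>) *\<^sub>R \<nu>"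
proof -
  define y where "y = x - (\<Sum>e\<in>B. (x \<bullet> e) *\<^sub>R e) - (x \<bullet> \<nu>) *\<^sub>R \<nu>"
  have \<nu>: "\<nu> \<bullet> \<nu> = 1" using onb by (simp add: completing_onb_def norm_eq_1)
  have "e \<bullet> \<nu> = 0" if "e \<in> B" for e using onb_orth[OF that] by (simp add: inner_commute)
  then have "y \<bullet> \<nu> = 0" using \<nu> by (simp add: y_def inner_diff_left inner_sum_left)
  then have ys: "y \<in> span B" using onb by (simp add: completing_onb_def inner_commute)
  have "y \<bullet> e = 0" if e: "e \<in> B" for e
  proof -
    have "(\<Sum>e'\<in>B. (x \<bullet> e') * (e' \<bullet> e)) = (\<Sum>e'\<in>B. if e' = e then x \<bullet> e else 0)"
      by (rule sum.cong) (use onb_inner e in auto)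
    also have "\<dots> = x \<bullet> e" using onb_finite e by simp
    finally show ?thesis using onb_orth[OF e] by (simp add: y_def inner_diff_left inner_sum_left)
  qed
  then have "orthogonal y y"
    by (intro orthogonal_to_span[OF ys]) (auto simp: orthogonal_def)
  then have "y = 0" by (simp add: orthogonal_def)
  then show ?thesis by (simp only: y_def diff_diff_eq right_minus_eq)
qed

text \<open>Expanding each standard basis vector in \<open>B\<close> and \<open>\<nu>\<close> trades
  the arbitrarily chosen basis for the standard one. The right-hand side no longer mentions the
  choice and can be differentiated in the base point.\<close>

lemma onb_trace:
  assumes "linear L"
  shows "(\<Sum>e\<in>B. L e \<bullet> e) = (\<Sum>b\<in>Basis. L b \<bullet> b) - L \<nu> \<bullet> \<nu>"
proof -
  have "L b \<bullet> b = (\<Sum>e\<in>B. (b \<bullet> e) * (L e \<bullet> b)) + (b \<bullet> \<nu>) * (L \<nu> \<bullet> b)" for b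
  proof -
    have "L b = L ((\<Sum>e\<in>B. (b \<bullet> e) *\<^sub>R e) + (b \<bullet> \<nu>) *\<^sub>R \<nu>)" using onb_expand[of b] by simp
    also have "\<dots> = (\<Sum>e\<in>B. (b \<bullet> e) *\<^sub>R L e) + (b \<bullet> \<nu>) *\<^sub>R L \<nu>"
      unfolding linear_add[OF assms] linear_sum[OF assms] linear_cmul[OF assms] ..
    finally show ?thesis by (simp add: inner_add_left inner_sum_left)
  qed
  then have "(\<Sum>b\<in>Basis. L b \<bullet> b) = (\<Sum>b\<in>Basis. \<Sum>e\<in>B. (b \<bullet> e) * (L e \<bullet> b)) + (\<Sum>b\<in>Basis. (b \<bullet> \<nu>) * (L \<nu> \<bullet> b))"
    by (simp add: sum.distrib)
  also have "(\<Sum>b\<in>Basis. \<Sum>e\<in>B. (b \<bullet> e) * (L e \<bullet> b)) = (\<Sum>e\<in>B. \<Sum>b\<in>Basis. (L e \<bullet> b) * (e \<bullet> b))"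
    by (subst sum.swap) (simp add: inner_commute mult.commute)
  also have "\<dots> = (\<Sum>e\<in>B. L e \<bullet> e)" by (simp only: euclidean_inner[symmetric])
  also have "(\<Sum>b\<in>Basis. (b \<bullet> \<nu>) * (L \<nu> \<bullet> b)) = L \<nu> \<bullet> \<nu>"
    by (subst euclidean_inner) (simp add: inner_commute mult.commute)
  finally show ?thesis by simp
qed

lemma onb_card: "real (card B) = real DIM('a) - 1"
proof -
  have "(\<Sum>e\<in>B. e \<bullet> e) = (\<Sum>e\<in>B. 1)" by (rule sum.cong) (simp_all add: onb_inner)
  moreover have "(\<Sum>e\<in>B. e \<bullet> e) = (\<Sum>b\<in>Basis. b \<bullet> (b::'a)) - \<nu> \<bullet> \<nu>" using onb_trace[of "\<lambda>x. x"] linear_id by (simp add: id_def)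
  moreover have "\<nu> \<bullet> \<nu> = 1" using onb by (simp add: completing_onb_def norm_eq_1)
  ultimately show ?thesis by simp
qed

lemma onb_sum_squares: "(\<Sum>e\<in>B. (y \<bullet> e)\<^sup>2) = y \<bullet> y - (y \<bullet> \<nu>)\<^sup>2"
proof -
  have "y \<bullet> y = y \<bullet> ((\<Sum>e\<in>B. (y \<bullet> e) *\<^sub>R e) + (y \<bullet> \<nu>) *\<^sub>R \<nu>)" using onb_expand[of y] by simp
  also have "\<dots> = (\<Sum>e\<in>B. (y \<bullet> e)\<^sup>2) + (y \<bullet> \<nu>)\<^sup>2"
    by (simp add: inner_add_right inner_sum_right power2_eq_square)
  finally show ?thesis by simp
qed

text \<open>With \<open>P\<close> the orthogonal projection along \<open>\<nu>\<close> and
  \<open>M\<close> the composition \<open>P D P\<close>, both sides are the trace of the adjoint of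
  \<open>M\<close> times \<open>M\<close>. The normal direction contributes nothing because
  \<open>P \<nu> = 0\<close>.\<close>

lemma onb_Hilbert_Schmidt:
  assumes "linear D"
  shows "(\<Sum>e\<in>B. \<Sum>e'\<in>B. (D e \<bullet> e')\<^sup>2) =
    (\<Sum>b\<in>Basis. \<Sum>b'\<in>Basis. (D (b - (b \<bullet> \<nu>) *\<^sub>R \<nu>) \<bullet> (b' - (b' \<bullet> \<nu>) *\<^sub>R \<nu>))\<^sup>2)"
proof -
  define P where "P x = x - (x \<bullet> \<nu>) *\<^sub>R \<nu>" for x
  have \<nu>: "\<nu> \<bullet> \<nu> = 1" using onb by (simp add: completing_onb_def norm_eq_1)
  have lP: "linear P" unfolding P_def by (intro linearI) (simp_all add: inner_add_left algebra_simps)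
  define M where "M x = P (D (P x))" for x
  have lM: "linear M" unfolding M_def using linear_compose[OF linear_compose[OF lP assms] lP] by (simp add: o_def)
  have PP: "P x \<bullet> y = x \<bullet> P y" for x y by (simp add: P_def inner_diff_left inner_diff_right inner_commute)
  have PPP: "P (P x) = P x" for x using \<nu> by (simp add: P_def inner_diff_left)
  have nP: "P x \<bullet> P x = x \<bullet> x - (x \<bullet> \<nu>)\<^sup>2" for x using \<nu> by (simp add: P_def inner_diff_left inner_diff_right inner_commute power2_eq_square)
  have Pe: "P e = e" if "e \<in> B" for e using onb_orth[OF that] by (simp add: P_def inner_commute)
  have P\<nu>: "P \<nu> = 0" using \<nu> by (simp add: P_def)
  have "(\<Sum>e\<in>B. \<Sum>e'\<in>B. (D e \<bullet> e')\<^sup>2) = (\<Sum>e\<in>B. M e \<bullet> M e)"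
    by (rule sum.cong) (simp_all add: onb_sum_squares M_def Pe nP)
  also have "\<dots> = (\<Sum>e\<in>B. adjoint M (M e) \<bullet> e)"
    by (simp add: adjoint_clauses(2)[OF lM])
  also have "\<dots> = (\<Sum>b\<in>Basis. adjoint M (M b) \<bullet> b) - adjoint M (M \<nu>) \<bullet> \<nu>"
    by (rule onb_trace) (use linear_compose[OF lM adjoint_linear[OF lM]] in \<open>simp add: o_def\<close>)
  also have "\<dots> = (\<Sum>b\<in>Basis. M b \<bullet> M b)"
    using linear_0[OF assms] linear_0[OF lP] by (simp add: adjoint_clauses(2)[OF lM] M_def P\<nu>)
  also have "\<dots> = (\<Sum>b\<in>Basis. \<Sum>b'\<in>Basis. (D (P b) \<bullet> P b')\<^sup>2)"
  proof (rule sum.cong[OF refl])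
    fix b :: 'a
    show "M b \<bullet> M b = (\<Sum>b'\<in>Basis. (D (P b) \<bullet> P b')\<^sup>2)"
      by (subst euclidean_inner) (simp add: M_def PP power2_eq_square)
  qed
  finally show ?thesis by (simp add: P_def)
qed

end

section \<open>Independence of the chosen normal field\<close>

lemma sign_locally_constant:
  fixes \<nu> \<nu>' :: "'a::euclidean_space \<Rightarrow> 'a"
  assumes "open U" "p \<in> U" "p \<in> S" "\<And>q. q \<in> S \<inter> U \<Longrightarrow> \<bar>\<nu>' q \<bullet> \<nu> q\<bar> = 1"
    "continuous (at p within S) \<nu>" "continuous (at p within S) \<nu>'"
  obtains s :: real and d where "\<bar>s\<bar> = 1" "d > 0" "\<And>q. q \<in> S \<Longrightarrow> dist q p < d \<Longrightarrow> q \<in> U \<and> \<nu>' q \<bullet> \<nu> q = s"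
proof -
  define s where "s = \<nu>' p \<bullet> \<nu> p"
  have s: "\<bar>s\<bar> = 1" using assms(2-4) by (simp add: s_def)
  have "continuous (at p within S) (\<lambda>q. \<nu>' q \<bullet> \<nu> q)" using assms(5,6) by (intro continuous_intros)
  then obtain d1 where d1: "d1 > 0" "\<And>q. q \<in> S \<Longrightarrow> dist q p < d1 \<Longrightarrow> dist (\<nu>' q \<bullet> \<nu> q) s < 1"
    unfolding continuous_within_eps_delta s_def by (meson zero_less_one)
  obtain d2 where d2: "d2 > 0" "ball p d2 \<subseteq> U" using assms(1,2) open_contains_ball by blast
  show thesis
  proof (rule that[OF s, of "min d1 d2"])
    fix q assume q: "q \<in> S" "dist q p < min d1 d2"
    then have qU: "q \<in> U" using d2(2) by (auto simp: dist_commute)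
    have "\<bar>\<nu>' q \<bullet> \<nu> q\<bar> = 1" using assms(4) q(1) qU by simp
    moreover have "\<bar>\<nu>' q \<bullet> \<nu> q - s\<bar> < 1" using d1(2)[OF q(1)] q(2) by (simp add: dist_real_def)
    ultimately show "q \<in> U \<and> \<nu>' q \<bullet> \<nu> q = s" using s qU by (simp add: abs_if split: if_splits)
  qed (use d1 d2 in auto)
qed

text \<open>A curve in \<open>S\<close> need not stay in \<open>V\<close> for all times. Both spaces
  are instead computed from the same local equation.\<close>

lemma tangent_space_Int_open:
  assumes "smooth_hypersurface S" "open V" "q \<in> S" "q \<in> V"
  shows "tangent_space (S \<inter> V) q = tangent_space S q"
proof -
  obtain U f where U: "q \<in> U" "defining_function S U f" using hypersurface_defining_function[OF assms(1,3)] .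
  have "tangent_space (S \<inter> V) q = {v. grad f q \<bullet> v = 0}"
    by (rule tangent_space_level[OF defining_function_Int(1)[OF U(2) assms(2)]]) (use U assms in auto)
  then show ?thesis using tangent_space_level[OF U(2) assms(3) U(1)] by simp
qed

text \<open>The defining choice \<open>local_unit_normal\<close> agrees near \<open>p\<close> with
  any given unit normal field up to a constant sign. Derivatives within \<open>S\<close> are unique
  on tangent vectors, so the two derivatives there differ by that sign.\<close>

lemma second_fundamental_form_eq:
  assumes S: "smooth_hypersurface S" "p \<in> S" and U: "open U" "p \<in> U" "\<And>q. q \<in> S \<inter> U \<Longrightarrow> unit_normal S q (\<nu> q)"
    and D: "(\<nu> has_derivative D) (at p within S)"
  obtains s :: real where "\<bar>s\<bar> = 1" "\<And>u v. u \<in> tangent_space S p \<Longrightarrow> second_fundamental_form S p u v = s * (D u \<bullet> v)"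
proof -
  define \<nu>' where "\<nu>' = local_unit_normal S p"
  obtain W f where W: "p \<in> W" "defining_function S W f" using hypersurface_defining_function[OF S] .
  have "unit_normal_field (S \<inter> W) (nrm f)"
    unfolding unit_normal_field_def smooth_fun_on_def
  proof (intro conjI ballI)
    fix q assume "q \<in> S \<inter> W"
    then show "\<exists>U g. open U \<and> q \<in> U \<and> (\<forall>k. Ck_on k U g) \<and> (\<forall>q\<in>S \<inter> W \<inter> U. nrm f q = g q)"
      using defining_functionD(1)[OF W(2)] Ck_on_nrm[OF W(2)] by (intro exI[of _ W] exI[of _ "nrm f"]) auto
  next
    fix q assume q: "q \<in> S \<inter> W"
    then have n: "unit_normal S q (nrm f q)" using unit_normal_nrm[OF W(2)] by blast
    then show "norm (nrm f q) = 1" by (simp add: unit_normal_def)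
    fix v assume "v \<in> tangent_space (S \<inter> W) q"
    then show "nrm f q \<bullet> v = 0"
      using n tangent_space_Int_open[OF S(1) defining_functionD(1)[OF W(2)]] q by (simp add: unit_normal_def)
  qed
  then have "\<exists>\<nu> U. open U \<and> p \<in> U \<and> unit_normal_field (S \<inter> U) \<nu>"
    using W(1) defining_functionD(1)[OF W(2)] by blast
  then have "\<exists>U. open U \<and> p \<in> U \<and> unit_normal_field (S \<inter> U) \<nu>'"
    unfolding \<nu>'_def local_unit_normal_def by (rule someI_ex)
  then obtain V where V: "open V" "p \<in> V" "unit_normal_field (S \<inter> V) \<nu>'" by blast
  obtain V' g where V': "open V'" "p \<in> V'" "\<forall>k. Ck_on k V' g" "\<And>q. q \<in> S \<inter> V \<inter> V' \<Longrightarrow> \<nu>' q = g q"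
    using V S(2) unfolding unit_normal_field_def smooth_fun_on_def by blast
  have n': "unit_normal S q (\<nu>' q)" if "q \<in> S \<inter> V" for q
    using V(3) that tangent_space_Int_open[OF S(1) V(1)] by (simp add: unit_normal_field_def unit_normal_def)
  have dg: "(g has_derivative frechet_derivative g (at p)) (at p within S)"
    using Ck_on_SucD[of 0 V' g p] V' has_derivative_at_withinI by blast
  obtain d0 where d0: "d0 > 0" "ball p d0 \<subseteq> V \<inter> V'" using V V' open_contains_ball[of "V \<inter> V'"] open_Int by blast
  have c': "continuous (at p within S) \<nu>'"
  proof -
    have "continuous (at p within S) g" using dg has_derivative_continuous by blast
    then show ?thesis
      by (rule continuous_transform_within[OF _ d0(1) S(2)]) (use V'(4) d0(2) in \<open>force simp: dist_commute\<close>)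
  qed
  have c: "continuous (at p within S) \<nu>" using D has_derivative_continuous by blast
  obtain s d where s: "\<bar>s\<bar> = (1::real)" "d > 0" "\<And>q. q \<in> S \<Longrightarrow> dist q p < d \<Longrightarrow> q \<in> U \<inter> V \<and> \<nu>' q \<bullet> \<nu> q = s"
  proof (rule sign_locally_constant[of "U \<inter> V" p S \<nu>' \<nu>])
    show "open (U \<inter> V)" using U V by blast
    show "\<bar>\<nu>' q \<bullet> \<nu> q\<bar> = 1" if "q \<in> S \<inter> (U \<inter> V)" for q
      using unit_normal_unique(2)[OF S(1) _ U(3) n'] that by blast
  qed (use U V S c c' in auto)
  have "(\<nu>' has_derivative (\<lambda>v. s *\<^sub>R D v)) (at p within S)"
  proof (rule has_derivative_transform_within[OF _ s(2) S(2)])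
    show "((\<lambda>q. s *\<^sub>R \<nu> q) has_derivative (\<lambda>v. s *\<^sub>R D v)) (at p within S)"
      using D by (rule has_derivative_scaleR_right)
    fix q assume "q \<in> S" "dist q p < d"
    then have q: "q \<in> S" "q \<in> U" "q \<in> V" "\<nu>' q \<bullet> \<nu> q = s" using s(3) by auto
    have "\<nu>' q = (\<nu>' q \<bullet> \<nu> q) *\<^sub>R \<nu> q"
      by (rule unit_normal_unique(1)[OF S(1) q(1)]) (use q U(3) n' in auto)
    then show "s *\<^sub>R \<nu> q = \<nu>' q" using q(4) by simp
  qed
  note 1 = this
  then have "(\<nu>' has_derivative frechet_derivative \<nu>' (at p within S)) (at p within S)"
    using differentiableI frechet_derivative_works by blast
  then have "frechet_derivative \<nu>' (at p within S) u = s *\<^sub>R D u" if "u \<in> tangent_space S p" for u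
    using has_derivative_within_unique_on_tangent_space[OF _ 1 that] by blast
  then have "second_fundamental_form S p u v = (- s) * (D u \<bullet> v)" if "u \<in> tangent_space S p" for u v
    using that by (simp add: second_fundamental_form_def \<nu>'_def)
  \<comment> \<open>The extra sign comes from the minus in
    \<open>second_fundamental_form\<close>.\<close>
  then show thesis using s(1) by (intro that[of "- s"]) auto
qed

lemma tangent_onb_mem:
  assumes "smooth_hypersurface S" "p \<in> S" "e \<in> tangent_onb S p"
  shows "e \<in> tangent_space S p"
proof -
  obtain \<nu> where \<nu>: "unit_normal S p \<nu>" using unit_normal_exists[OF assms(1,2)] .
  show ?thesis
    using onb_orth[OF tangent_onb_completing[OF assms(1,2) \<nu>] assms(3)] unit_normal_tangent_space[OF assms(1,2) \<nu>] by simp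
qed

context
  fixes S :: "'a::euclidean_space set" and p U \<nu> D
  assumes S: "smooth_hypersurface S" "p \<in> S" and U: "open U" "p \<in> U" "\<And>q. q \<in> S \<inter> U \<Longrightarrow> unit_normal S q (\<nu> q)"
    and D: "(\<nu> has_derivative D) (at p within S)"
begin

lemma minimal_trace_normal:
  assumes "minimal_hypersurface S"
  shows "(\<Sum>e\<in>tangent_onb S p. D e \<bullet> e) = 0"
proof -
  obtain s where s: "\<bar>s\<bar> = 1" "\<And>u v. u \<in> tangent_space S p \<Longrightarrow> second_fundamental_form S p u v = s * (D u \<bullet> v)"
    using second_fundamental_form_eq[OF S U D] by blast
  have "mean_curvature S p = (\<Sum>e\<in>tangent_onb S p. s * (D e \<bullet> e))"
    unfolding mean_curvature_def by (rule sum.cong) (use s(2) tangent_onb_mem[OF S] in auto)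
  also have "\<dots> = s * (\<Sum>e\<in>tangent_onb S p. D e \<bullet> e)" by (simp add: sum_distrib_left)
  finally show ?thesis using s(1) assms S(2) by (auto simp: minimal_hypersurface_def)
qed

lemma second_fundamental_form_norm_eq:
  "(second_fundamental_form_norm S p)\<^sup>2 = (\<Sum>e\<in>tangent_onb S p. \<Sum>e'\<in>tangent_onb S p. (D e \<bullet> e')\<^sup>2)"
proof -
  obtain s where s: "\<bar>s\<bar> = 1" "\<And>u v. u \<in> tangent_space S p \<Longrightarrow> second_fundamental_form S p u v = s * (D u \<bullet> v)"
    using second_fundamental_form_eq[OF S U D] by blast
  have s2: "s\<^sup>2 = 1" using s(1) by (metis abs_1 power2_abs one_power2)
  have "(\<Sum>e\<in>tangent_onb S p. \<Sum>e'\<in>tangent_onb S p. (second_fundamental_form S p e e')\<^sup>2) =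
    (\<Sum>e\<in>tangent_onb S p. \<Sum>e'\<in>tangent_onb S p. (D e \<bullet> e')\<^sup>2)"
  proof (intro sum.cong refl)
    fix e e' assume "e \<in> tangent_onb S p"
    then show "(second_fundamental_form S p e e')\<^sup>2 = (D e \<bullet> e')\<^sup>2"
      using s(2) tangent_onb_mem[OF S] s2 by (simp add: power_mult_distrib)
  qed
  then show ?thesis unfolding second_fundamental_form_norm_def by (simp add: sum_nonneg)
qed

lemma second_fundamental_form_norm_Basis:
  "(second_fundamental_form_norm S p)\<^sup>2 =
    (\<Sum>b\<in>Basis. \<Sum>b'\<in>Basis. (D (b - (b \<bullet> \<nu> p) *\<^sub>R \<nu> p) \<bullet> (b' - (b' \<bullet> \<nu> p) *\<^sub>R \<nu> p))\<^sup>2)"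
  unfolding second_fundamental_form_norm_eq
  by (rule onb_Hilbert_Schmidt[OF tangent_onb_completing[OF S]]) (use U S D has_derivative_linear in auto)

end

text \<open>The normal \<open>nrm f\<close> of a local equation is defined and smooth on an open set
  of the ambient space, so \<open>|A|^2\<close> and the squared support function have smooth ambient
  extensions. Squaring removes the dependence on the sign of the normal.\<close>

lemma curvature_locally_smooth:
  assumes S: "smooth_hypersurface S" "p \<in> S"
  obtains U and A R :: "'a::euclidean_space \<Rightarrow> real" where "open U" "p \<in> U" "\<And>k. Ck_on k U A" "\<And>k. Ck_on k U R"
    "\<And>q. q \<in> S \<inter> U \<Longrightarrow> (second_fundamental_form_norm S q)\<^sup>2 = A q"
    "\<And>q \<nu>. q \<in> S \<inter> U \<Longrightarrow> unit_normal S q \<nu> \<Longrightarrow> (q \<bullet> \<nu>)\<^sup>2 = R q"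
proof -
  obtain U f where U: "p \<in> U" "defining_function S U f" using hypersurface_defining_function[OF S] .
  have o: "open U" using defining_functionD(1)[OF U(2)] .
  define N where "N = nrm f"
  have CN: "Ck_on k U N" for k unfolding N_def by (rule Ck_on_nrm[OF U(2)])
  define P where "P b q = b - (b \<bullet> N q) *\<^sub>R N q" for b q
  have CP: "Ck_on k U (P b)" for k b unfolding P_def[abs_def]
    by (intro Ck_on_diff[OF o] Ck_on_scaleR[OF o] Ck_on_inner[OF o] Ck_on_const[OF o] CN)
  define A where "A q = (\<Sum>b\<in>Basis. \<Sum>b'\<in>Basis. (frechet_derivative N (at q) (P b q) \<bullet> P b' q)\<^sup>2)" for q
  have CA: "Ck_on k U A" for k unfolding A_def[abs_def] power2_eq_square
    by (intro Ck_on_sum[OF o] Ck_on_mult[OF o] Ck_on_inner[OF o] Ck_on_frechet_derivative[OF o CN] CP)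
  define R where "R q = (q \<bullet> N q) * (q \<bullet> N q)" for q
  have CR: "Ck_on k U R" for k unfolding R_def[abs_def]
    by (intro Ck_on_mult[OF o] Ck_on_inner[OF o] CN Ck_on_linear[OF o] bounded_linear_ident)
  have N: "unit_normal S q (N q)" if "q \<in> S \<inter> U" for q
    using unit_normal_nrm[OF U(2)] that by (simp add: N_def)
  show thesis
  proof (rule that[OF o U(1) CA CR])
    fix q assume q: "q \<in> S \<inter> U"
    have "(N has_derivative frechet_derivative N (at q)) (at q within S)"
      using Ck_on_SucD[OF CN] q has_derivative_at_withinI by blast
    from second_fundamental_form_norm_Basis[OF S(1) _ o _ N this]
    show "(second_fundamental_form_norm S q)\<^sup>2 = A q" using q by (simp add: A_def P_def)
    fix \<nu> assume "unit_normal S q \<nu>"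
    then show "(q \<bullet> \<nu>)\<^sup>2 = R q"
      using unit_normal_square_unique[OF S(1) _ N[OF q], of \<nu> q] q by (simp add: R_def power2_eq_square)
  qed
qed

section \<open>Behaviour under isometries\<close>

lemma tangent_space_isometry:
  assumes "linear T" "\<And>q. q \<in> S \<Longrightarrow> T q \<in> S" "v \<in> tangent_space S p"
  shows "T v \<in> tangent_space S (T (p :: 'a::euclidean_space))"
proof -
  obtain \<gamma> :: "real \<Rightarrow> 'a" where g: "\<And>t. \<gamma> t \<in> S" "\<gamma> 0 = p" "(\<gamma> has_vector_derivative v) (at 0)"
    using assms(3) unfolding tangent_space_def by blast
  have "((\<lambda>t. T (\<gamma> t)) has_vector_derivative T v) (at 0)"
    by (rule bounded_linear.has_vector_derivative[OF linear_linear[THEN iffD2, OF assms(1)] g(3)])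
  then show ?thesis unfolding tangent_space_def using g(1,2) assms(2)
    by (intro CollectI exI[of _ "\<lambda>t. T (\<gamma> t)"]) auto
qed

context
  fixes S :: "'a::euclidean_space set" and T T' :: "'a \<Rightarrow> 'a" and p
  assumes S: "smooth_hypersurface S" "p \<in> S"
    and T: "orthogonal_transformation T" "orthogonal_transformation T'" "\<And>x. T (T' x) = x" "\<And>x. T' (T x) = x"
    and inv: "\<And>q. q \<in> S \<Longrightarrow> T q \<in> S" "\<And>q. q \<in> S \<Longrightarrow> T' q \<in> S"
begin

lemma T_inner: "T x \<bullet> y = x \<bullet> T' y"
proof -
  have "T x \<bullet> T (T' y) = x \<bullet> T' y" using T(1) unfolding orthogonal_transformation_def by blast
  then show ?thesis by (simp only: T(3))
qed

lemma unit_normal_isometry: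
  assumes "q \<in> S" "unit_normal S q \<nu>"
  shows "unit_normal S (T q) (T \<nu>)"
  unfolding unit_normal_def
proof (intro conjI ballI)
  show "norm (T \<nu>) = 1" using assms(2) orthogonal_transformation_norm[OF T(1)] by (simp add: unit_normal_def)
  fix v assume "v \<in> tangent_space S (T q)"
  then have "T' v \<in> tangent_space S q"
    using tangent_space_isometry[OF orthogonal_transformation_linear[OF T(2)] inv(2), of v "T q"] by (simp add: T(4))
  then show "T \<nu> \<bullet> v = 0" using assms(2) by (simp add: unit_normal_def T_inner)
qed

text \<open>Transporting the normal field by \<open>T\<close> conjugates its derivative by
  \<open>T\<close>, and a Hilbert-Schmidt norm does not change under conjugation by an
  isometry.\<close>

lemma second_fundamental_form_norm_isometry:
  "(second_fundamental_form_norm S (T p))\<^sup>2 = (second_fundamental_form_norm S p)\<^sup>2"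
proof -
  obtain U f where U: "p \<in> U" "defining_function S U f" using hypersurface_defining_function[OF S] .
  have o: "open U" using defining_functionD(1)[OF U(2)] .
  define N where "N = nrm f"
  have N: "unit_normal S q (N q)" if "q \<in> S \<inter> U" for q
    using unit_normal_nrm[OF U(2)] that by (simp add: N_def)
  define D where "D = frechet_derivative N (at p)"
  have D: "(N has_derivative D) (at p)"
    using Ck_on_SucD[OF Ck_on_nrm[OF U(2), of "Suc 0"] U(1)] by (simp add: N_def D_def)
  have lT: "linear T" "linear T'" using T(1,2) orthogonal_transformation_linear by auto
  have bT: "bounded_linear T" "bounded_linear T'" using lT linear_linear by auto
  define V where "V = T' -` U"
  have V: "open V" "T p \<in> V" unfolding V_def using U(1) T(4)
    by (auto intro!: open_vimage[OF o] linear_continuous_on[OF bT(2)])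
  define M where "M q = T (N (T' q))" for q
  have M: "unit_normal S q (M q)" if "q \<in> S \<inter> V" for q
    using unit_normal_isometry[OF _ N, of "T' q"] that inv(2) by (simp add: M_def V_def T(3))
  define E where "E = (\<lambda>v. T (D (T' v)))"
  have "(M has_derivative E) (at (T p))"
  proof -
    have "(N has_derivative D) (at (T' (T p)))" using D by (simp add: T(4))
    from diff_chain_at[OF bounded_linear_imp_has_derivative[OF bT(2)] this]
    have "((\<lambda>q. N (T' q)) has_derivative (\<lambda>v. D (T' v))) (at (T p))" by (simp add: o_def)
    from diff_chain_at[OF this bounded_linear_imp_has_derivative[OF bT(1)]]
    show ?thesis by (simp add: o_def M_def[abs_def] E_def)
  qed
  then have E: "(M has_derivative E) (at (T p) within S)" by (rule has_derivative_at_withinI)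
  let ?B = "tangent_onb S (T p)"
  have TpS: "T p \<in> S" using inv S by blast
  have B: "completing_onb ?B (M (T p))" by (rule tangent_onb_completing[OF S(1) TpS M]) (use TpS V in simp)
  have inj: "inj_on T' ?B" using T(3) by (metis inj_onI)
  have T'i: "T' x \<bullet> T' y = x \<bullet> y" for x y using T(2) by (simp add: orthogonal_transformation_def)
  \<comment> \<open>Pulling the basis at \<open>T p\<close> back to \<open>p\<close> gives an
    orthonormal basis there, in general a different one from \<open>tangent_onb S p\<close>; the
    basis-free form of the norm absorbs the difference.\<close>
  have B': "completing_onb (T' ` ?B) (N p)"
    unfolding completing_onb_def
  proof (intro conjI)
    show "pairwise orthogonal (T' ` ?B)"
      using B unfolding completing_onb_def pairwise_def orthogonal_def by (auto simp: T'i)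
    show "\<forall>e\<in>T' ` ?B. norm e = 1"
      using B unfolding completing_onb_def by (simp add: orthogonal_transformation_norm[OF T(2)])
    show "norm (N p) = 1" using N[of p] S U(1) by (simp add: unit_normal_def)
    have "span (T' ` ?B) = T' ` {v. M (T p) \<bullet> v = 0}"
      using B linear_span_image[OF lT(2)] unfolding completing_onb_def by simp
    also have "\<dots> = {v. N p \<bullet> v = 0}"
    proof (intro equalityI subsetI)
      fix v assume "v \<in> {v. N p \<bullet> v = 0}"
      then have "M (T p) \<bullet> T v = 0" by (simp add: M_def T(4) T_inner)
      then show "v \<in> T' ` {v. M (T p) \<bullet> v = 0}" using T(4)[of v] by (metis (mono_tags) image_eqI mem_Collect_eq)
    qed (auto simp: M_def T(4) T_inner)
    finally show "span (T' ` ?B) = {v. N p \<bullet> v = 0}" .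
  qed
  have "(second_fundamental_form_norm S (T p))\<^sup>2 = (\<Sum>e\<in>?B. \<Sum>e'\<in>?B. (E e \<bullet> e')\<^sup>2)"
    by (rule second_fundamental_form_norm_eq[OF S(1) TpS V M E])
  also have "\<dots> = (\<Sum>e\<in>T' ` ?B. \<Sum>e'\<in>T' ` ?B. (D e \<bullet> e')\<^sup>2)"
    by (simp add: sum.reindex[OF inj] E_def T_inner)
  also have "\<dots> = (\<Sum>b\<in>Basis. \<Sum>b'\<in>Basis. (D (b - (b \<bullet> N p) *\<^sub>R N p) \<bullet> (b' - (b' \<bullet> N p) *\<^sub>R N p))\<^sup>2)"
    by (rule onb_Hilbert_Schmidt[OF B' has_derivative_linear[OF D]])
  also have "\<dots> = (second_fundamental_form_norm S p)\<^sup>2"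
    by (rule second_fundamental_form_norm_Basis[symmetric, OF S o U(1) N has_derivative_at_withinI[OF D]])
  finally show ?thesis .
qed

end

text \<open>The curve has a derivative at time 0 only, so it cannot be differentiated twice. Instead
  the mean value theorem is applied on the chord from \<open>p\<close> to \<open>\<gamma> t\<close>.
  The chord leaves the curve, which is why the full gradient of \<open>L\<close> has to vanish at
  \<open>p\<close>.\<close>

lemma second_derivative_nonneg:
  fixes L :: "'a::euclidean_space \<Rightarrow> real"
  assumes "open W" "p \<in> W" "\<And>q. q \<in> W \<Longrightarrow> (L has_derivative (\<lambda>v. G q \<bullet> v)) (at q)"
    "G p = 0" "(G has_derivative M) (at p)" "\<gamma> 0 = p" "(\<gamma> has_vector_derivative e) (at 0)"
    "\<And>t::real. \<gamma> t \<in> W \<Longrightarrow> L p \<le> L (\<gamma> t)"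
  shows "0 \<le> M e \<bullet> e"
proof (rule ccontr)
  assume "\<not> 0 \<le> M e \<bullet> e"
  define \<kappa> where "\<kappa> = - (M e \<bullet> e)"
  have k: "\<kappa> > 0" using \<open>\<not> 0 \<le> M e \<bullet> e\<close> by (simp add: \<kappa>_def)
  \<comment> \<open>Small enough that \<open>M e \<bullet> e + \<epsilon> * (e \<bullet> e)\<close>
    stays negative; the added 1 keeps the denominator positive when \<open>e\<close> is
    zero.\<close>
  define \<epsilon> where "\<epsilon> = \<kappa> / (2 * (e \<bullet> e + 1))"
  have ee: "e \<bullet> e \<ge> 0" by simp
  have eps: "\<epsilon> > 0" "\<epsilon> * (e \<bullet> e) < \<kappa>"
  proof -
    have E: "2 * (e \<bullet> e + 1) > 0" by (rule mult_pos_pos[OF _ add_nonneg_pos[OF ee zero_less_one]]) simp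
    show "\<epsilon> > 0" unfolding \<epsilon>_def using k E by (rule divide_pos_pos)
    have "e \<bullet> e < 2 * (e \<bullet> e + 1)" using E by (simp add: algebra_simps)
    then have "\<kappa> * (e \<bullet> e) < \<kappa> * (2 * (e \<bullet> e + 1))" using k by (rule mult_strict_left_mono)
    then have "\<kappa> * (e \<bullet> e) / (2 * (e \<bullet> e + 1)) < \<kappa>" unfolding pos_divide_less_eq[OF E] .
    then show "\<epsilon> * (e \<bullet> e) < \<kappa>" by (simp add: \<epsilon>_def)
  qed
  have lM: "bounded_linear M" using assms(5) has_derivative_bounded_linear by blast
  obtain d1 where d1: "d1 > 0" "\<And>y. norm (y - p) < d1 \<Longrightarrow> norm (G y - G p - M (y - p)) \<le> \<epsilon> * norm (y - p)"
    using assms(5) eps(1) unfolding has_derivative_at_alt by blast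
  obtain d2 where d2: "d2 > 0" "ball p d2 \<subseteq> W" using assms(1,2) open_contains_ball by blast
  have "((\<lambda>t. norm (\<gamma> t - p - t *\<^sub>R e) / norm t) \<longlongrightarrow> 0) (at 0)"
    using assms(6,7) unfolding has_vector_derivative_def has_derivative_at by simp
  then have "((\<lambda>t. norm ((\<gamma> t - p) /\<^sub>R t - e)) \<longlongrightarrow> 0) (at 0)"
  proof (rule Lim_transform_eventually)
    have "norm (\<gamma> t - p - t *\<^sub>R e) / norm t = norm ((\<gamma> t - p) /\<^sub>R t - e)" if "t \<noteq> 0" for t
    proof -
      have "(\<gamma> t - p) /\<^sub>R t - e = (\<gamma> t - p - t *\<^sub>R e) /\<^sub>R t" using that by (simp add: scaleR_diff_right)
      then show ?thesis by (simp add: divide_inverse mult.commute)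
    qed
    then show "\<forall>\<^sub>F t in at 0. norm (\<gamma> t - p - t *\<^sub>R e) / norm t = norm ((\<gamma> t - p) /\<^sub>R t - e)"
      unfolding eventually_at_filter by (intro always_eventually) blast
  qed
  then have lim: "((\<lambda>t. (\<gamma> t - p) /\<^sub>R t) \<longlongrightarrow> e) (at 0)"
    by (rule LIM_zero_cancel[OF tendsto_norm_zero_cancel])
  define u where "u t = (\<gamma> t - p) /\<^sub>R t" for t
  have lim: "(u \<longlongrightarrow> e) (at 0)" using lim by (simp add: u_def[abs_def])
  have "((\<lambda>t. M (u t) \<bullet> u t + \<epsilon> * (u t \<bullet> u t)) \<longlongrightarrow> M e \<bullet> e + \<epsilon> * (e \<bullet> e)) (at 0)"
    by (intro tendsto_intros bounded_linear.tendsto[OF lM] lim)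
  moreover have "M e \<bullet> e + \<epsilon> * (e \<bullet> e) < 0" using eps(2) by (simp add: \<kappa>_def)
  ultimately have ev1: "\<forall>\<^sub>F t in at 0. M (u t) \<bullet> u t + \<epsilon> * (u t \<bullet> u t) < 0" by (rule order_tendstoD(2))
  have "isCont \<gamma> 0" using assms(7) has_vector_derivative_continuous by blast
  then have "(\<gamma> \<longlongrightarrow> p) (at 0)" using assms(6) by (simp add: isCont_def)
  then have ev2: "\<forall>\<^sub>F t in at 0. dist (\<gamma> t) p < min d1 d2" using d1(1) d2(1) by (intro tendstoD) auto
  have ev3: "\<forall>\<^sub>F t in at 0. (t::real) \<noteq> 0" unfolding eventually_at_filter by simp
  obtain t where t: "M (u t) \<bullet> u t + \<epsilon> * (u t \<bullet> u t) < 0" "dist (\<gamma> t) p < min d1 d2" "t \<noteq> 0"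
    using eventually_happens'[OF at_neq_bot eventually_conj[OF ev1 eventually_conj[OF ev2 ev3]]] by blast
  define \<delta> where "\<delta> = \<gamma> t - p"
  have \<delta>: "\<delta> = t *\<^sub>R u t" "norm \<delta> < d1" "norm \<delta> < d2" using t(2,3) by (auto simp: \<delta>_def u_def dist_norm)
  have neg: "M \<delta> \<bullet> \<delta> + \<epsilon> * (\<delta> \<bullet> \<delta>) < 0"
  proof -
    have "M \<delta> = t *\<^sub>R M (u t)" unfolding \<delta>(1) using lM linear_cmul bounded_linear.linear by blast
    then have "M \<delta> \<bullet> \<delta> + \<epsilon> * (\<delta> \<bullet> \<delta>) = t\<^sup>2 * (M (u t) \<bullet> u t + \<epsilon> * (u t \<bullet> u t))"
      using \<delta>(1) by (simp add: power2_eq_square algebra_simps)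
    then show ?thesis using t(1,3) by (simp add: mult_less_0_iff)
  qed
  have inW: "p + z *\<^sub>R \<delta> \<in> W" and nz: "norm (z *\<^sub>R \<delta>) < d1" if "0 \<le> z" "z \<le> 1" for z
  proof -
    have "norm (z *\<^sub>R \<delta>) \<le> norm \<delta>" using that by (simp add: mult_left_le_one_le)
    then show "norm (z *\<^sub>R \<delta>) < d1" using \<delta>(2) by linarith
    have "dist p (p + z *\<^sub>R \<delta>) < d2" using \<open>norm (z *\<^sub>R \<delta>) \<le> norm \<delta>\<close> \<delta>(3) by (simp add: dist_norm)
    then show "p + z *\<^sub>R \<delta> \<in> W" using d2(2) by auto
  qed
  have "\<exists>z. 0 < z \<and> z < (1::real) \<and> L (p + 1 *\<^sub>R \<delta>) - L (p + 0 *\<^sub>R \<delta>) = (1 - 0) * (G (p + z *\<^sub>R \<delta>) \<bullet> \<delta>)"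
  proof (rule MVT2)
    fix z :: real assume z: "0 \<le> z" "z \<le> 1"
    have "((\<lambda>z. p + z *\<^sub>R \<delta>) has_derivative (\<lambda>h. h *\<^sub>R \<delta>)) (at z)"
      by (auto intro!: derivative_eq_intros)
    from diff_chain_at[OF this assms(3)[OF inW[OF z]]]
    show "((\<lambda>z. L (p + z *\<^sub>R \<delta>)) has_real_derivative G (p + z *\<^sub>R \<delta>) \<bullet> \<delta>) (at z)"
      by (simp add: o_def has_field_derivative_def mult_commute_abs)
  qed simp
  then obtain z where z: "0 < z" "z < 1" "L (p + \<delta>) - L p = G (p + z *\<^sub>R \<delta>) \<bullet> \<delta>" by auto
  have "norm (G (p + z *\<^sub>R \<delta>) - M (z *\<^sub>R \<delta>)) \<le> \<epsilon> * norm (z *\<^sub>R \<delta>)"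
    using d1(2)[of "p + z *\<^sub>R \<delta>"] nz[of z] z assms(4) by simp
  then have "norm (G (p + z *\<^sub>R \<delta>) - M (z *\<^sub>R \<delta>)) * norm \<delta> \<le> \<epsilon> * norm (z *\<^sub>R \<delta>) * norm \<delta>"
    by (rule mult_right_mono) simp
  also have "\<dots> = z * (\<epsilon> * (\<delta> \<bullet> \<delta>))" using z(1) by (simp add: dot_square_norm power2_eq_square)
  finally have "(G (p + z *\<^sub>R \<delta>) - M (z *\<^sub>R \<delta>)) \<bullet> \<delta> \<le> z * (\<epsilon> * (\<delta> \<bullet> \<delta>))"
    using norm_cauchy_schwarz[of "G (p + z *\<^sub>R \<delta>) - M (z *\<^sub>R \<delta>)" \<delta>] by linarith
  moreover have "M (z *\<^sub>R \<delta>) \<bullet> \<delta> = z * (M \<delta> \<bullet> \<delta>)"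
    using linear_cmul[OF bounded_linear.linear[OF lM], of z \<delta>] by simp
  ultimately have "G (p + z *\<^sub>R \<delta>) \<bullet> \<delta> \<le> z * (M \<delta> \<bullet> \<delta> + \<epsilon> * (\<delta> \<bullet> \<delta>))"
    by (simp add: inner_diff_left algebra_simps)
  also have "\<dots> < 0" using z(1) neg by (simp add: mult_less_0_iff)
  finally have "L (p + \<delta>) < L p" using z(3) by linarith
  moreover have "\<gamma> t = p + \<delta>" by (simp add: \<delta>_def)
  moreover have "p + \<delta> \<in> W" using inW[of 1] by simp
  ultimately show False using assms(8)[of t] by simp
qed

text \<open>The maximum principle: subtracting a multiple of a defining function (Lagrange multiplier) makes
  the full gradient vanish, and the trace of the Hessian of a defining function over the tangent space
  vanishes because the mean curvature does.\<close>

lemma minimal_local_min: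
  fixes u :: "'a::euclidean_space \<Rightarrow> real"
  assumes S: "minimal_hypersurface S" "p \<in> S" "unit_normal S p \<nu>"
    and W: "open W" "p \<in> W" "\<And>q. q \<in> W \<Longrightarrow> (u has_derivative (\<lambda>v. g q \<bullet> v)) (at q)" "(g has_derivative H) (at p)"
    and m: "\<And>q. q \<in> S \<inter> W \<Longrightarrow> u p \<le> u q"
  shows "0 \<le> (\<Sum>b\<in>Basis. H b \<bullet> b) - H \<nu> \<bullet> \<nu>"
proof -
  have Sh: "smooth_hypersurface S" using S(1) by (simp add: minimal_hypersurface_def)
  obtain U f where U: "p \<in> U" "defining_function S U f" using hypersurface_defining_function[OF Sh S(2)] .
  note df = defining_functionD[OF U(2)]
  define n where "n = grad f p"
  have n0: "n \<noteq> 0" using df(3)[OF U(1)] by (simp add: n_def)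
  have T: "tangent_space S p = {v. n \<bullet> v = 0}" unfolding n_def by (rule tangent_space_level[OF U(2) S(2) U(1)])
  define K where "K = frechet_derivative (grad f) (at p)"
  have K: "(grad f has_derivative K) (at p)" using Ck_on_SucD[OF df(6)[of "Suc 0"] U(1)] by (simp add: K_def)
  define c where "c q = (grad f q \<bullet> grad f q) powr (-1/2)" for q
  define c' where "c' = frechet_derivative c (at p)"
  have c: "(c has_derivative c') (at p)"
    using Ck_on_SucD[OF Ck_on_nrm_factor[OF U(2), of "Suc 0"] U(1)] by (simp add: c'_def c_def[abs_def])
  have c0: "c p > 0" using n0 by (simp add: c_def n_def)
  let ?B = "tangent_onb S p"
  have B: "completing_onb ?B \<nu>" by (rule tangent_onb_completing[OF Sh S(2,3)])
  have Bt: "n \<bullet> e = 0" "e \<in> tangent_space S p" if "e \<in> ?B" for e using tangent_onb_mem[OF Sh S(2) that] T by auto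
  \<comment> \<open>Differentiating the normalised gradient gives \<open>c p *\<^sub>R K\<close>
    plus a multiple of \<open>n\<close>, and \<open>n\<close> is orthogonal to the tangent basis; so
    vanishing mean curvature is the vanishing of the tangential trace of \<open>K\<close>.\<close>
  have trK: "(\<Sum>e\<in>?B. K e \<bullet> e) = 0"
  proof -
    have "(nrm f has_derivative (\<lambda>v. c p *\<^sub>R K v + c' v *\<^sub>R n)) (at p)"
      using has_derivative_scaleR[OF c K] by (simp add: nrm_def[abs_def] c_def[abs_def] n_def)
    then have d: "(nrm f has_derivative (\<lambda>v. c p *\<^sub>R K v + c' v *\<^sub>R n)) (at p within S)" by (rule has_derivative_at_withinI)
    have "(\<Sum>e\<in>?B. (c p *\<^sub>R K e + c' e *\<^sub>R n) \<bullet> e) = 0"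
      by (rule minimal_trace_normal[OF Sh S(2) df(1) U(1) _ d S(1)]) (use unit_normal_nrm[OF U(2)] in auto)
    moreover have "(\<Sum>e\<in>?B. (c p *\<^sub>R K e + c' e *\<^sub>R n) \<bullet> e) = (\<Sum>e\<in>?B. c p * (K e \<bullet> e))"
      by (rule sum.cong) (use Bt in \<open>auto simp: inner_add_left\<close>)
    ultimately show ?thesis using c0 by (simp flip: sum_distrib_left)
  qed
  have gp: "g p \<bullet> v = 0" if v: "n \<bullet> v = 0" for v
  proof -
    have "v \<in> tangent_space S p" using v T by simp
    then obtain \<gamma> :: "real \<Rightarrow> 'a" where \<gamma>: "\<And>t. \<gamma> t \<in> S" "\<gamma> 0 = p" "(\<gamma> has_vector_derivative v) (at 0)"
      unfolding tangent_space_def by blast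
    have "(u has_derivative (\<lambda>v. g p \<bullet> v)) (at (\<gamma> 0))" using W(3)[OF W(2)] \<gamma>(2) by simp
    from vector_derivative_diff_chain_within[OF \<gamma>(3) has_derivative_at_withinI[OF this]]
    have d: "((\<lambda>t. u (\<gamma> t)) has_real_derivative (g p \<bullet> v)) (at 0)"
      by (simp add: o_def has_real_derivative_iff_has_vector_derivative)
    have "isCont \<gamma> 0" using \<gamma>(3) has_vector_derivative_continuous by blast
    then have "\<forall>\<^sub>F t in at 0. \<gamma> t \<in> W"
      using \<gamma>(2) W(1,2) unfolding isCont_def tendsto_def by simp
    then obtain d where "d > 0" "\<And>t. t \<noteq> 0 \<Longrightarrow> dist t 0 < d \<Longrightarrow> \<gamma> t \<in> W" unfolding eventually_at by blast
    then have "\<forall>t. \<bar>0 - t\<bar> < d \<longrightarrow> u (\<gamma> 0) \<le> u (\<gamma> t)" using m \<gamma>(1,2) W(2)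
      by (metis IntI abs_minus_commute diff_zero dist_0_norm dist_commute real_norm_def)
    with d \<open>d > 0\<close> show ?thesis by (rule DERIV_local_min)
  qed
  define \<kappa> where "\<kappa> = (g p \<bullet> n) / (n \<bullet> n)"
  have gl: "g p = \<kappa> *\<^sub>R n" unfolding \<kappa>_def by (rule orthogonal_complement_line[OF n0 gp])
  have second: "0 \<le> (H e - \<kappa> *\<^sub>R K e) \<bullet> e" if e: "e \<in> ?B" for e
  proof -
    obtain \<gamma> :: "real \<Rightarrow> 'a" where \<gamma>: "\<And>t. \<gamma> t \<in> S" "\<gamma> 0 = p" "(\<gamma> has_vector_derivative e) (at 0)"
      using Bt(2)[OF e] unfolding tangent_space_def by blast
    show ?thesis
    proof (rule second_derivative_nonneg[where L = "\<lambda>q. u q - \<kappa> * f q" and G = "\<lambda>q. g q - \<kappa> *\<^sub>R grad f q" and W = "U \<inter> W"])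
      show "open (U \<inter> W)" "p \<in> U \<inter> W" using df(1) U W by auto
      fix q assume q: "q \<in> U \<inter> W"
      show "((\<lambda>q. u q - \<kappa> * f q) has_derivative (\<lambda>v. (g q - \<kappa> *\<^sub>R grad f q) \<bullet> v)) (at q)"
        by (rule has_derivative_eq_rhs[OF has_derivative_diff[OF W(3) has_derivative_mult_right[OF df(5)]]])
          (use q in \<open>auto simp: inner_diff_left\<close>)
    next
      show "g p - \<kappa> *\<^sub>R grad f p = 0" using gl by (simp add: n_def)
      show "((\<lambda>q. g q - \<kappa> *\<^sub>R grad f q) has_derivative (\<lambda>v. H v - \<kappa> *\<^sub>R K v)) (at p)"
        by (intro has_derivative_diff W(4) has_derivative_scaleR_right K)
      show "\<gamma> 0 = p" "(\<gamma> has_vector_derivative e) (at 0)" by fact+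
      fix t assume t: "\<gamma> t \<in> U \<inter> W"
      have "f p = 0" "f (\<gamma> t) = 0" using df(4) U(1) S(2) \<gamma>(1) t by auto
      then show "u p - \<kappa> * f p \<le> u (\<gamma> t) - \<kappa> * f (\<gamma> t)" using m[of "\<gamma> t"] \<gamma>(1) t by simp
    qed
  qed
  have "0 \<le> (\<Sum>e\<in>?B. (H e - \<kappa> *\<^sub>R K e) \<bullet> e)" using second by (rule sum_nonneg)
  also have "\<dots> = (\<Sum>e\<in>?B. H e \<bullet> e) - \<kappa> * (\<Sum>e\<in>?B. K e \<bullet> e)"
    by (simp add: inner_diff_left sum_subtractf sum_distrib_left)
  also have "\<dots> = (\<Sum>e\<in>?B. H e \<bullet> e)" using trK by simp
  also have "\<dots> = (\<Sum>b\<in>Basis. H b \<bullet> b) - H \<nu> \<bullet> \<nu>" by (rule onb_trace[OF B has_derivative_linear[OF W(4)]])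
  finally show ?thesis .
qed

text \<open>The surface gradient is \<open>2 F1\<close> times the tangential part of the position
  vector. In its divergence the tangential trace of the identity gives the dimension, the derivative
  of the normal gives the mean curvature, which is zero, and the derivative of \<open>F1\<close>
  gives the squared length of the tangential part.\<close>

lemma laplace_beltrami_radial:
  fixes S :: "'a::euclidean_space set"
  assumes S: "minimal_hypersurface S" "p \<in> S" "unit_normal S p \<nu>"
    and F: "\<And>q. q \<in> S \<Longrightarrow> q \<bullet> q \<in> I" "\<And>h. h \<in> I \<Longrightarrow> (F has_vector_derivative F1 h) (at h within I)"
      "\<And>h. h \<in> I \<Longrightarrow> (F1 has_vector_derivative F2 h) (at h within I)"
  shows "laplace_beltrami S (\<lambda>q. F (q \<bullet> q)) p =
    4 * (p \<bullet> p - (p \<bullet> \<nu>)\<^sup>2) * F2 (p \<bullet> p) + 2 * (real DIM('a) - 1) * (F1 (p \<bullet> p) :: real)"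
proof -
  have Sh: "smooth_hypersurface S" using S(1) by (simp add: minimal_hypersurface_def)
  obtain U f where U: "p \<in> U" "defining_function S U f" using hypersurface_defining_function[OF Sh S(2)] .
  note df = defining_functionD[OF U(2)]
  define N where "N = nrm f"
  have N: "unit_normal S q (N q)" if "q \<in> S \<inter> U" for q
    using unit_normal_nrm[OF U(2)] that by (simp add: N_def)
  define D where "D = frechet_derivative N (at p)"
  have D: "(N has_derivative D) (at p within S)"
    using Ck_on_SucD[OF Ck_on_nrm[OF U(2), of "Suc 0"] U(1)] has_derivative_at_withinI by (auto simp: N_def D_def)
  \<comment> \<open>On \<open>S\<close> the squared norm stays in \<open>I\<close>, so one-sided
    derivatives of \<open>\<Phi>\<close> suffice where it attains an end point.\<close>
  have comp: "((\<lambda>q. \<Phi> (q \<bullet> q)) has_derivative (\<lambda>v. 2 * (q \<bullet> v) * \<Phi>1)) (at q within S)"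
    if "q \<in> S" "(\<Phi> has_vector_derivative \<Phi>1) (at (q \<bullet> q) within I)" for q and \<Phi> :: "real \<Rightarrow> real" and \<Phi>1
  proof -
    have "((\<lambda>q. q \<bullet> q) has_derivative (\<lambda>v. 2 * (q \<bullet> v))) (at q within S)"
      by (auto intro!: derivative_eq_intros simp: inner_commute)
    moreover have "(\<Phi> has_derivative (\<lambda>h. h * \<Phi>1)) (at (q \<bullet> q) within (\<lambda>q. q \<bullet> q) ` S)"
      using that(2) F(1) unfolding has_vector_derivative_def by (auto intro: has_derivative_subset)
    ultimately show ?thesis by (rule has_derivative_in_compose)
  qed
  let ?w = "\<lambda>q. F (q \<bullet> q)"
  define X where "X q = (2 * F1 (q \<bullet> q)) *\<^sub>R (q - (q \<bullet> N q) *\<^sub>R N q)" for q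
  have grad: "surface_gradient S ?w q = X q" if q: "q \<in> S \<inter> U" for q
  proof -
    have d: "(?w has_derivative (\<lambda>v. 2 * (q \<bullet> v) * F1 (q \<bullet> q))) (at q within S)"
      by (rule comp) (use q F in auto)
    then have "(?w has_derivative frechet_derivative ?w (at q within S)) (at q within S)"
      using differentiableI frechet_derivative_works by blast
    then have fe: "frechet_derivative ?w (at q within S) e = 2 * (q \<bullet> e) * F1 (q \<bullet> q)" if "e \<in> tangent_onb S q" for e
      using has_derivative_within_unique_on_tangent_space[OF _ d tangent_onb_mem[OF Sh _ that]] q by blast
    have B: "completing_onb (tangent_onb S q) (N q)" by (rule tangent_onb_completing[OF Sh _ N[OF q]]) (use q in simp)
    have "surface_gradient S ?w q = (\<Sum>e\<in>tangent_onb S q. (2 * F1 (q \<bullet> q)) *\<^sub>R ((q \<bullet> e) *\<^sub>R e))"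
      unfolding surface_gradient_def by (rule sum.cong) (simp_all add: fe mult_ac)
    also have "\<dots> = (2 * F1 (q \<bullet> q)) *\<^sub>R (\<Sum>e\<in>tangent_onb S q. (q \<bullet> e) *\<^sub>R e)" by (rule scaleR_sum_right[symmetric])
    also have "(\<Sum>e\<in>tangent_onb S q. (q \<bullet> e) *\<^sub>R e) = q - (q \<bullet> N q) *\<^sub>R N q"
      using onb_expand[OF B, of q] by (simp add: algebra_simps)
    finally show ?thesis by (simp add: X_def)
  qed
  define DX where "DX v = (2 * F1 (p \<bullet> p)) *\<^sub>R (v - ((p \<bullet> N p) *\<^sub>R D v + (p \<bullet> D v + v \<bullet> N p) *\<^sub>R N p))
     + (2 * (2 * (p \<bullet> v) * F2 (p \<bullet> p))) *\<^sub>R (p - (p \<bullet> N p) *\<^sub>R N p)" for v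
  have "(X has_derivative DX) (at p within S)"
    unfolding X_def[abs_def] DX_def[abs_def]
  proof (rule has_derivative_scaleR)
    show "((\<lambda>q. 2 * F1 (q \<bullet> q)) has_derivative (\<lambda>v. 2 * (2 * (p \<bullet> v) * F2 (p \<bullet> p)))) (at p within S)"
      by (rule has_derivative_mult_right[OF comp]) (use F S in auto)
    show "((\<lambda>q. q - (q \<bullet> N q) *\<^sub>R N q) has_derivative (\<lambda>v. v - ((p \<bullet> N p) *\<^sub>R D v + (p \<bullet> D v + v \<bullet> N p) *\<^sub>R N p))) (at p within S)"
      by (rule has_derivative_diff[OF has_derivative_ident has_derivative_scaleR[OF has_derivative_inner[OF has_derivative_ident D] D]])
  qed
  obtain d0 where d0: "d0 > 0" "ball p d0 \<subseteq> U" using df(1) U(1) open_contains_ball by blast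
  have dS: "(surface_gradient S ?w has_derivative DX) (at p within S)"
  proof (rule has_derivative_transform_within[OF \<open>(X has_derivative DX) (at p within S)\<close> d0(1) S(2)])
    fix q assume "q \<in> S" "dist q p < d0"
    then have "q \<in> S \<inter> U" using subsetD[OF d0(2), of q] by (simp add: dist_commute)
    then show "X q = surface_gradient S ?w q" by (rule grad[symmetric])
  qed
  then have "(surface_gradient S ?w has_derivative frechet_derivative (surface_gradient S ?w) (at p within S)) (at p within S)"
    using differentiableI frechet_derivative_works by blast
  then have fe: "frechet_derivative (surface_gradient S ?w) (at p within S) e = DX e" if "e \<in> tangent_onb S p" for e
    using has_derivative_within_unique_on_tangent_space[OF _ dS tangent_onb_mem[OF Sh S(2) that]] by blast
  let ?B = "tangent_onb S p"
  have pU: "p \<in> S \<inter> U" using S U by blast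
  have B: "completing_onb ?B (N p)" by (rule tangent_onb_completing[OF Sh S(2) N[OF pU]])
  have tr: "(\<Sum>e\<in>?B. D e \<bullet> e) = 0"
    by (rule minimal_trace_normal[OF Sh S(2) df(1) U(1) N D S(1)])
  have "laplace_beltrami S ?w p = (\<Sum>e\<in>?B. 2 * F1 (p \<bullet> p) - 2 * F1 (p \<bullet> p) * (p \<bullet> N p) * (D e \<bullet> e) + 4 * F2 (p \<bullet> p) * (p \<bullet> e)\<^sup>2)"
    unfolding laplace_beltrami_def surface_divergence_def
  proof (rule sum.cong[OF refl])
    fix e assume e: "e \<in> ?B"
    have eN: "N p \<bullet> e = 0" "e \<bullet> e = 1" using onb_orth[OF B e] onb_inner[OF B e e] by auto
    have "DX e \<bullet> e = 2 * F1 (p \<bullet> p) - 2 * F1 (p \<bullet> p) * (p \<bullet> N p) * (D e \<bullet> e) + 4 * F2 (p \<bullet> p) * (p \<bullet> e)\<^sup>2"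
      unfolding DX_def by (simp add: inner_add_left inner_diff_left eN power2_eq_square algebra_simps)
    then show "frechet_derivative (surface_gradient S ?w) (at p within S) e \<bullet> e = 2 * F1 (p \<bullet> p) - 2 * F1 (p \<bullet> p) * (p \<bullet> N p) * (D e \<bullet> e) + 4 * F2 (p \<bullet> p) * (p \<bullet> e)\<^sup>2"
      using fe[OF e] by simp
  qed
  also have "\<dots> = (\<Sum>e\<in>?B. 2 * F1 (p \<bullet> p)) - 2 * F1 (p \<bullet> p) * (p \<bullet> N p) * (\<Sum>e\<in>?B. D e \<bullet> e) + 4 * F2 (p \<bullet> p) * (\<Sum>e\<in>?B. (p \<bullet> e)\<^sup>2)"
    by (simp only: sum.distrib sum_subtractf sum_distrib_left)
  also have "\<dots> = 2 * F1 (p \<bullet> p) * (real DIM('a) - 1) + 4 * F2 (p \<bullet> p) * (p \<bullet> p - (p \<bullet> N p)\<^sup>2)"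
    using tr onb_card[OF B] onb_sum_squares[OF B, of p] by simp
  also have "(p \<bullet> N p)\<^sup>2 = (p \<bullet> \<nu>)\<^sup>2" by (rule unit_normal_square_unique[OF Sh S(2,3) N[OF pU]])
  finally show ?thesis by (simp add: mult_ac)
qed

section \<open>Hypersurfaces invariant under a product of orthogonal groups\<close>

lemma Ck_on_compose_affine:
  fixes f :: "'a::euclidean_space \<Rightarrow> 'b::real_normed_vector" and L :: "'c::euclidean_space \<Rightarrow> 'a"
  assumes "bounded_linear L" "open W" "\<And>x. x \<in> W \<Longrightarrow> a + L x \<in> U"
  shows "Ck_on k U f \<Longrightarrow> Ck_on k W (\<lambda>x. f (a + L x))"
proof (induction k arbitrary: f)
  case 0
  have "continuous_on W (\<lambda>x. a + L x)" by (intro continuous_intros linear_continuous_on assms(1))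
  then show ?case using 0 assms(3) by (auto intro: continuous_on_compose2)
next
  case (Suc k)
  show ?case
  proof (rule Ck_on_SucI[OF assms(2)])
    fix x assume x: "x \<in> W"
    have "((\<lambda>x. a + L x) has_derivative L) (at x)"
      using has_derivative_add[OF has_derivative_const bounded_linear_imp_has_derivative[OF assms(1)]] by fastforce
    from diff_chain_at[OF this Ck_on_SucD[OF Suc.prems assms(3)[OF x]]]
    show "((\<lambda>x. f (a + L x)) has_derivative (\<lambda>v. frechet_derivative f (at (a + L x)) (L v))) (at x)" by (simp add: o_def)
  next
    fix v
    have "frechet_derivative f (at (a + L x)) (L v) = (\<Sum>b\<in>Basis. (L v \<bullet> b) *\<^sub>R frechet_derivative f (at (a + L x)) b)"
      if "x \<in> W" for x
      using frechet_derivative_expand[of f "at (a + L x)" "L v"] Suc.prems assms(3)[OF that] by simp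
    moreover have "Ck_on k W (\<lambda>x. \<Sum>b\<in>Basis. (L v \<bullet> b) *\<^sub>R frechet_derivative f (at (a + L x)) b)"
      by (intro Ck_on_sum[OF assms(2)] Ck_on_scaleR[OF assms(2)] Ck_on_const[OF assms(2)] Suc.IH[OF Ck_on_Suc_frechet[OF Suc.prems]])
    ultimately show "Ck_on k W (\<lambda>x. frechet_derivative f (at (a + L x)) (L v))"
      using Ck_on_cong[OF assms(2), of "\<lambda>x. frechet_derivative f (at (a + L x)) (L v)"
          "\<lambda>x. \<Sum>b\<in>Basis. (L v \<bullet> b) *\<^sub>R frechet_derivative f (at (a + L x)) b" k] by blast
  qed
qed

lemma second_derivative_strict_min:
  fixes g :: "real \<Rightarrow> real"
  assumes "\<epsilon> > 0" "\<And>x. \<bar>x\<bar> < \<epsilon> \<Longrightarrow> (g has_real_derivative g1 x) (at x)" "g1 0 = 0" "(g1 has_real_derivative d) (at 0)" "d > 0"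
  obtains \<delta> where "0 < \<delta>" "\<delta> \<le> \<epsilon>" "\<And>x. \<bar>x\<bar> < \<delta> \<Longrightarrow> x \<noteq> 0 \<Longrightarrow> g 0 < g x"
proof -
  obtain d1 where d1: "d1 > 0" "\<And>h. 0 < h \<Longrightarrow> h < d1 \<Longrightarrow> g1 0 < g1 (0 + h)"
    using DERIV_pos_inc_right[OF assms(4,5)] by blast
  obtain d2 where d2: "d2 > 0" "\<And>h. 0 < h \<Longrightarrow> h < d2 \<Longrightarrow> g1 (0 - h) < g1 0"
    using DERIV_pos_inc_left[OF assms(4,5)] by blast
  show thesis
  proof (rule that[of "min \<epsilon> (min d1 d2)"])
    fix x :: real assume x: "\<bar>x\<bar> < min \<epsilon> (min d1 d2)" "x \<noteq> 0"
    show "g 0 < g x"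
    proof (cases "x > 0")
      case True
      have "\<exists>z. 0 < z \<and> z < x \<and> g x - g 0 = (x - 0) * g1 z" by (rule MVT2[OF True]) (use x assms(2) in auto)
      then obtain z where z: "0 < z" "z < x" "g x - g 0 = x * g1 z" by auto
      then have "g1 z > 0" using d1(2)[of z] x(1) assms(3) by simp
      then have "x * g1 z > 0" using True by simp
      then show ?thesis using z(3) by linarith
    next
      case False
      then have x0: "x < 0" using x(2) by simp
      have "\<exists>z. x < z \<and> z < 0 \<and> g 0 - g x = (0 - x) * g1 z" by (rule MVT2[OF x0]) (use x assms(2) in auto)
      then obtain z where z: "x < z" "z < 0" "g 0 - g x = (0 - x) * g1 z" by auto
      then have "g1 z < 0" using d2(2)[of "- z"] x(1) assms(3) by simp
      then have "(0 - x) * g1 z < 0" using x0 by (intro mult_pos_neg) auto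
      then show ?thesis using z(3) by linarith
    qed
  qed (use assms d1 d2 in auto)
qed

section \<open>Reflections\<close>

definition reflect :: "'a::euclidean_space \<Rightarrow> 'a \<Rightarrow> 'a" where
  "reflect w x = x - (2 * (x \<bullet> w) / (w \<bullet> w)) *\<^sub>R w"

lemma reflect_linear: "linear (reflect w)"
  unfolding reflect_def by (intro linearI) (simp_all add: inner_add_left algebra_simps add_divide_distrib)

lemma reflect_inner: "reflect w x \<bullet> reflect w y = x \<bullet> y"
  by (cases "w = 0") (simp_all add: reflect_def inner_diff_left inner_diff_right inner_commute)

lemma reflect_orthogonal: "orthogonal_transformation (reflect w)"
  by (simp add: orthogonal_transformation_def reflect_linear reflect_inner)

lemma reflect_reflect: "reflect w (reflect w x) = x"
  by (cases "w = 0") (simp_all add: reflect_def inner_diff_left)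

text \<open>The mirror is the bisecting hyperplane of two vectors of equal length. For
  \<open>x = y\<close> division by zero yields 0 and \<open>reflect 0\<close> is the identity, so
  the statement needs no exception.\<close>

lemma reflect_swap:
  assumes "norm x = norm y"
  shows "reflect (x - y) x = y"
proof (cases "x = y")
  case False
  have "x \<bullet> x = y \<bullet> y" using assms by (simp add: dot_square_norm)
  then have "(x - y) \<bullet> (x - y) = 2 * (x \<bullet> (x - y))" by (simp add: inner_diff_left inner_diff_right inner_commute)
  moreover have "(x - y) \<bullet> (x - y) \<noteq> 0" using False by (simp only: inner_eq_zero_iff right_minus_eq) simp
  ultimately have "2 * (x \<bullet> (x - y)) / ((x - y) \<bullet> (x - y)) = 1" by (metis divide_self)
  then have "reflect (x - y) x = x - 1 *\<^sub>R (x - y)" unfolding reflect_def by (simp only:)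
  then show ?thesis by simp
qed (simp add: reflect_def)

lemma reflect_fix: "x \<bullet> w = 0 \<Longrightarrow> reflect w x = x"
  by (simp add: reflect_def)

text \<open>The splitting into two orthogonal factors in a form symmetric under exchange: through
  \<open>swapped\<close>, every result about \<open>P1\<close> also holds for
  \<open>P2\<close>.\<close>

locale projections =
  fixes P1 P2 :: "'a::euclidean_space \<Rightarrow> 'a"
  assumes lin: "linear P1" "linear P2" and sum: "P1 x + P2 x = x" and orth: "P1 x \<bullet> P2 y = 0"
begin

lemma swapped: "projections P2 P1"
proof (rule projections.intro)
  show "P2 x + P1 x = x" for x using sum[of x] by (simp add: add.commute)
  show "P2 x \<bullet> P1 y = 0" for x y using orth[of y x] by (simp add: inner_commute)
qed (rule lin)+

lemma P21: "P2 (P1 x) = 0" and P11: "P1 (P1 x) = P1 x"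
proof -
  have e: "P2 (P1 x) = P1 x - P1 (P1 x)" using sum[of "P1 x"] by (simp add: algebra_simps)
  have "P2 (P1 x) \<bullet> P2 (P1 x) = (P1 x - P1 (P1 x)) \<bullet> P2 (P1 x)" using e by simp
  also have "\<dots> = 0" by (simp add: inner_diff_left orth)
  finally show "P2 (P1 x) = 0" by simp
  then show "P1 (P1 x) = P1 x" using e by simp
qed

lemma P12: "P1 (P2 x) = 0" and P22: "P2 (P2 x) = P2 x"
  using projections.P21[OF swapped] projections.P11[OF swapped] by auto

lemma P1_inner: "P1 x \<bullet> y = P1 x \<bullet> P1 y" and P1_inner': "P1 x \<bullet> y = x \<bullet> P1 y"
proof -
  have "P1 x \<bullet> (P1 y + P2 y) = P1 x \<bullet> P1 y" by (simp only: inner_add_right orth)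
  then show 1: "P1 x \<bullet> y = P1 x \<bullet> P1 y" by (simp only: sum)
  have "P1 y \<bullet> (P1 x + P2 x) = P1 y \<bullet> P1 x" by (simp only: inner_add_right orth)
  then have "P1 y \<bullet> x = P1 y \<bullet> P1 x" by (simp only: sum)
  with 1 show "P1 x \<bullet> y = x \<bullet> P1 y" by (simp add: inner_commute)
qed

lemma P2_inner: "P2 x \<bullet> y = P2 x \<bullet> P2 y" and P2_inner': "P2 x \<bullet> y = x \<bullet> P2 y"
  using projections.P1_inner[OF swapped] projections.P1_inner'[OF swapped] by auto

lemma inner_split: "x \<bullet> y = P1 x \<bullet> P1 y + P2 x \<bullet> P2 y"
proof -
  have "x \<bullet> y = (P1 x + P2 x) \<bullet> y" by (simp only: sum)
  then show ?thesis using P1_inner[of x y] P2_inner[of x y] by (simp only: inner_add_left)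
qed

lemma norm_split: "x \<bullet> x = (norm (P1 x))\<^sup>2 + (norm (P2 x))\<^sup>2"
  using inner_split[of x x] by (simp add: dot_square_norm)

lemma bl: "bounded_linear P1" "bounded_linear P2"
  using lin linear_linear by auto

lemma cont [continuous_intros]: "continuous_on X P1" "continuous_on X P2"
  using bl linear_continuous_on by auto

text \<open>Invariance under the product of the orthogonal groups, encoded by its orbits: two points
  lie on one orbit exactly if both pairs of norms agree.\<close>

definition radial_set :: "'a set \<Rightarrow> bool" where
  "radial_set W \<longleftrightarrow> (\<forall>p q. p \<in> W \<longrightarrow> norm (P1 q) = norm (P1 p) \<longrightarrow> norm (P2 q) = norm (P2 p) \<longrightarrow> q \<in> W)"

lemma reflect_P1:
  assumes "P1 w = w"
  shows "norm (P1 (reflect w x)) = norm (P1 x)" "P2 (reflect w x) = P2 x"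
proof -
  have w2: "P2 w = 0" using P21[of w] assms by simp
  have "x \<bullet> w = P1 x \<bullet> w" using P1_inner'[of x w] assms by simp
  then have "P1 (reflect w x) = reflect w (P1 x)"
    unfolding reflect_def linear_diff[OF lin(1)] linear_cmul[OF lin(1)] by (simp add: assms)
  then show "norm (P1 (reflect w x)) = norm (P1 x)"
    using orthogonal_transformation_norm[OF reflect_orthogonal] by simp
  show "P2 (reflect w x) = P2 x"
    unfolding reflect_def linear_diff[OF lin(2)] linear_cmul[OF lin(2)] by (simp add: w2)
qed

text \<open>One reflection in each factor suffices: the mirror vector \<open>P1 p - P1 q\<close>
  lies in the first factor, so that reflection fixes the second component, and conversely.\<close>

lemma radial_transport:
  assumes "norm (P1 p) = norm (P1 q)" "norm (P2 p) = norm (P2 q)"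
  obtains T T' where "orthogonal_transformation T" "orthogonal_transformation T'" "\<And>x. T (T' x) = x" "\<And>x. T' (T x) = x"
    "T p = q" "\<And>W x. radial_set W \<Longrightarrow> x \<in> W \<Longrightarrow> T x \<in> W" "\<And>W x. radial_set W \<Longrightarrow> x \<in> W \<Longrightarrow> T' x \<in> W"
proof -
  interpret sw: projections P2 P1 by (rule swapped)
  define w1 where "w1 = P1 p - P1 q"
  define w2 where "w2 = P2 p - P2 q"
  have w1: "P1 w1 = w1" by (simp add: w1_def linear_diff[OF lin(1)] P11)
  have w2: "P2 w2 = w2" by (simp add: w2_def linear_diff[OF lin(2)] P22)
  have r1: "norm (P1 (reflect w1 x)) = norm (P1 x)" "norm (P2 (reflect w1 x)) = norm (P2 x)" for x
    using reflect_P1[OF w1] by auto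
  have r2: "norm (P1 (reflect w2 x)) = norm (P1 x)" "norm (P2 (reflect w2 x)) = norm (P2 x)" for x
    using sw.reflect_P1[OF w2] by auto
  have pres: "reflect w1 x \<in> W" "reflect w2 x \<in> W" if "radial_set W" "x \<in> W" for W x
    using that r1[of x] r2[of x] unfolding radial_set_def by blast+
  have "reflect w1 p = reflect w1 (P1 p) + reflect w1 (P2 p)" using linear_add[OF reflect_linear, of w1 "P1 p" "P2 p"] by (simp add: sum)
  also have "reflect w1 (P1 p) = P1 q" unfolding w1_def by (rule reflect_swap[OF assms(1)])
  also have "reflect w1 (P2 p) = P2 p" by (rule reflect_fix) (simp add: w1_def inner_diff_right inner_commute[of "P2 p"] orth)
  finally have e1: "reflect w1 p = P1 q + P2 p" .
  have "reflect w2 (P1 q + P2 p) = reflect w2 (P1 q) + reflect w2 (P2 p)" by (rule linear_add[OF reflect_linear])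
  also have "reflect w2 (P2 p) = P2 q" unfolding w2_def by (rule reflect_swap[OF assms(2)])
  also have "reflect w2 (P1 q) = P1 q" by (rule reflect_fix) (simp add: w2_def inner_diff_right orth)
  finally have e2: "reflect w2 (reflect w1 p) = q" by (simp add: e1 sum)
  show thesis
  proof (rule that[of "\<lambda>x. reflect w2 (reflect w1 x)" "\<lambda>x. reflect w1 (reflect w2 x)"])
    show "orthogonal_transformation (\<lambda>x. reflect w2 (reflect w1 x))" "orthogonal_transformation (\<lambda>x. reflect w1 (reflect w2 x))"
      using orthogonal_transformation_compose[OF reflect_orthogonal[of w2] reflect_orthogonal[of w1]]
        orthogonal_transformation_compose[OF reflect_orthogonal[of w1] reflect_orthogonal[of w2]] unfolding o_def by blast+
    show "reflect w2 (reflect w1 p) = q" by (rule e2)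
    show "reflect w2 (reflect w1 x) \<in> W" "reflect w1 (reflect w2 x) \<in> W" if "radial_set W" "x \<in> W" for W x
      using pres[OF that(1)] that(2) by blast+
  qed (simp_all only: reflect_reflect)
qed

text \<open>Rotating \<open>P1 q\<close> towards \<open>z\<close> stays on the orbit of
  \<open>q\<close>, and \<open>z\<close> is the initial velocity.\<close>

lemma rotation_tangent:
  assumes "radial_set W" "q \<in> W" "P1 z = z" "z \<bullet> P1 q = 0" "norm z = norm (P1 q)"
  shows "z \<in> tangent_space W q"
proof -
  define \<gamma> where "\<gamma> \<theta> = cos \<theta> *\<^sub>R P1 q + sin \<theta> *\<^sub>R z + P2 q" for \<theta>
  have z2: "P2 z = 0" using P21[of z] assms(3) by simp
  have 1: "P1 (\<gamma> \<theta>) = cos \<theta> *\<^sub>R P1 q + sin \<theta> *\<^sub>R z" "P2 (\<gamma> \<theta>) = P2 q" for \<theta>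
    unfolding \<gamma>_def linear_add[OF lin(1)] linear_cmul[OF lin(1)] linear_add[OF lin(2)] linear_cmul[OF lin(2)]
    by (simp_all add: P11 P12 P21 P22 assms(3) z2)
  have "(norm (P1 (\<gamma> \<theta>)))\<^sup>2 = (norm (P1 q))\<^sup>2" for \<theta>
  proof -
    have zz: "z \<bullet> z = P1 q \<bullet> P1 q" using assms(5) by (simp add: dot_square_norm)
    have "P1 q \<bullet> z = 0" using assms(4) by (simp add: inner_commute)
    then have "P1 (\<gamma> \<theta>) \<bullet> P1 (\<gamma> \<theta>) = (cos \<theta>)\<^sup>2 * (P1 q \<bullet> P1 q) + (sin \<theta>)\<^sup>2 * (P1 q \<bullet> P1 q)"
      unfolding 1 using assms(4) zz by (simp add: inner_add_left inner_add_right power2_eq_square)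
    also have "\<dots> = ((cos \<theta>)\<^sup>2 + (sin \<theta>)\<^sup>2) * (P1 q \<bullet> P1 q)" by (rule distrib_right[symmetric])
    finally show ?thesis by (simp add: dot_square_norm)
  qed
  then have "norm (P1 (\<gamma> \<theta>)) = norm (P1 q)" for \<theta> by simp
  then have "\<gamma> \<theta> \<in> W" for \<theta> using assms(1,2) 1(2) unfolding radial_set_def by metis
  moreover have "\<gamma> 0 = q" by (simp add: \<gamma>_def sum)
  moreover have "(\<gamma> has_vector_derivative z) (at 0)"
  proof -
    have "(\<gamma> has_vector_derivative (- sin 0) *\<^sub>R P1 q + cos 0 *\<^sub>R z + 0) (at 0)"
      unfolding \<gamma>_def[abs_def] by (auto intro!: derivative_eq_intros)
    then show ?thesis by simp
  qed
  ultimately show ?thesis unfolding tangent_space_def by blast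
qed

text \<open>The part \<open>z\<close> of \<open>P1 \<nu>\<close> orthogonal to \<open>P1 q\<close>
  is, up to scaling, the velocity of a rotation inside the orbit. Hence it is tangent, orthogonal to
  \<open>\<nu>\<close>, and so zero.\<close>

lemma normal_parallel:
  assumes "radial_set W" "q \<in> W" "P1 q \<noteq> 0" "\<And>v. v \<in> tangent_space W q \<Longrightarrow> \<nu> \<bullet> v = 0"
  shows "P1 \<nu> = ((\<nu> \<bullet> P1 q) / (P1 q \<bullet> P1 q)) *\<^sub>R P1 q"
proof -
  define z where "z = P1 \<nu> - ((\<nu> \<bullet> P1 q) / (P1 q \<bullet> P1 q)) *\<^sub>R P1 q"
  have z1: "P1 z = z" unfolding z_def linear_diff[OF lin(1)] linear_cmul[OF lin(1)] by (simp add: P11)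
  have "P1 \<nu> \<bullet> P1 q = \<nu> \<bullet> P1 q" using P1_inner'[of \<nu> "P1 q"] by (simp add: P11)
  then have zq: "z \<bullet> P1 q = 0" using assms(3) by (simp add: z_def inner_diff_left)
  show ?thesis
  proof (cases "z = 0")
    case False
    define k where "k = norm (P1 q) / norm z"
    have k: "k \<noteq> 0" using False assms(3) by (simp add: k_def)
    have "k *\<^sub>R z \<in> tangent_space W q"
      by (rule rotation_tangent[OF assms(1,2)]) (use z1 zq False in \<open>auto simp: linear_cmul[OF lin(1)] k_def\<close>)
    then have "\<nu> \<bullet> z = 0" using assms(4)[of "k *\<^sub>R z"] k by simp
    then have "P1 \<nu> \<bullet> z = 0" using P1_inner'[of \<nu> z] z1 by simp
    moreover have "P1 q \<bullet> z = 0" using zq by (simp add: inner_commute)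
    moreover have "z \<bullet> z = (P1 \<nu> - ((\<nu> \<bullet> P1 q) / (P1 q \<bullet> P1 q)) *\<^sub>R P1 q) \<bullet> z" unfolding z_def[symmetric] ..
    ultimately have "z \<bullet> z = 0" by (simp add: inner_diff_left)
    then show ?thesis using False by simp
  qed (simp add: z_def)
qed

text \<open>The factor has dimension at least 2, by the trace condition. If \<open>P1 \<nu>\<close>
  were nonzero, some \<open>y\<close> in the factor orthogonal to it would be tangent. A reflection
  fixing \<open>q\<close> and preserving \<open>S\<close> turns \<open>y\<close> into a multiple of
  \<open>P1 \<nu>\<close>, which would then be both tangent and not orthogonal to
  \<open>\<nu>\<close>.\<close>

lemma axis_normal:
  assumes "radial_set S" "smooth_hypersurface S" "q \<in> S" "P1 q = 0" "unit_normal S q \<nu>" "(\<Sum>b\<in>Basis. P1 b \<bullet> b) > 1"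
  shows "P1 \<nu> = 0"
proof (rule ccontr)
  define x0 where "x0 = P1 \<nu>"
  assume "P1 \<nu> \<noteq> 0"
  then have x0: "x0 \<noteq> 0" "P1 x0 = x0" "x0 \<bullet> x0 \<noteq> 0" by (auto simp: x0_def P11)
  \<comment> \<open>Otherwise \<open>P1\<close> would be the projection onto the line of
    \<open>x0\<close>, whose trace is 1.\<close>
  have "\<exists>b\<in>Basis. P1 b - ((b \<bullet> x0) / (x0 \<bullet> x0)) *\<^sub>R x0 \<noteq> 0"
  proof (rule ccontr)
    assume "\<not> ?thesis"
    then have "(\<Sum>b\<in>Basis. P1 b \<bullet> b) = (\<Sum>b\<in>Basis. (((b \<bullet> x0) / (x0 \<bullet> x0)) *\<^sub>R x0) \<bullet> b)"
      by (intro sum.cong) auto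
    also have "\<dots> = (\<Sum>b\<in>Basis. (x0 \<bullet> b) * (x0 \<bullet> b)) / (x0 \<bullet> x0)"
      by (simp add: sum_divide_distrib inner_commute)
    also have "\<dots> = 1" using x0(3) by (simp only: euclidean_inner[symmetric]) (rule divide_self)
    finally show False using assms(6) by simp
  qed
  then obtain b where b: "P1 b - ((b \<bullet> x0) / (x0 \<bullet> x0)) *\<^sub>R x0 \<noteq> 0" by blast
  define y where "y = P1 b - ((b \<bullet> x0) / (x0 \<bullet> x0)) *\<^sub>R x0"
  have y0: "y \<noteq> 0" using b by (simp add: y_def)
  have y1: "P1 y = y" unfolding y_def linear_diff[OF lin(1)] linear_cmul[OF lin(1)] by (simp add: P11 x0(2))
  have "P1 b \<bullet> x0 = b \<bullet> x0" using P1_inner'[of b x0] x0(2) by simp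
  then have yx: "y \<bullet> x0 = 0" using x0(3) by (simp add: y_def inner_diff_left)
  have "\<nu> \<bullet> y = x0 \<bullet> y" using P1_inner'[of \<nu> y] y1 by (simp add: x0_def)
  then have "\<nu> \<bullet> y = 0" using yx by (simp add: inner_commute)
  then have yt: "y \<in> tangent_space S q" using unit_normal_tangent_space[OF assms(2,3,5)] by simp
  define x1 where "x1 = (norm y / norm x0) *\<^sub>R x0"
  have x1: "norm y = norm x1" "P1 x1 = x1" using x0(1,2) by (auto simp: x1_def linear_cmul[OF lin(1)])
  define w where "w = y - x1"
  have w: "P1 w = w" unfolding w_def linear_diff[OF lin(1)] by (simp add: y1 x1(2))
  have "reflect w q = q"
    by (rule reflect_fix) (use P1_inner'[of q w] w assms(4) in simp)
  moreover have "reflect w x \<in> S" if "x \<in> S" for x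
    using assms(1) that reflect_P1[OF w, of x] unfolding radial_set_def by metis
  ultimately have "reflect w y \<in> tangent_space S q"
    using tangent_space_isometry[OF reflect_linear _ yt, of w] by auto
  moreover have "reflect w y = x1" unfolding w_def by (rule reflect_swap[OF x1(1)])
  ultimately have "\<nu> \<bullet> x1 = 0" using assms(5) by (simp add: unit_normal_def)
  moreover have "\<nu> \<bullet> x0 = x0 \<bullet> x0" using P1_inner'[of \<nu> x0] x0(2) by (simp add: x0_def)
  ultimately show False using x0(1) y0 by (simp add: x1_def)
qed

end

text \<open>The derivatives supplied by the different orders coincide by uniqueness, so one function
  serves for all orders.\<close>

lemma Cw_all_derivative:
  assumes "\<And>k. Cw k I u" "\<And>x. x \<in> I \<Longrightarrow> at x within I \<noteq> bot"
  obtains u' where "\<And>x. x \<in> I \<Longrightarrow> (u has_vector_derivative u' x) (at x within I)" "\<And>k. Cw k I u'"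
proof -
  define u' where "u' x = vector_derivative u (at x within I)" for x
  have *: "(\<forall>x\<in>I. (u has_vector_derivative u' x) (at x within I)) \<and> Cw k I u'" for k
  proof -
    obtain f' where f': "\<And>y. y\<in>I \<Longrightarrow> (u has_vector_derivative f' y) (at y within I)" "Cw k I f'"
      using assms(1)[of "Suc k"] by (rule Cw_SucE) blast
    have eq: "u' y = f' y" if "y \<in> I" for y
      using that f'(1) assms(2) unfolding u'_def by (intro vector_derivative_within) auto
    then show ?thesis using f' Cw_cong[of I u' f' k] by simp
  qed
  show thesis by (rule that[of u']) (use * in blast)+
qed

lemma smooth_inverse_interval:
  fixes h :: "real \<Rightarrow> real"
  assumes ab: "a < b" and h: "\<And>x. x \<in> {a..b} \<Longrightarrow> (h has_real_derivative h' x) (at x within {a..b})" "\<And>k. Cw k {a..b} h'"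
    "\<And>x. x \<in> {a..b} \<Longrightarrow> h' x > 0"
  obtains g where "\<And>k. Cw k {h a..h b} g" "\<And>y. y \<in> {h a..h b} \<Longrightarrow> g y \<in> {a..b} \<and> h (g y) = y" "\<And>x. x \<in> {a..b} \<Longrightarrow> g (h x) = x \<and> h x \<in> {h a..h b}"
    "h a < h b"
proof -
  have c: "continuous_on {a..b} h"
    using h(1) DERIV_continuous continuous_on_eq_continuous_within by blast
  have sm: "h x < h y" if "x \<in> {a..b}" "y \<in> {a..b}" "x < y" for x y
  proof (rule DERIV_pos_imp_increasing_open[OF that(3)])
    fix z assume z: "x < z" "z < y"
    then have "z \<in> {a<..<b}" using that by auto
    then have "at z within {a..b} = at z" using at_within_interior[of z "{a..b}"] by simp
    then show "\<exists>d. (h has_real_derivative d) (at z) \<and> 0 < d" using h(1)[of z] h(3)[of z] z that by auto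
  next
    show "continuous_on {x..y} h" by (rule continuous_on_subset[OF c]) (use that in auto)
  qed
  have inj: "inj_on h {a..b}" by (rule linorder_inj_onI) (use sm in fastforce)+
  have im: "h ` {a..b} = {h a..h b}"
  proof (intro equalityI subsetI)
    fix y assume "y \<in> h ` {a..b}"
    then obtain x where x: "x \<in> {a..b}" "y = h x" by blast
    then have "h a \<le> h x" using sm[of a x] ab by (cases "x = a") auto
    moreover have "h x \<le> h b" using sm[of x b] x ab by (cases "x = b") auto
    ultimately show "y \<in> {h a..h b}" using x by simp
  next
    fix y assume "y \<in> {h a..h b}"
    then show "y \<in> h ` {a..b}" using IVT'[OF _ _ _ c, of y] ab by force
  qed
  define g where "g = the_inv_into {a..b} h"
  have gc: "continuous_on {h a..h b} g"
    unfolding g_def im[symmetric] by (rule continuous_on_inv_into[OF c compact_Icc inj])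
  have g1: "g y \<in> {a..b} \<and> h (g y) = y" if "y \<in> {h a..h b}" for y
    using the_inv_into_into[OF inj, of y "{a..b}"] f_the_inv_into_f[OF inj, of y] that unfolding g_def im by auto
  have g2: "g (h x) = x \<and> h x \<in> {h a..h b}" if "x \<in> {a..b}" for x
    using the_inv_into_f_f[OF inj that] that im unfolding g_def by auto
  have "Cw k {h a..h b} g" for k
    by (rule Cw_inverse_function[where f = h and f' = h' and I = "{a..b}"]) (use h gc g1 g2 in auto)
  then show thesis using g1 g2 sm[of a b] ab by (intro that) auto
qed

section \<open>The profile curve\<close>

text \<open>For \<open>\<Sigma>\<^sup>+\<close> the projections are \<open>P1 (x, y) = (x, 0)\<close> and \<open>P2 (x, y) = (0, y)\<close>; for \<open>\<Sigma>\<^sup>-\<close> they are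
  exchanged, so that \<open>S\<close> always lies on the same side of the cone. The dimensions \<open>m1\<close> and \<open>m2\<close>
  enter as the traces of the projections.\<close>

locale radial_minimal = projections P1 P2 for P1 P2 :: "'a::euclidean_space \<Rightarrow> 'a" +
  fixes S :: "'a set" and e f :: 'a and m1 m2 c :: real
  assumes e: "P1 e = e" "norm e = 1" and f: "P2 f = f" "norm f = 1"
    and m1: "(\<Sum>b\<in>Basis. P1 b \<bullet> b) = m1" "m1 \<ge> 3" and m2: "(\<Sum>b\<in>Basis. P2 b \<bullet> b) = m2" "m2 \<ge> 3"
    and c: "c = (m1 - 1) / (m2 - 1)"
    and minimal: "minimal_hypersurface S" and radial: "radial_set S"
    and region: "p \<in> S \<Longrightarrow> (norm (P1 p))\<^sup>2 < c * (norm (P2 p))\<^sup>2"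
    and asymptotic: "asymptotic_at_infinity S {p. (norm (P1 p))\<^sup>2 = c * (norm (P2 p))\<^sup>2}"
    and dist: "infdist 0 S = 1"
begin

lemma c_pos: "c > 0"
  using c m1(2) m2(2) by simp

lemma hyper: "smooth_hypersurface S" and closed_S: "closed S"
  using minimal by (auto simp: minimal_hypersurface_def)

lemma dim: "real DIM('a) = m1 + m2"
proof -
  have "(\<Sum>b\<in>Basis. b \<bullet> (b::'a)) = (\<Sum>b\<in>Basis. P1 b \<bullet> b + P2 b \<bullet> b)"
    by (rule sum.cong) (simp_all only: inner_add_left[symmetric] sum)
  then show ?thesis using m1(1) m2(1) by (simp add: sum.distrib)
qed

lemma ef: "P2 e = 0" "P1 f = 0" "e \<bullet> f = 0" "f \<bullet> e = 0" "e \<bullet> e = 1" "f \<bullet> f = 1"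
proof -
  show "P2 e = 0" "P1 f = 0" using P21[of e] P12[of f] e f by auto
  show "e \<bullet> f = 0" using orth[of e f] e f by simp
  then show "f \<bullet> e = 0" by (simp add: inner_commute)
  show "e \<bullet> e = 1" "f \<bullet> f = 1" using e(2) f(2) by (auto simp: norm_eq_1)
qed

lemma P2_nonzero: "p \<in> S \<Longrightarrow> P2 p \<noteq> 0"
  using region[of p] by auto

definition pl :: "real \<Rightarrow> real \<Rightarrow> 'a" where "pl x y = x *\<^sub>R e + y *\<^sub>R f"

lemma P_pl: "P1 (pl x y) = x *\<^sub>R e" "P2 (pl x y) = y *\<^sub>R f"
  unfolding pl_def linear_add[OF lin(1)] linear_cmul[OF lin(1)] linear_add[OF lin(2)] linear_cmul[OF lin(2)]
  by (simp_all add: ef e f)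

lemma norm_P_pl: "norm (P1 (pl x y)) = \<bar>x\<bar>" "norm (P2 (pl x y)) = \<bar>y\<bar>"
  by (simp_all add: P_pl e f)

lemma pl_inner: "pl x y \<bullet> pl x' y' = x * x' + y * y'"
  by (simp add: pl_def inner_add_left inner_add_right ef)

lemma pl_add: "pl x y + pl x' y' = pl (x + x') (y + y')" and pl_scale: "k *\<^sub>R pl x y = pl (k * x) (k * y)"
  and pl_diff: "pl x y - pl x' y' = pl (x - x') (y - y')"
  by (simp_all add: pl_def algebra_simps)

text \<open>Every orbit meets the quarter plane spanned by \<open>e\<close> and \<open>f\<close> in exactly one point, \<open>hat q\<close>.\<close>

definition hat :: "'a \<Rightarrow> 'a" where "hat q = pl (norm (P1 q)) (norm (P2 q))"

lemma hat_norm: "norm (P1 (hat q)) = norm (P1 q)" "norm (P2 (hat q)) = norm (P2 q)" "hat q \<bullet> hat q = q \<bullet> q"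
  by (simp_all add: hat_def norm_P_pl pl_inner norm_split[of q] power2_eq_square)

lemma hat_mem: "hat q \<in> S \<longleftrightarrow> q \<in> S"
  using radial hat_norm[of q] unfolding radial_set_def by metis

lemma hat_hat: "hat (hat q) = hat q"
  by (simp add: hat_def hat_norm norm_P_pl)

lemma hat_pl: "hat (pl x y) = pl \<bar>x\<bar> \<bar>y\<bar>"
  by (simp add: hat_def norm_P_pl)

lemma continuous_hat: "continuous_on X hat"
  unfolding hat_def[abs_def] pl_def by (intro continuous_intros)

definition profile :: "'a set" where "profile = {q \<in> S. hat q = q}"

lemma profile_pl:
  assumes "q \<in> profile"
  shows "q = pl (norm (P1 q)) (norm (P2 q))" "q \<in> S" "norm (P2 q) > 0"
  using assms P2_nonzero[of q] by (auto simp: profile_def hat_def)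

lemma hat_profile: "q \<in> S \<Longrightarrow> hat q \<in> profile"
  by (simp add: profile_def hat_mem hat_hat)

lemma pl_profile: "pl x y \<in> S \<Longrightarrow> x \<ge> 0 \<Longrightarrow> y \<ge> 0 \<Longrightarrow> pl x y \<in> profile"
  by (simp add: profile_def hat_pl)

lemma closed_profile: "closed profile"
proof -
  have "closed {q. hat q = q}" by (rule closed_Collect_eq[OF continuous_hat continuous_on_id])
  moreover have "profile = S \<inter> {q. hat q = q}" by (auto simp: profile_def)
  ultimately show ?thesis using closed_S by (simp add: closed_Int)
qed

lemma normal_in_plane:
  assumes p: "p \<in> profile" and n: "unit_normal S p n"
  obtains x y where "n = pl x y" "x\<^sup>2 + y\<^sup>2 = 1" "P1 p = 0 \<Longrightarrow> x = 0"
proof -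
  interpret sw: projections P2 P1 by (rule swapped)
  have rs: "sw.radial_set S" using radial unfolding radial_set_def sw.radial_set_def by blast
  have nt: "n \<bullet> v = 0" if "v \<in> tangent_space S p" for v using n that by (simp add: unit_normal_def)
  note g = profile_pl[OF p]
  have p1: "P1 p = norm (P1 p) *\<^sub>R e" and p2: "P2 p = norm (P2 p) *\<^sub>R f" using P_pl g(1) by metis+
  have "P2 n = ((n \<bullet> P2 p) / (P2 p \<bullet> P2 p)) *\<^sub>R P2 p"
    by (rule sw.normal_parallel[OF rs g(2) P2_nonzero[OF g(2)] nt])
  then obtain y where y: "P2 n = y *\<^sub>R f" using p2 by (metis scaleR_scaleR)
  obtain x where x: "P1 n = x *\<^sub>R e" "P1 p = 0 \<Longrightarrow> x = 0"
  proof (cases "P1 p = 0")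
    case True
    have "P1 n = 0" by (rule axis_normal[OF radial hyper g(2) True n]) (use m1 in simp)
    then show thesis by (intro that[of 0]) auto
  next
    case False
    have "P1 n = ((n \<bullet> P1 p) / (P1 p \<bullet> P1 p)) *\<^sub>R P1 p" by (rule normal_parallel[OF radial g(2) False nt])
    then show thesis using p1 False that by (metis scaleR_scaleR)
  qed
  have npl: "n = pl x y" using sum[of n] x(1) y by (simp add: pl_def)
  have "n \<bullet> n = 1" using n by (simp add: unit_normal_def norm_eq_1)
  then have "x\<^sup>2 + y\<^sup>2 = 1" by (simp add: npl pl_inner power2_eq_square)
  from npl this x(2) show thesis by (rule that)
qed

text \<open>Inside the plane through \<open>p\<close> spanned by \<open>\<tau>\<close> and
  \<open>n\<close>, the set \<open>S\<close> is near \<open>p\<close> a graph over the line in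
  direction \<open>\<tau>\<close>. At a point with \<open>P1 p = 0\<close> the chart runs across the
  axis, and only one half of it belongs to the profile.\<close>

definition chart :: "'a \<Rightarrow> 'a \<Rightarrow> 'a \<Rightarrow> real \<Rightarrow> real \<Rightarrow> (real \<Rightarrow> real) \<Rightarrow> bool" where
  "chart p \<tau> n \<epsilon> \<delta> \<phi> \<longleftrightarrow> \<epsilon> > 0 \<and> \<delta> > 0 \<and> (\<forall>k. Cw k {-\<epsilon><..<\<epsilon>} \<phi>) \<and> \<phi> 0 = 0 \<and> (\<phi> has_real_derivative 0) (at 0) \<and>
     (\<forall>x y. \<bar>x\<bar> < \<epsilon> \<longrightarrow> \<bar>y\<bar> < \<delta> \<longrightarrow> (p + x *\<^sub>R \<tau> + y *\<^sub>R n \<in> S \<longleftrightarrow> y = \<phi> x)) \<and> (\<forall>x. \<bar>x\<bar> < \<epsilon> \<longrightarrow> \<bar>\<phi> x\<bar> < \<delta>)"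

lemma chart_exists:
  assumes p: "p \<in> S" and n: "unit_normal S p n" and \<tau>: "n \<bullet> \<tau> = 0"
  obtains \<epsilon> \<delta> \<phi> where "chart p \<tau> n \<epsilon> \<delta> \<phi>"
proof -
  obtain U g where U: "p \<in> U" "defining_function S U g" using hypersurface_defining_function[OF hyper p] .
  note dg = defining_functionD[OF U(2)]
  have T: "{v. grad g p \<bullet> v = 0} = {v. n \<bullet> v = 0}"
    using tangent_space_level[OF U(2) p U(1)] unit_normal_tangent_space[OF hyper p n] by simp
  have "n \<bullet> n = 1" using n by (simp add: unit_normal_def norm_eq_1)
  then have gn: "grad g p \<bullet> n \<noteq> 0" using T by (metis (mono_tags, lifting) mem_Collect_eq zero_neq_one)
  have gt: "grad g p \<bullet> \<tau> = 0" using T \<tau> by blast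
  \<comment> \<open>The sign makes the derivative in the second variable positive, as
    \<open>implicit_function\<close> requires.\<close>
  define s where "s = sgn (grad g p \<bullet> n)"
  have s: "s * (grad g p \<bullet> n) > 0" "s \<noteq> 0" using gn by (auto simp: s_def sgn_if)
  define L where "L w = fst w *\<^sub>R \<tau> + snd w *\<^sub>R n" for w :: "real \<times> real"
  have L: "bounded_linear L" unfolding L_def[abs_def]
    by (intro bounded_linear_add bounded_linear_compose[OF bounded_linear_scaleR_left] bounded_linear_fst bounded_linear_snd)
  define W where "W = (\<lambda>w. p + L w) -` U"
  have W: "open W" unfolding W_def
    by (intro open_vimage dg(1) continuous_intros linear_continuous_on[OF L])
  define K where "K w = s * g (p + L w)" for w
  have CK: "Ck_on k W K" for k unfolding K_def[abs_def]
    by (intro Ck_on_mult[OF W] Ck_on_const[OF W] Ck_on_compose_affine[OF L W _ dg(2)]) (simp add: W_def)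
  have DK: "(K has_derivative (\<lambda>v. s * (grad g (p + L w) \<bullet> L v))) (at w)" if "w \<in> W" for w
  proof -
    have "((\<lambda>w. p + L w) has_derivative L) (at w)"
      using has_derivative_add[OF has_derivative_const bounded_linear_imp_has_derivative[OF L]] by fastforce
    from diff_chain_at[OF this dg(5)[of "p + L w"]] that
    have "((\<lambda>w. g (p + L w)) has_derivative (\<lambda>v. grad g (p + L w) \<bullet> L v)) (at w)" by (simp add: o_def W_def)
    then show ?thesis unfolding K_def[abs_def] by (rule has_derivative_mult_right)
  qed
  have L0: "L (0, 0) = 0" "L (1, 0) = \<tau>" "L (0, 1) = n" by (simp_all add: L_def)
  have 0: "(0, 0) \<in> W" using U(1) L0 by (simp add: W_def)
  have fd: "frechet_derivative K (at (0, 0)) = (\<lambda>v. s * (grad g p \<bullet> L v))"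
    using frechet_derivative_at[OF DK[OF 0]] L0 by simp
  have K00: "K (0, 0) = 0" using dg(4)[OF U(1)] p L0 by (simp add: K_def)
  obtain \<epsilon> \<delta> \<phi> where r: "\<epsilon> > 0" "\<delta> > 0" "\<And>k. Cw k {0-\<epsilon><..<0+\<epsilon>} \<phi>" "\<phi> 0 = 0"
    "\<And>x y. \<bar>x - 0\<bar> < \<epsilon> \<Longrightarrow> \<bar>y - 0\<bar> < \<delta> \<Longrightarrow> (x, y) \<in> W \<and> (K (x, y) = 0 \<longleftrightarrow> y = \<phi> x)"
    "\<And>x. \<bar>x - 0\<bar> < \<epsilon> \<Longrightarrow> \<bar>\<phi> x - 0\<bar> < \<delta>"
    "\<And>x. \<bar>x - 0\<bar> < \<epsilon> \<Longrightarrow> (\<phi> has_real_derivative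
        - frechet_derivative K (at (x, \<phi> x)) (1, 0) / frechet_derivative K (at (x, \<phi> x)) (0, 1)) (at x)"
  proof (rule implicit_function[OF W _ 0, of K])
    show "\<forall>j. Ck_on j W K" using CK by blast
    show "K (0, 0) = 0" by (rule K00)
    show "frechet_derivative K (at (0, 0)) (0, 1) > 0" unfolding fd L0 by (rule s(1))
  qed (rule that; assumption)
  have "chart p \<tau> n \<epsilon> \<delta> \<phi>"
    unfolding chart_def
  proof (intro conjI allI impI)
    show "0 < \<epsilon>" "0 < \<delta>" "\<phi> 0 = 0" by fact+
    show "Cw k {-\<epsilon><..<\<epsilon>} \<phi>" for k using r(3)[of k] by simp
    show "(\<phi> has_real_derivative 0) (at 0)" using r(7)[of 0] r(1) by (simp add: r(4) fd L0 gt)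
    show "\<bar>\<phi> x\<bar> < \<delta>" if "\<bar>x\<bar> < \<epsilon>" for x using r(6)[of x] that by simp
    fix x y :: real assume xy: "\<bar>x\<bar> < \<epsilon>" "\<bar>y\<bar> < \<delta>"
    have k: "(x, y) \<in> W" "K (x, y) = 0 \<longleftrightarrow> y = \<phi> x" using r(5)[of x y] xy by auto
    have eq: "p + x *\<^sub>R \<tau> + y *\<^sub>R n = p + L (x, y)" by (simp add: L_def)
    show "p + x *\<^sub>R \<tau> + y *\<^sub>R n \<in> S \<longleftrightarrow> y = \<phi> x"
      unfolding eq using dg(4)[of "p + L (x, y)"] k s(2) by (simp add: K_def W_def)
  qed
  then show thesis by (rule that)
qed

lemma chartD:
  assumes "chart p \<tau> n \<epsilon> \<delta> \<phi>"
  shows "\<epsilon> > 0" "\<delta> > 0" "Cw k {-\<epsilon><..<\<epsilon>} \<phi>" "\<phi> 0 = 0" "(\<phi> has_real_derivative 0) (at 0)"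
    "\<bar>x\<bar> < \<epsilon> \<Longrightarrow> \<bar>y\<bar> < \<delta> \<Longrightarrow> p + x *\<^sub>R \<tau> + y *\<^sub>R n \<in> S \<longleftrightarrow> y = \<phi> x" "\<bar>x\<bar> < \<epsilon> \<Longrightarrow> \<bar>\<phi> x\<bar> < \<delta>"
  using assms unfolding chart_def by blast+

definition sig :: "'a \<Rightarrow> 'a \<Rightarrow> 'a \<Rightarrow> (real \<Rightarrow> real) \<Rightarrow> real \<Rightarrow> 'a" where
  "sig p \<tau> n \<phi> x = p + x *\<^sub>R \<tau> + \<phi> x *\<^sub>R n"

definition eta :: "'a \<Rightarrow> 'a \<Rightarrow> 'a \<Rightarrow> (real \<Rightarrow> real) \<Rightarrow> real \<Rightarrow> real" where
  "eta p \<tau> n \<phi> x = sig p \<tau> n \<phi> x \<bullet> sig p \<tau> n \<phi> x"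

lemma Cw_sig:
  assumes "chart p \<tau> n \<epsilon> \<delta> \<phi>"
  shows "Cw k {-\<epsilon><..<\<epsilon>} (sig p \<tau> n \<phi>)" "Cw k {-\<epsilon><..<\<epsilon>} (eta p \<tau> n \<phi>)"
proof -
  show 1: "Cw k {-\<epsilon><..<\<epsilon>} (sig p \<tau> n \<phi>)"
    unfolding sig_def[abs_def] by (intro Cw_add Cw_scaleR Cw_id Cw_const chartD(3)[OF assms])
  show "Cw k {-\<epsilon><..<\<epsilon>} (eta p \<tau> n \<phi>)"
    unfolding eta_def[abs_def] by (intro Cw_inner 1)
qed

lemma chart_point:
  assumes "chart p \<tau> n \<epsilon> \<delta> \<phi>" "\<bar>x\<bar> < \<epsilon>"
  shows "sig p \<tau> n \<phi> x \<in> S"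
  using chartD(6)[OF assms chartD(7)[OF assms]] by (simp add: sig_def)

lemma chart_derivatives:
  assumes ch: "chart p \<tau> n \<epsilon> \<delta> \<phi>"
  obtains h1 h2 where "\<And>x. \<bar>x\<bar> < \<epsilon> \<Longrightarrow> (eta p \<tau> n \<phi> has_real_derivative h1 x) (at x)"
    "\<And>k. Cw k {-\<epsilon><..<\<epsilon>} h1" "h1 0 = 2 * (p \<bullet> \<tau>)" "(h1 has_real_derivative h2) (at 0)"
proof -
  let ?I = "{-\<epsilon><..<\<epsilon>}"
  have o: "open ?I" by simp
  have nb: "at x within ?I \<noteq> bot" if "x \<in> ?I" for x using at_within_open[OF that o] by simp
  have I: "x \<in> ?I" if "\<bar>x\<bar> < \<epsilon>" for x using that by auto
  obtain h1 where h1: "\<And>x. x \<in> ?I \<Longrightarrow> (eta p \<tau> n \<phi> has_vector_derivative h1 x) (at x within ?I)" "\<And>k. Cw k ?I h1"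
    using Cw_all_derivative[OF Cw_sig(2)[OF ch] nb] by blast
  obtain h2 where h2: "\<And>x. x \<in> ?I \<Longrightarrow> (h1 has_vector_derivative h2 x) (at x within ?I)" "\<And>k. Cw k ?I h2"
    using Cw_all_derivative[OF h1(2) nb] by blast
  have d1: "(eta p \<tau> n \<phi> has_real_derivative h1 x) (at x)" if "\<bar>x\<bar> < \<epsilon>" for x
    using h1(1)[OF I[OF that]] at_within_open[OF I[OF that] o] by (simp add: has_real_derivative_iff_has_vector_derivative)
  have "0 \<in> ?I" using chartD(1)[OF ch] by simp
  then have d2: "(h1 has_real_derivative h2 0) (at 0)"
    using h2(1)[of 0] at_within_open[of 0, OF _ o] by (simp add: has_real_derivative_iff_has_vector_derivative)
  have "(sig p \<tau> n \<phi> has_vector_derivative \<tau>) (at 0)"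
  proof -
    have "(\<phi> has_vector_derivative 0) (at 0)" using chartD(5)[OF ch] by (simp add: has_real_derivative_iff_has_vector_derivative)
    then have "((\<lambda>x. \<phi> x *\<^sub>R n) has_vector_derivative 0 *\<^sub>R n) (at 0)"
      by (rule bounded_linear.has_vector_derivative[OF bounded_linear_scaleR_left])
    moreover have "((\<lambda>x. p + x *\<^sub>R \<tau>) has_vector_derivative \<tau>) (at 0)" by (auto intro!: derivative_eq_intros)
    ultimately show ?thesis unfolding sig_def[abs_def] using has_vector_derivative_add by fastforce
  qed
  from bounded_bilinear.has_vector_derivative[OF bounded_bilinear_inner this this]
  have "(eta p \<tau> n \<phi> has_real_derivative p \<bullet> \<tau> + \<tau> \<bullet> p) (at 0)"
    by (simp add: eta_def[abs_def] has_real_derivative_iff_has_vector_derivative sig_def chartD(4)[OF ch])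
  then have "h1 0 = 2 * (p \<bullet> \<tau>)"
    using DERIV_unique d1[of 0] chartD(1)[OF ch] by (fastforce simp: inner_commute)
  with d1 h1(2) d2 show thesis by (intro that)
qed

lemma chart_hat:
  assumes ch: "chart p \<tau> n \<epsilon> \<delta> \<phi>" and p: "p = pl p1 p2" and n: "n = pl a b" "\<tau> = pl b (- a)" "a\<^sup>2 + b\<^sup>2 = 1"
    and q: "q \<in> S" "\<bar>(hat q - p) \<bullet> \<tau>\<bar> < \<epsilon>" "\<bar>(hat q - p) \<bullet> n\<bar> < \<delta>"
  shows "hat q = sig p \<tau> n \<phi> ((hat q - p) \<bullet> \<tau>)"
proof -
  define x where "x = (hat q - p) \<bullet> \<tau>"
  define y where "y = (hat q - p) \<bullet> n"
  have "hat q = p + x *\<^sub>R \<tau> + y *\<^sub>R n"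
  proof -
    define u v where "u = norm (P1 q) - p1" and "v = norm (P2 q) - p2"
    have d: "hat q - p = pl u v" by (simp add: hat_def p pl_diff u_def v_def)
    have xy: "x = u * b - v * a" "y = u * a + v * b" by (simp_all add: x_def y_def d n pl_inner)
    have "x * b + y * a = u * (a\<^sup>2 + b\<^sup>2)" "- x * a + y * b = v * (a\<^sup>2 + b\<^sup>2)"
      unfolding xy by (simp_all add: algebra_simps power2_eq_square)
    then have "x *\<^sub>R \<tau> + y *\<^sub>R n = pl u v" by (simp add: n(1,2) pl_scale pl_add n(3))
    then show ?thesis using d by (simp add: algebra_simps)
  qed
  then show ?thesis
    using chartD(6)[OF ch, of x y] q hat_mem[of q] by (simp add: x_def y_def sig_def)
qed

lemma open_chart_nbhd: "open {q. \<bar>(hat q - p) \<bullet> \<tau>\<bar> < r \<and> \<bar>(hat q - p) \<bullet> n\<bar> < d}"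
  by (intro open_Collect_conj open_Collect_less continuous_intros continuous_hat)

text \<open>Suppose \<open>h2 \<le> 0\<close>. Then the square of the chart coordinate minus
  \<open>|q|^2\<close> has positive second derivative along the curve, hence by invariance a local
  minimum on \<open>S\<close> at \<open>p\<close>. But its Hessian at \<open>p\<close> is twice the
  projection onto \<open>\<tau>\<close> minus twice the identity, with tangential trace
  \<open>2 - 2 N < 0\<close>, where \<open>N = DIM('a) - 1\<close>. Minimality excludes
  this.\<close>

lemma critical_point_nondegenerate:
  assumes p: "p \<in> profile" "P1 p \<noteq> 0" and un: "unit_normal S p n" and n: "n = pl a b" "\<tau> = pl b (- a)" "a\<^sup>2 + b\<^sup>2 = 1"
    and ch: "chart p \<tau> n \<epsilon> \<delta> \<phi>" and crit: "p \<bullet> \<tau> = 0"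
    and h: "\<And>x. \<bar>x\<bar> < \<epsilon> \<Longrightarrow> (eta p \<tau> n \<phi> has_real_derivative h1 x) (at x)" "h1 0 = 0" "(h1 has_real_derivative h2) (at 0)"
  shows "h2 > 0"
proof (rule ccontr)
  assume "\<not> h2 > 0"
  note g = profile_pl[OF p(1)]
  have p1: "P1 p = norm (P1 p) *\<^sub>R e" and p2: "P2 p = norm (P2 p) *\<^sub>R f" using P_pl g(1) by metis+
  obtain \<rho> where \<rho>: "0 < \<rho>" "\<rho> \<le> \<epsilon>" "\<And>x. \<bar>x\<bar> < \<rho> \<Longrightarrow> x \<noteq> 0 \<Longrightarrow> 0\<^sup>2 - eta p \<tau> n \<phi> 0 < x\<^sup>2 - eta p \<tau> n \<phi> x"
  proof (rule second_derivative_strict_min[where g = "\<lambda>x. x\<^sup>2 - eta p \<tau> n \<phi> x" and ?g1.0 = "\<lambda>x. 2 * x - h1 x" and d = "2 - h2" and \<epsilon> = \<epsilon>])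
    show "0 < \<epsilon>" using chartD(1)[OF ch] .
    show "((\<lambda>x. x\<^sup>2 - eta p \<tau> n \<phi> x) has_real_derivative 2 * x - h1 x) (at x)" if "\<bar>x\<bar> < \<epsilon>" for x
      by (rule DERIV_cong[OF DERIV_diff[OF DERIV_power[OF DERIV_ident] h(1)[OF that]]]) simp
    show "((\<lambda>x. 2 * x - h1 x) has_real_derivative 2 - h2) (at 0)"
      by (rule DERIV_cong[OF DERIV_diff[OF DERIV_cmult[OF DERIV_ident] h(3)]]) simp
    show "2 - h2 > 0" using \<open>\<not> h2 > 0\<close> by simp
  qed (use h(2) in auto)
  \<comment> \<open>The chart coordinate expressed by the two norms: this extends it off the plane
    as an invariant function, differentiable where neither component vanishes. Its gradient is
    \<open>G\<close>. Since \<open>\<Theta> p = 0\<close>, the Hessian of \<open>\<Theta>\<close>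
    does not contribute to that of its square.\<close>
  define \<Theta> where "\<Theta> q = b * norm (P1 q) - a * norm (P2 q) - p \<bullet> \<tau>" for q
  have \<Theta>: "(hat q - p) \<bullet> \<tau> = \<Theta> q" for q
    by (simp add: inner_diff_left \<Theta>_def hat_def n(2) pl_inner)
  define G where "G q = (b / norm (P1 q)) *\<^sub>R P1 q - (a / norm (P2 q)) *\<^sub>R P2 q" for q
  have Gp: "G p = \<tau>"
  proof -
    define r t where "r = norm (P1 p)" and "t = norm (P2 p)"
    have r: "P1 p = r *\<^sub>R e" "r \<noteq> 0" and t: "P2 p = t *\<^sub>R f" "t \<noteq> 0"
      using p1 p2 p(2) P2_nonzero[OF g(2)] by (auto simp: r_def t_def)
    have "G p = (b / r) *\<^sub>R P1 p - (a / t) *\<^sub>R P2 p" by (simp add: G_def r_def t_def)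
    also have "\<dots> = (b / r) *\<^sub>R (r *\<^sub>R e) - (a / t) *\<^sub>R (t *\<^sub>R f)" by (simp only: r(1) t(1))
    also have "\<dots> = b *\<^sub>R e - a *\<^sub>R f" using r(2) t(2) by simp
    finally show ?thesis by (simp add: n(2) pl_def)
  qed
  have D\<Theta>: "(\<Theta> has_derivative (\<lambda>v. G q \<bullet> v)) (at q)" if "P1 q \<noteq> 0" "P2 q \<noteq> 0" for q
  proof -
    have "((\<lambda>q. norm (P1 q)) has_derivative (\<lambda>v. sgn (P1 q) \<bullet> P1 v)) (at q)"
      using diff_chain_at[OF bounded_linear_imp_has_derivative[OF bl(1)] has_derivative_norm[OF that(1)]] 
      by (simp add: o_def inner_commute)
    moreover have "((\<lambda>q. norm (P2 q)) has_derivative (\<lambda>v. sgn (P2 q) \<bullet> P2 v)) (at q)"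
      using diff_chain_at[OF bounded_linear_imp_has_derivative[OF bl(2)] has_derivative_norm[OF that(2)]]
      by (simp add: o_def inner_commute)
    ultimately have "(\<Theta> has_derivative (\<lambda>v. b * (sgn (P1 q) \<bullet> P1 v) - a * (sgn (P2 q) \<bullet> P2 v) - 0)) (at q)"
      unfolding \<Theta>_def[abs_def] by (intro has_derivative_diff has_derivative_mult_right has_derivative_const)
    moreover have "(\<lambda>v. b * (sgn (P1 q) \<bullet> P1 v) - a * (sgn (P2 q) \<bullet> P2 v) - 0) = (\<lambda>v. G q \<bullet> v)"
      by (rule ext) (simp add: G_def sgn_div_norm inner_diff_left P1_inner[symmetric] P2_inner[symmetric] divide_inverse)
    ultimately show ?thesis by simp
  qed
  have dG: "G differentiable (at p)"
  proof -
    have n1: "(\<lambda>q. norm (P1 q)) differentiable (at p)" "(\<lambda>q. norm (P2 q)) differentiable (at p)"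
      using diff_chain_at[OF bounded_linear_imp_has_derivative[OF bl(1)] has_derivative_norm[OF p(2)]]
        diff_chain_at[OF bounded_linear_imp_has_derivative[OF bl(2)] has_derivative_norm[OF P2_nonzero[OF g(2)]]]
      by (auto simp: o_def differentiable_def)
    show ?thesis unfolding G_def[abs_def]
      by (intro differentiable_diff differentiable_scaleR differentiable_divide differentiable_const n1 bounded_linear_imp_differentiable[OF bl(1)] bounded_linear_imp_differentiable[OF bl(2)])
        (use p(2) P2_nonzero[OF g(2)] in auto)
  qed
  define G' where "G' = frechet_derivative G (at p)"
  have G': "(G has_derivative G') (at p)" using dG by (simp add: G'_def frechet_derivative_works)
  have \<Theta>p: "\<Theta> p = 0" using \<Theta>[of p] p(1) by (simp add: profile_def)
  define W where "W = {q. \<bar>(hat q - p) \<bullet> \<tau>\<bar> < \<rho> \<and> \<bar>(hat q - p) \<bullet> n\<bar> < \<delta>} \<inter> {q. P1 q \<noteq> 0} \<inter> {q. P2 q \<noteq> 0}"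
  have "0 \<le> (\<Sum>i\<in>Basis. ((2 * (\<tau> \<bullet> i)) *\<^sub>R \<tau> - 2 *\<^sub>R i) \<bullet> i) - ((2 * (\<tau> \<bullet> n)) *\<^sub>R \<tau> - 2 *\<^sub>R n) \<bullet> n"
  proof (rule minimal_local_min[OF minimal g(2) un, where u = "\<lambda>q. (\<Theta> q)\<^sup>2 - q \<bullet> q" and g = "\<lambda>q. (2 * \<Theta> q) *\<^sub>R G q - 2 *\<^sub>R q" and W = W])
    show "open W" unfolding W_def
      by (intro open_Int open_chart_nbhd open_Collect_neq continuous_intros)
    show "p \<in> W" using p P2_nonzero[OF g(2)] \<rho>(1) chartD(2)[OF ch] by (simp add: W_def profile_def)
    show "((\<lambda>q. (\<Theta> q)\<^sup>2 - q \<bullet> q) has_derivative (\<lambda>v. ((2 * \<Theta> q) *\<^sub>R G q - 2 *\<^sub>R q) \<bullet> v)) (at q)" if "q \<in> W" for q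
    proof -
      have "((\<lambda>q. (\<Theta> q)\<^sup>2 - q \<bullet> q) has_derivative (\<lambda>v. of_nat 2 * (G q \<bullet> v) * \<Theta> q ^ (2 - 1) - (q \<bullet> v + v \<bullet> q))) (at q)"
        by (intro has_derivative_diff has_derivative_power has_derivative_inner has_derivative_ident D\<Theta>) (use that in \<open>auto simp: W_def\<close>)
      then show ?thesis by (rule has_derivative_eq_rhs) (auto simp: inner_diff_left inner_diff_right inner_commute)
    qed
    have "((\<lambda>q. (2 * \<Theta> q) *\<^sub>R G q - 2 *\<^sub>R q) has_derivative (\<lambda>v. ((2 * \<Theta> p) *\<^sub>R G' v + (2 * (G p \<bullet> v)) *\<^sub>R G p) - 2 *\<^sub>R v)) (at p)"
      by (intro has_derivative_diff has_derivative_scaleR has_derivative_mult_right has_derivative_scaleR_right has_derivative_ident D\<Theta> G' p(2) P2_nonzero[OF g(2)])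
    then show "((\<lambda>q. (2 * \<Theta> q) *\<^sub>R G q - 2 *\<^sub>R q) has_derivative (\<lambda>v. (2 * (\<tau> \<bullet> v)) *\<^sub>R \<tau> - 2 *\<^sub>R v)) (at p)"
      by (simp add: \<Theta>p Gp)
    fix q assume q: "q \<in> S \<inter> W"
    have hq: "hat q = sig p \<tau> n \<phi> (\<Theta> q)"
      using chart_hat[OF ch g(1) n, of q] q \<rho>(2) unfolding W_def by (simp add: \<Theta>)
    have "q \<bullet> q = eta p \<tau> n \<phi> (\<Theta> q)" using hat_norm(3)[of q] by (simp add: hq eta_def)
    moreover have "p \<bullet> p = eta p \<tau> n \<phi> 0" by (simp add: eta_def sig_def chartD(4)[OF ch])
    moreover have "\<bar>\<Theta> q\<bar> < \<rho>" using q by (simp add: W_def \<Theta>)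
    ultimately show "(\<Theta> p)\<^sup>2 - p \<bullet> p \<le> (\<Theta> q)\<^sup>2 - q \<bullet> q"
      using \<rho>(3)[of "\<Theta> q"] \<Theta>p by (cases "\<Theta> q = 0") auto
  qed
  also have "(\<Sum>i\<in>Basis. ((2 * (\<tau> \<bullet> i)) *\<^sub>R \<tau> - 2 *\<^sub>R i) \<bullet> i) = 2 * (\<Sum>i\<in>Basis. (\<tau> \<bullet> i) * (\<tau> \<bullet> i)) - 2 * real DIM('a)"
    by (simp add: inner_diff_left sum_subtractf sum_distrib_left mult.assoc)
  also have "(\<Sum>i\<in>Basis. (\<tau> \<bullet> i) * (\<tau> \<bullet> i)) = \<tau> \<bullet> \<tau>" by (rule euclidean_inner[symmetric])
  also have "\<tau> \<bullet> \<tau> = 1" using n(3) by (simp add: n pl_inner power2_eq_square)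
  also have "((2 * (\<tau> \<bullet> n)) *\<^sub>R \<tau> - 2 *\<^sub>R n) \<bullet> n = - 2"
  proof -
    have "n \<bullet> n = 1" using un by (simp add: unit_normal_def norm_eq_1)
    moreover have "\<tau> \<bullet> n = 0" by (simp add: n pl_inner)
    ultimately show ?thesis by (simp add: inner_diff_left)
  qed
  finally show False using dim m1 m2 by simp
qed

text \<open>To second order \<open>|q|^2\<close> on \<open>S\<close> is \<open>|p|^2\<close> plus
  \<open>h2 / 2\<close> times \<open>|P1 q|^2\<close>. The tangential traces of the Hessians of
  \<open>|q|^2\<close> and \<open>|P1 q|^2\<close> are \<open>2 (m1 + m2 - 1)\<close> and
  \<open>2 m1\<close>, so their ratio must be \<open>h2 / 2\<close>. The comparison is made with
  \<open>\<kappa> |P1 q|^2\<close>, which is smooth across the axis.\<close>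

lemma axis_point_second_derivative:
  assumes p: "p \<in> profile" "P1 p = 0" and un: "unit_normal S p f"
    and ch: "chart p e f \<epsilon> \<delta> \<phi>"
    and h: "\<And>x. \<bar>x\<bar> < \<epsilon> \<Longrightarrow> (eta p e f \<phi> has_real_derivative h1 x) (at x)" "h1 0 = 0" "(h1 has_real_derivative h2) (at 0)"
  shows "h2 = 2 * (m1 + m2 - 1) / m1"
proof -
  note g = profile_pl[OF p(1)]
  have fe: "f = pl 0 1" "e = pl 1 (- 0)" "0\<^sup>2 + 1\<^sup>2 = (1::real)" by (simp_all add: pl_def)
  have pe: "p = pl 0 (norm (P2 p))" using g(1) p(2) by simp
  have x: "(hat q - p) \<bullet> e = norm (P1 q)" for q
    by (subst pe, subst fe(2)) (simp add: hat_def pl_diff pl_inner)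
  \<comment> \<open>With \<open>s = 1\<close> the comparison function lies strictly above
    \<open>|q|^2\<close> to second order, with \<open>s = -1\<close> strictly below; minimality
    gives one inequality in each case.\<close>
  have key: "0 \<le> s * (\<kappa> * m1 - (m1 + m2 - 1))" if s: "s * (2 * \<kappa> - h2) > 0" "\<bar>s\<bar> = 1" for s \<kappa>
  proof -
    obtain \<rho> where \<rho>: "0 < \<rho>" "\<rho> \<le> \<epsilon>" "\<And>x. \<bar>x\<bar> < \<rho> \<Longrightarrow> x \<noteq> 0 \<Longrightarrow> s * (\<kappa> * 0\<^sup>2 - eta p e f \<phi> 0) < s * (\<kappa> * x\<^sup>2 - eta p e f \<phi> x)"
    proof (rule second_derivative_strict_min[where g = "\<lambda>x. s * (\<kappa> * x\<^sup>2 - eta p e f \<phi> x)" and ?g1.0 = "\<lambda>x. s * (2 * \<kappa> * x - h1 x)" and d = "s * (2 * \<kappa> - h2)" and \<epsilon> = \<epsilon>])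
      show "0 < \<epsilon>" using chartD(1)[OF ch] .
      show "((\<lambda>x. s * (\<kappa> * x\<^sup>2 - eta p e f \<phi> x)) has_real_derivative s * (2 * \<kappa> * x - h1 x)) (at x)" if "\<bar>x\<bar> < \<epsilon>" for x
        by (rule DERIV_cong[OF DERIV_cmult[OF DERIV_diff[OF DERIV_cmult[OF DERIV_power[OF DERIV_ident]] h(1)[OF that]]]]) simp
      show "((\<lambda>x. s * (2 * \<kappa> * x - h1 x)) has_real_derivative s * (2 * \<kappa> - h2)) (at 0)"
        by (rule DERIV_cong[OF DERIV_cmult[OF DERIV_diff[OF DERIV_cmult[OF DERIV_ident] h(3)]]]) simp
    qed (use h(2) s in auto)
    define W where "W = {q. \<bar>(hat q - p) \<bullet> e\<bar> < \<rho> \<and> \<bar>(hat q - p) \<bullet> f\<bar> < \<delta>}"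
    have "0 \<le> (\<Sum>i\<in>Basis. (s *\<^sub>R ((2 * \<kappa>) *\<^sub>R P1 i - 2 *\<^sub>R i)) \<bullet> i) - (s *\<^sub>R ((2 * \<kappa>) *\<^sub>R P1 f - 2 *\<^sub>R f)) \<bullet> f"
    proof (rule minimal_local_min[OF minimal g(2) un, where u = "\<lambda>q. s * (\<kappa> * (P1 q \<bullet> P1 q) - q \<bullet> q)" and g = "\<lambda>q. s *\<^sub>R ((2 * \<kappa>) *\<^sub>R P1 q - 2 *\<^sub>R q)" and W = W])
      show "open W" unfolding W_def by (rule open_chart_nbhd)
      show "p \<in> W" using p \<rho>(1) chartD(2)[OF ch] by (simp add: W_def profile_def)
      show "((\<lambda>q. s * (\<kappa> * (P1 q \<bullet> P1 q) - q \<bullet> q)) has_derivative (\<lambda>v. (s *\<^sub>R ((2 * \<kappa>) *\<^sub>R P1 q - 2 *\<^sub>R q)) \<bullet> v)) (at q)" for q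
      proof -
        have "((\<lambda>q. s * (\<kappa> * (P1 q \<bullet> P1 q) - q \<bullet> q)) has_derivative (\<lambda>v. s * (\<kappa> * (P1 q \<bullet> P1 v + P1 v \<bullet> P1 q) - (q \<bullet> v + v \<bullet> q)))) (at q)"
          by (intro has_derivative_diff has_derivative_mult_right has_derivative_inner has_derivative_ident bounded_linear_imp_has_derivative[OF bl(1)])
        moreover have "s * (\<kappa> * (P1 q \<bullet> P1 v + P1 v \<bullet> P1 q) - (q \<bullet> v + v \<bullet> q)) = (s *\<^sub>R ((2 * \<kappa>) *\<^sub>R P1 q - 2 *\<^sub>R q)) \<bullet> v" for v
        proof -
          have "P1 v \<bullet> P1 q = P1 q \<bullet> P1 v" "v \<bullet> q = q \<bullet> v" by (simp_all add: inner_commute)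
          moreover have "P1 q \<bullet> v = P1 q \<bullet> P1 v" by (rule P1_inner)
          ultimately show ?thesis by (simp add: inner_diff_left)
        qed
        ultimately show ?thesis by simp
      qed
      have "linear (\<lambda>q. s *\<^sub>R ((2 * \<kappa>) *\<^sub>R P1 q - 2 *\<^sub>R q))"
        using lin(1) by (intro linear_compose_scale_right linear_compose_sub linear_ident)
      then show "((\<lambda>q. s *\<^sub>R ((2 * \<kappa>) *\<^sub>R P1 q - 2 *\<^sub>R q)) has_derivative (\<lambda>v. s *\<^sub>R ((2 * \<kappa>) *\<^sub>R P1 v - 2 *\<^sub>R v))) (at p)"
        by (intro bounded_linear_imp_has_derivative) (simp add: linear_linear)
      fix q assume q: "q \<in> S \<inter> W"
      have hq: "hat q = sig p e f \<phi> (norm (P1 q))"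
        using chart_hat[OF ch g(1) fe, of q] q \<rho>(2) unfolding W_def by (simp add: x)
      have "q \<bullet> q = eta p e f \<phi> (norm (P1 q))" using hat_norm(3)[of q] by (simp add: hq eta_def)
      moreover have "p \<bullet> p = eta p e f \<phi> 0" by (simp add: eta_def sig_def chartD(4)[OF ch])
      moreover have "norm (P1 q) < \<rho>" using q by (simp add: W_def x)
      moreover have "P1 q \<bullet> P1 q = (norm (P1 q))\<^sup>2" by (simp add: dot_square_norm)
      ultimately show "s * (\<kappa> * (P1 p \<bullet> P1 p) - p \<bullet> p) \<le> s * (\<kappa> * (P1 q \<bullet> P1 q) - q \<bullet> q)"
        using \<rho>(3)[of "norm (P1 q)"] p(2) by (cases "norm (P1 q) = 0") (auto simp del: norm_eq_zero)
    qed
    also have "(\<Sum>i\<in>Basis. (s *\<^sub>R ((2 * \<kappa>) *\<^sub>R P1 i - 2 *\<^sub>R i)) \<bullet> i) = s * (2 * \<kappa> * (\<Sum>i\<in>Basis. P1 i \<bullet> i) - 2 * real DIM('a))"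
      by (simp add: inner_diff_left sum_subtractf sum_distrib_left right_diff_distrib mult.assoc)
    also have "\<dots> - (s *\<^sub>R ((2 * \<kappa>) *\<^sub>R P1 f - 2 *\<^sub>R f)) \<bullet> f = s * (2 * (\<kappa> * m1 - (m1 + m2 - 1)))"
      by (simp add: m1(1) dim ef algebra_simps)
    finally show ?thesis using s(2) by (auto simp: zero_le_mult_iff)
  qed
  have m: "m1 > 0" using m1(2) by simp
  define K where "K = 2 * (m1 + m2 - 1) / m1"
  have K: "K * m1 = 2 * (m1 + m2 - 1)" using m by (simp add: K_def)
  have "\<not> h2 < K"
  proof
    assume "h2 < K"
    \<comment> \<open>Here \<open>2 \<kappa>\<close> is the midpoint of \<open>h2\<close> and
      \<open>K\<close>, so it lies strictly between them.\<close>
    then have "0 \<le> ((h2 + K) / 4) * m1 - (m1 + m2 - 1)" using key[of 1 "(h2 + K) / 4"] by simp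
    then have "2 * (K * m1) \<le> (h2 + K) * m1" using K by simp
    then have "2 * K \<le> h2 + K" using m by (simp add: mult.assoc[symmetric])
    then show False using \<open>h2 < K\<close> by simp
  qed
  moreover have "\<not> h2 > K"
  proof
    assume "h2 > K"
    then have "((h2 + K) / 4) * m1 - (m1 + m2 - 1) \<le> 0" using key[of "-1" "(h2 + K) / 4"] by simp
    then have "(h2 + K) * m1 \<le> 2 * (K * m1)" using K by simp
    then have "h2 + K \<le> 2 * K" using m by (simp add: mult.assoc[symmetric])
    then show False using \<open>h2 > K\<close> by simp
  qed
  ultimately show ?thesis by (simp add: K_def)
qed


section \<open>The levels of the squared distance near a point of the curve\<close>

lemma unit_normal_minus: "unit_normal S p n \<Longrightarrow> unit_normal S p (- n)"
  by (simp add: unit_normal_def)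

text \<open>The sign of the normal is used up to make \<open>|.|^2\<close> nondecreasing to first
  order in the direction of the tangent. On the axis this product is zero anyway, and the sign is
  chosen so that the tangent is \<open>e\<close> and points into the quarter plane.\<close>

lemma chart_at:
  assumes p: "p \<in> profile"
  obtains a b \<epsilon> \<delta> \<phi> where "a\<^sup>2 + b\<^sup>2 = 1" "unit_normal S p (pl a b)" "chart p (pl b (- a)) (pl a b) \<epsilon> \<delta> \<phi>"
    "P1 p = 0 \<Longrightarrow> a = 0 \<and> b = 1" "p \<bullet> pl b (- a) \<ge> 0"
proof -
  obtain \<nu> where \<nu>: "unit_normal S p \<nu>" using unit_normal_exists[OF hyper] profile_pl(2)[OF p] by blast
  obtain x y where xy: "\<nu> = pl x y" "x\<^sup>2 + y\<^sup>2 = 1" "P1 p = 0 \<Longrightarrow> x = 0" using normal_in_plane[OF p \<nu>] by blast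
  have ex: "\<exists>a b. a\<^sup>2 + b\<^sup>2 = 1 \<and> unit_normal S p (pl a b) \<and> (P1 p = 0 \<longrightarrow> a = 0 \<and> b = 1) \<and> p \<bullet> pl b (- a) \<ge> 0"
  proof (cases "P1 p = 0")
    case True
    then have "x = 0" "y = 1 \<or> y = -1" using xy by (auto simp: power2_eq_1_iff)
    moreover have "pl 0 1 = - pl 0 (-1)" by (simp add: pl_def)
    ultimately have "unit_normal S p (pl 0 1)" using \<nu> xy(1) unit_normal_minus by metis
    moreover have "p \<bullet> pl 1 (- 0) = 0" using profile_pl(1)[OF p] True by (metis add.right_neutral minus_zero mult_zero_left mult_zero_right norm_zero pl_inner)
    ultimately show ?thesis by (intro exI[of _ 0] exI[of _ 1]) auto
  next
    case False
    show ?thesis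
    proof (cases "p \<bullet> pl y (- x) \<ge> 0")
      case True
      then show ?thesis using xy \<nu> False by blast
    next
      case neg: False
      have m: "pl (- x) (- y) = - \<nu>" "pl (- y) (- (- x)) = - pl y (- x)" by (simp_all add: xy(1) pl_def)
      show ?thesis
        by (intro exI[of _ "- x"] exI[of _ "- y"]) (use m neg xy(2) unit_normal_minus[OF \<nu>] False in auto)
    qed
  qed
  then obtain a b where ab: "a\<^sup>2 + b\<^sup>2 = 1" "unit_normal S p (pl a b)" "P1 p = 0 \<Longrightarrow> a = 0 \<and> b = 1" "p \<bullet> pl b (- a) \<ge> 0" by blast
  obtain \<epsilon> \<delta> \<phi> where "chart p (pl b (- a)) (pl a b) \<epsilon> \<delta> \<phi>"
    using chart_exists[OF profile_pl(2)[OF p] ab(2), of "pl b (- a)"] by (auto simp: pl_inner)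
  with ab show thesis by (intro that)
qed

text \<open>The curve escapes from \<open>p\<close> through higher levels. Monotonicity is not asked
  for: by the intermediate value theorem all levels slightly above that of \<open>p\<close> are met
  arbitrarily close to \<open>p\<close>.\<close>

definition rising :: "'a \<Rightarrow> (real \<Rightarrow> 'a) \<Rightarrow> real \<Rightarrow> bool" where
  "rising p s b \<longleftrightarrow> b > 0 \<and> continuous_on {0..b} s \<and> s 0 = p \<and> (\<forall>x. 0 < x \<and> x \<le> b \<longrightarrow> s x \<in> profile \<and> p \<bullet> p < s x \<bullet> s x)"

lemma rising_levels:
  assumes r: "rising p s b" and N: "open N" "p \<in> N"
  obtains \<epsilon> where "\<epsilon> > 0" "\<And>H. p \<bullet> p < H \<Longrightarrow> H < p \<bullet> p + \<epsilon> \<Longrightarrow> \<exists>x. 0 < x \<and> x \<le> b \<and> s x \<in> N \<and> s x \<in> profile \<and> s x \<bullet> s x = H"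
proof -
  have b: "b > 0" and c: "continuous_on {0..b} s" and s0: "s 0 = p"
    and g: "\<And>x. 0 < x \<Longrightarrow> x \<le> b \<Longrightarrow> s x \<in> profile \<and> p \<bullet> p < s x \<bullet> s x" using r by (auto simp: rising_def)
  obtain e where e: "e > 0" "ball p e \<subseteq> N" using N open_contains_ball by blast
  obtain d where d: "d > 0" "\<And>x. x \<in> {0..b} \<Longrightarrow> dist x 0 < d \<Longrightarrow> dist (s x) (s 0) < e"
    using c b e(1) unfolding continuous_on_iff by (metis atLeastAtMost_iff less_eq_real_def)
  define b' where "b' = min b (d / 2)"
  have b': "0 < b'" "b' \<le> b" using b d(1) by (auto simp: b'_def)
  have sN: "s x \<in> N" if "0 \<le> x" "x \<le> b'" for x
  proof -
    have "dist (s x) (s 0) < e" using d(2)[of x] that b' d(1) by (simp add: b'_def)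
    then show ?thesis using e(2) s0 by (auto simp: dist_commute)
  qed
  show thesis
  proof (rule that[of "s b' \<bullet> s b' - p \<bullet> p"])
    show "0 < s b' \<bullet> s b' - p \<bullet> p" using g[OF b'] by simp
    fix H assume H: "p \<bullet> p < H" "H < p \<bullet> p + (s b' \<bullet> s b' - p \<bullet> p)"
    have "continuous_on {0..b'} (\<lambda>x. s x \<bullet> s x)"
      by (intro continuous_on_inner continuous_on_subset[OF c]) (use b' in auto)
    then obtain x where x: "0 \<le> x" "x \<le> b'" "s x \<bullet> s x = H" using IVT'[of "\<lambda>x. s x \<bullet> s x" 0 H b'] H s0 b' by auto
    then have "x \<noteq> 0" using s0 H(1) by auto
    then show "\<exists>x. 0 < x \<and> x \<le> b \<and> s x \<in> N \<and> s x \<in> profile \<and> s x \<bullet> s x = H"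
      using x sN[of x] g[of x] b' by (intro exI[of _ x]) auto
  qed
qed

context
  fixes p a b \<epsilon> \<delta> \<phi>
  assumes p: "p \<in> profile" and ab: "a\<^sup>2 + b\<^sup>2 = 1" and un: "unit_normal S p (pl a b)"
    and ch: "chart p (pl b (- a)) (pl a b) \<epsilon> \<delta> \<phi>"
    and ax: "P1 p = 0 \<Longrightarrow> a = 0 \<and> b = 1" and pt: "p \<bullet> pl b (- a) \<ge> 0"
begin

abbreviation "tau \<equiv> pl b (- a)"
abbreviation "nn \<equiv> pl a b"
abbreviation "sg \<equiv> sig p tau nn \<phi>"
abbreviation "et \<equiv> eta p tau nn \<phi>"

lemma sg_pl: "sg x = pl (norm (P1 p) + x * b + \<phi> x * a) (norm (P2 p) - x * a + \<phi> x * b)"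
proof -
  have "sg x = pl (norm (P1 p)) (norm (P2 p)) + x *\<^sub>R tau + \<phi> x *\<^sub>R nn" using profile_pl(1)[OF p] by (simp add: sig_def)
  then show ?thesis by (simp add: pl_scale pl_add)
qed

lemma sg0: "sg 0 = p" "et 0 = p \<bullet> p"
  by (simp_all add: sig_def eta_def chartD(4)[OF ch])

lemma sg_coords: "(sg x - p) \<bullet> tau = x" "(sg x - p) \<bullet> nn = \<phi> x"
proof -
  have "sg x - p = x *\<^sub>R tau + \<phi> x *\<^sub>R nn" by (simp add: sig_def)
  moreover have "tau \<bullet> tau = 1" "nn \<bullet> nn = 1" "tau \<bullet> nn = 0" "nn \<bullet> tau = 0"
    using ab by (simp_all add: pl_inner power2_eq_square)
  ultimately show "(sg x - p) \<bullet> tau = x" "(sg x - p) \<bullet> nn = \<phi> x" by (simp_all add: inner_add_left)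
qed

lemma sg_inj: "sg x = sg y \<Longrightarrow> x = y"
  using sg_coords(1) by metis

lemma sg_profile:
  obtains r where "0 < r" "r \<le> \<epsilon>" "\<And>x. \<bar>x\<bar> < r \<Longrightarrow> P1 p \<noteq> 0 \<or> 0 \<le> x \<Longrightarrow> sg x \<in> profile"
proof -
  have cphi: "isCont \<phi> 0" using chartD(5)[OF ch] DERIV_isCont by blast
  have "isCont (\<lambda>x. norm (P2 p) - x * a + \<phi> x * b) 0" by (intro continuous_intros cphi)
  then have l2: "((\<lambda>x. norm (P2 p) - x * a + \<phi> x * b) \<longlongrightarrow> norm (P2 p)) (at 0)"
    by (simp add: isCont_def chartD(4)[OF ch])
  have e2: "\<forall>\<^sub>F x in at 0. norm (P2 p) - x * a + \<phi> x * b > 0" by (rule order_tendstoD(1)[OF l2 profile_pl(3)[OF p]])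
  have "isCont (\<lambda>x. norm (P1 p) + x * b + \<phi> x * a) 0" by (intro continuous_intros cphi)
  then have l1: "((\<lambda>x. norm (P1 p) + x * b + \<phi> x * a) \<longlongrightarrow> norm (P1 p)) (at 0)"
    by (simp add: isCont_def chartD(4)[OF ch])
  have e1: "\<forall>\<^sub>F x in at 0. P1 p \<noteq> 0 \<or> 0 \<le> x \<longrightarrow> norm (P1 p) + x * b + \<phi> x * a \<ge> 0"
  proof (cases "P1 p = 0")
    case True
    then show ?thesis using ax by simp
  next
    case False
    then show ?thesis using order_tendstoD(1)[OF l1, of 0] by (auto elim!: eventually_mono)
  qed
  obtain d where d: "d > 0" "\<And>x. x \<noteq> 0 \<Longrightarrow> dist x 0 < d \<Longrightarrow> norm (P2 p) - x * a + \<phi> x * b > 0 \<and> (P1 p \<noteq> 0 \<or> 0 \<le> x \<longrightarrow> norm (P1 p) + x * b + \<phi> x * a \<ge> 0)"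
    using eventually_conj[OF e2 e1] unfolding eventually_at by blast
  show thesis
  proof (rule that[of "min d \<epsilon>"])
    show "0 < min d \<epsilon>" using d(1) chartD(1)[OF ch] by simp
    fix x assume x: "\<bar>x\<bar> < min d \<epsilon>" "P1 p \<noteq> 0 \<or> 0 \<le> x"
    show "sg x \<in> profile"
    proof (cases "x = 0")
      case True
      then show ?thesis using p sg0 by simp
    next
      case False
      have "sg x \<in> S" using chart_point[OF ch] x by simp
      then show ?thesis using d(2)[OF False] x unfolding sg_pl by (intro pl_profile) auto
    qed
  qed simp
qed

definition "nb r = {q. \<bar>(hat q - p) \<bullet> tau\<bar> < r \<and> \<bar>(hat q - p) \<bullet> nn\<bar> < \<delta>}"

lemma nb: "open (nb r)" "r > 0 \<Longrightarrow> p \<in> nb r"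
  using open_chart_nbhd p chartD(2)[OF ch] by (auto simp: nb_def profile_def)

lemma nb_sg:
  assumes "q \<in> profile" "q \<in> nb r" "r \<le> \<epsilon>"
  obtains x where "\<bar>x\<bar> < r" "q = sg x" "P1 p = 0 \<Longrightarrow> x = norm (P1 q)"
proof -
  have hq: "hat q = q" "q \<in> S" using assms(1) by (auto simp: profile_def)
  show thesis
  proof (rule that[of "(q - p) \<bullet> tau"])
    show "\<bar>(q - p) \<bullet> tau\<bar> < r" using assms(2) hq by (simp add: nb_def)
    show "q = sg ((q - p) \<bullet> tau)"
      using chart_hat[OF ch profile_pl(1)[OF p] refl refl ab hq(2)] assms(2,3) hq(1) by (simp add: nb_def)
    assume 0: "P1 p = 0"
    have "(q - p) \<bullet> tau = (pl (norm (P1 q)) (norm (P2 q)) - pl (norm (P1 p)) (norm (P2 p))) \<bullet> tau"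
      using profile_pl(1)[OF p] profile_pl(1)[OF assms(1)] by simp
    also have "\<dots> = norm (P1 q)" using ax[OF 0] 0 by (simp add: pl_diff pl_inner)
    finally show "(q - p) \<bullet> tau = norm (P1 q)" .
  qed
qed

lemma sg_nb: "sg x \<in> profile \<Longrightarrow> \<bar>x\<bar> < r \<Longrightarrow> r \<le> \<epsilon> \<Longrightarrow> sg x \<in> nb r"
  using sg_coords[of x] chartD(7)[OF ch, of x] by (simp add: nb_def profile_def)

lemma continuous_sg: "continuous_on {-\<epsilon><..<\<epsilon>} sg"
  using Cw_continuous[OF Cw_sig(1)[OF ch]] .

lemma critical_strict_min:
  assumes "p \<bullet> tau = 0"
  obtains r where "0 < r" "r \<le> \<epsilon>" "\<And>x. \<bar>x\<bar> < r \<Longrightarrow> x \<noteq> 0 \<Longrightarrow> p \<bullet> p < et x"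
proof -
  obtain h1 h2 where h: "\<And>x. \<bar>x\<bar> < \<epsilon> \<Longrightarrow> (et has_real_derivative h1 x) (at x)" "h1 0 = 2 * (p \<bullet> tau)" "(h1 has_real_derivative h2) (at 0)"
  proof (rule chart_derivatives[OF ch])
  qed (rule that; assumption)
  have h10: "h1 0 = 0" using h(2) assms by simp
  have "h2 > 0"
  proof (cases "P1 p = 0")
    case True
    have eqs: "tau = e" "nn = f" using ax[OF True] by (simp_all add: pl_def)
    have "h2 = 2 * (m1 + m2 - 1) / m1"
      by (rule axis_point_second_derivative[OF p True _ _ _ h10 h(3)]) (use un ch h(1) in \<open>simp_all only: eqs\<close>)
    then show ?thesis using m1(2) m2(2) by simp
  next
    case False
    show ?thesis by (rule critical_point_nondegenerate[OF p False un refl refl ab ch assms h(1) h10 h(3)])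
  qed
  then obtain r where "0 < r" "r \<le> \<epsilon>" "\<And>x. \<bar>x\<bar> < r \<Longrightarrow> x \<noteq> 0 \<Longrightarrow> et 0 < et x"
    using second_derivative_strict_min[OF chartD(1)[OF ch] h(1) h10 h(3)] by blast
  then show thesis using sg0 by (intro that) auto
qed

lemma sg_rising:
  assumes r: "0 < r" "r < \<epsilon>" "\<And>x. 0 < x \<Longrightarrow> x \<le> r \<Longrightarrow> sg (s * x) \<in> profile \<and> p \<bullet> p < et (s * x)" "\<bar>s\<bar> = 1"
  shows "rising p (\<lambda>x. sg (s * x)) r"
  unfolding rising_def
proof (intro conjI allI impI)
  show "continuous_on {0..r} (\<lambda>x. sg (s * x))"
  proof (rule continuous_on_compose2[OF continuous_sg])
    show "(\<lambda>x. s * x) ` {0..r} \<subseteq> {-\<epsilon><..<\<epsilon>}"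
    proof clarsimp
      fix x assume "0 \<le> x" "x \<le> r"
      then have "\<bar>s * x\<bar> < \<epsilon>" using r(2,4) by (simp add: abs_mult)
      then show "- \<epsilon> < s * x \<and> s * x < \<epsilon>" by linarith
    qed
  qed (auto intro!: continuous_intros)
qed (use r sg0 in \<open>auto simp: eta_def\<close>)

text \<open>Either the derivative of \<open>|.|^2\<close> in the direction of the tangent is
  positive, or the point is critical and therefore a strict minimum. In both cases the squared
  distance increases at first, so it has no local maximum on the curve.\<close>

lemma rising_chart: "\<exists>s r. rising p s r"
proof -
  obtain r1 where r1: "0 < r1" "r1 \<le> \<epsilon>" "\<And>x. \<bar>x\<bar> < r1 \<Longrightarrow> P1 p \<noteq> 0 \<or> 0 \<le> x \<Longrightarrow> sg x \<in> profile" using sg_profile by blast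
  obtain r2 where r2: "0 < r2" "\<And>x. 0 < x \<Longrightarrow> x < r2 \<Longrightarrow> p \<bullet> p < et x"
  proof (cases "p \<bullet> tau = 0")
    case True
    then show thesis using critical_strict_min that by (metis abs_of_pos less_numeral_extra(3))
  next
    case False
    obtain h1 where h: "\<And>x. \<bar>x\<bar> < \<epsilon> \<Longrightarrow> (et has_real_derivative h1 x) (at x)" "h1 0 = 2 * (p \<bullet> tau)"
    proof (rule chart_derivatives[OF ch])
    qed (rule that; assumption)
    have "h1 0 > 0" using h(2) pt False by simp
    then obtain d where "d > 0" "\<And>x. 0 < x \<Longrightarrow> x < d \<Longrightarrow> et 0 < et (0 + x)"
      using DERIV_pos_inc_right[OF h(1)[of 0]] chartD(1)[OF ch] by auto
    then show thesis using sg0 by (intro that) auto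
  qed
  have "rising p (\<lambda>x. sg (1 * x)) (min r1 r2 / 2)"
    by (rule sg_rising) (use r1 r2 in \<open>auto simp: min_less_iff_disj\<close>)
  then show ?thesis by blast
qed

text \<open>Off the axis both halves of the chart belong to the profile, and each rises from the
  strict minimum; on the axis one half would be cut off.\<close>

lemma critical_two_levels:
  assumes crit: "p \<bullet> tau = 0" "P1 p \<noteq> 0" and N: "open N" "p \<in> N"
  obtains d where "d > 0" "\<And>H. p \<bullet> p < H \<Longrightarrow> H < p \<bullet> p + d \<Longrightarrow> \<exists>q q'. q \<noteq> q' \<and> q \<in> profile \<and> q' \<in> profile \<and> q \<bullet> q = H \<and> q' \<bullet> q' = H"
proof -
  obtain r1 where r1: "0 < r1" "r1 \<le> \<epsilon>" "\<And>x. \<bar>x\<bar> < r1 \<Longrightarrow> P1 p \<noteq> 0 \<or> 0 \<le> x \<Longrightarrow> sg x \<in> profile" using sg_profile by blast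
  obtain r2 where r2: "0 < r2" "\<And>x. \<bar>x\<bar> < r2 \<Longrightarrow> x \<noteq> 0 \<Longrightarrow> p \<bullet> p < et x" using critical_strict_min[OF crit(1)] by metis
  define r where "r = min r1 r2 / 2"
  have r: "0 < r" "r < r1" "r < r2" using r1 r2 by (auto simp: r_def min_def)
  have "rising p (\<lambda>x. sg (s * x)) r" if "\<bar>s\<bar> = 1" for s
  proof (rule sg_rising[OF r(1) _ _ that])
    show "r < \<epsilon>" using r r1 by simp
    fix x assume "0 < x" "x \<le> r"
    then have "\<bar>s * x\<bar> < r1" "\<bar>s * x\<bar> < r2" "s * x \<noteq> 0" using r that by (auto simp: abs_mult)
    then show "sg (s * x) \<in> profile \<and> p \<bullet> p < et (s * x)" using r1(3) r2(2) crit(2) by blast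
  qed
  note ris = this
  obtain e1 where e1: "e1 > 0" "\<And>H. p \<bullet> p < H \<Longrightarrow> H < p \<bullet> p + e1 \<Longrightarrow> \<exists>x. 0 < x \<and> x \<le> r \<and> sg (1 * x) \<in> N \<and> sg (1 * x) \<in> profile \<and> sg (1 * x) \<bullet> sg (1 * x) = H"
    using rising_levels[OF ris[of 1] N] by auto
  obtain e2 where e2: "e2 > 0" "\<And>H. p \<bullet> p < H \<Longrightarrow> H < p \<bullet> p + e2 \<Longrightarrow> \<exists>x. 0 < x \<and> x \<le> r \<and> sg ((-1) * x) \<in> N \<and> sg ((-1) * x) \<in> profile \<and> sg ((-1) * x) \<bullet> sg ((-1) * x) = H"
    using rising_levels[OF ris[of "-1"] N] by auto
  show thesis
  proof (rule that[of "min e1 e2"])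
    fix H assume H: "p \<bullet> p < H" "H < p \<bullet> p + min e1 e2"
    have H12: "H < p \<bullet> p + e1" "H < p \<bullet> p + e2" using H(2) by auto
    obtain x where x: "0 < x" "sg (1 * x) \<in> profile" "sg (1 * x) \<bullet> sg (1 * x) = H" using e1(2)[OF H(1) H12(1)] by blast
    obtain y where y: "0 < y" "sg ((-1) * y) \<in> profile" "sg ((-1) * y) \<bullet> sg ((-1) * y) = H" using e2(2)[OF H(1) H12(2)] by blast
    have "sg (1 * x) \<noteq> sg ((-1) * y)" using sg_inj[of "1 * x" "(-1) * y"] x(1) y(1) by auto
    then show "\<exists>q q'. q \<noteq> q' \<and> q \<in> profile \<and> q' \<in> profile \<and> q \<bullet> q = H \<and> q' \<bullet> q' = H" using x y by blast
  qed (use e1 e2 in auto)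
qed

lemma axis_local_min:
  assumes "P1 p = 0"
  obtains N where "open N" "p \<in> N" "\<And>q. q \<in> profile \<Longrightarrow> q \<in> N \<Longrightarrow> p \<bullet> p \<le> q \<bullet> q"
proof -
  have "p \<bullet> tau = (pl (norm (P1 p)) (norm (P2 p))) \<bullet> tau" using profile_pl(1)[OF p] by simp
  then have z: "p \<bullet> tau = 0" using ax[OF assms] assms by (simp add: pl_inner)
  obtain r where r: "0 < r" "r \<le> \<epsilon>" "\<And>x. \<bar>x\<bar> < r \<Longrightarrow> x \<noteq> 0 \<Longrightarrow> p \<bullet> p < et x"
  proof (rule critical_strict_min[OF z])
  qed (rule that; assumption)
  show thesis
  proof (rule that[OF nb(1) nb(2)[OF r(1)]])
    fix q assume q: "q \<in> profile" "q \<in> nb r"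
    obtain x where x: "\<bar>x\<bar> < r" "q = sg x" using nb_sg[OF q r(2)] by blast
    then show "p \<bullet> p \<le> q \<bullet> q" using r(3)[OF x(1)] sg0 by (cases "x = 0") (auto simp: eta_def)
  qed
qed

text \<open>Where \<open>|.|^2\<close> has nonzero derivative along the curve, it is itself a smooth
  coordinate, and the curve can be reparametrised by its level.\<close>

lemma regular_local:
  assumes "p \<bullet> tau \<noteq> 0"
  obtains N e1 g where "open N" "p \<in> N" "e1 > 0"
    "\<And>q q'. q \<in> profile \<Longrightarrow> q \<in> N \<Longrightarrow> q' \<in> profile \<Longrightarrow> q' \<in> N \<Longrightarrow> q \<bullet> q = q' \<bullet> q' \<Longrightarrow> q = q'"
    "\<And>k. Cw k {p \<bullet> p - e1<..<p \<bullet> p + e1} g"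
    "\<And>H. \<bar>H - p \<bullet> p\<bar> < e1 \<Longrightarrow> g H \<in> profile \<and> g H \<in> N \<and> g H \<bullet> g H = H"
proof -
  have P1p: "P1 p \<noteq> 0"
  proof
    assume 0: "P1 p = 0"
    have "p \<bullet> tau = (pl (norm (P1 p)) (norm (P2 p))) \<bullet> tau" using profile_pl(1)[OF p] by simp
    then show False using ax[OF 0] 0 assms by (simp add: pl_inner)
  qed
  obtain h1 where h: "\<And>x. \<bar>x\<bar> < \<epsilon> \<Longrightarrow> (et has_real_derivative h1 x) (at x)" "\<And>k. Cw k {-\<epsilon><..<\<epsilon>} h1" "h1 0 = 2 * (p \<bullet> tau)"
  proof (rule chart_derivatives[OF ch])
  qed (rule that; assumption)
  have eps: "\<epsilon> > 0" by (rule chartD(1)[OF ch])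
  have "h1 0 > 0" using h(3) assms pt by simp
  have "isCont h1 0" using Cw_continuous[OF h(2)] eps by (simp add: continuous_on_eq_continuous_at)
  then have "\<forall>\<^sub>F x in at 0. h1 x > 0" using \<open>h1 0 > 0\<close> by (auto simp: isCont_def dest: order_tendstoD(1))
  then obtain d where d: "d > 0" "\<And>x. x \<noteq> 0 \<Longrightarrow> dist x 0 < d \<Longrightarrow> h1 x > 0" unfolding eventually_at by blast
  obtain r1 where r1: "0 < r1" "r1 \<le> \<epsilon>" "\<And>x. \<bar>x\<bar> < r1 \<Longrightarrow> P1 p \<noteq> 0 \<or> 0 \<le> x \<Longrightarrow> sg x \<in> profile" using sg_profile by blast
  define r where "r = min r1 d / 2"
  have r: "0 < r" "r < r1" "r < d" "r < \<epsilon>" using r1 d(1) by (auto simp: r_def min_def)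
  have I: "\<bar>x\<bar> < \<epsilon>" "\<bar>x\<bar> < d" "\<bar>x\<bar> < r1" if "x \<in> {-r..r}" for x using that r by auto
  have hp: "h1 x > 0" if "x \<in> {-r..r}" for x using d(2)[of x] I(2)[OF that] \<open>h1 0 > 0\<close> by (cases "x = 0") auto
  have rr: "- r < r" using r by simp
  obtain y where y: "\<And>k. Cw k {et (-r)..et r} y" "\<And>H. H \<in> {et (-r)..et r} \<Longrightarrow> y H \<in> {-r..r} \<and> et (y H) = H"
    "\<And>x. x \<in> {-r..r} \<Longrightarrow> y (et x) = x \<and> et x \<in> {et (-r)..et r}" "et (-r) < et r"
  proof (rule smooth_inverse_interval[OF rr, of et h1])
    show "(et has_real_derivative h1 x) (at x within {-r..r})" if "x \<in> {-r..r}" for x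
      using h(1)[OF I(1)[OF that]] has_field_derivative_at_within by blast
    show "Cw k {-r..r} h1" for k by (rule Cw_subset[OF h(2)]) (use r in auto)
  qed (use hp in auto)
  have inj: "x = x'" if "x \<in> {-r..r}" "x' \<in> {-r..r}" "et x = et x'" for x x' using y(3) that by metis
  have 0: "0 \<in> {-r..r}" using r by simp
  have e0: "et (-r) < p \<bullet> p" "p \<bullet> p < et r"
  proof -
    have "et 0 \<in> {et (-r)..et r}" using y(3)[OF 0] by blast
    moreover have "et 0 \<noteq> et (-r)" "et 0 \<noteq> et r" using inj[OF 0, of "-r"] inj[OF 0, of r] r by auto
    ultimately show "et (-r) < p \<bullet> p" "p \<bullet> p < et r" using sg0 by auto
  qed
  define e1 where "e1 = min (p \<bullet> p - et (-r)) (et r - p \<bullet> p)"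
  have sub: "H \<in> {et (-r)<..<et r}" if "\<bar>H - p \<bullet> p\<bar> < e1" for H using that by (auto simp: e1_def abs_less_iff)
  show thesis
  proof (rule that[of "nb r" e1 "\<lambda>H. sg (y H)"])
    show "open (nb r)" "p \<in> nb r" using nb r(1) by auto
    show "0 < e1" using e0 by (simp add: e1_def)
    show "q = q'" if q: "q \<in> profile" "q \<in> nb r" "q' \<in> profile" "q' \<in> nb r" "q \<bullet> q = q' \<bullet> q'" for q q'
    proof -
      obtain x where x: "\<bar>x\<bar> < r" "q = sg x" using nb_sg[OF q(1,2)] r(4) by auto
      obtain x' where x': "\<bar>x'\<bar> < r" "q' = sg x'" using nb_sg[OF q(3,4)] r(4) by auto
      have "x = x'" by (rule inj) (use x x' q(5) in \<open>auto simp: eta_def abs_less_iff\<close>)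
      then show ?thesis using x x' by simp
    qed
    show "Cw k {p \<bullet> p - e1<..<p \<bullet> p + e1} (\<lambda>H. sg (y H))" for k
    proof (rule Cw_compose_real[OF Cw_sig(1)[OF ch]])
      have "{p \<bullet> p - e1<..<p \<bullet> p + e1} \<subseteq> {et (-r)..et r}"
      proof
        fix H assume "H \<in> {p \<bullet> p - e1<..<p \<bullet> p + e1}"
        then have "H \<in> {et (-r)<..<et r}" by (intro sub) (auto simp: abs_less_iff)
        then show "H \<in> {et (-r)..et r}" by simp
      qed
      then show "Cw k {p \<bullet> p - e1<..<p \<bullet> p + e1} y" by (rule Cw_subset[OF y(1)])
      show "y ` {p \<bullet> p - e1<..<p \<bullet> p + e1} \<subseteq> {-\<epsilon><..<\<epsilon>}"
      proof (rule image_subsetI)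
        fix H assume "H \<in> {p \<bullet> p - e1<..<p \<bullet> p + e1}"
        then have "H \<in> {et (-r)<..<et r}" by (intro sub) (auto simp: abs_less_iff)
        then have "y H \<in> {-r..r}" using y(2)[of H] by simp
        then show "y H \<in> {-\<epsilon><..<\<epsilon>}" using r(4) by auto
      qed
    qed
    fix H assume H: "\<bar>H - p \<bullet> p\<bar> < e1"
    have "H \<in> {et (-r)<..<et r}" by (rule sub[OF H])
    then have yH: "y H \<in> {-r..r}" "et (y H) = H" "y H \<noteq> r" "y H \<noteq> - r" using y(2)[of H] by auto
    then have "\<bar>y H\<bar> < r" by auto
    moreover have "sg (y H) \<in> profile" by (rule r1(3)) (use I(3)[OF yH(1)] P1p in auto)
    ultimately show "sg (y H) \<in> profile \<and> sg (y H) \<in> nb r \<and> sg (y H) \<bullet> sg (y H) = H"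
      using sg_nb[of "y H" r] r(4) yH(2) by (simp add: eta_def)
  qed
qed

end

section \<open>Uniqueness of the levels by downward continuation\<close>

lemma rising_exists: "p \<in> profile \<Longrightarrow> \<exists>s r. rising p s r"
  using chart_at rising_chart by metis

lemma levels_above:
  assumes "p \<in> profile" "open N" "p \<in> N"
  obtains d where "d > 0" "\<And>H. p \<bullet> p < H \<Longrightarrow> H < p \<bullet> p + d \<Longrightarrow> \<exists>q. q \<in> N \<and> q \<in> profile \<and> q \<bullet> q = H"
  using rising_exists[OF assms(1)] rising_levels[OF _ assms(2,3)] by metis

lemma infdist_facts: "\<exists>p\<in>S. norm p = 1" "q \<in> S \<Longrightarrow> 1 \<le> q \<bullet> q"
proof -
  have "S \<noteq> {}" using dist by (auto simp: infdist_def)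
  then show "\<exists>p\<in>S. norm p = 1"
    using infdist_attains_inf[OF closed_S, of 0] dist by (metis dist_0_norm)
  assume "q \<in> S"
  then have "1 \<le> norm q" using infdist_le[of q S 0] dist by (simp add: dist_norm)
  then have "1\<^sup>2 \<le> (norm q)\<^sup>2" by (rule power_mono) simp
  then show "1 \<le> q \<bullet> q" by (simp add: dot_square_norm)
qed

text \<open>The profile points outside \<open>N\<close> of level at most \<open>H + 1\<close> form a
  compact set; its image under \<open>|.|^2\<close> is closed and misses \<open>H\<close>.\<close>

lemma level_away:
  assumes N: "open N" "\<And>q. q \<in> profile \<Longrightarrow> q \<bullet> q = H \<Longrightarrow> q \<in> N"
  obtains d where "d > 0" "\<And>q. q \<in> profile \<Longrightarrow> \<bar>q \<bullet> q - H\<bar> < d \<Longrightarrow> q \<in> N"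
proof -
  define M where "M = (profile \<inter> {q. q \<bullet> q \<le> H + 1}) - N"
  have "closed {q::'a. q \<bullet> q \<le> H + 1}" by (intro closed_Collect_le continuous_intros)
  then have "closed M" unfolding M_def using closed_profile N(1) by (intro closed_Diff closed_Int)
  moreover have "bounded M"
  proof -
    have "norm q \<le> sqrt (H + 1)" if "q \<in> M" for q
      using that by (auto simp: M_def norm_eq_sqrt_inner)
    then show ?thesis by (auto simp: bounded_iff)
  qed
  ultimately have "compact M" by (simp add: compact_eq_bounded_closed)
  then have "compact ((\<lambda>q. q \<bullet> q) ` M)" by (intro compact_continuous_image continuous_intros)
  then have "open (- ((\<lambda>q. q \<bullet> q) ` M))" using compact_imp_closed by blast
  moreover have "H \<in> - ((\<lambda>q. q \<bullet> q) ` M)" using N(2) by (auto simp: M_def)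
  ultimately obtain d where d: "d > 0" "ball H d \<subseteq> - ((\<lambda>q. q \<bullet> q) ` M)" using open_contains_ball by blast
  show thesis
  proof (rule that[of "min d 1"])
    fix q assume q: "q \<in> profile" "\<bar>q \<bullet> q - H\<bar> < min d 1"
    have "q \<bullet> q \<in> ball H d" using q(2) by (simp add: dist_real_def abs_minus_commute)
    then have "q \<notin> M" using d(2) by blast
    then show "q \<in> N" using q by (auto simp: M_def)
  qed (use d in auto)
qed

text \<open>The gap below \<open>H0\<close> makes the part of the profile under \<open>H0\<close>
  compact. A highest point of it cannot exist, because levels slightly above every point are
  occupied.\<close>

lemma profile_no_max:
  assumes "H0 > 0" "\<And>q. q \<in> profile \<Longrightarrow> q \<bullet> q < H0 \<Longrightarrow> q \<bullet> q \<le> H0 - \<epsilon>" "\<epsilon> > 0"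
  shows "\<not> (\<exists>q\<in>profile. q \<bullet> q < H0)"
proof
  assume ex: "\<exists>q\<in>profile. q \<bullet> q < H0"
  define M where "M = profile \<inter> {q. q \<bullet> q \<le> H0 - \<epsilon>}"
  have "M \<noteq> {}" using ex assms(2) by (auto simp: M_def)
  have "closed {q::'a. q \<bullet> q \<le> H0 - \<epsilon>}" by (intro closed_Collect_le continuous_intros)
  then have "closed M" unfolding M_def using closed_profile by (intro closed_Int)
  moreover have "bounded M"
  proof -
    have "norm q \<le> sqrt (H0 - \<epsilon>)" if "q \<in> M" for q
      using that by (auto simp: M_def norm_eq_sqrt_inner)
    then show ?thesis by (auto simp: bounded_iff)
  qed
  ultimately have "compact M" by (simp add: compact_eq_bounded_closed)
  then have "\<exists>q\<in>M. \<forall>q'\<in>M. q' \<bullet> q' \<le> q \<bullet> q"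
    by (rule continuous_attains_sup[OF _ \<open>M \<noteq> {}\<close>]) (intro continuous_intros)
  then obtain q where q: "q \<in> M" "\<And>q'. q' \<in> M \<Longrightarrow> q' \<bullet> q' \<le> q \<bullet> q" by blast
  have qG: "q \<in> profile" "q \<bullet> q < H0" using q(1) assms(3) by (auto simp: M_def)
  obtain d where d: "d > 0" "\<And>H. q \<bullet> q < H \<Longrightarrow> H < q \<bullet> q + d \<Longrightarrow> \<exists>q. q \<in> UNIV \<and> q \<in> profile \<and> q \<bullet> q = H"
    using levels_above[OF qG(1) open_UNIV] by blast
  define H where "H = q \<bullet> q + min d (H0 - q \<bullet> q) / 2"
  have "q \<bullet> q < H" "H < q \<bullet> q + d" "H < H0" using d(1) qG(2) by (auto simp: H_def min_def field_simps)
  then obtain q' where q': "q' \<in> profile" "q' \<bullet> q' = H" using d(2) by blast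
  then have "q' \<in> M" using assms(2)[of q'] \<open>H < H0\<close> by (simp add: M_def)
  then show False using q(2)[of q'] q'(2) \<open>q \<bullet> q < H\<close> by simp
qed

text \<open>Let \<open>Hs\<close> be the infimum of the levels from which on every sphere meets the
  profile exactly once. At \<open>Hs\<close> there is again exactly one point: one by closedness,
  not two since each would create a point on the levels just above. Off the axis this point is
  regular and uniqueness would extend below \<open>Hs\<close>. So it lies on the axis and is a local
  minimum, which isolates the remaining profile below \<open>Hs\<close>; that part must then be
  empty, and \<open>Hs\<close> is the least level, 1.\<close>

lemma unique_levels:
  assumes large: "\<And>H. H > H1 \<Longrightarrow> \<exists>!q. q \<in> profile \<and> q \<bullet> q = H"
  shows "H \<ge> 1 \<Longrightarrow> \<exists>!q. q \<in> profile \<and> q \<bullet> q = H" "q \<in> profile \<Longrightarrow> q \<bullet> q > 1 \<Longrightarrow> P1 q \<noteq> 0" "q \<in> profile \<Longrightarrow> q \<bullet> q = 1 \<Longrightarrow> P1 q = 0"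
proof -
  define A where "A = {H. \<forall>H'\<ge>H. \<exists>!q. q \<in> profile \<and> q \<bullet> q = H'}"
  have up: "H' \<in> A" if "H \<in> A" "H \<le> H'" for H H' using that unfolding A_def by auto
  have ge1: "1 \<le> H" if HA: "H \<in> A" for H
  proof -
    obtain q where "q \<in> profile" "q \<bullet> q = H" using HA unfolding A_def by blast
    then show ?thesis using infdist_facts(2) profile_pl(2) by blast
  qed
  have A: "max (H1 + 1) 1 \<in> A" using large unfolding A_def by auto
  have bdd: "bdd_below A" using ge1 by (rule bdd_belowI)
  define Hs where "Hs = Inf A"
  have above: "H \<in> A" if HH: "H > Hs" for H
  proof -
    obtain H' where "H' \<in> A" "H' < H" using cInf_lessD[of A H] A HH unfolding Hs_def by blast
    then show ?thesis using up by simp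
  qed
  have Hs1: "1 \<le> Hs" unfolding Hs_def by (rule cInf_greatest) (use A ge1 in auto)
  have uniq: "\<exists>!q. q \<in> profile \<and> q \<bullet> q = H" if "H > Hs" for H using above[OF that] unfolding A_def by blast
  have ex: "\<exists>q. q \<in> profile \<and> q \<bullet> q = Hs"
  proof (rule ccontr)
    assume no: "\<nexists>q. q \<in> profile \<and> q \<bullet> q = Hs"
    obtain d where d: "d > 0" "\<And>q. q \<in> profile \<Longrightarrow> \<bar>q \<bullet> q - Hs\<bar> < d \<Longrightarrow> q \<in> {}" using level_away[of "{}" Hs] no by blast
    obtain q where "q \<in> profile" "q \<bullet> q = Hs + d / 2" using uniq[of "Hs + d / 2"] d(1) by auto
    then show False using d(2)[of q] d(1) by simp
  qed
  have one: "q = q'" if qq: "q \<in> profile" "q \<bullet> q = Hs" "q' \<in> profile" "q' \<bullet> q' = Hs" for q q'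
  proof (rule ccontr)
    assume "q \<noteq> q'"
    from hausdorff[OF this] obtain U V where UV: "open U" "open V" "q \<in> U" "q' \<in> V" "U \<inter> V = {}" by blast
    obtain d1 where d1: "d1 > 0" "\<And>H. q \<bullet> q < H \<Longrightarrow> H < q \<bullet> q + d1 \<Longrightarrow> \<exists>x. x \<in> U \<and> x \<in> profile \<and> x \<bullet> x = H"
      using levels_above[OF qq(1) UV(1,3)] by blast
    obtain d2 where d2: "d2 > 0" "\<And>H. q' \<bullet> q' < H \<Longrightarrow> H < q' \<bullet> q' + d2 \<Longrightarrow> \<exists>x. x \<in> V \<and> x \<in> profile \<and> x \<bullet> x = H"
      using levels_above[OF qq(3) UV(2,4)] by blast
    define H where "H = Hs + min d1 d2 / 2"
    have H: "Hs < H" "H < Hs + d1" "H < Hs + d2" using d1(1) d2(1) by (auto simp: H_def min_def field_simps)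
    obtain x where x: "x \<in> U" "x \<in> profile" "x \<bullet> x = H" using d1(2)[of H] H qq(2) by auto
    obtain x' where x': "x' \<in> V" "x' \<in> profile" "x' \<bullet> x' = H" using d2(2)[of H] H qq(4) by auto
    have "x = x'" using uniq[OF H(1)] x x' by blast
    then show False using x(1) x'(1) UV(5) by blast
  qed
  obtain p where p: "p \<in> profile" "p \<bullet> p = Hs" using ex by blast
  have HsA: "Hs \<in> A" unfolding A_def
  proof (intro CollectI allI impI)
    fix H' assume "Hs \<le> H'"
    then show "\<exists>!q. q \<in> profile \<and> q \<bullet> q = H'" using uniq[of H'] ex one by (cases "H' = Hs") auto
  qed
  have not_crit: "p \<bullet> pl b (- a) \<noteq> 0"
    if q: "p \<in> profile" "p \<bullet> p \<ge> Hs" "P1 p \<noteq> 0" and ch: "a\<^sup>2 + b\<^sup>2 = 1" "unit_normal S p (pl a b)" "chart p (pl b (- a)) (pl a b) \<epsilon> \<delta> \<phi>"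
      "P1 p = 0 \<Longrightarrow> a = 0 \<and> b = 1" "p \<bullet> pl b (- a) \<ge> 0" for p a b \<epsilon> \<delta> \<phi>
  proof
    assume z: "p \<bullet> pl b (- a) = 0"
    obtain d where d: "d > 0" "\<And>H. p \<bullet> p < H \<Longrightarrow> H < p \<bullet> p + d \<Longrightarrow> \<exists>q q'. q \<noteq> q' \<and> q \<in> profile \<and> q' \<in> profile \<and> q \<bullet> q = H \<and> q' \<bullet> q' = H"
      using critical_two_levels[OF q(1) ch z q(3) open_UNIV] by blast
    obtain x x' where "x \<noteq> x'" "x \<in> profile" "x' \<in> profile" "x \<bullet> x = p \<bullet> p + d/2" "x' \<bullet> x' = p \<bullet> p + d/2"
      using d(2)[of "p \<bullet> p + d/2"] d(1) by auto
    then show False using uniq[of "p \<bullet> p + d/2"] q(2) d(1) by auto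
  qed
  have axis_p: "P1 p = 0"
  proof (rule ccontr)
    assume P1p: "P1 p \<noteq> 0"
    obtain a b \<epsilon> \<delta> \<phi> where ch: "a\<^sup>2 + b\<^sup>2 = 1" "unit_normal S p (pl a b)" "chart p (pl b (- a)) (pl a b) \<epsilon> \<delta> \<phi>"
      "P1 p = 0 \<Longrightarrow> a = 0 \<and> b = 1" "p \<bullet> pl b (- a) \<ge> 0" using chart_at[OF p(1)] by metis
    have nz: "p \<bullet> pl b (- a) \<noteq> 0" by (rule not_crit[OF p(1) _ P1p ch]) (use p in simp)
    obtain N e1 g where N: "open N" "p \<in> N" "e1 > 0"
      "\<And>q q'. q \<in> profile \<Longrightarrow> q \<in> N \<Longrightarrow> q' \<in> profile \<Longrightarrow> q' \<in> N \<Longrightarrow> q \<bullet> q = q' \<bullet> q' \<Longrightarrow> q = q'"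
      "\<And>H. \<bar>H - p \<bullet> p\<bar> < e1 \<Longrightarrow> g H \<in> profile \<and> g H \<in> N \<and> g H \<bullet> (g H :: 'a) = H"
      using regular_local[OF p(1) ch nz] by metis
    obtain d where d: "d > 0" "\<And>q. q \<in> profile \<Longrightarrow> \<bar>q \<bullet> q - Hs\<bar> < d \<Longrightarrow> q \<in> N"
      using level_away[OF N(1), of Hs] one p N(2) by metis
    define H where "H = Hs - min d e1 / 2"
    have HH: "H < Hs" "Hs - H < d" "Hs - H < e1" using d(1) N(3) by (auto simp: H_def min_def field_simps)
    have "H \<in> A" unfolding A_def
    proof (intro CollectI allI impI)
      fix H' assume H': "H \<le> H'"
      show "\<exists>!q. q \<in> profile \<and> q \<bullet> q = H'"
      proof (cases "H' \<ge> Hs")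
        case True
        then show ?thesis using HsA unfolding A_def by blast
      next
        case False
        then have s: "\<bar>H' - p \<bullet> p\<bar> < e1" "\<bar>H' - Hs\<bar> < d" using H' HH p(2) by auto
        show ?thesis
        proof (rule ex1I[of _ "g H'"])
          show "g H' \<in> profile \<and> g H' \<bullet> g H' = H'" using N(5)[OF s(1)] by blast
          fix q assume "q \<in> profile \<and> q \<bullet> q = H'"
          then show "q = g H'" using N(4)[of q "g H'"] N(5)[OF s(1)] d(2)[of q] s(2) by auto
        qed
      qed
    qed
    then have "Hs \<le> H" unfolding Hs_def using bdd by (rule cInf_lower)
    then show False using HH(1) by simp
  qed
  obtain N where N: "open N" "p \<in> N" "\<And>q. q \<in> profile \<Longrightarrow> q \<in> N \<Longrightarrow> p \<bullet> p \<le> q \<bullet> q"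
    using chart_at[OF p(1)] axis_local_min[OF p(1) _ _ _ _ _ axis_p] by metis
  obtain d where d: "d > 0" "\<And>q. q \<in> profile \<Longrightarrow> \<bar>q \<bullet> q - Hs\<bar> < d \<Longrightarrow> q \<in> N"
    using level_away[OF N(1), of Hs] one p N(2) by metis
  \<comment> \<open>Near \<open>Hs\<close> all profile points lie in \<open>N\<close>, where no
    level is below \<open>Hs\<close>; this is the gap required by
    \<open>profile_no_max\<close>.\<close>
  have low: "q \<bullet> q \<le> Hs - d" if "q \<in> profile" "q \<bullet> q < Hs" for q
    using d(2)[OF that(1)] N(3)[OF that(1)] that(2) p(2) by force
  have "\<not> (\<exists>q\<in>profile. q \<bullet> q < Hs)" by (rule profile_no_max[OF _ low d(1)]) (use Hs1 in auto)
  moreover obtain p0 where p0: "p0 \<in> S" "norm p0 = 1" using infdist_facts(1) by blast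
  moreover have "hat p0 \<in> profile" "hat p0 \<bullet> hat p0 = 1" using hat_profile[OF p0(1)] hat_norm(3)[of p0] p0(2) by (auto simp: norm_eq_1)
  ultimately have "Hs \<le> 1" by force
  then have Hs: "Hs = 1" using Hs1 by simp
  show "H \<ge> 1 \<Longrightarrow> \<exists>!q. q \<in> profile \<and> q \<bullet> q = H" using HsA unfolding A_def Hs by blast
  show "q \<in> profile \<Longrightarrow> q \<bullet> q = 1 \<Longrightarrow> P1 q = 0" using axis_p one[of q p] p Hs by simp
  show "P1 q \<noteq> 0" if q: "q \<in> profile" "q \<bullet> q > 1"
  proof
    assume 0: "P1 q = 0"
    obtain N where N: "open N" "q \<in> N" "\<And>x. x \<in> profile \<Longrightarrow> x \<in> N \<Longrightarrow> q \<bullet> q \<le> x \<bullet> x"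
      using chart_at[OF q(1)] axis_local_min[OF q(1) _ _ _ _ _ 0] by metis
    have "x = q" if "x \<in> profile" "x \<bullet> x = q \<bullet> q" for x using uniq[of "q \<bullet> q"] q that Hs by auto
    note xq = this
    obtain d where d: "d > 0" "\<And>x. x \<in> profile \<Longrightarrow> \<bar>x \<bullet> x - q \<bullet> q\<bar> < d \<Longrightarrow> x \<in> N"
      using level_away[OF N(1), of "q \<bullet> q"] N(2) xq by metis
    \<comment> \<open>Any level just below that of \<open>q\<close> and above 1 is occupied, yet its
      point would lie in \<open>N\<close>, where \<open>q\<close> is lowest.\<close>
    define H where "H = q \<bullet> q - min d (q \<bullet> q - 1) / 2"
    have H: "H > 1" "H < q \<bullet> q" "q \<bullet> q - H < d" using d(1) q(2) by (auto simp: H_def min_def field_simps)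
    obtain x where x: "x \<in> profile" "x \<bullet> x = H" using uniq[of H] H Hs by auto
    then show False using N(3)[OF x(1)] d(2)[OF x(1)] H by auto
  qed
qed

end

section \<open>The asymptotic end\<close>

lemma smooth_fun_on_continuous:
  assumes "smooth_fun_on X f"
  shows "continuous_on X f"
  unfolding continuous_on_eq_continuous_within
proof
  fix p assume p: "p \<in> X"
  obtain U g where U: "open U" "p \<in> U" "\<forall>k. Ck_on k U g" "\<forall>q\<in>X \<inter> U. f q = g q"
    using bspec[OF assms[unfolded smooth_fun_on_def] p] by blast
  have "continuous_on U g" using U(3)[rule_format, of 0] by simp
  then have "isCont g p" using U(1,2) continuous_on_eq_continuous_at by blast
  then have g: "continuous (at p within X) g" by (rule continuous_at_imp_continuous_within)
  obtain d where d: "d > 0" "ball p d \<subseteq> U" using U(1,2) open_contains_ball by blast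
  show "continuous (at p within X) f"
  proof (rule continuous_transform_within[OF g d(1) p])
    fix q assume "q \<in> X" "dist q p < d"
    then have "q \<in> X \<inter> U" using subsetD[OF d(2), of q] by (simp add: dist_commute)
    then show "g q = f q" using U(4) by simp
  qed
qed

context radial_minimal
begin

text \<open>\<open>ca\<close> and \<open>sa\<close> are the cosine and sine of the angle between the
  ray of the cone and the direction of \<open>e\<close>: the point of the ray at distance
  \<open>d\<close> is \<open>pl (ca * d) (sa * d)\<close>.\<close>

definition "sa = sqrt (1 / (1 + c))"
definition "ca = sqrt (c / (1 + c))"

lemma sa_ca: "sa > 0" "ca > 0" "ca\<^sup>2 + sa\<^sup>2 = 1" "ca = sqrt c * sa" "sa\<^sup>2 = 1 / (1 + c)"
proof -
  show "sa > 0" "ca > 0" "sa\<^sup>2 = 1 / (1 + c)" using c_pos by (simp_all add: sa_def ca_def)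
  show "ca = sqrt c * sa" by (simp add: sa_def ca_def real_sqrt_divide)
  have "c / (1 + c) + 1 / (1 + c) = 1" using c_pos by (simp add: add_divide_distrib[symmetric])
  then show "ca\<^sup>2 + sa\<^sup>2 = 1" using c_pos by (simp add: sa_def ca_def)
qed

definition "lcone = {p. (norm (P1 p))\<^sup>2 = c * (norm (P2 p))\<^sup>2}"

lemma cone_coords:
  assumes "p \<in> lcone"
  shows "norm (P1 p) = ca * norm p" "norm (P2 p) = sa * norm p"
proof -
  have n: "(norm p)\<^sup>2 = (1 + c) * (norm (P2 p))\<^sup>2"
    using assms norm_split[of p] by (simp add: lcone_def dot_square_norm algebra_simps)
  have "(sa * norm p)\<^sup>2 = (norm (P2 p))\<^sup>2"
    unfolding power_mult_distrib n sa_ca(5) using c_pos by simp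
  then show 2: "norm (P2 p) = sa * norm p"
    using sa_ca(1) by (metis norm_ge_zero power2_eq_imp_eq mult_nonneg_nonneg less_imp_le)
  have "(norm (P1 p))\<^sup>2 = (ca * norm p)\<^sup>2"
    using assms c_pos unfolding sa_ca(4) lcone_def by (simp add: 2 power_mult_distrib)
  then show "norm (P1 p) = ca * norm p"
    using sa_ca(2) by (metis norm_ge_zero power2_eq_imp_eq mult_nonneg_nonneg less_imp_le)
qed

text \<open>The cone is invariant, so the components of the normal are multiples of those of
  \<open>p\<close>; it is also orthogonal to the radial direction. Only a sign \<open>s\<close>
  remains free.\<close>

lemma cone_normal:
  assumes p: "p \<in> lcone" "norm p > \<rho>" "\<rho> > 0" and \<nu>: "norm \<nu> = 1" "\<And>v. v \<in> tangent_space (lcone - cball 0 \<rho>) p \<Longrightarrow> \<nu> \<bullet> v = 0"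
  obtains s where "\<bar>s\<bar> = 1" "P1 \<nu> = (s * sa / (ca * norm p)) *\<^sub>R P1 p" "P2 \<nu> = (- s * ca / (sa * norm p)) *\<^sub>R P2 p"
proof -
  interpret sw: projections P2 P1 by (rule swapped)
  define W where "W = lcone - cball 0 \<rho>"
  define d where "d = norm p"
  have d: "d > 0" using p(2,3) unfolding d_def by linarith
  have np: "norm (P1 p) = ca * d" "norm (P2 p) = sa * d" using cone_coords[OF p(1)] by (simp_all add: d_def)
  have norms: "norm q = sqrt ((norm (P1 q))\<^sup>2 + (norm (P2 q))\<^sup>2)" for q
    using norm_split[of q] by (simp add: norm_eq_sqrt_inner)
  have rW: "radial_set W" unfolding radial_set_def W_def
  proof (intro allI impI)
    fix p q assume h: "p \<in> lcone - cball 0 \<rho>" "norm (P1 q) = norm (P1 p)" "norm (P2 q) = norm (P2 p)"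
    then have "norm q = norm p" unfolding norms[of q] norms[of p] by (simp only:)
    then show "q \<in> lcone - cball 0 \<rho>" using h by (simp add: lcone_def)
  qed
  then have rW': "sw.radial_set W" unfolding radial_set_def sw.radial_set_def by blast
  have pW: "p \<in> W" using p by (simp add: W_def)
  have nt: "\<nu> \<bullet> v = 0" if "v \<in> tangent_space W p" for v using \<nu>(2) that by (simp add: W_def)
  have nz: "P1 p \<noteq> 0" "P2 p \<noteq> 0" using np d sa_ca(1,2) by auto
  obtain x where x: "P1 \<nu> = x *\<^sub>R P1 p" using normal_parallel[OF rW pW nz(1) nt] by blast
  obtain y where y: "P2 \<nu> = y *\<^sub>R P2 p" using sw.normal_parallel[OF rW' pW nz(2) nt] by blast
  have "\<nu> \<bullet> p = 0"
  proof -
    \<comment> \<open>The curve must remain outside the ball at all times, so the radial motion is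
      an oscillation of relative amplitude \<open>\<delta>\<close>; this value keeps the norm at
      least halfway between \<open>\<rho>\<close> and \<open>d\<close>.\<close>
    define \<delta> where "\<delta> = (d - \<rho>) / (2 * d)"
    have \<delta>: "\<delta> > 0" "\<delta> < 1" "(1 - \<delta>) * d > \<rho>" using p d by (auto simp: \<delta>_def d_def field_simps)
    define \<gamma> where "\<gamma> t = (1 + \<delta> * sin t) *\<^sub>R p" for t
    have "\<gamma> t \<in> W" for t
    proof -
      have "\<bar>\<delta> * sin t\<bar> \<le> \<delta>" using \<delta>(1) by (simp add: abs_mult mult_left_le)
      then have k: "1 + \<delta> * sin t \<ge> 1 - \<delta>" by linarith
      then have "norm (\<gamma> t) \<ge> (1 - \<delta>) * d" using \<delta>(2) d by (simp add: \<gamma>_def d_def mult_right_mono)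
      then have "norm (\<gamma> t) > \<rho>" using \<delta>(3) by linarith
      moreover have "\<gamma> t \<in> lcone" using p(1)
        by (simp add: lcone_def \<gamma>_def linear_cmul[OF lin(1)] linear_cmul[OF lin(2)] power_mult_distrib)
      ultimately show ?thesis by (simp add: W_def)
    qed
    moreover have "\<gamma> 0 = p" by (simp add: \<gamma>_def)
    moreover have "(\<gamma> has_vector_derivative (\<delta> *\<^sub>R p)) (at 0)"
    proof -
      have "((\<lambda>t. 1 + \<delta> * sin t) has_real_derivative \<delta>) (at 0)" by (auto intro!: derivative_eq_intros)
      then have "((\<lambda>t. 1 + \<delta> * sin t) has_vector_derivative \<delta>) (at 0)" by (simp add: has_real_derivative_iff_has_vector_derivative)
      then show ?thesis unfolding \<gamma>_def[abs_def] by (rule bounded_linear.has_vector_derivative[OF bounded_linear_scaleR_left])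
    qed
    ultimately have "\<delta> *\<^sub>R p \<in> tangent_space W p" unfolding tangent_space_def by blast
    then show ?thesis using nt[of "\<delta> *\<^sub>R p"] \<delta>(1) by simp
  qed
  then have "x * (ca * d)\<^sup>2 + y * (sa * d)\<^sup>2 = 0"
    using inner_split[of \<nu> p] by (simp add: x y dot_square_norm np)
  then have "d * d * (x * ca * ca + y * sa * sa) = 0" by (simp add: power2_eq_square algebra_simps)
  then have o: "x * ca * ca + y * sa * sa = 0" using d by simp
  define X where "X = x * ca * d"
  define Y where "Y = y * sa * d"
  have o': "X * ca + Y * sa = 0"
  proof -
    have "X * ca + Y * sa = d * (x * ca * ca + y * sa * sa)" by (simp add: X_def Y_def algebra_simps)
    then show ?thesis using o by simp
  qed
  have one: "X\<^sup>2 + Y\<^sup>2 = 1"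
  proof -
    have "\<nu> \<bullet> \<nu> = 1" using \<nu>(1) by (simp add: norm_eq_1)
    moreover have "\<nu> \<bullet> \<nu> = (x * (ca * d))\<^sup>2 + (y * (sa * d))\<^sup>2"
      using norm_split[of \<nu>] d sa_ca(1,2) by (simp add: x y np power_mult_distrib)
    ultimately show ?thesis by (simp add: X_def Y_def mult.assoc)
  qed
  define s where "s = X * sa - Y * ca"
  have X: "X = s * sa"
  proof -
    have "X = X * (ca\<^sup>2 + sa\<^sup>2)" by (simp add: sa_ca(3))
    also have "\<dots> = (X * ca + Y * sa) * ca + s * sa" by (simp add: s_def power2_eq_square algebra_simps)
    finally show ?thesis by (simp add: o')
  qed
  have Y: "Y = - s * ca"
  proof -
    have "Y = Y * (ca\<^sup>2 + sa\<^sup>2)" by (simp add: sa_ca(3))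
    also have "\<dots> = (X * ca + Y * sa) * sa - s * ca" by (simp add: s_def power2_eq_square algebra_simps)
    finally show ?thesis by (simp add: o')
  qed
  have "s\<^sup>2 * (ca\<^sup>2 + sa\<^sup>2) = 1" using one unfolding X Y by (simp add: power_mult_distrib algebra_simps)
  then have "\<bar>s\<bar> = 1" by (simp add: sa_ca(3) power2_eq_1_iff) auto
  moreover have "x = s * sa / (ca * d)" using X sa_ca(2) d by (simp add: X_def field_simps)
  moreover have "y = - s * ca / (sa * d)" using Y sa_ca(1) d by (simp add: Y_def field_simps)
  ultimately show thesis using x y by (intro that[of s]) (auto simp: d_def)
qed

text \<open>In the quarter plane, \<open>perp\<close> is the signed distance from the ray of the cone and \<open>along\<close> the
  coordinate along this ray; \<open>psi\<close> is the signed distance from the ray \<open>|P2 q| = \<surd>c |P1 q|\<close>, the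
  mirror image of the first one in the diagonal.\<close>

definition "psi q = sa * norm (P2 q) - ca * norm (P1 q)"
definition "perp q = sa * norm (P1 q) - ca * norm (P2 q)"
definition "along q = ca * norm (P1 q) + sa * norm (P2 q)"

text \<open>Far out, the curve is the graph \<open>Q\<close> over the part \<open>d \<ge> D\<close>
  of the ray, where \<open>\<phi>\<close> is small, possibly together with points over the bounded
  part of the cone, where \<open>\<phi>\<close> may be large. The latter lie on a normal line of the
  ray, folded into the quarter plane by the absolute values; after folding, \<open>psi\<close> is
  constant up to sign along it, with absolute value the norm of the foot point.\<close>

lemma asymptotic_data:
  obtains \<rho> \<eta> D R and Q :: "real \<Rightarrow> 'a" where "0 < \<eta>" "\<eta> < \<rho>" "1 \<le> D" "continuous_on {D..} Q"
    "\<And>d. D \<le> d \<Longrightarrow> Q d \<in> profile \<and> d\<^sup>2 \<le> Q d \<bullet> Q d \<and> Q d \<bullet> Q d \<le> d\<^sup>2 + 1 \<and> along (Q d) = d \<and> \<bar>perp (Q d)\<bar> \<le> \<eta>"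
    "\<And>q. q \<in> profile \<Longrightarrow> R \<le> q \<bullet> q \<Longrightarrow> (\<exists>d\<ge>D. q = Q d) \<or> (\<rho> \<le> \<bar>psi q\<bar> \<and> \<bar>psi q\<bar> \<le> D)"
proof -
  obtain \<rho> R and \<nu> :: "'a \<Rightarrow> 'a" and \<phi> :: "'a \<Rightarrow> real" where as: "\<rho> > 0" "R > 0" "unit_normal_field (lcone - cball 0 \<rho>) \<nu>"
    "smooth_fun_on (lcone - cball 0 \<rho>) \<phi>" "(\<phi> \<longlongrightarrow> 0) (inf at_infinity (principal lcone))"
    "S - cball 0 R = (\<lambda>p. p + \<phi> p *\<^sub>R \<nu> p) ` (lcone - cball 0 \<rho>) - cball 0 R"
    using asymptotic unfolding asymptotic_at_infinity_def lcone_def[symmetric] by blast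
  \<comment> \<open>Below \<open>\<rho>\<close>, so that the strip around the cone and the possible
    other ends can be told apart; below 1, so that \<open>\<phi>\<close> changes the squared
    distance by at most 1.\<close>
  define \<eta> where "\<eta> = min 1 \<rho> / 4"
  have \<eta>: "\<eta> > 0" "\<eta> < \<rho>" "\<eta> < 1" using as(1) by (auto simp: \<eta>_def)
  have "\<forall>\<^sub>F p in inf at_infinity (principal lcone). dist (\<phi> p) 0 < \<eta>" using as(5) \<eta>(1) tendstoD by blast
  then obtain D1 where D1: "\<And>p. p \<in> lcone \<Longrightarrow> D1 \<le> norm p \<Longrightarrow> \<bar>\<phi> p\<bar> < \<eta>"
    unfolding eventually_inf_principal eventually_at_infinity by auto
  \<comment> \<open>Beyond \<open>D\<close> the graph function is below \<open>\<eta>\<close>, and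
    the last two terms keep both plane coordinates positive, so that nothing is folded
    there.\<close>
  define D where "D = 1 + \<rho> + \<bar>D1\<bar> + R + \<eta> / ca + \<eta> / sa"
  have q0: "\<eta> / ca > 0" "\<eta> / sa > 0" using \<eta>(1) sa_ca(1,2) by auto
  have D: "1 \<le> D" "\<rho> < D" "D1 \<le> D" "R < D" "\<eta> / ca < D" "\<eta> / sa < D"
    using q0 as(1,2) by (auto simp: D_def)
  have normal: "\<exists>s. \<bar>s\<bar> = 1 \<and> P1 (\<nu> p) = (s * sa / (ca * norm p)) *\<^sub>R P1 p \<and> P2 (\<nu> p) = (- s * ca / (sa * norm p)) *\<^sub>R P2 p"
    if "p \<in> lcone - cball 0 \<rho>" for p
  proof -
    have "norm (\<nu> p) = 1" "\<And>v. v \<in> tangent_space (lcone - cball 0 \<rho>) p \<Longrightarrow> \<nu> p \<bullet> v = 0"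
      using as(3) that unfolding unit_normal_field_def by blast+
    moreover have "p \<in> lcone" "\<rho> < norm p" using that by auto
    ultimately show ?thesis using cone_normal[of p \<rho> "\<nu> p"] as(1) by metis
  qed
  have graph: "\<exists>s. \<bar>s\<bar> = 1 \<and> P1 (p + \<phi> p *\<^sub>R \<nu> p) = ((ca * norm p + \<phi> p * s * sa) / (ca * norm p)) *\<^sub>R P1 p \<and>
      P2 (p + \<phi> p *\<^sub>R \<nu> p) = ((sa * norm p - \<phi> p * s * ca) / (sa * norm p)) *\<^sub>R P2 p"
    if p: "p \<in> lcone - cball 0 \<rho>" for p
  proof -
    obtain s where s: "\<bar>s\<bar> = 1" "P1 (\<nu> p) = (s * sa / (ca * norm p)) *\<^sub>R P1 p" "P2 (\<nu> p) = (- s * ca / (sa * norm p)) *\<^sub>R P2 p"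
      using normal[OF p] by blast
    have d: "ca * norm p \<noteq> 0" "sa * norm p \<noteq> 0" using p as(1) sa_ca(1,2) by auto
    have "P1 (p + \<phi> p *\<^sub>R \<nu> p) = (1 + \<phi> p * (s * sa / (ca * norm p))) *\<^sub>R P1 p"
      unfolding linear_add[OF lin(1)] linear_cmul[OF lin(1)] s(2) by (simp add: scaleR_add_left)
    also have "1 + \<phi> p * (s * sa / (ca * norm p)) = (ca * norm p + \<phi> p * s * sa) / (ca * norm p)"
      using d(1) by (simp add: add_divide_distrib mult.assoc)
    finally have 1: "P1 (p + \<phi> p *\<^sub>R \<nu> p) = ((ca * norm p + \<phi> p * s * sa) / (ca * norm p)) *\<^sub>R P1 p" .
    have "P2 (p + \<phi> p *\<^sub>R \<nu> p) = (1 + \<phi> p * (- s * ca / (sa * norm p))) *\<^sub>R P2 p"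
      unfolding linear_add[OF lin(2)] linear_cmul[OF lin(2)] s(3) by (simp add: scaleR_diff_left)
    also have "1 + \<phi> p * (- s * ca / (sa * norm p)) = (sa * norm p - \<phi> p * s * ca) / (sa * norm p)"
      using d(2) by (simp add: diff_divide_distrib mult.assoc)
    finally show ?thesis using 1 s(1) by blast
  qed
  define pd where "pd d = pl (ca * d) (sa * d)" for d
  have pd: "pd d \<in> lcone" "norm (pd d) = d" "P1 (pd d) = (ca * d) *\<^sub>R e" "P2 (pd d) = (sa * d) *\<^sub>R f" if "d \<ge> 0" for d
  proof -
    show "pd d \<in> lcone"
      using c_pos by (simp add: pd_def lcone_def norm_P_pl sa_ca(4) power_mult_distrib)
    have "pd d \<bullet> pd d = d\<^sup>2 * (ca\<^sup>2 + sa\<^sup>2)" by (simp add: pd_def pl_inner power2_eq_square algebra_simps)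
    then show "norm (pd d) = d" using that by (simp add: norm_eq_sqrt_inner sa_ca(3))
  qed (simp_all add: pd_def P_pl)
  define Q where "Q d = pd d + \<phi> (pd d) *\<^sub>R \<nu> (pd d)" for d
  have small: "\<bar>\<phi> p * s * sa\<bar> < ca * norm p" "\<bar>\<phi> p * s * ca\<bar> < sa * norm p" if "p \<in> lcone" "D \<le> norm p" "\<bar>s\<bar> = 1" for p s
  proof -
    have "\<bar>\<phi> p\<bar> < \<eta>" using D1[OF that(1)] that(2) D(3) by simp
    moreover have "sa \<le> 1" "ca \<le> 1" using sa_ca(1-3) by (smt (verit) power2_less_0 zero_le_power2 power_le_one_iff one_le_power power2_le_imp_le power_one)+
    ultimately have "\<bar>\<phi> p * s * sa\<bar> < \<eta>" "\<bar>\<phi> p * s * ca\<bar> < \<eta>"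
      using that(3) sa_ca(1,2) by (simp_all add: abs_mult) (smt (verit) mult_left_le abs_ge_zero)+
    moreover have "\<eta> < ca * D" "\<eta> < sa * D" using D(5,6) sa_ca(1,2) by (simp_all add: pos_divide_less_eq mult.commute)
    moreover have "ca * D \<le> ca * norm p" "sa * D \<le> sa * norm p" using that(2) sa_ca(1,2) by auto
    ultimately show "\<bar>\<phi> p * s * sa\<bar> < ca * norm p" "\<bar>\<phi> p * s * ca\<bar> < sa * norm p" by linarith+
  qed
  have Qd: "Q d \<in> profile \<and> d\<^sup>2 \<le> Q d \<bullet> Q d \<and> Q d \<bullet> Q d \<le> d\<^sup>2 + 1 \<and> along (Q d) = d \<and> \<bar>perp (Q d)\<bar> \<le> \<eta>" if d: "D \<le> d" for d
  proof -
    have d0: "d > 0" "d \<ge> 0" using d D(1) by auto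
    note p = pd[OF d0(2)]
    have pC: "pd d \<in> lcone - cball 0 \<rho>" using p(1,2) d D(2) by simp
    obtain s where s: "\<bar>s\<bar> = 1" "P1 (Q d) = ((ca * d + \<phi> (pd d) * s * sa) / (ca * d)) *\<^sub>R (ca * d) *\<^sub>R e"
      "P2 (Q d) = ((sa * d - \<phi> (pd d) * s * ca) / (sa * d)) *\<^sub>R (sa * d) *\<^sub>R f"
      using graph[OF pC] unfolding Q_def[symmetric] p by blast
    define A B where "A = ca * d + \<phi> (pd d) * s * sa" and "B = sa * d - \<phi> (pd d) * s * ca"
    have AB: "A > 0" "B > 0" using small[OF p(1) _ s(1)] d p(2) by (auto simp: A_def B_def)
    have "P1 (Q d) = A *\<^sub>R e" "P2 (Q d) = B *\<^sub>R f" using s(2,3) d0(1) sa_ca(1,2) by (simp_all add: A_def B_def)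
    then have Qpl: "Q d = pl A B" using sum[of "Q d"] by (simp add: pl_def)
    have sq: "(\<phi> (pd d) * s)\<^sup>2 = (\<phi> (pd d))\<^sup>2" using s(1) by (simp add: power_mult_distrib) (metis abs_1 power2_abs one_power2 mult.right_neutral)
    have "Q d \<bullet> Q d = d\<^sup>2 * (ca\<^sup>2 + sa\<^sup>2) + (\<phi> (pd d) * s)\<^sup>2 * (ca\<^sup>2 + sa\<^sup>2)"
      unfolding Qpl pl_inner A_def B_def by (simp add: power2_eq_square algebra_simps)
    then have curvature_sq: "Q d \<bullet> Q d = d\<^sup>2 + (\<phi> (pd d))\<^sup>2" by (simp add: sa_ca(3) sq)
    have ph: "\<bar>\<phi> (pd d)\<bar> < \<eta>" using D1[OF p(1)] p(2) d D(3) by simp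
    then have "(\<phi> (pd d))\<^sup>2 \<le> 1" using \<eta>(3) by (simp add: abs_square_le_1)
    moreover have "norm (Q d) > R"
    proof -
      have "d\<^sup>2 \<le> (norm (Q d))\<^sup>2" using curvature_sq by (simp add: dot_square_norm)
      then have "d \<le> norm (Q d)" by (rule power2_le_imp_le) simp
      then show ?thesis using d D(4) by simp
    qed
    then have "Q d \<in> (\<lambda>p. p + \<phi> p *\<^sub>R \<nu> p) ` (lcone - cball 0 \<rho>) - cball 0 R"
      using pC unfolding Q_def by auto
    then have "Q d \<in> S" using as(6) by blast
    then have "Q d \<in> profile" unfolding Qpl by (rule pl_profile) (use AB in auto)
    moreover have "along (Q d) = d * (ca\<^sup>2 + sa\<^sup>2)" "perp (Q d) = \<phi> (pd d) * s * (ca\<^sup>2 + sa\<^sup>2)"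
      using AB by (simp_all add: Qpl along_def perp_def norm_P_pl A_def B_def power2_eq_square algebra_simps)
    moreover have "\<bar>\<phi> (pd d) * s\<bar> \<le> \<eta>" using ph s(1) by (simp add: abs_mult)
    ultimately show ?thesis using curvature_sq by (simp add: sa_ca(3))
  qed
  have cont: "continuous_on {D..} Q"
  proof -
    have cp: "continuous_on {D..} pd" unfolding pd_def pl_def by (intro continuous_intros)
    have "pd ` {D..} \<subseteq> lcone - cball 0 \<rho>"
    proof (rule image_subsetI)
      fix d assume "d \<in> {D..}"
      then show "pd d \<in> lcone - cball 0 \<rho>" using pd(1,2)[of d] D(1,2) by simp
    qed
    note sub = this
    have "continuous_on {D..} (\<lambda>d. \<phi> (pd d))"
      by (rule continuous_on_compose2[OF smooth_fun_on_continuous[OF as(4)] cp sub])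
    moreover have "smooth_fun_on (lcone - cball 0 \<rho>) \<nu>" using as(3) by (simp add: unit_normal_field_def)
    then have "continuous_on {D..} (\<lambda>d. \<nu> (pd d))"
      by (rule continuous_on_compose2[OF smooth_fun_on_continuous cp sub])
    ultimately show ?thesis unfolding Q_def using cp by (intro continuous_intros)
  qed
  \<comment> \<open>The last two terms bound the squared norm of points with foot point below
    \<open>D\<close> and both coordinates positive. Beyond \<open>R'\<close> a foot point below
    \<open>D\<close> therefore leads to a folded point.\<close>
  define R' where "R' = R\<^sup>2 + 1 + (D / ca)\<^sup>2 + (D / sa)\<^sup>2"
  have cls: "(\<exists>d\<ge>D. q = Q d) \<or> (\<rho> \<le> \<bar>psi q\<bar> \<and> \<bar>psi q\<bar> \<le> D)" if q: "q \<in> profile" "R' \<le> q \<bullet> q" for q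
  proof -
    have "R\<^sup>2 < (norm q)\<^sup>2" using q(2) unfolding R'_def dot_square_norm by (smt (verit) zero_le_power2)
    then have "R < norm q" by (rule power2_less_imp_less) simp
    then have "q \<in> S - cball 0 R" using profile_pl(2)[OF q(1)] by simp
    then obtain p where p: "p \<in> lcone - cball 0 \<rho>" "q = p + \<phi> p *\<^sub>R \<nu> p" using as(6) by blast
    define d where "d = norm p"
    have d: "d > \<rho>" "d > 0" using p(1) as(1) by (auto simp: d_def)
    obtain s where s: "\<bar>s\<bar> = 1" "P1 q = ((ca * d + \<phi> p * s * sa) / (ca * d)) *\<^sub>R P1 p"
      "P2 q = ((sa * d - \<phi> p * s * ca) / (sa * d)) *\<^sub>R P2 p"
      using graph[OF p(1)] unfolding p(2)[symmetric] d_def[symmetric] by blast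
    define A B where "A = ca * d + \<phi> p * s * sa" and "B = sa * d - \<phi> p * s * ca"
    have np: "norm (P1 p) = ca * d" "norm (P2 p) = sa * d" using cone_coords p(1) by (auto simp: d_def)
    have nq: "norm (P1 q) = \<bar>A\<bar>" "norm (P2 q) = \<bar>B\<bar>"
      using s(2,3) np d(2) sa_ca(1,2) by (simp_all add: A_def B_def abs_mult)
    have "ca * A + sa * B = d * (ca\<^sup>2 + sa\<^sup>2)" by (simp add: A_def B_def power2_eq_square algebra_simps)
    then have al: "ca * A + sa * B = d" by (simp add: sa_ca(3))
    show ?thesis
    proof (cases "D \<le> d")
      case True
      have AB: "A > 0" "B > 0" using small[of p s] p(1) True s(1) by (auto simp: A_def B_def d_def)
      have q1: "P1 q = A *\<^sub>R e" "P2 q = B *\<^sub>R f" using P_pl[of "\<bar>A\<bar>" "\<bar>B\<bar>"] profile_pl(1)[OF q(1)] nq AB by auto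
      have "(A / (ca * d)) *\<^sub>R P1 p = A *\<^sub>R e" using s(2) q1(1) by (simp add: A_def)
      then have "(ca * d / A) *\<^sub>R (A / (ca * d)) *\<^sub>R P1 p = (ca * d / A) *\<^sub>R A *\<^sub>R e" by simp
      then have e1: "P1 p = (ca * d) *\<^sub>R e" using AB d(2) sa_ca(2) by simp
      have "(B / (sa * d)) *\<^sub>R P2 p = B *\<^sub>R f" using s(3) q1(2) by (simp add: B_def)
      then have "(sa * d / B) *\<^sub>R (B / (sa * d)) *\<^sub>R P2 p = (sa * d / B) *\<^sub>R B *\<^sub>R f" by simp
      then have e2: "P2 p = (sa * d) *\<^sub>R f" using AB d(2) sa_ca(1) by simp
      have "p = pd d" using sum[of p] by (simp add: e1 e2 pd_def pl_def)
      then have "q = Q d" using p(2) by (simp add: Q_def)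
      then show ?thesis using True by blast
    next
      case False
      have "\<bar>psi q\<bar> = d"
      proof (cases "A > 0")
        case A: True
        show ?thesis
        proof (cases "B > 0")
          case B: True
          have "ca * A \<le> D" "sa * B \<le> D" using al A B False sa_ca(1,2) by (smt (verit) mult_pos_pos)+
          then have "A \<le> D / ca" "B \<le> D / sa" using sa_ca(1,2) by (simp_all add: pos_le_divide_eq mult.commute)
          then have "A\<^sup>2 \<le> (D / ca)\<^sup>2" "B\<^sup>2 \<le> (D / sa)\<^sup>2" using A B by (auto intro: power_mono)
          moreover have "q \<bullet> q = A\<^sup>2 + B\<^sup>2" using norm_split[of q] by (simp add: nq)
          ultimately have "q \<bullet> q < R'" unfolding R'_def using zero_le_power2[of R] by linarith
          then show ?thesis using q(2) by simp
        next
          case B: False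
          then have "psi q = - d" using A al by (simp add: psi_def nq)
          then show ?thesis using d(2) by simp
        qed
      next
        case A: False
        then have "sa * B > 0" using al d(2) sa_ca(2) by (smt (verit) mult_nonneg_nonpos2 mult.commute)
        then have "B > 0" using sa_ca(1) by (simp add: zero_less_mult_iff)
        then have "psi q = d" using A al by (simp add: psi_def nq)
        then show ?thesis using d(2) by simp
      qed
      then show ?thesis using d(1) False by auto
    qed
  qed
  show thesis by (rule that[OF \<eta>(1,2) D(1) cont Qd cls])
qed

text \<open>The normal lies in the plane of \<open>e\<close> and \<open>f\<close>, on which the
  Hessians of both norms vanish; so the norms contribute \<open>(m2 - 1) / |P2 p|\<close> and
  \<open>(m1 - 1) / |P1 p|\<close>. With \<open>N = m1 + m2 - 1\<close>, the logarithm contributes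
  at most \<open>2 N \<epsilon> / h\<close> and the term \<open>K / h\<close> at most
  \<open>(8 - 2 N) K / h^2\<close>, which is not positive because \<open>N \<ge> 5\<close>.\<close>

lemma superharmonic_no_min:
  assumes p: "p \<in> profile" "P1 p \<noteq> 0" and pos: "\<epsilon> > 0" "K > 0" and W: "open W" "p \<in> W"
    and m: "\<And>q. q \<in> S \<inter> W \<Longrightarrow> norm (P2 p) - sqrt c * norm (P1 p) + \<epsilon> * ln (p \<bullet> p) + K / (p \<bullet> p) \<le>
        norm (P2 q) - sqrt c * norm (P1 q) + \<epsilon> * ln (q \<bullet> q) + K / (q \<bullet> q)"
  shows "0 \<le> (m2 - 1) / norm (P2 p) - sqrt c * ((m1 - 1) / norm (P1 p)) + 2 * (m1 + m2 - 1) * \<epsilon> / (p \<bullet> p)"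
proof -
  note g = profile_pl[OF p(1)]
  obtain \<nu> where \<nu>: "unit_normal S p \<nu>" using unit_normal_exists[OF hyper g(2)] .
  obtain a b where ab: "\<nu> = pl a b" "a\<^sup>2 + b\<^sup>2 = 1" using normal_in_plane[OF p(1) \<nu>] by blast
  define r t h where "r = norm (P1 p)" and "t = norm (P2 p)" and "h = p \<bullet> p"
  have r: "r > 0" "t > 0" "h = r\<^sup>2 + t\<^sup>2" using p(2) g(3) norm_split[of p] by (auto simp: r_def t_def h_def)
  have h: "h > 0" using r by (simp add: add_pos_pos)
  have prt: "P1 p = r *\<^sub>R e" "P2 p = t *\<^sub>R f" using P_pl g(1) unfolding r_def t_def by metis+
  define V where "V = W \<inter> {q. P1 q \<noteq> 0} \<inter> {q. P2 q \<noteq> 0}"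
  have V: "open V" "p \<in> V" unfolding V_def using W p(2) P2_nonzero[OF g(2)]
    by (auto intro!: open_Int open_Collect_neq continuous_intros)
  \<comment> \<open>\<open>B1\<close> is the derivative of \<open>\<epsilon> ln y + K / y\<close>,
    and \<open>B2\<close> is the derivative of \<open>B1\<close> at \<open>h\<close>.\<close>
  define B1 where "B1 y = \<epsilon> / y - K / y\<^sup>2" for y :: real
  define B2 where "B2 = - \<epsilon> / h\<^sup>2 + 2 * K / h ^ 3"
  define G where "G q = (1 / norm (P2 q)) *\<^sub>R P2 q - (sqrt c / norm (P1 q)) *\<^sub>R P1 q + (2 * B1 (q \<bullet> q)) *\<^sub>R q" for q
  define H where "H v = ((1 / t) *\<^sub>R P2 v - (t * (f \<bullet> P2 v) / t\<^sup>2) *\<^sub>R f) - ((sqrt c / r) *\<^sub>R P1 v - (sqrt c * (r * (e \<bullet> P1 v)) / r\<^sup>2) *\<^sub>R e)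
     + ((2 * B1 h) *\<^sub>R v + (4 * B2 * (p \<bullet> v)) *\<^sub>R p)" for v
  have dn: "((\<lambda>q. norm (P q)) has_derivative (\<lambda>v. sgn (P q) \<bullet> P v)) (at q)" if "bounded_linear P" "P q \<noteq> 0" for P :: "'a \<Rightarrow> 'a" and q
    using diff_chain_at[OF bounded_linear_imp_has_derivative[OF that(1)] has_derivative_norm[OF that(2)]]
    by (simp add: o_def inner_commute)
  have dq: "((\<lambda>q::'a. q \<bullet> q) has_derivative (\<lambda>v. 2 * (q \<bullet> v))) (at q)" for q
    by (auto intro!: derivative_eq_intros simp: inner_commute)
  have dc: "((\<lambda>q::'a. \<Phi> (q \<bullet> q)) has_derivative (\<lambda>v. \<Phi>' * (2 * (q \<bullet> v)))) (at q)" if "(\<Phi> has_real_derivative \<Phi>') (at (q \<bullet> q))" for \<Phi> \<Phi>' q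
    using diff_chain_at[OF dq that[unfolded has_field_derivative_def]] by (simp add: o_def)
  have first: "((\<lambda>q. norm (P2 q) - sqrt c * norm (P1 q) + \<epsilon> * ln (q \<bullet> q) + K / (q \<bullet> q)) has_derivative (\<lambda>v. G q \<bullet> v)) (at q)"
    if q: "q \<in> V" for q
  proof -
    have nz: "P1 q \<noteq> 0" "P2 q \<noteq> 0" "q \<bullet> q > 0" using q norm_split[of q] by (auto simp: V_def add_pos_pos)
    have "((\<lambda>y. \<epsilon> * ln y + K / y) has_real_derivative B1 (q \<bullet> q)) (at (q \<bullet> q))"
      unfolding B1_def using nz(3) by (auto intro!: derivative_eq_intros simp: power2_eq_square field_simps)
    from dc[OF this] have 1: "((\<lambda>q. \<epsilon> * ln (q \<bullet> q) + K / (q \<bullet> q)) has_derivative (\<lambda>v. B1 (q \<bullet> q) * (2 * (q \<bullet> v)))) (at q)" .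
    have "((\<lambda>q. (norm (P2 q) - sqrt c * norm (P1 q)) + (\<epsilon> * ln (q \<bullet> q) + K / (q \<bullet> q))) has_derivative
      (\<lambda>v. (sgn (P2 q) \<bullet> P2 v - sqrt c * (sgn (P1 q) \<bullet> P1 v)) + B1 (q \<bullet> q) * (2 * (q \<bullet> v)))) (at q)"
      by (intro has_derivative_add has_derivative_diff has_derivative_mult_right dn bl nz 1)
    moreover have "(sgn (P2 q) \<bullet> P2 v - sqrt c * (sgn (P1 q) \<bullet> P1 v)) + B1 (q \<bullet> q) * (2 * (q \<bullet> v)) = G q \<bullet> v" for v
      by (simp add: G_def sgn_div_norm inner_diff_left inner_add_left P1_inner[symmetric] P2_inner[symmetric] divide_inverse)
    ultimately show ?thesis by (simp add: add.assoc)
  qed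
  have second: "(G has_derivative H) (at p)"
  proof -
    have u: "((\<lambda>q. (k / norm (P q)) *\<^sub>R P q) has_derivative (\<lambda>v. (k / s) *\<^sub>R P v - (k * (s * (x \<bullet> P v)) / s\<^sup>2) *\<^sub>R x)) (at p)"
      if P: "bounded_linear P" "P p = s *\<^sub>R x" "norm x = 1" "s > 0" for P :: "'a \<Rightarrow> 'a" and s x k
    proof -
      have nP: "P p \<noteq> 0" "norm (P p) = s" "sgn (P p) = x" using P(2-4) by (auto simp: sgn_div_norm)
      have "((\<lambda>q. k / norm (P q)) has_derivative (\<lambda>v. - k * (x \<bullet> P v) / s\<^sup>2)) (at p)"
        using dn[OF P(1) nP(1)] nP by (auto intro!: derivative_eq_intros simp: power2_eq_square)
      from has_derivative_scaleR[OF this bounded_linear_imp_has_derivative[OF P(1)]]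
      show ?thesis by (rule has_derivative_eq_rhs) (auto simp: P(2,3) abs_of_pos[OF P(4)] fun_eq_iff mult_ac)
    qed
    have "(B1 has_real_derivative B2) (at (p \<bullet> p))"
      unfolding B1_def[abs_def] B2_def h_def[symmetric] using h
      by (auto intro!: derivative_eq_intros simp: power2_eq_square power3_eq_cube field_simps)
    from has_derivative_scaleR[OF has_derivative_mult_right[OF dc[OF this], of 2] has_derivative_ident]
    have 3: "((\<lambda>q. (2 * B1 (q \<bullet> q)) *\<^sub>R q) has_derivative (\<lambda>v. (2 * B1 h) *\<^sub>R v + (4 * B2 * (p \<bullet> v)) *\<^sub>R p)) (at p)"
      by (rule has_derivative_eq_rhs) (auto simp: h_def fun_eq_iff mult_ac)
    have 2: "((\<lambda>q. (1 / norm (P2 q)) *\<^sub>R P2 q) has_derivative (\<lambda>v. (1 / t) *\<^sub>R P2 v - (t * (f \<bullet> P2 v) / t\<^sup>2) *\<^sub>R f)) (at p)"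
      using u[OF bl(2) prt(2) f(2) r(2), of 1] by simp
    show ?thesis unfolding G_def[abs_def] H_def[abs_def]
      by (intro has_derivative_add has_derivative_diff 2 3 u[OF bl(1) prt(1) e(2) r(1)])
  qed
  have "0 \<le> (\<Sum>i\<in>Basis. H i \<bullet> i) - H \<nu> \<bullet> \<nu>"
    by (rule minimal_local_min[OF minimal g(2) \<nu> V first second]) (use m in \<open>auto simp: V_def\<close>)
  also have "(\<Sum>i\<in>Basis. H i \<bullet> i) = (m2 - 1) / t - sqrt c * ((m1 - 1) / r) + 2 * B1 h * (m1 + m2) + 4 * B2 * h"
  proof -
    have fP: "f \<bullet> P2 i = f \<bullet> i" "e \<bullet> P1 i = e \<bullet> i" for i
      using P2_inner'[of f i] P1_inner'[of e i] e f by auto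
    have sq: "(\<Sum>i\<in>Basis. (x \<bullet> i) * (x \<bullet> i)) = x \<bullet> x" for x :: 'a by (rule euclidean_inner[symmetric])
    have "(\<Sum>i\<in>Basis. H i \<bullet> i) = (\<Sum>i\<in>Basis. (1 / t) * (P2 i \<bullet> i) - (1 / t) * ((f \<bullet> i) * (f \<bullet> i)) - ((sqrt c / r) * (P1 i \<bullet> i) - (sqrt c / r) * ((e \<bullet> i) * (e \<bullet> i)))
       + (2 * B1 h * (i \<bullet> i) + 4 * B2 * ((p \<bullet> i) * (p \<bullet> i))))"
      by (rule sum.cong[OF refl])
        (use r in \<open>simp add: H_def inner_add_left inner_diff_left fP power2_eq_square\<close>)
    also have "\<dots> = (1 / t) * m2 - (1 / t) * (f \<bullet> f) - ((sqrt c / r) * m1 - (sqrt c / r) * (e \<bullet> e)) + (2 * B1 h * (\<Sum>i\<in>Basis. i \<bullet> (i::'a)) + 4 * B2 * (p \<bullet> p))"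
      by (simp only: sum.distrib sum_subtractf sum_distrib_left[symmetric] m1(1) m2(1) sq)
    also have "(\<Sum>i\<in>Basis. i \<bullet> (i::'a)) = m1 + m2" using dim by simp
    finally show ?thesis using ef by (simp add: h_def diff_divide_distrib right_diff_distrib)
  qed
  also have "H \<nu> \<bullet> \<nu> = 2 * B1 h + 4 * B2 * (p \<bullet> \<nu>)\<^sup>2"
  proof -
    have P\<nu>: "P1 \<nu> = a *\<^sub>R e" "P2 \<nu> = b *\<^sub>R f" by (simp_all add: ab(1) P_pl)
    have "\<nu> \<bullet> \<nu> = 1" using \<nu> by (simp add: unit_normal_def norm_eq_1)
    moreover have "e \<bullet> \<nu> = a" "f \<bullet> \<nu> = b" by (simp_all add: ab(1) pl_def inner_add_right ef)
    ultimately show ?thesis using r(1,2)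
      by (simp add: H_def P\<nu> inner_add_left inner_diff_left ef power2_eq_square)
  qed
  finally have "0 \<le> (m2 - 1) / t - sqrt c * ((m1 - 1) / r) + (2 * (m1 + m2 - 1) * B1 h + 4 * B2 * (h - (p \<bullet> \<nu>)\<^sup>2))"
    by (simp add: algebra_simps)
  also have "2 * (m1 + m2 - 1) * B1 h + 4 * B2 * (h - (p \<bullet> \<nu>)\<^sup>2) \<le> 2 * (m1 + m2 - 1) * \<epsilon> / h"
  proof -
    define y where "y = h - (p \<bullet> \<nu>)\<^sup>2"
    have "(p \<bullet> \<nu>)\<^sup>2 \<le> (p \<bullet> p) * (\<nu> \<bullet> \<nu>)" by (rule Cauchy_Schwarz_ineq)
    moreover have "\<nu> \<bullet> \<nu> = 1" using \<nu> by (simp add: unit_normal_def norm_eq_1)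
    ultimately have y: "0 \<le> y" "y \<le> h" by (auto simp: y_def h_def)
    have "4 * B2 * y \<le> 8 * K / h ^ 3 * y"
      unfolding B2_def using pos(1) h y(1) by (intro mult_right_mono) (auto simp: field_simps)
    also have "\<dots> \<le> 8 * K / h ^ 3 * h" using y(2) pos(2) h by (intro mult_left_mono) auto
    also have "\<dots> = 8 * (K / h\<^sup>2)" using h by (simp add: power2_eq_square power3_eq_cube)
    finally have "4 * B2 * y \<le> 8 * (K / h\<^sup>2)" .
    moreover have "8 * (K / h\<^sup>2) \<le> 2 * (m1 + m2 - 1) * (K / h\<^sup>2)"
      using pos(2) h m1(2) m2(2) by (intro mult_right_mono) auto
    moreover have "2 * (m1 + m2 - 1) * B1 h = 2 * (m1 + m2 - 1) * \<epsilon> / h - 2 * (m1 + m2 - 1) * (K / h\<^sup>2)"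
      by (simp add: B1_def right_diff_distrib)
    ultimately show ?thesis unfolding y_def by linarith
  qed
  finally show ?thesis by (simp add: r_def t_def h_def)
qed


section \<open>Exclusion of further ends of the curve\<close>

lemma hat_radial: "psi (hat q) = psi q" "perp (hat q) = perp q"
  by (simp_all add: psi_def perp_def hat_norm)

lemma profile_region:
  assumes "q \<in> profile"
  shows "norm (P1 q) < sqrt c * norm (P2 q)"
proof -
  have "(norm (P1 q))\<^sup>2 < (sqrt c * norm (P2 q))\<^sup>2"
    using region[OF profile_pl(2)[OF assms]] c_pos by (simp add: power_mult_distrib)
  then show ?thesis by (rule power2_less_imp_less) (use c_pos in simp)
qed

lemma psi_eq: "psi q = sa * (norm (P2 q) - sqrt c * norm (P1 q))"
  and perp_eq: "perp q = sa * (norm (P1 q) - sqrt c * norm (P2 q))"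
  by (simp_all add: psi_def perp_def sa_ca(4) algebra_simps)

lemma norm_bound:
  assumes "q \<in> profile" "norm (P2 q) \<le> T"
  shows "q \<bullet> q \<le> (1 + c) * T\<^sup>2"
proof -
  have "(norm (P1 q))\<^sup>2 \<le> c * (norm (P2 q))\<^sup>2" using region[OF profile_pl(2)[OF assms(1)]] by simp
  then have "q \<bullet> q \<le> (1 + c) * (norm (P2 q))\<^sup>2" using norm_split[of q] by (simp add: algebra_simps)
  also have "\<dots> \<le> (1 + c) * T\<^sup>2" using assms(2) c_pos by (intro mult_left_mono power_mono) auto
  finally show ?thesis .
qed

text \<open>Since \<open>m1 - 1 = c * (m2 - 1)\<close>, the expression is \<open>m2 - 1\<close>
  times \<open>1 / |P2 q| - c * sqrt c / |P1 q|\<close>. For \<open>c > 1\<close> the region gives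
  \<open>1 / |P2 q| < sqrt c / |P1 q|\<close>, and the factor \<open>c - 1\<close> provides
  negativity. For \<open>c = 1\<close> the two terms nearly cancel, and the lower bound on
  \<open>\<bar>psi q\<bar>\<close> is what keeps the difference of order
  \<open>1 / |q|^2\<close>.\<close>

lemma drift_negative:
  assumes "c \<ge> 1" "\<rho> > 0"
  obtains C where "C > 0" "\<And>q. q \<in> profile \<Longrightarrow> 1 \<le> q \<bullet> q \<Longrightarrow> P1 q \<noteq> 0 \<Longrightarrow> \<rho> \<le> \<bar>psi q\<bar> \<Longrightarrow>
    (m2 - 1) / norm (P2 q) - sqrt c * ((m1 - 1) / norm (P1 q)) \<le> - C / (q \<bullet> q)"
proof -
  have mc: "m1 - 1 = c * (m2 - 1)" using c m2(2) by (simp add: field_simps)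
  have m: "m2 - 1 > 0" using m2(2) by simp
  have eq: "(m2 - 1) / norm (P2 q) - sqrt c * ((m1 - 1) / norm (P1 q)) = (m2 - 1) * (1 / norm (P2 q) - sqrt c * c / norm (P1 q))" for q
    by (simp add: mc right_diff_distrib mult_ac)
  show thesis
  proof (cases "c = 1")
    case True
    show thesis
    proof (rule that[of "(m2 - 1) * (\<rho> / sa)"])
      show "(m2 - 1) * (\<rho> / sa) > 0" using m assms(2) sa_ca(1) by simp
      fix q assume q: "q \<in> profile" "1 \<le> q \<bullet> q" "P1 q \<noteq> 0" "\<rho> \<le> \<bar>psi q\<bar>"
      define r t h where "r = norm (P1 q)" and "t = norm (P2 q)" and "h = q \<bullet> q"
      have rt: "0 < r" "r < t" "0 < t" "h = r\<^sup>2 + t\<^sup>2" "0 < h"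
        using q profile_region[OF q(1)] True profile_pl(3)[OF q(1)] norm_split[of q] by (auto simp: r_def t_def h_def)
      have "sqrt c = 1" using True by simp
      then have "psi q = sa * (t - r)" by (simp only: psi_eq mult_1 t_def r_def)
      then have "\<rho> \<le> sa * (t - r)" using q(4) rt sa_ca(1) by simp
      then have 1: "\<rho> / sa \<le> t - r" using sa_ca(1) by (simp add: pos_divide_le_eq mult.commute)
      have 2: "r * t \<le> h"
      proof -
        have "r * t \<le> t * t" using rt by (intro mult_right_mono) auto
        also have "\<dots> \<le> h" using rt(4) by (simp add: power2_eq_square)
        finally show ?thesis .
      qed
      have "(\<rho> / sa) / h \<le> (t - r) / h" using 1 rt by (intro divide_right_mono) auto
      also have "\<dots> \<le> (t - r) / (r * t)" using 2 rt by (intro divide_left_mono) auto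
      also have "\<dots> = 1 / r - 1 / t" using rt by (simp add: field_simps)
      finally have "1 / t - 1 / r \<le> - ((\<rho> / sa) / h)" by simp
      then have "(m2 - 1) * (1 / t - 1 / r) \<le> (m2 - 1) * - ((\<rho> / sa) / h)" using m by (intro mult_left_mono) auto
      then show "(m2 - 1) / norm (P2 q) - sqrt c * ((m1 - 1) / norm (P1 q)) \<le> - ((m2 - 1) * (\<rho> / sa)) / (q \<bullet> q)"
        unfolding eq using True by (simp add: r_def t_def h_def)
    qed
  next
    case False
    then have c1: "c > 1" using assms(1) by simp
    show thesis
    proof (rule that[of "(m2 - 1) * (sqrt c * (c - 1))"])
      show "(m2 - 1) * (sqrt c * (c - 1)) > 0" using m c1 by simp
      fix q assume q: "q \<in> profile" "1 \<le> q \<bullet> q" "P1 q \<noteq> 0" "\<rho> \<le> \<bar>psi q\<bar>"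
      define r t h where "r = norm (P1 q)" and "t = norm (P2 q)" and "h = q \<bullet> q"
      have rt: "0 < r" "r < sqrt c * t" "0 < t" "h = r\<^sup>2 + t\<^sup>2" "1 \<le> h"
        using q profile_region[OF q(1)] profile_pl(3)[OF q(1)] norm_split[of q] by (auto simp: r_def t_def h_def)
      have rh: "r \<le> h"
      proof (rule power2_le_imp_le)
        have "r\<^sup>2 \<le> h * 1" using rt by simp
        also have "\<dots> \<le> h * h" using rt(5) by (intro mult_left_mono) auto
        finally show "r\<^sup>2 \<le> h\<^sup>2" by (simp add: power2_eq_square)
      qed (use rt in simp)
      have "1 / t \<le> sqrt c / r" using rt c1 by (simp add: field_simps)
      then have "1 / t - sqrt c * c / r \<le> sqrt c / r - sqrt c * c / r" by simp
      also have "\<dots> = - (sqrt c * (c - 1) / r)" by (simp add: diff_divide_distrib algebra_simps)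
      also have "\<dots> \<le> - (sqrt c * (c - 1) / h)" using rh rt c1 by (simp add: divide_left_mono)
      finally have "(m2 - 1) * (1 / t - sqrt c * c / r) \<le> (m2 - 1) * - (sqrt c * (c - 1) / h)" using m by (intro mult_left_mono) auto
      then show "(m2 - 1) / norm (P2 q) - sqrt c * ((m1 - 1) / norm (P1 q)) \<le> - ((m2 - 1) * (sqrt c * (c - 1))) / (q \<bullet> q)"
        unfolding eq by (simp add: r_def t_def h_def)
    qed
  qed
qed

text \<open>The asymptotic condition allows the graph function to be unbounded near the inner boundary of
  its domain, which could produce an end of the profile curve at bounded distance \<open>|psi|\<close> from a
  line through the origin. Such an end would carry the superharmonic function
  \<open>|y| - \<surd>c |x| + \<epsilon> ln h + K / h\<close>, \<open>h = |p|\<^sup>2\<close>, with an interior minimum.\<close>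

lemma no_spurious_end:
  assumes eta: "0 < \<eta>" "\<eta> < \<rho>" and D: "1 \<le> D"
    and cls: "\<And>q. q \<in> profile \<Longrightarrow> R \<le> q \<bullet> q \<Longrightarrow> \<bar>perp q\<bar> \<le> \<eta> \<or> (\<rho> \<le> \<bar>psi q\<bar> \<and> \<bar>psi q\<bar> \<le> D)"
  shows "\<exists>H. \<forall>q\<in>profile. H \<le> q \<bullet> q \<longrightarrow> \<not> (\<rho> \<le> \<bar>psi q\<bar> \<and> \<bar>psi q\<bar> \<le> D)"
proof (cases "c < 1")
  case True
  \<comment> \<open>For \<open>c < 1\<close> the region forces \<open>psi q\<close> to be at least
    \<open>sa * (1 - c)\<close> times the norm of \<open>P2 q\<close>, so a bounded
    \<open>psi\<close> leaves only a bounded set.\<close>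
  define T where "T = D / (sa * (1 - c))"
  have den: "sa * (1 - c) > 0" using True sa_ca(1) by simp
  show ?thesis
  proof (intro exI[of _ "(1 + c) * T\<^sup>2 + 1"] ballI impI notI)
    fix q assume q: "q \<in> profile" "(1 + c) * T\<^sup>2 + 1 \<le> q \<bullet> q" "\<rho> \<le> \<bar>psi q\<bar> \<and> \<bar>psi q\<bar> \<le> D"
    have "sqrt c * norm (P1 q) \<le> sqrt c * (sqrt c * norm (P2 q))" using profile_region[OF q(1)] c_pos by (intro mult_left_mono) auto
    also have "\<dots> = c * norm (P2 q)" using c_pos by (simp add: mult.assoc[symmetric])
    finally have "sa * ((1 - c) * norm (P2 q)) \<le> psi q" unfolding psi_eq using sa_ca(1) by (intro mult_left_mono) (auto simp: algebra_simps)
    moreover have "psi q \<le> D" using q(3) by linarith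
    moreover have "norm (P2 q) * (sa * (1 - c)) = sa * ((1 - c) * norm (P2 q))" by (simp only: mult_ac)
    ultimately have "norm (P2 q) * (sa * (1 - c)) \<le> D" by linarith
    then have "norm (P2 q) \<le> T" using den by (simp add: T_def pos_le_divide_eq)
    then show False using norm_bound[OF q(1)] q(2) by fastforce
  qed
next
  case False
  then have c1: "c \<ge> 1" by simp
  define Bad where "Bad q \<longleftrightarrow> \<rho> \<le> \<bar>psi q\<bar> \<and> \<bar>psi q\<bar> \<le> D" for q :: 'a
  obtain C where C: "C > 0" "\<And>q. q \<in> profile \<Longrightarrow> 1 \<le> q \<bullet> q \<Longrightarrow> P1 q \<noteq> 0 \<Longrightarrow> \<rho> \<le> \<bar>psi q\<bar> \<Longrightarrow>
    (m2 - 1) / norm (P2 q) - sqrt c * ((m1 - 1) / norm (P1 q)) \<le> - C / (q \<bullet> q)"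
  proof (rule drift_negative[OF c1])
    show "\<rho> > 0" using eta by simp
  qed (rule that; assumption)
  \<comment> \<open>\<open>T0\<close> bounds the bad points on the axis. For \<open>c > 1\<close>,
    \<open>T1\<close> bounds those in the strip around the cone; for \<open>c = 1\<close> the strip
    is excluded by \<open>\<eta> < \<rho>\<close>. Beyond \<open>H0\<close> the bad set is away from
    both.\<close>
  define T0 where "T0 = (D / sa)\<^sup>2"
  define T1 where "T1 = (D + sqrt c * \<eta>) / (sa * (c - 1))"
  define H0 where "H0 = \<bar>R\<bar> + T0 + (1 + c) * T1\<^sup>2 + 1"
  have T0: "T0 \<ge> 0" "(1 + c) * T1\<^sup>2 \<ge> 0" using c_pos by (auto simp: T0_def)
  then have H0: "H0 \<ge> 1" "H0 \<ge> R" "H0 > T0" "H0 > (1 + c) * T1\<^sup>2" by (auto simp: H0_def)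
  have far: "P1 q \<noteq> 0" "\<bar>perp q\<bar> > \<eta>" if q: "q \<in> profile" "H0 \<le> q \<bullet> q" "Bad q" for q
  proof -
    show "P1 q \<noteq> 0"
    proof
      assume 0: "P1 q = 0"
      then have "\<bar>psi q\<bar> = sa * norm (P2 q)" using sa_ca(1) by (simp add: psi_def abs_mult)
      then have "norm (P2 q) \<le> D / sa" using q(3) sa_ca(1) by (simp add: Bad_def pos_le_divide_eq mult.commute)
      then have "(norm (P2 q))\<^sup>2 \<le> T0" unfolding T0_def by (rule power_mono) simp
      then show False using norm_split[of q] 0 q(2) H0(3) by simp
    qed
    show "\<bar>perp q\<bar> > \<eta>"
    proof (rule ccontr)
      assume "\<not> \<bar>perp q\<bar> > \<eta>"
      then have pe: "\<bar>perp q\<bar> \<le> \<eta>" by simp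
      show False
      proof (cases "c = 1")
        case True
        then have "sqrt c = 1" by simp
        then have "psi q = - perp q" by (simp only: psi_eq perp_eq mult_1 right_diff_distrib minus_diff_eq)
        then show False using pe q(3) eta by (simp add: Bad_def)
      next
        case c1': False
        have "psi q + sqrt c * perp q = sa * (norm (P2 q) - (sqrt c * sqrt c) * norm (P2 q))"
          by (simp add: psi_eq perp_eq algebra_simps)
        also have "sqrt c * sqrt c = c" using c_pos by simp
        finally have e1: "norm (P2 q) * (sa * (c - 1)) = - (psi q + sqrt c * perp q)" by (simp add: algebra_simps)
        also have "\<dots> \<le> \<bar>psi q\<bar> + \<bar>sqrt c * perp q\<bar>" by linarith
        also have "\<dots> \<le> D + sqrt c * \<eta>"
        proof (rule add_mono)
          show "\<bar>psi q\<bar> \<le> D" using q(3) by (simp add: Bad_def)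
          show "\<bar>sqrt c * perp q\<bar> \<le> sqrt c * \<eta>" using pe c_pos by (simp add: abs_mult)
        qed
        finally have "norm (P2 q) * (sa * (c - 1)) \<le> D + sqrt c * \<eta>" .
        moreover have "sa * (c - 1) > 0" using c1 c1' sa_ca(1) by simp
        ultimately have "norm (P2 q) \<le> T1" by (simp add: T1_def pos_le_divide_eq)
        then show False using norm_bound[OF q(1)] q(2) H0(4) by fastforce
      qed
    qed
  qed
  show ?thesis
  proof (rule ccontr)
    assume "\<not> ?thesis"
    then have "\<exists>q\<in>profile. H0 + 1 \<le> q \<bullet> q \<and> Bad q" unfolding Bad_def by blast
    then obtain q1 where q1: "q1 \<in> profile" "H0 + 1 \<le> q1 \<bullet> q1" "Bad q1" by blast
    define h1 where "h1 = q1 \<bullet> q1"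
    define D' where "D' = D / sa"
    \<comment> \<open>The logarithmic term then uses up exactly half of the negative drift
      \<open>C / |q|^2\<close>.\<close>
    define \<epsilon> where "\<epsilon> = C / (4 * (m1 + m2 - 1))"
    have N: "m1 + m2 - 1 > 0" using m1(2) m2(2) by simp
    have eps: "\<epsilon> > 0" using C(1) N by (simp add: \<epsilon>_def)
    have D': "D' > 0" using D sa_ca(1) by (simp add: D'_def)
    have h1: "h1 > H0" "h1 > 1" using q1(2) H0(1) by (auto simp: h1_def)
    have gap: "1 / H0 - 1 / h1 > 0" using h1 H0(1) by (simp add: frac_less2)
    \<comment> \<open>Chosen so that on the inner level \<open>H0\<close> the function
      \<open>u\<close> exceeds its value at \<open>q1\<close> by at least 1; a minimum cannot lie
      there.\<close>
    define K where "K = (2 * D' + \<epsilon> * ln h1 + 1) / (1 / H0 - 1 / h1)"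
    have lnh1: "\<epsilon> * ln h1 \<ge> 0" using eps h1(2) by simp
    have K: "K > 0" "K * (1 / H0 - 1 / h1) = 2 * D' + \<epsilon> * ln h1 + 1"
      using gap D' lnh1 unfolding K_def by (auto intro!: divide_pos_pos add_nonneg_pos)
    define u where "u q = norm (P2 q) - sqrt c * norm (P1 q) + \<epsilon> * ln (q \<bullet> q) + K / (q \<bullet> q)" for q :: 'a
    have low: "\<bar>norm (P2 q) - sqrt c * norm (P1 q)\<bar> \<le> D'" if "Bad q" for q
    proof -
      have "\<bar>norm (P2 q) - sqrt c * norm (P1 q)\<bar> * sa \<le> D" using that sa_ca(1) by (simp add: Bad_def psi_eq abs_mult mult.commute)
      then show ?thesis using sa_ca(1) by (simp add: D'_def pos_le_divide_eq)
    qed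
    have u1: "u q1 \<le> D' + \<epsilon> * ln h1 + K / h1" using low[OF q1(3)] by (simp add: u_def h1_def)
    have bd: "u q \<ge> u q1 + 1" if "Bad q" "q \<bullet> q = H0" for q
    proof -
      have "\<epsilon> * ln H0 \<ge> 0" using eps H0(1) by simp
      then have "u q \<ge> - D' + K / H0" using low[OF that(1)] by (simp add: u_def that(2))
      moreover have "K / H0 = K / h1 + (2 * D' + \<epsilon> * ln h1 + 1)" using K(2) by (simp add: right_diff_distrib)
      ultimately show ?thesis using u1 by linarith
    qed
    \<comment> \<open>Above this level the logarithm alone lifts \<open>u\<close> beyond its value
      at \<open>q1\<close>, although the distance difference may be as low as
      \<open>- D'\<close>.\<close>
    define h2 where "h2 = max h1 (exp ((u q1 + D' + 1) / \<epsilon>))"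
    have fr: "u q > u q1" if "Bad q" "q \<bullet> q > h2" for q
    proof -
      have "h2 > 1" using h1(2) by (simp add: h2_def)
      then have hpos: "q \<bullet> q > 0" using that(2) by linarith
      have "exp ((u q1 + D' + 1) / \<epsilon>) < q \<bullet> q" using that(2) by (simp add: h2_def)
      then have "(u q1 + D' + 1) / \<epsilon> < ln (q \<bullet> q)" using hpos by (metis exp_less_cancel_iff exp_ln)
      then have "u q1 + D' + 1 < \<epsilon> * ln (q \<bullet> q)" using eps by (simp add: pos_divide_less_eq mult.commute)
      moreover have "K / (q \<bullet> q) > 0" using K(1) hpos by simp
      ultimately show ?thesis using low[OF that(1)] unfolding u_def[of q] by linarith
    qed
    define M where "M = profile \<inter> {q. H0 \<le> q \<bullet> q} \<inter> {q. q \<bullet> q \<le> h2} \<inter> {q. \<rho> \<le> \<bar>psi q\<bar>} \<inter> {q. \<bar>psi q\<bar> \<le> D}"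
    have M: "q \<in> M \<longleftrightarrow> q \<in> profile \<and> H0 \<le> q \<bullet> q \<and> q \<bullet> q \<le> h2 \<and> Bad q" for q by (auto simp: M_def Bad_def)
    have cpsi: "continuous_on X psi" "continuous_on X perp" for X
      unfolding psi_def[abs_def] perp_def[abs_def] by (intro continuous_intros)+
    have "closed M" unfolding M_def
      by (intro closed_Int closed_profile closed_Collect_le continuous_intros cpsi)
    moreover have "bounded M"
    proof -
      have "norm q \<le> sqrt h2" if "q \<in> M" for q using that by (simp add: M norm_eq_sqrt_inner)
      then show ?thesis by (auto simp: bounded_iff)
    qed
    ultimately have "compact M" by (simp add: compact_eq_bounded_closed)
    have q1M: "q1 \<in> M" using q1 by (simp add: M h2_def h1_def)
    have pos: "q \<bullet> q \<noteq> 0" if "q \<in> M" for q using that H0(1) by (auto simp: M)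
    have "continuous_on M u" unfolding u_def[abs_def]
      by (intro continuous_intros) (use pos in auto)
    then have "\<exists>q\<in>M. \<forall>q'\<in>M. u q \<le> u q'"
      using q1M by (intro continuous_attains_inf[OF \<open>compact M\<close>]) auto
    then obtain q where q: "q \<in> M" "\<And>q'. q' \<in> M \<Longrightarrow> u q \<le> u q'" by blast
    have qG: "q \<in> profile" "H0 \<le> q \<bullet> q" "Bad q" using q(1) M by auto
    have uq: "u q \<le> u q1" by (rule q(2)[OF q1M])
    have "q \<bullet> q \<noteq> H0" using bd[OF qG(3)] uq by linarith
    then have qH: "q \<bullet> q > H0" using qG(2) by simp
    note fq = far[OF qG]
    \<comment> \<open>The closed condition on \<open>psi\<close> is replaced by an open one on
      \<open>perp\<close>: by \<open>cls\<close>, the profile points in \<open>W\<close> are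
      automatically bad. Hence the minimum over the compact set \<open>M\<close> is a minimum over
      all of \<open>S\<close> in the open set \<open>W\<close>.\<close>
    define W where "W = {x::'a. H0 < x \<bullet> x} \<inter> {x. \<eta> < \<bar>perp x\<bar>}"
    have W: "open W" "q \<in> W"
      unfolding W_def using qH fq(2) by (auto intro!: open_Int open_Collect_less continuous_intros cpsi)
    have "0 \<le> (m2 - 1) / norm (P2 q) - sqrt c * ((m1 - 1) / norm (P1 q)) + 2 * (m1 + m2 - 1) * \<epsilon> / (q \<bullet> q)"
    proof (rule superharmonic_no_min[OF qG(1) fq(1) eps K(1) W])
      fix x assume x: "x \<in> S \<inter> W"
      define y where "y = hat x"
      have y: "y \<in> profile" "norm (P1 y) = norm (P1 x)" "norm (P2 y) = norm (P2 x)" "y \<bullet> y = x \<bullet> x" "perp y = perp x"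
        using hat_profile x hat_norm[of x] by (simp_all add: y_def hat_radial)
      have "\<eta> < \<bar>perp y\<bar>" "H0 < y \<bullet> y" using x y by (auto simp: W_def)
      then have "Bad y" using cls[OF y(1)] H0(2) by (auto simp: Bad_def)
      have "u q \<le> u y"
      proof (cases "y \<bullet> y \<le> h2")
        case True
        then have "y \<in> M" using y(1) \<open>H0 < y \<bullet> y\<close> \<open>Bad y\<close> by (simp add: M)
        then show ?thesis by (rule q(2))
      next
        case False
        then show ?thesis using fr[OF \<open>Bad y\<close>] uq by simp
      qed
      then show "norm (P2 q) - sqrt c * norm (P1 q) + \<epsilon> * ln (q \<bullet> q) + K / (q \<bullet> q)
          \<le> norm (P2 x) - sqrt c * norm (P1 x) + \<epsilon> * ln (x \<bullet> x) + K / (x \<bullet> x)"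
        by (simp only: u_def y)
    qed
    moreover have "(m2 - 1) / norm (P2 q) - sqrt c * ((m1 - 1) / norm (P1 q)) \<le> - C / (q \<bullet> q)"
      by (rule C(2)[OF qG(1) _ fq(1)]) (use qG H0(1) in \<open>auto simp: Bad_def\<close>)
    moreover have "2 * (m1 + m2 - 1) * \<epsilon> / (q \<bullet> q) = (C / 2) / (q \<bullet> q)"
    proof -
      have "2 * n * (C / (4 * n)) = C / 2" if "n > 0" for n :: real using that by simp
      from this[OF N] show ?thesis unfolding \<epsilon>_def by (simp only:)
    qed
    moreover have "- C / (q \<bullet> q) + (C / 2) / (q \<bullet> q) < 0"
    proof -
      have "- C / (q \<bullet> q) + (C / 2) / (q \<bullet> q) = (- C / 2) / (q \<bullet> q)" by (simp add: add_divide_distrib[symmetric])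
      also have "\<dots> < 0"
      proof (rule divide_neg_pos)
        show "0 < q \<bullet> q" using qG(2) H0(1) by linarith
      qed (use C(1) in simp)
      finally show ?thesis .
    qed
    moreover have False if "0 \<le> A + B" "A \<le> x" "B = y" "x + y < 0" for A B x y :: real using that by linarith
    ultimately show False by blast
  qed
qed

text \<open>Far out the profile is the single arc \<open>Q\<close>, along which the level grows like
  \<open>d\<^sup>2\<close> up to an error of 1, so every large level occurs. A level occurring twice
  would force an interior maximum of \<open>|.|^2\<close> on the arc, and the curve has
  none.\<close>

lemma large_levels_unique:
  obtains H1 where "\<And>H. H > H1 \<Longrightarrow> \<exists>!q. q \<in> profile \<and> q \<bullet> q = H"
proof -
  obtain \<rho> \<eta> D R and Q :: "real \<Rightarrow> 'a" where a: "0 < \<eta>" "\<eta> < \<rho>" "1 \<le> D" "continuous_on {D..} Q"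
    "\<And>d. D \<le> d \<Longrightarrow> Q d \<in> profile \<and> d\<^sup>2 \<le> Q d \<bullet> Q d \<and> Q d \<bullet> Q d \<le> d\<^sup>2 + 1 \<and> along (Q d) = d \<and> \<bar>perp (Q d)\<bar> \<le> \<eta>"
    "\<And>q. q \<in> profile \<Longrightarrow> R \<le> q \<bullet> q \<Longrightarrow> (\<exists>d\<ge>D. q = Q d) \<or> (\<rho> \<le> \<bar>psi q\<bar> \<and> \<bar>psi q\<bar> \<le> D)"
  proof (rule asymptotic_data)
  qed (rule that; assumption)
  have cls: "\<bar>perp q\<bar> \<le> \<eta> \<or> (\<rho> \<le> \<bar>psi q\<bar> \<and> \<bar>psi q\<bar> \<le> D)" if "q \<in> profile" "R \<le> q \<bullet> q" for q
    using a(6)[OF that] a(5) by auto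
  obtain H' where H': "\<And>q. q \<in> profile \<Longrightarrow> H' \<le> q \<bullet> q \<Longrightarrow> \<not> (\<rho> \<le> \<bar>psi q\<bar> \<and> \<bar>psi q\<bar> \<le> D)"
    using no_spurious_end[OF a(1-3) cls] by blast
  define Hb where "Hb = \<bar>R\<bar> + \<bar>H'\<bar> + 1"
  have good: "\<exists>d\<ge>D. q = Q d" if "q \<in> profile" "Hb \<le> q \<bullet> q" for q
  proof -
    have "R \<le> q \<bullet> q" "H' \<le> q \<bullet> q" using that(2) unfolding Hb_def by linarith+
    then show ?thesis using a(6)[OF that(1)] H'[OF that(1)] by blast
  qed
  define D2 where "D2 = D + Hb"
  have D2: "D < D2" "1 \<le> D2" "Hb \<le> D2\<^sup>2"
  proof -
    show "D < D2" "1 \<le> D2" using a(3) by (auto simp: D2_def Hb_def)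
    then have "D2 * 1 \<le> D2 * D2" by (intro mult_left_mono) auto
    moreover have "Hb \<le> D2" using a(3) by (simp add: D2_def)
    ultimately show "Hb \<le> D2\<^sup>2" by (simp add: power2_eq_square)
  qed
  define h where "h d = Q d \<bullet> Q d" for d
  have hc: "continuous_on {D..} h" unfolding h_def by (intro continuous_on_inner a(4))
  have hb: "d\<^sup>2 \<le> h d" "h d \<le> d\<^sup>2 + 1" if "D \<le> d" for d using a(5)[OF that] by (auto simp: h_def)
  define H1 where "H1 = max (h D2) (D2\<^sup>2 + 1)"
  \<comment> \<open>The coordinate \<open>along\<close> identifies the profile points near
    \<open>Q x\<close> as points \<open>Q y\<close> with \<open>y\<close> in the same interval, so a
    maximum of \<open>h\<close> would be a local maximum of \<open>|.|^2\<close> on the whole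
    profile.\<close>
  have no_max: False if x: "D2 < x" "x < d'" and mx: "\<And>y. D2 \<le> y \<Longrightarrow> y \<le> d' \<Longrightarrow> h y \<le> h x" for x d'
  proof -
    define N where "N = {q. D2 < along q} \<inter> {q. along q < d'}"
    have "continuous_on UNIV along" unfolding along_def[abs_def] by (intro continuous_intros)
    then have N: "open N" unfolding N_def by (intro open_Int open_Collect_less continuous_intros) auto
    have Dx: "D \<le> x" using x D2 by simp
    have Qx: "Q x \<in> profile" "Q x \<in> N" using a(5)[OF Dx] x by (auto simp: N_def)
    obtain d where d: "d > 0" "\<And>H. Q x \<bullet> Q x < H \<Longrightarrow> H < Q x \<bullet> Q x + d \<Longrightarrow> \<exists>q. q \<in> N \<and> q \<in> profile \<and> q \<bullet> q = H"
      using levels_above[OF Qx(1) N Qx(2)] by blast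
    obtain q where q: "q \<in> N" "q \<in> profile" "q \<bullet> q = h x + d / 2" using d(2)[of "h x + d / 2"] d(1) by (auto simp: h_def)
    have "D2\<^sup>2 \<le> x\<^sup>2" using x D2 by (intro power_mono) auto
    then have "Hb \<le> q \<bullet> q" using q(3) hb(1)[OF Dx] D2(3) d(1) by linarith
    then obtain y where y: "D \<le> y" "q = Q y" using good[OF q(2)] by blast
    have "along q = y" using a(5)[OF y(1)] y(2) by simp
    then have "h y \<le> h x" using mx[of y] q(1) by (auto simp: N_def)
    then show False using q(3) y(2) d(1) by (simp add: h_def)
  qed
  show thesis
  proof (rule that[of H1])
    fix H assume H: "H > H1"
    define d where "d = D2 + H"
    have H0: "H > 0" using H D2 by (auto simp: H1_def) (smt (verit) zero_le_power2)
    have "H \<le> h d"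
    proof -
      have "H * 1 \<le> d * d" using H0 D2 by (intro mult_mono) (auto simp: d_def)
      then show ?thesis using hb(1)[of d] D2 H0 by (simp add: d_def power2_eq_square)
    qed
    moreover have "continuous_on {D2..d} h" by (rule continuous_on_subset[OF hc]) (use D2 in auto)
    moreover have "h D2 \<le> H" using H by (simp add: H1_def)
    moreover have "D2 \<le> d" using H0 by (simp add: d_def)
    ultimately obtain x where x: "D2 \<le> x" "h x = H" using IVT'[of h D2 H d] by auto
    have "Q x \<in> profile \<and> Q x \<bullet> Q x = H" using a(5)[of x] x D2 by (simp add: h_def)
    moreover have uq: "d1 = d2" if d: "D \<le> d1" "D \<le> d2" "h d1 = H" "h d2 = H" "d1 \<le> d2" for d1 d2
    proof (rule ccontr)
      assume "d1 \<noteq> d2"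
      then have lt: "d1 < d2" using d(5) by simp
      have "D2\<^sup>2 < d1\<^sup>2" using hb(2)[OF d(1)] d(3) H by (simp add: H1_def)
      then have D21: "D2 < d1" by (rule power2_less_imp_less) (use d(1) a(3) in simp)
      have "continuous_on {D2..d2} h" by (rule continuous_on_subset[OF hc]) (use D2 in auto)
      then obtain m where m: "m \<in> {D2..d2}" "\<And>y. y \<in> {D2..d2} \<Longrightarrow> h y \<le> h m"
        using continuous_attains_sup[OF compact_Icc, of D2 d2 h] D21 lt by fastforce
      have "H \<le> h m" using m(2)[of d1] d(3) D21 lt by simp
      have "m \<noteq> D2" using \<open>H \<le> h m\<close> H by (auto simp: H1_def)
      \<comment> \<open>If the maximum sits at the right end point \<open>d2\<close>, then
        \<open>d1\<close>, having the same level, is an interior maximum; otherwise \<open>m\<close>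
        itself is one.\<close>
      show False
      proof (cases "m = d2")
        case True
        show False by (rule no_max[OF D21 lt]) (use m(2) True d in auto)
      next
        case False
        show False by (rule no_max[of m d2]) (use m False \<open>m \<noteq> D2\<close> in auto)
      qed
    qed
    have "q = Q x" if q: "q \<in> profile" "q \<bullet> q = H" for q
    proof -
      have "Hb \<le> q \<bullet> q" using q(2) H D2(3) by (simp add: H1_def)
      then obtain d where d: "D \<le> d" "q = Q d" using good[OF q(1)] by blast
      have "d = x" using uq[of d x] uq[of x d] d x D2 q(2) by (cases "d \<le> x") (auto simp: h_def)
      then show ?thesis using d(2) by simp
    qed
    ultimately show "\<exists>!q. q \<in> profile \<and> q \<bullet> q = H" by blast
  qed
qed

lemma slice_levels:
  shows "H \<ge> 1 \<Longrightarrow> \<exists>!q. q \<in> profile \<and> q \<bullet> q = H" "q \<in> profile \<Longrightarrow> q \<bullet> q > 1 \<Longrightarrow> P1 q \<noteq> 0" "q \<in> profile \<Longrightarrow> q \<bullet> q = 1 \<Longrightarrow> P1 q = 0"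
proof -
  obtain H1 where "\<And>H. H > H1 \<Longrightarrow> \<exists>!q. q \<in> profile \<and> q \<bullet> q = H"
  proof (rule large_levels_unique)
  qed (rule that; assumption)
  note unique_levels[OF this]
  then show "H \<ge> 1 \<Longrightarrow> \<exists>!q. q \<in> profile \<and> q \<bullet> q = H" "q \<in> profile \<Longrightarrow> q \<bullet> q > 1 \<Longrightarrow> P1 q \<noteq> 0" "q \<in> profile \<Longrightarrow> q \<bullet> q = 1 \<Longrightarrow> P1 q = 0"
    by blast+
qed

end

section \<open>A singular nonlinear initial value problem\<close>

lemma integral_has_derivative_halfline:
  fixes b :: "real \<Rightarrow> real"
  assumes "continuous_on {0..} b" "z \<ge> 0"
  shows "((\<lambda>z. integral {0..z} b) has_vector_derivative b z) (at z within {0..})"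
proof -
  have "((\<lambda>z. integral {0..z} b) has_vector_derivative b z) (at z within {0..z + 1})"
    by (rule integral_has_vector_derivative) (use assms in \<open>auto intro: continuous_on_subset\<close>)
  moreover have "at z within {0..} = at z within {0..z + 1}"
    by (rule at_within_nhd[of z "{..<z + 1}"]) (use assms in auto)
  ultimately show ?thesis by simp
qed

lemma halfline_not_bot: "(z::real) \<ge> 0 \<Longrightarrow> at z within {0..} \<noteq> bot"
  by (rule interval_at_within_neq_bot[of _ 0 1]) auto

lemma continuous_on_halfline:
  assumes "\<And>L. L > 0 \<Longrightarrow> continuous_on {0..L} (f :: real \<Rightarrow> real)"
  shows "continuous_on {0..} f"
  unfolding continuous_on_eq_continuous_within
proof
  fix z :: real assume z: "z \<in> {0..}"
  then have "continuous (at z within {0..z + 1}) f"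
    using assms[of "z + 1"] by (simp add: continuous_on_eq_continuous_within)
  moreover have "at z within {0..} = at z within {0..z + 1}"
    by (rule at_within_nhd[of z "{..<z + 1}"]) (use z in auto)
  ultimately show "continuous (at z within {0..}) f" by simp
qed

text \<open>Picard iteration. The hypothesis raises the exponent of the error by one and divides by
  it, so successive differences are bounded by terms of an exponential series. The iterates converge
  uniformly on every bounded interval, without any smallness, and the solution is global.\<close>

lemma Volterra_fixed_point:
  fixes T :: "(real \<Rightarrow> real) \<Rightarrow> real \<Rightarrow> real"
  assumes cont: "\<And>F. continuous_on {0..} F \<Longrightarrow> continuous_on {0..} (T F)"
    and lip: "\<And>L. L > 0 \<Longrightarrow> \<exists>C\<ge>0. \<forall>F F' a n. continuous_on {0..} F \<longrightarrow> continuous_on {0..} F' \<longrightarrow> a \<ge> 0 \<longrightarrow>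
      (\<forall>s\<in>{0..L}. \<bar>F s - F' s\<bar> \<le> a * s ^ n) \<longrightarrow> (\<forall>z\<in>{0..L}. \<bar>T F z - T F' z\<bar> \<le> C * a * z ^ Suc n / real (Suc n))"
  obtains F where "continuous_on {0..} F" "\<And>z. z \<ge> 0 \<Longrightarrow> T F z = F z"
proof -
  define F where "F n = (T ^^ n) (\<lambda>_. 0)" for n
  have FS: "F (Suc n) = T (F n)" for n by (simp add: F_def)
  have Fc: "continuous_on {0..} (F n)" for n by (induction n) (auto simp: FS cont, simp add: F_def)
  define f where "f n z = F (Suc n) z - F n z" for n z
  define \<Phi> where "\<Phi> z = (\<Sum>n. f n z)" for z
  have tele: "(\<Sum>i<n. f i z) = F n z" for n z
  proof -
    have "(\<Sum>i<n. f i z) = F n z - F 0 z" unfolding f_def by (rule sum_lessThan_telescope)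
    then show ?thesis by (simp add: F_def)
  qed
  have ul: "uniform_limit {0..L} F \<Phi> sequentially" if L: "L > 0" for L
  proof -
    obtain C where C: "C \<ge> 0" "\<forall>F F' a n. continuous_on {0..} F \<longrightarrow> continuous_on {0..} F' \<longrightarrow> a \<ge> 0 \<longrightarrow>
      (\<forall>s\<in>{0..L}. \<bar>F s - F' s\<bar> \<le> a * s ^ n) \<longrightarrow> (\<forall>z\<in>{0..L}. \<bar>T F z - T F' z\<bar> \<le> C * a * z ^ Suc n / real (Suc n))"
      using lip[OF L] by blast
    have "continuous_on {0..L} (f 0)" unfolding f_def[abs_def]
      by (intro continuous_intros continuous_on_subset[OF Fc]) auto
    then have "bounded (f 0 ` {0..L})" using compact_continuous_image compact_imp_bounded by blast
    then obtain W where W: "W > 0" "\<And>z. z \<in> {0..L} \<Longrightarrow> \<bar>f 0 z\<bar> \<le> W" unfolding bounded_pos by auto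
    have bound: "\<bar>f n z\<bar> \<le> (W * C ^ n / fact n) * z ^ n" if "z \<in> {0..L}" for n z
      using that
    proof (induction n arbitrary: z)
      case 0
      then show ?case using W(2) by simp
    next
      case (Suc n)
      have "\<bar>T (F (Suc n)) z - T (F n) z\<bar> \<le> C * (W * C ^ n / fact n) * z ^ Suc n / real (Suc n)"
        by (rule C(2)[rule_format, OF Fc Fc]) (use Suc W(1) C(1) in \<open>auto simp: f_def\<close>)
      also have "\<dots> = (W * C ^ Suc n / fact (Suc n)) * z ^ Suc n" by (simp add: field_simps)
      finally show ?case by (simp add: f_def FS)
    qed
    have "norm (f n z) \<le> W * ((C * L) ^ n /\<^sub>R fact n)" if "z \<in> {0..L}" for n z
    proof -
      have "\<bar>f n z\<bar> \<le> (W * C ^ n / fact n) * z ^ n" by (rule bound[OF that])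
      also have "\<dots> \<le> (W * C ^ n / fact n) * L ^ n" using that W(1) C(1) by (intro mult_left_mono power_mono) auto
      finally show ?thesis by (simp add: power_mult_distrib divide_inverse mult_ac)
    qed
    moreover have "summable (\<lambda>n. W * ((C * L) ^ n /\<^sub>R fact n))" by (intro summable_mult summable_exp_generic)
    ultimately have "uniform_limit {0..L} (\<lambda>n z. \<Sum>i<n. f i z) (\<lambda>z. \<Sum>n. f n z) sequentially" by (rule Weierstrass_m_test)
    then show ?thesis unfolding tele \<Phi>_def .
  qed
  have \<Phi>c: "continuous_on {0..} \<Phi>"
  proof (rule continuous_on_halfline)
    fix L :: real assume "L > 0"
    show "continuous_on {0..L} \<Phi>"
      by (rule uniform_limit_theorem[OF _ ul[OF \<open>L > 0\<close>]])
        (auto intro!: always_eventually continuous_on_subset[OF Fc])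
  qed
  have "T \<Phi> z = \<Phi> z" if z: "z \<ge> 0" for z
  proof -
    define L where "L = z + 1"
    have L: "L > 0" "z \<in> {0..L}" using z by (auto simp: L_def)
    obtain C where C: "C \<ge> 0" "\<forall>F F' a n. continuous_on {0..} F \<longrightarrow> continuous_on {0..} F' \<longrightarrow> a \<ge> 0 \<longrightarrow>
      (\<forall>s\<in>{0..L}. \<bar>F s - F' s\<bar> \<le> a * s ^ n) \<longrightarrow> (\<forall>z\<in>{0..L}. \<bar>T F z - T F' z\<bar> \<le> C * a * z ^ Suc n / real (Suc n))"
      using lip[OF L(1)] by blast
    have "(\<lambda>n. F (Suc n) z) \<longlonglongrightarrow> T \<Phi> z"
    proof (rule metric_LIMSEQ_I)
      fix r :: real assume r: "r > 0"
      \<comment> \<open>The estimate is used here with exponent 0: uniform closeness within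
        \<open>a\<close> on the interval passes to the images at \<open>z\<close> within
        \<open>a * (C * z)\<close>, which is below \<open>r\<close>.\<close>
      define a where "a = r / (C * z + 1)"
      have Cz: "C * z \<ge> 0" using C(1) z by simp
      then have a: "a > 0" "a * (C * z) < r" using r by (auto simp: a_def field_simps)
      have "\<forall>\<^sub>F n in sequentially. \<forall>x\<in>{0..L}. dist (F n x) (\<Phi> x) < a" using ul[OF L(1)] a(1) by (simp add: uniform_limit_iff)
      then obtain n0 where n0: "\<And>n x. n \<ge> n0 \<Longrightarrow> x \<in> {0..L} \<Longrightarrow> dist (F n x) (\<Phi> x) < a" unfolding eventually_sequentially by blast
      have "dist (F (Suc n) z) (T \<Phi> z) < r" if n: "n \<ge> n0" for n
      proof -
        have "\<bar>T (F n) z - T \<Phi> z\<bar> \<le> C * a * z ^ Suc 0 / real (Suc 0)"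
          by (rule C(2)[rule_format, OF Fc \<Phi>c _ _ L(2)]) (use a(1) n0[OF n] in \<open>auto simp: dist_real_def intro: less_imp_le\<close>)
        also have "\<dots> = a * (C * z)" by simp
        finally show ?thesis using a(2) by (simp add: FS dist_real_def)
      qed
      then show "\<exists>no. \<forall>n\<ge>no. dist (F (Suc n) z) (T \<Phi> z) < r" by blast
    qed
    moreover have "(\<lambda>n. F (Suc n) z) \<longlonglongrightarrow> \<Phi> z"
      by (rule LIMSEQ_Suc[OF tendsto_uniform_limitI[OF ul[OF L(1)] L(2)]])
    ultimately show ?thesis by (rule LIMSEQ_unique)
  qed
  with \<Phi>c show thesis by (rule that)
qed

text \<open>Substituting \<open>s = \<theta> * z\<close> turns the average into
  \<open>z powr (- k)\<close> times the integral of \<open>s powr (k - 1) * u s\<close> over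
  \<open>{0..z}\<close>, the solution of \<open>z A' + k A = u\<close> that stays bounded at
  0.\<close>

lemma average_power_weight_derivative:
  assumes k: "k > 1" and u: "continuous_on {0..} u" and z: "z > 0"
  shows "(average (\<lambda>\<theta>. \<theta> powr (k - 1)) u has_real_derivative (u z - k * average (\<lambda>\<theta>. \<theta> powr (k - 1)) u z) / z) (at z)"
proof -
  define w where "w s = s powr (k - 1) * u s" for s
  have w: "continuous_on {0..} w" unfolding w_def
    by (intro continuous_intros u continuous_on_powr') (use k in auto)
  define J where "J z = integral {0..z} w" for z
  have J: "(J has_vector_derivative w z) (at z within {0..})" if "z \<ge> 0" for z
    unfolding J_def by (rule integral_has_derivative_halfline[OF w that])
  have eq: "average (\<lambda>\<theta>. \<theta> powr (k - 1)) u z = z powr (- k) * J z" if z: "z > 0" for z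
  proof -
    have "((\<lambda>\<theta>. z powr k * (\<theta> powr (k - 1) * u (\<theta> * z))) has_integral J (1 * z) - J (0 * z)) {0..1}"
    proof (rule fundamental_theorem_of_calculus)
      fix \<theta> :: real assume t: "\<theta> \<in> {0..1}"
      have "(J has_vector_derivative w (\<theta> * z)) (at (\<theta> * z) within (\<lambda>\<theta>. \<theta> * z) ` {0..1})"
        by (rule has_vector_derivative_within_subset[OF J]) (use t z in auto)
      moreover have "((\<lambda>\<theta>. \<theta> * z) has_vector_derivative z) (at \<theta> within {0..1})"
        by (auto intro!: derivative_eq_intros simp flip: has_real_derivative_iff_has_vector_derivative)
      ultimately have "((\<lambda>\<theta>. J (\<theta> * z)) has_vector_derivative z * w (\<theta> * z)) (at \<theta> within {0..1})"
        using vector_diff_chain_within[of "\<lambda>\<theta>. \<theta> * z" z \<theta> "{0..1}" J] by (simp add: o_def)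
      moreover have "z * w (\<theta> * z) = z powr k * (\<theta> powr (k - 1) * u (\<theta> * z))"
      proof -
        have "(\<theta> * z) powr (k - 1) = \<theta> powr (k - 1) * z powr (k - 1)" by (rule powr_mult)
        moreover have "z * z powr (k - 1) = z powr k" using powr_mult_base[of z "k - 1"] z by simp
        ultimately show ?thesis by (simp add: w_def mult_ac)
      qed
      ultimately show "((\<lambda>\<theta>. J (\<theta> * z)) has_vector_derivative z powr k * (\<theta> powr (k - 1) * u (\<theta> * z))) (at \<theta> within {0..1})" by simp
    qed simp
    then have "integral {0..1} (\<lambda>\<theta>. z powr k * (\<theta> powr (k - 1) * u (\<theta> * z))) = J (1 * z) - J (0 * z)" by (rule integral_unique)
    moreover have "J 0 = 0" by (simp add: J_def)
    ultimately have "z powr k * average (\<lambda>\<theta>. \<theta> powr (k - 1)) u z = J z"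
      unfolding average_def by (simp only: integral_mult_right mult_1 mult_zero_left diff_0_right real_scaleR_def)
    then show ?thesis using z by (simp add: powr_minus field_simps)
  qed
  have Jz: "(J has_real_derivative w z) (at z)"
  proof -
    have "at z within {0..} = at z" using z by (intro at_within_interior) simp
    then show ?thesis using J[of z] z by (simp add: has_real_derivative_iff_has_vector_derivative)
  qed
  have "((\<lambda>z. z powr (- k) * J z) has_real_derivative (- k * z powr (- k - 1) * J z + z powr (- k) * w z)) (at z)"
    using z by (auto intro!: derivative_eq_intros Jz)
  moreover have "- k * z powr (- k - 1) * J z + z powr (- k) * w z = (u z - k * average (\<lambda>\<theta>. \<theta> powr (k - 1)) u z) / z"
  proof -
    have "z powr (- k - 1) = z powr (- k) / z" using z by (simp add: powr_diff)
    moreover have "z powr (- k) * z powr (k - 1) = 1 / z"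
    proof -
      have "z powr (- k) * z powr (k - 1) = z powr (- k + (k - 1))" by (rule powr_add[symmetric])
      also have "\<dots> = z powr (- 1)" by simp
      also have "\<dots> = 1 / z" using z by (simp add: powr_minus_divide)
      finally show ?thesis .
    qed
    then have "z powr (- k) * w z = u z / z" by (simp add: w_def mult.assoc[symmetric])
    ultimately show ?thesis unfolding eq[OF z] by (simp add: diff_divide_distrib)
  qed
  ultimately have "((\<lambda>z. z powr (- k) * J z) has_real_derivative (u z - k * average (\<lambda>\<theta>. \<theta> powr (k - 1)) u z) / z) (at z)" by simp
  then show ?thesis
    by (rule has_field_derivative_transform_within_open[of _ _ _ "{0<..}"]) (use z eq in auto)
qed

lemma average_bound:
  assumes "\<And>\<theta>. \<theta> \<in> {0..1} \<Longrightarrow> 0 \<le> \<kappa> \<theta> \<and> \<kappa> \<theta> \<le> 1" "continuous_on {0..1} \<kappa>" "continuous_on {0..} u" "continuous_on {0..} v"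
    "z \<ge> 0" "a \<ge> 0" "\<And>s. 0 \<le> s \<Longrightarrow> s \<le> z \<Longrightarrow> \<bar>u s - v s\<bar> \<le> a"
  shows "\<bar>average \<kappa> u z - average \<kappa> v z\<bar> \<le> a"
proof -
  have I: "convex {0::real..}" "(0::real) \<in> {0..}" "z \<in> {0..}" using assms(5) by auto
  note iu = integrable_average[OF I(1,2) assms(2,3) I(3)] and iv = integrable_average[OF I(1,2) assms(2,4) I(3)]
  have "average \<kappa> u z - average \<kappa> v z = integral {0..1} (\<lambda>\<theta>. \<kappa> \<theta> * u (\<theta> * z) - \<kappa> \<theta> * v (\<theta> * z))"
    unfolding average_def by (rule integral_diff[OF iu iv, symmetric])
  also have "norm \<dots> \<le> a * (1 - 0)"
  proof (rule integral_bound)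
    show "(0::real) \<le> 1" by simp
    show "continuous_on {0..1} (\<lambda>\<theta>. \<kappa> \<theta> * u (\<theta> * z) - \<kappa> \<theta> * v (\<theta> * z))"
      using assms(5) by (intro continuous_intros assms(2) continuous_on_compose2[OF assms(3)] continuous_on_compose2[OF assms(4)]) auto
    fix \<theta> :: real assume "\<theta> \<in> {0..1}"
    then have t: "0 \<le> \<theta> \<and> \<theta> \<le> 1" by simp
    have "\<theta> * z \<le> z" using t assms(5) by (simp add: mult_left_le_one_le)
    then have "\<bar>u (\<theta> * z) - v (\<theta> * z)\<bar> \<le> a" using assms(7)[of "\<theta> * z"] t assms(5) by simp
    then have "\<kappa> \<theta> * \<bar>u (\<theta> * z) - v (\<theta> * z)\<bar> \<le> 1 * a" using assms(1)[of \<theta>] t by (intro mult_mono) auto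
    then show "norm (\<kappa> \<theta> * u (\<theta> * z) - \<kappa> \<theta> * v (\<theta> * z)) \<le> a"
      using assms(1)[of \<theta>] t by (simp add: right_diff_distrib[symmetric] abs_mult)
  qed
  finally show ?thesis by simp
qed

lemma Cw_integral_halfline:
  assumes "Cw k {0..} b"
  shows "Cw (Suc k) {0..} (\<lambda>z. integral {0..z} (b :: real \<Rightarrow> real))"
  by (rule Cw_SucI[OF _ assms], rule integral_has_derivative_halfline[OF Cw_continuous[OF assms]]) simp

text \<open>The exponential is not Lipschitz towards \<open>- \<infinity>\<close>. Cutting its
  argument at \<open>- M\<close> bounds the derivative, and the cut itself does not increase
  distances.\<close>

lemma exp_trunc_lipschitz:
  fixes w w' M :: real
  shows "\<bar>exp (- sqrt 2 * max w (- M)) - exp (- sqrt 2 * max w' (- M))\<bar> \<le> sqrt 2 * exp (sqrt 2 * M) * \<bar>w - w'\<bar>"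
proof -
  have key: "\<bar>exp (- sqrt 2 * x) - exp (- sqrt 2 * y)\<bar> \<le> sqrt 2 * exp (sqrt 2 * M) * \<bar>x - y\<bar>"
    if xy: "- M \<le> x" "x < y" for x y
  proof -
    have "\<exists>z. x < z \<and> z < y \<and> exp (- sqrt 2 * y) - exp (- sqrt 2 * x) = (y - x) * (- sqrt 2 * exp (- sqrt 2 * z))"
      by (rule MVT2[OF xy(2)]) (auto intro!: derivative_eq_intros)
    then obtain z where z: "x < z" "z < y" "exp (- sqrt 2 * y) - exp (- sqrt 2 * x) = (y - x) * (- sqrt 2 * exp (- sqrt 2 * z))" by blast
    have "- sqrt 2 * z \<le> sqrt 2 * M" using z(1) xy(1) by (smt (verit) mult_left_mono mult_minus_left mult_minus_right real_sqrt_ge_zero)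
    then have "exp (- sqrt 2 * z) \<le> exp (sqrt 2 * M)" by simp
    then have "(y - x) * (sqrt 2 * exp (- sqrt 2 * z)) \<le> (y - x) * (sqrt 2 * exp (sqrt 2 * M))" using xy(2) by (intro mult_left_mono) auto
    moreover have "\<bar>exp (- sqrt 2 * x) - exp (- sqrt 2 * y)\<bar> = (y - x) * (sqrt 2 * exp (- sqrt 2 * z))"
    proof -
      have "exp (- sqrt 2 * x) - exp (- sqrt 2 * y) = (y - x) * (sqrt 2 * exp (- sqrt 2 * z))" using z(3) by (simp add: algebra_simps)
      moreover have "(y - x) * (sqrt 2 * exp (- sqrt 2 * z)) \<ge> 0" using xy(2) by simp
      ultimately show ?thesis by (simp only: abs_of_nonneg)
    qed
    ultimately show ?thesis using xy(2) by (simp add: mult_ac)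
  qed
  let ?x = "max w (- M)" and ?y = "max w' (- M)"
  have "\<bar>exp (- sqrt 2 * ?x) - exp (- sqrt 2 * ?y)\<bar> \<le> sqrt 2 * exp (sqrt 2 * M) * \<bar>?x - ?y\<bar>"
  proof (cases ?x ?y rule: linorder_cases)
    case less
    show ?thesis by (rule key[OF _ less]) simp
  next
    case greater
    have "\<bar>exp (- sqrt 2 * ?y) - exp (- sqrt 2 * ?x)\<bar> \<le> sqrt 2 * exp (sqrt 2 * M) * \<bar>?y - ?x\<bar>" by (rule key[OF _ greater]) simp
    then show ?thesis by (simp only: abs_minus_commute)
  qed simp
  also have "\<dots> \<le> sqrt 2 * exp (sqrt 2 * M) * \<bar>w - w'\<bar>"
    by (intro mult_left_mono) auto
  finally show ?thesis .
qed

lemma continuous_bounded_Icc: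
  assumes "continuous_on {0..} (u :: real \<Rightarrow> real)"
  obtains B where "B > 0" "\<And>z. 0 \<le> z \<Longrightarrow> z \<le> L \<Longrightarrow> \<bar>u z\<bar> \<le> B"
proof -
  have "continuous_on {0..L} u" by (rule continuous_on_subset[OF assms]) auto
  then have "bounded (u ` {0..L})" using compact_continuous_image compact_imp_bounded by blast
  then obtain B where "B > 0" "\<And>z. z \<in> {0..L} \<Longrightarrow> \<bar>u z\<bar> \<le> B" unfolding bounded_pos by auto
  then show thesis by (intro that) auto
qed

text \<open>Writing \<open>k z / G\<close> as \<open>k0 + z b\<close> and \<open>E = exp (\<integral> b)\<close>, the equation becomes
  \<open>(z\<^sup>k\<^sup>0 E F')' = z\<^bsup>k0-1\<^esup> E g(z, F)\<close>, that is, \<open>F'\<close> is a weighted average of \<open>E g(z, F)\<close> divided by \<open>E\<close>.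
  The nonlinearity is truncated below the level \<open>-M(z)\<close>; an energy estimate shows that the truncation is never active.\<close>

lemma singular_exponential_ode:
  fixes G Q :: "real \<Rightarrow> real" and k K g0 :: real
  assumes G: "\<And>j. Cw j {0..} G" "G 0 = 0" "\<And>z. z > 0 \<Longrightarrow> G z > 0" "(G has_real_derivative g0) (at 0 within {0..})"
    and Q: "\<And>j. Cw j {0..} Q" and k: "0 < g0" "g0 < k" and K: "K > 0"
  obtains F F1 F2 where "\<And>j. Cw j {0..} F" "\<And>z. z \<ge> 0 \<Longrightarrow> (F has_vector_derivative F1 z) (at z within {0..})"
    "\<And>z. z \<ge> 0 \<Longrightarrow> (F1 has_vector_derivative F2 z) (at z within {0..})"
    "\<And>z. z \<ge> 0 \<Longrightarrow> G z * F2 z + k * F1 z + Q z * F z = K * exp (- sqrt 2 * F z)"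
proof -
  let ?I = "{0::real..}"
  have I: "convex ?I" "(0::real) \<in> ?I" by auto
  obtain G' where G': "\<And>z. z \<in> ?I \<Longrightarrow> (G has_vector_derivative G' z) (at z within ?I)" "\<And>j. Cw j ?I G'"
    using Cw_all_derivative[OF G(1) halfline_not_bot] by auto
  have "(G has_vector_derivative g0) (at 0 within ?I)" using G(4) by (simp add: has_real_derivative_iff_has_vector_derivative)
  moreover have "(G has_vector_derivative G' 0) (at 0 within ?I)" by (rule G'(1)) simp
  ultimately have G'0: "G' 0 = g0"
    using vector_derivative_unique_within[OF halfline_not_bot[of 0, OF order_refl]] by metis
  define \<gamma> where "\<gamma> = average (\<lambda>_. 1) G'"
  have C\<gamma>: "Cw j ?I \<gamma>" for j unfolding \<gamma>_def by (rule Cw_average[OF I _ G'(2)]) simp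
  have G\<gamma>: "G z = z * \<gamma> z" if "z \<ge> 0" for z
    using Hadamard[OF I G'(1) Cw_continuous[OF G'(2)[of 0]], of z] G(2) that by (simp add: \<gamma>_def)
  have \<gamma>0: "\<gamma> 0 = g0" by (simp add: \<gamma>_def average_def G'0)
  have \<gamma>pos: "\<gamma> z > 0" if "z \<ge> 0" for z
  proof (cases "z = 0")
    case False
    then have "z * \<gamma> z > 0" using G(3)[of z] G\<gamma>[of z] that by simp
    then show ?thesis using False that by (simp add: zero_less_mult_iff)
  qed (use \<gamma>0 k in simp)
  define cc where "cc z = k / \<gamma> z" for z
  have Ccc: "Cw j ?I cc" for j unfolding cc_def by (rule Cw_divide[OF Cw_const C\<gamma>]) (use \<gamma>pos in auto)
  define k0 where "k0 = k / g0"
  have k0: "k0 > 1" using k by (simp add: k0_def)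
  have cc0: "cc 0 = k0" by (simp add: cc_def \<gamma>0 k0_def)
  obtain cc' where cc': "\<And>z. z \<in> ?I \<Longrightarrow> (cc has_vector_derivative cc' z) (at z within ?I)" "\<And>j. Cw j ?I cc'"
    using Cw_all_derivative[OF Ccc halfline_not_bot] by auto
  define b where "b = average (\<lambda>_. 1) cc'"
  have Cb: "Cw j ?I b" for j unfolding b_def by (rule Cw_average[OF I _ cc'(2)]) simp
  have ccb: "cc z = k0 + z * b z" if "z \<ge> 0" for z
    using Hadamard[OF I cc'(1) Cw_continuous[OF cc'(2)[of 0]], of z] that by (simp add: b_def cc0)
  define E where "E z = exp (integral {0..z} b)" for z
  have CE: "Cw j ?I E" for j unfolding E_def
    by (rule Cw_exp_compose[OF Cw_Suc_imp[OF Cw_integral_halfline[OF Cb]]])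
  have Epos: "E z > 0" for z by (simp add: E_def)
  have E': "(E has_real_derivative b z * E z) (at z)" if "z > 0" for z
  proof -
    have "at z within ?I = at z" using that by (intro at_within_interior) simp
    then have "((\<lambda>z. integral {0..z} b) has_real_derivative b z) (at z)"
      using integral_has_derivative_halfline[OF Cw_continuous[OF Cb[of 0]], of z] that by (simp add: has_real_derivative_iff_has_vector_derivative)
    then show ?thesis unfolding E_def by (auto intro!: derivative_eq_intros)
  qed
  define \<kappa> where "\<kappa> \<theta> = \<theta> powr (k0 - 1)" for \<theta> :: real
  have \<kappa>c: "continuous_on {0..1} \<kappa>" unfolding \<kappa>_def by (intro continuous_on_powr' continuous_intros) (use k0 in auto)
  have \<kappa>b: "0 \<le> \<kappa> \<theta> \<and> \<kappa> \<theta> \<le> 1" if "\<theta> \<in> {0..1}" for \<theta> using that k0 by (auto simp: \<kappa>_def intro: powr_le1)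
  \<comment> \<open>The rate of growth in the energy estimate; the maximum with \<open>z0\<close> in the denominator avoids
    the zero of \<open>G\<close>, near which the numerator vanishes.\<close>
  define \<eta> where "\<eta> = (k - g0 / 2) / 2"
  have \<eta>: "\<eta> > 0" using k by (simp add: \<eta>_def)
  define num where "num z = G' z / 2 - k + \<eta>" for z
  have cnum: "continuous_on ?I num" unfolding num_def using Cw_continuous[OF G'(2)[of 0]] by (intro continuous_intros) auto
  have "num 0 < 0" using k by (simp add: num_def G'0 \<eta>_def field_simps)
  then obtain z0 where z0: "z0 > 0" "\<And>z. 0 \<le> z \<Longrightarrow> z < z0 \<Longrightarrow> num z < 0"
  proof -
    assume n0: "num 0 < 0"
    obtain d where d: "d > 0" "\<And>z. z \<in> ?I \<Longrightarrow> dist z 0 < d \<Longrightarrow> dist (num z) (num 0) < - num 0"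
      using cnum n0 unfolding continuous_on_iff by (metis atLeast_iff neg_0_less_iff_less order_refl)
    have "num z < 0" if "0 \<le> z" "z < d" for z using d(2)[of z] that by (simp add: dist_real_def abs_less_iff)
    then show thesis using d(1) by (intro that) auto
  qed
  define rate where "rate z = 2 * max 0 (num z) / (\<gamma> z * max z z0) + (1 - Q z)\<^sup>2 / (2 * \<eta>)" for z
  have cQ: "continuous_on ?I Q" and c\<gamma>: "continuous_on ?I \<gamma>" and cE: "continuous_on ?I E"
    using Cw_continuous Q C\<gamma> CE by blast+
  have dpos: "\<gamma> z * max z z0 > 0" if "z \<ge> 0" for z using \<gamma>pos[OF that] z0(1) by (intro mult_pos_pos) auto
  have crate: "continuous_on ?I rate" unfolding rate_def[abs_def]
  proof (intro continuous_on_add continuous_on_divide)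
    show "\<forall>z\<in>?I. \<gamma> z * max z z0 \<noteq> 0" using dpos by fastforce
    show "\<forall>z\<in>?I. 2 * \<eta> \<noteq> 0" using \<eta> by simp
  qed (intro continuous_intros cnum c\<gamma> cQ)+
  \<comment> \<open>For \<open>z < z0\<close> the left side is negative; for larger \<open>z\<close>
    the denominator in \<open>rate\<close> is exactly \<open>G z\<close>.\<close>
  have rate1: "num z \<le> rate z * G z / 2" if z: "z > 0" for z
  proof -
    have "2 * max 0 (num z) / (\<gamma> z * max z z0) \<le> rate z" using \<eta> by (simp add: rate_def)
    then have "2 * max 0 (num z) / (\<gamma> z * max z z0) * G z \<le> rate z * G z" using G(3)[OF z] by (intro mult_right_mono) auto
    moreover have "2 * num z \<le> 2 * max 0 (num z) / (\<gamma> z * max z z0) * G z"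
    proof (cases "z < z0")
      case True
      then have "num z < 0" using z0(2)[of z] z by simp
      then show ?thesis by simp
    next
      case False
      then have "\<gamma> z * max z z0 = G z" using G\<gamma>[of z] z by (simp add: mult.commute)
      then show ?thesis using G(3)[OF z] by simp
    qed
    ultimately show ?thesis by linarith
  qed
  have rate2: "(1 - Q z)\<^sup>2 / (2 * \<eta>) \<le> rate z" if z: "z \<ge> 0" for z
    using dpos[OF z] by (simp add: rate_def)
  define Rt where "Rt z = integral {0..z} rate" for z
  have cRt: "continuous_on ?I Rt"
    using integral_has_derivative_halfline[OF crate] unfolding Rt_def continuous_on_eq_continuous_within
    by (auto intro: has_vector_derivative_continuous)
  \<comment> \<open>The energy starts at \<open>K / sqrt 2\<close>, since \<open>F 0 = 0\<close> and
    \<open>G 0 = 0\<close>, and grows at most like \<open>exp (Rt z)\<close>. As it dominates half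
    the square of \<open>F\<close>, this is the resulting bound on \<open>\<bar>F z\<bar>\<close>.
    The truncation level \<open>M\<close> exceeds it by 1.\<close>
  define Y where "Y z = sqrt (sqrt 2 * K * exp (Rt z))" for z
  define M where "M z = Y z + 1" for z
  have cM: "continuous_on ?I M" unfolding M_def Y_def by (intro continuous_intros cRt)
  have Y0: "Y z \<ge> 0" for z using K by (simp add: Y_def)
  define g where "g z w = (K * exp (- sqrt 2 * max w (- M z)) - Q z * w) / \<gamma> z" for z w
  have cg: "continuous_on ?I (\<lambda>z. E z * g z (F z))" if "continuous_on ?I F" for F
    unfolding g_def by (intro continuous_intros that cM cQ c\<gamma> cE continuous_on_max) (use \<gamma>pos in \<open>auto simp: less_imp_neq[symmetric]\<close>)
  define V where "V F z = average \<kappa> (\<lambda>r. E r * g r (F r)) z / E z" for F z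
  have cA: "continuous_on ?I (average \<kappa> u)" if "continuous_on ?I u" for u
    using Cw_average[OF I \<kappa>c, of 0 u] that by simp
  have cV: "continuous_on ?I (V F)" if "continuous_on ?I F" for F
    unfolding V_def[abs_def] by (intro continuous_on_divide cA cg that cE) (use Epos in \<open>auto simp: less_imp_neq[symmetric]\<close>)
  define T where "T F z = integral {0..z} (V F)" for F z
  obtain F where F: "continuous_on ?I F" "\<And>z. z \<ge> 0 \<Longrightarrow> T F z = F z"
  proof (rule Volterra_fixed_point)
    fix F :: "real \<Rightarrow> real" assume "continuous_on ?I F"
    then show "continuous_on ?I (T F)" unfolding T_def[abs_def] 
      using integral_has_derivative_halfline[OF cV] unfolding continuous_on_eq_continuous_within[of _ "\<lambda>z. integral {0..z} (V F)"]
      by (auto intro: has_vector_derivative_continuous)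
  next
    fix L :: real assume L: "L > 0"
    obtain BE where BE: "BE > 0" "\<And>z. 0 \<le> z \<Longrightarrow> z \<le> L \<Longrightarrow> \<bar>E z\<bar> \<le> BE" using continuous_bounded_Icc[OF cE, of L] by blast
    have "continuous_on ?I (\<lambda>z. 1 / E z)" by (intro continuous_intros cE) (use Epos in \<open>auto simp: less_imp_neq[symmetric]\<close>)
    then obtain BI where BI: "BI > 0" "\<And>z. 0 \<le> z \<Longrightarrow> z \<le> L \<Longrightarrow> \<bar>1 / E z\<bar> \<le> BI"
      using continuous_bounded_Icc[of "\<lambda>z. 1 / E z" L] by blast
    define lip_const where "lip_const z = (K * (sqrt 2 * exp (sqrt 2 * M z)) + \<bar>Q z\<bar>) / \<gamma> z" for z
    have "continuous_on ?I lip_const" unfolding lip_const_def by (intro continuous_intros cM cQ c\<gamma>) (use \<gamma>pos in \<open>auto simp: less_imp_neq[symmetric]\<close>)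
    then obtain BL where BL: "BL > 0" "\<And>z. 0 \<le> z \<Longrightarrow> z \<le> L \<Longrightarrow> \<bar>lip_const z\<bar> \<le> BL"
      using continuous_bounded_Icc[of lip_const L] by blast
    have lip: "\<bar>g z w - g z w'\<bar> \<le> BL * \<bar>w - w'\<bar>" if z: "0 \<le> z" "z \<le> L" for z w w'
    proof -
      have gp: "\<gamma> z > 0" using \<gamma>pos z by simp
      let ?e = "\<lambda>w. exp (- sqrt 2 * max w (- M z))"
      have "\<bar>(K * ?e w - Q z * w) - (K * ?e w' - Q z * w')\<bar> = \<bar>K * (?e w - ?e w') - Q z * (w - w')\<bar>" by (simp add: algebra_simps)
      also have "\<dots> \<le> \<bar>K * (?e w - ?e w')\<bar> + \<bar>Q z * (w - w')\<bar>" by (rule abs_triangle_ineq4)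
      also have "\<dots> = K * \<bar>?e w - ?e w'\<bar> + \<bar>Q z\<bar> * \<bar>w - w'\<bar>" using K by (simp add: abs_mult)
      also have "\<dots> \<le> K * (sqrt 2 * exp (sqrt 2 * M z) * \<bar>w - w'\<bar>) + \<bar>Q z\<bar> * \<bar>w - w'\<bar>"
        using exp_trunc_lipschitz[of w "M z" w'] K by (intro add_right_mono mult_left_mono) auto
      also have "\<dots> = (K * (sqrt 2 * exp (sqrt 2 * M z)) + \<bar>Q z\<bar>) * \<bar>w - w'\<bar>" by (simp add: algebra_simps)
      finally have "\<bar>(K * ?e w - Q z * w) - (K * ?e w' - Q z * w')\<bar> / \<gamma> z \<le> (K * (sqrt 2 * exp (sqrt 2 * M z)) + \<bar>Q z\<bar>) * \<bar>w - w'\<bar> / \<gamma> z"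
        using gp by (intro divide_right_mono) auto
      moreover have "\<bar>g z w - g z w'\<bar> = \<bar>(K * ?e w - Q z * w) - (K * ?e w' - Q z * w')\<bar> / \<gamma> z"
        using gp by (simp add: g_def diff_divide_distrib[symmetric])
      ultimately have "\<bar>g z w - g z w'\<bar> \<le> lip_const z * \<bar>w - w'\<bar>" by (simp add: lip_const_def)
      also have "\<dots> \<le> BL * \<bar>w - w'\<bar>" using BL(2)[OF z] by (intro mult_right_mono) auto
      finally show ?thesis .
    qed
    define C where "C = BI * (BE * BL)"
    have C: "C \<ge> 0" using BI(1) BE(1) BL(1) by (simp add: C_def)
    have "\<bar>T F z - T F' z\<bar> \<le> C * a * z ^ Suc n / real (Suc n)"
      if h: "continuous_on ?I F" "continuous_on ?I F'" "a \<ge> 0" "\<And>s. s\<in>{0..L} \<Longrightarrow> \<bar>F s - F' s\<bar> \<le> a * s ^ n" "z\<in>{0..L}" for F F' a n z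
    proof -
      have VV: "\<bar>V F s - V F' s\<bar> \<le> C * a * s ^ n" if s: "s \<in> {0..z}" for s
      proof -
        have s': "0 \<le> s" "s \<le> L" using s h(5) by auto
        have "\<bar>average \<kappa> (\<lambda>r. E r * g r (F r)) s - average \<kappa> (\<lambda>r. E r * g r (F' r)) s\<bar> \<le> BE * BL * (a * s ^ n)"
        proof (rule average_bound[OF \<kappa>b \<kappa>c cg[OF h(1)] cg[OF h(2)] s'(1)])
          show "0 \<le> BE * BL * (a * s ^ n)" using BE(1) BL(1) h(3) s' by simp
          fix r assume r: "0 \<le> r" "r \<le> s"
          have "\<bar>E r * g r (F r) - E r * g r (F' r)\<bar> = \<bar>E r\<bar> * \<bar>g r (F r) - g r (F' r)\<bar>" by (simp add: right_diff_distrib[symmetric] abs_mult)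
          also have "\<dots> \<le> BE * (BL * \<bar>F r - F' r\<bar>)" by (rule mult_mono[OF BE(2) lip]) (use r s' BE(1) in auto)
          also have "\<dots> \<le> BE * (BL * (a * s ^ n))"
          proof (intro mult_left_mono)
            have "\<bar>F r - F' r\<bar> \<le> a * r ^ n" by (rule h(4)) (use r s' in auto)
            also have "a * r ^ n \<le> a * s ^ n" using r h(3) by (intro mult_left_mono power_mono) auto
            finally show "\<bar>F r - F' r\<bar> \<le> a * s ^ n" .
          qed (use BE(1) BL(1) in auto)
          finally show "\<bar>E r * g r (F r) - E r * g r (F' r)\<bar> \<le> BE * BL * (a * s ^ n)" using BE(1) BL(1) by (simp add: mult.assoc)
        qed
        then have "\<bar>1 / E s\<bar> * \<bar>average \<kappa> (\<lambda>r. E r * g r (F r)) s - average \<kappa> (\<lambda>r. E r * g r (F' r)) s\<bar> \<le> BI * (BE * BL * (a * s ^ n))"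
          by (intro mult_mono BI(2) s') (use BI(1) in auto)
        moreover have "V F s - V F' s = (1 / E s) * (average \<kappa> (\<lambda>r. E r * g r (F r)) s - average \<kappa> (\<lambda>r. E r * g r (F' r)) s)"
          by (simp add: V_def diff_divide_distrib)
        ultimately show ?thesis by (simp add: abs_mult C_def mult_ac)
      qed
      have sub: "{0..z} \<subseteq> ?I" by auto
      note cVs = continuous_on_subset[OF cV[OF h(1)] sub] continuous_on_subset[OF cV[OF h(2)] sub]
      have hi: "((\<lambda>s. C * a * s ^ n) has_integral (C * a * z ^ Suc n / real (Suc n) - C * a * 0 ^ Suc n / real (Suc n))) {0..z}"
      proof (rule fundamental_theorem_of_calculus)
        show "0 \<le> z" using h(5) by simp
        fix s assume "s \<in> {0..z}"
        show "((\<lambda>z. C * a * z ^ Suc n / real (Suc n)) has_vector_derivative C * a * s ^ n) (at s within {0..z})"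
          unfolding has_real_derivative_iff_has_vector_derivative[symmetric]
          by (rule DERIV_cong[OF DERIV_cdivide[OF DERIV_cmult[OF DERIV_power[OF DERIV_ident]]]]) simp
      qed
      have "T F z - T F' z = integral {0..z} (\<lambda>s. V F s - V F' s)"
        unfolding T_def by (rule integral_diff[OF integrable_continuous_real integrable_continuous_real, OF cVs, symmetric])
      also have "norm \<dots> \<le> integral {0..z} (\<lambda>s. C * a * s ^ n)"
        by (rule integral_norm_bound_integral)
          (use VV hi in \<open>auto intro!: integrable_continuous_real continuous_on_diff cVs continuous_intros\<close>)
      also have "\<dots> = C * a * z ^ Suc n / real (Suc n)"
        using integral_unique[OF hi] by (simp only: power_0_Suc mult_zero_right div_0 diff_0_right)
      finally show ?thesis by simp
    qed
    then show "\<exists>C\<ge>0. \<forall>F F' a n. continuous_on ?I F \<longrightarrow> continuous_on ?I F' \<longrightarrow> a \<ge> 0 \<longrightarrow>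
      (\<forall>s\<in>{0..L}. \<bar>F s - F' s\<bar> \<le> a * s ^ n) \<longrightarrow> (\<forall>z\<in>{0..L}. \<bar>T F z - T F' z\<bar> \<le> C * a * z ^ Suc n / real (Suc n))"
      using C by blast
  qed (rule that; assumption)
  have F': "(F has_vector_derivative V F z) (at z within ?I)" if "z \<ge> 0" for z
    by (rule has_vector_derivative_transform[OF _ _ integral_has_derivative_halfline[OF cV[OF F(1)] that]])
      (use F(2) that in \<open>auto simp: T_def\<close>)
  have F0: "F 0 = 0" using F(2)[of 0] by (simp add: T_def)
  have dat: "at z within ?I = at z" if "z > 0" for z :: real using that by (intro at_within_interior) simp
  have dF: "(F has_real_derivative V F z) (at z)" if "z > 0" for z
    using F'[of z] dat[OF that] that by (simp add: has_real_derivative_iff_has_vector_derivative)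
  \<comment> \<open>Derived from \<open>z V' + cc V = g\<close>: the factor \<open>E\<close>
    accounts for the difference between \<open>cc z\<close> and its value \<open>k0\<close> at
    0.\<close>
  define V' where "V' z = (g z (F z) - cc z * V F z) / z" for z
  have dV: "(V F has_real_derivative V' z) (at z)" if z: "z > 0" for z
  proof -
    define u where "u z = E z * g z (F z)" for z
    have dA: "(average \<kappa> u has_real_derivative (u z - k0 * average \<kappa> u z) / z) (at z)"
      unfolding \<kappa>_def[abs_def] by (rule average_power_weight_derivative[OF k0 _ z]) (simp add: u_def[abs_def] cg[OF F(1)])
    have "((\<lambda>z. average \<kappa> u z / E z) has_real_derivative ((u z - k0 * average \<kappa> u z) / z * E z - average \<kappa> u z * (b z * E z)) / (E z * E z)) (at z)"
      using Epos[of z] by (intro DERIV_divide dA E'[OF z]) auto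
    moreover have "((u z - k0 * average \<kappa> u z) / z * E z - average \<kappa> u z * (b z * E z)) / (E z * E z) = V' z"
    proof -
      define A where "A = average \<kappa> u z"
      have VA: "V F z = A / E z" by (simp add: V_def A_def u_def[abs_def])
      have uz: "u z = E z * g z (F z)" by (simp add: u_def)
      have c: "cc z = k0 + z * b z" using ccb z by simp
      have "E z \<noteq> 0" using Epos[of z] by simp
      then show ?thesis unfolding V'_def VA c uz A_def[symmetric] using z by (simp add: field_simps)
    qed
    ultimately show ?thesis by (simp add: V_def[abs_def] u_def[abs_def])
  qed
  have ode: "G z * V' z + k * V F z = \<gamma> z * g z (F z)" if z: "z > 0" for z
  proof -
    have gp: "\<gamma> z > 0" using \<gamma>pos[of z] z by simp
    have "G z * V' z = \<gamma> z * g z (F z) - (\<gamma> z * cc z) * V F z"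
      using G\<gamma>[of z] z by (simp add: V'_def field_simps)
    moreover have "\<gamma> z * cc z = k" using gp by (simp add: cc_def)
    ultimately show ?thesis by simp
  qed
  have energy: "\<bar>F z1\<bar> \<le> Y z1" if z1: "z1 > 0" and low: "\<And>z. 0 \<le> z \<Longrightarrow> z < z1 \<Longrightarrow> - M z \<le> F z" for z1
  proof -
    \<comment> \<open>The last term is the potential of the exponential and cancels its work; it is
      positive but gives no control as \<open>F\<close> grows. The term
      \<open>(F z)\<^sup>2 / 2\<close> is added to bound \<open>F\<close> itself, and
      \<open>Q F\<close> is treated as a perturbation.\<close>
    define en where "en z = G z * (V F z)\<^sup>2 / 2 + (F z)\<^sup>2 / 2 + (K / sqrt 2) * exp (- sqrt 2 * F z)" for z
    define en' where "en' z = (G' z / 2 - k) * (V F z)\<^sup>2 + (1 - Q z) * (F z * V F z)" for z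
    have den: "(en has_real_derivative en' z) (at z)" if z: "0 < z" "z < z1" for z
    proof -
      have dG: "(G has_real_derivative G' z) (at z)"
        using G'(1)[of z] dat[OF z(1)] z by (simp add: has_real_derivative_iff_has_vector_derivative)
      have mx: "max (F z) (- M z) = F z" using low[of z] z by simp
      have o: "G z * V' z = K * exp (- sqrt 2 * F z) - Q z * F z - k * V F z"
      proof -
        have "\<gamma> z * g z (F z) = K * exp (- sqrt 2 * F z) - Q z * F z"
          using \<gamma>pos[of z] z by (simp add: g_def mx)
        then show ?thesis using ode[OF z(1)] by linarith
      qed
      have "(en has_real_derivative (G' z * (V F z)\<^sup>2 + G z * (2 * V F z * V' z)) / 2 + (2 * F z * V F z) / 2 + (K / sqrt 2) * (exp (- sqrt 2 * F z) * (- sqrt 2 * V F z))) (at z)"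
        unfolding en_def[abs_def]
        by (rule DERIV_cong[OF DERIV_add[OF DERIV_add[OF DERIV_cdivide[OF DERIV_mult[OF dG DERIV_power[OF dV[OF z(1)]]]]
            DERIV_cdivide[OF DERIV_power[OF dF[OF z(1)]]]] DERIV_cmult[OF DERIV_fun_exp[OF DERIV_cmult[OF dF[OF z(1)]]]]]])
          (simp add: algebra_simps)
      moreover have "(G' z * (V F z)\<^sup>2 + G z * (2 * V F z * V' z)) / 2 + (2 * F z * V F z) / 2 + (K / sqrt 2) * (exp (- sqrt 2 * F z) * (- sqrt 2 * V F z)) = en' z"
      proof -
        have 1: "(K / sqrt 2) * (exp (- sqrt 2 * F z) * (- sqrt 2 * V F z)) = - K * exp (- sqrt 2 * F z) * V F z" by simp
        have 2: "G z * (2 * V F z * V' z) = 2 * V F z * (G z * V' z)" by (simp add: mult_ac)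
        show ?thesis unfolding 1 2 o en'_def by (simp add: field_simps power2_eq_square)
      qed
      ultimately show ?thesis by simp
    qed
    have ineq: "en' z \<le> rate z * en z" if z: "0 < z" for z
    proof -
      have "en' z = num z * (V F z)\<^sup>2 - \<eta> * (V F z)\<^sup>2 + (1 - Q z) * (F z * V F z)" by (simp add: en'_def num_def algebra_simps)
      moreover have "num z * (V F z)\<^sup>2 \<le> rate z * G z / 2 * (V F z)\<^sup>2" using rate1[OF z] by (intro mult_right_mono) auto
      \<comment> \<open>Completing the square against the portion \<open>\<eta>\<close> of the
        damping that was set aside in \<open>num\<close>.\<close>
      moreover have "(1 - Q z) * (F z * V F z) - \<eta> * (V F z)\<^sup>2 \<le> (1 - Q z)\<^sup>2 / (2 * \<eta>) * (F z)\<^sup>2 / 2"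
      proof -
        have "0 \<le> (2 * \<eta> * V F z - (1 - Q z) * F z)\<^sup>2 / (4 * \<eta>)" using \<eta> by simp
        also have "\<dots> = \<eta> * (V F z)\<^sup>2 - (1 - Q z) * (F z * V F z) + (1 - Q z)\<^sup>2 / (2 * \<eta>) * (F z)\<^sup>2 / 2"
          using \<eta> by (simp add: power2_eq_square field_simps)
        finally show ?thesis by linarith
      qed
      moreover have "(1 - Q z)\<^sup>2 / (2 * \<eta>) * (F z)\<^sup>2 / 2 \<le> rate z * (F z)\<^sup>2 / 2"
        using rate2[of z] z by (intro divide_right_mono mult_right_mono) auto
      moreover have "0 \<le> rate z * ((K / sqrt 2) * exp (- sqrt 2 * F z))"
      proof -
        have "0 \<le> (1 - Q z)\<^sup>2 / (2 * \<eta>)" using \<eta> by simp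
        then have "0 \<le> rate z" using rate2[of z] z by linarith
        then show ?thesis using K by simp
      qed
      moreover have "rate z * en z = rate z * G z / 2 * (V F z)\<^sup>2 + rate z * (F z)\<^sup>2 / 2 + rate z * ((K / sqrt 2) * exp (- sqrt 2 * F z))"
        by (simp add: en_def algebra_simps)
      ultimately show ?thesis by linarith
    qed
    have cen: "continuous_on ?I en" unfolding en_def
      by (intro continuous_intros cV F(1) Cw_continuous[OF G(1)[of 0]]) auto
    define D where "D z = en z * exp (- Rt z)" for z
    have "D z1 \<le> D 0"
    proof (rule DERIV_nonpos_imp_decreasing_open[of 0 z1 D])
      show "continuous_on {0..z1} D" unfolding D_def
        by (rule continuous_on_subset[of ?I]) (auto intro!: continuous_intros cen cRt)
      fix z assume z: "0 < z" "z < z1"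
      have dR: "(Rt has_real_derivative rate z) (at z)"
        using integral_has_derivative_halfline[OF crate, of z] dat[OF z(1)] z
        by (simp add: Rt_def[abs_def] has_real_derivative_iff_has_vector_derivative)
      have "(D has_real_derivative en' z * exp (- Rt z) + (exp (- Rt z) * (- rate z)) * en z) (at z)"
        unfolding D_def[abs_def] by (intro DERIV_mult den[OF z] DERIV_fun_exp DERIV_minus dR)
      moreover have "en' z * exp (- Rt z) + (exp (- Rt z) * (- rate z)) * en z = (en' z - rate z * en z) * exp (- Rt z)" by (simp add: algebra_simps)
      moreover have "(en' z - rate z * en z) * exp (- Rt z) \<le> 0" using ineq[OF z(1)] by (simp add: mult_nonpos_nonneg)
      ultimately show "\<exists>y. (D has_real_derivative y) (at z) \<and> y \<le> 0" by metis
    qed (use z1 in simp)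
    moreover have "D 0 = K / sqrt 2" by (simp add: D_def en_def G(2) F0 Rt_def)
    ultimately have "en z1 * exp (- Rt z1) \<le> K / sqrt 2" by (simp add: D_def)
    then have "en z1 * exp (- Rt z1) * exp (Rt z1) \<le> K / sqrt 2 * exp (Rt z1)" by (intro mult_right_mono) auto
    then have e: "en z1 \<le> K / sqrt 2 * exp (Rt z1)" by (simp add: mult.assoc exp_minus)
    have "(F z1)\<^sup>2 / 2 \<le> en z1" using G(3)[OF z1] K by (simp add: en_def)
    then have "(F z1)\<^sup>2 \<le> 2 * (K / sqrt 2 * exp (Rt z1))" using e by linarith
    also have "2 * (K / sqrt 2 * exp (Rt z1)) = sqrt 2 * K * exp (Rt z1)"
    proof -
      have "2 / sqrt 2 = sqrt 2" by (simp add: real_div_sqrt)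
      then show ?thesis by (simp add: field_simps)
    qed
    finally have "sqrt ((F z1)\<^sup>2) \<le> Y z1" unfolding Y_def by (rule real_sqrt_le_mono)
    then show ?thesis by simp
  qed
  have above: "- M z < F z" if "z \<ge> 0" for z
  proof (rule ccontr)
    assume "\<not> - M z < F z"
    \<comment> \<open>The infimum of \<open>X\<close> is the first place where \<open>F\<close>
      would reach the truncation level. Up to there the truncated and the original equation agree,
      and the energy bound contradicts the margin 1.\<close>
    define X where "X = {x \<in> {0..z}. F x + M x \<le> 0}"
    have ne: "X \<noteq> {}" using \<open>\<not> - M z < F z\<close> that by (auto simp: X_def)
    have "continuous_on {0..z} (\<lambda>x. F x + M x)"
      by (rule continuous_on_subset[of ?I]) (auto intro!: continuous_intros F(1) cM)
    then have "closed ({0..z} \<inter> (\<lambda>x. F x + M x) -` {..0})" by (intro continuous_closed_preimage) auto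
    moreover have "X = {0..z} \<inter> (\<lambda>x. F x + M x) -` {..0}" by (auto simp: X_def)
    ultimately have cX: "closed X" by simp
    have bX: "bdd_below X" by (rule bdd_belowI[of _ 0]) (auto simp: X_def)
    have "Inf X \<in> X" by (rule closed_contains_Inf[OF ne bX cX])
    then have z1: "Inf X \<ge> 0" "F (Inf X) + M (Inf X) \<le> 0" "Inf X \<le> z" by (auto simp: X_def)
    have "F 0 + M 0 > 0" using F0 Y0[of 0] by (simp add: M_def)
    then have "Inf X > 0" using z1 by (cases "Inf X = 0") auto
    moreover have "- M x \<le> F x" if "0 \<le> x" "x < Inf X" for x
    proof (rule ccontr)
      assume "\<not> - M x \<le> F x"
      then have "x \<in> X" using that z1 by (simp add: X_def)
      then show False using cInf_lower[OF _ bX] that(2) by fastforce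
    qed
    ultimately have "\<bar>F (Inf X)\<bar> \<le> Y (Inf X)" by (rule energy)
    then show False using z1(2) by (simp add: M_def)
  qed
  have gF: "g z (F z) = (K * exp (- sqrt 2 * F z) - Q z * F z) / \<gamma> z" if "z \<ge> 0" for z
    using above[OF that] by (simp add: g_def max_absorb1 less_imp_le)
  \<comment> \<open>Each order of smoothness of \<open>F\<close> passes through \<open>g\<close> and
    the average to \<open>V F\<close>, which is the derivative of \<open>F\<close>.\<close>
  have CF: "Cw j ?I F" for j
  proof (induction j)
    case 0
    then show ?case using F(1) by simp
  next
    case (Suc j)
    have "Cw j ?I (\<lambda>z. K * exp (- sqrt 2 * F z) - Q z * F z)"
      by (intro Cw_diff Cw_mult Cw_const Cw_exp_compose Suc Q)
    then have "Cw j ?I (\<lambda>z. (K * exp (- sqrt 2 * F z) - Q z * F z) / \<gamma> z)"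
      by (rule Cw_divide[OF _ C\<gamma>]) (use \<gamma>pos in auto)
    then have "Cw j ?I (\<lambda>z. g z (F z))" using Cw_cong[of ?I "\<lambda>z. g z (F z)" "\<lambda>z. (K * exp (- sqrt 2 * F z) - Q z * F z) / \<gamma> z" j] gF by auto
    then have "Cw j ?I (\<lambda>z. E z * g z (F z))" by (rule Cw_mult[OF CE])
    then have "Cw j ?I (average \<kappa> (\<lambda>z. E z * g z (F z)))" by (rule Cw_average[OF I \<kappa>c])
    then have "Cw j ?I (V F)" unfolding V_def[abs_def] by (rule Cw_divide[OF _ CE]) (use Epos in auto)
    then show ?case by (rule Cw_SucI[rotated]) (use F' in auto)
  qed
  obtain F1 where F1: "\<And>z. z \<in> ?I \<Longrightarrow> (F has_vector_derivative F1 z) (at z within ?I)" "\<And>j. Cw j ?I F1"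
    using Cw_all_derivative[OF CF halfline_not_bot] by auto
  obtain F2 where F2: "\<And>z. z \<in> ?I \<Longrightarrow> (F1 has_vector_derivative F2 z) (at z within ?I)" "\<And>j. Cw j ?I F2"
    using Cw_all_derivative[OF F1(2) halfline_not_bot] by auto
  have e1: "F1 z = V F z" if "z \<ge> 0" for z
    using vector_derivative_unique_within[OF halfline_not_bot[OF that] F1(1) F'[OF that]] that by simp
  have e2: "F2 z = V' z" if z: "z > 0" for z
  proof -
    have "(F1 has_real_derivative F2 z) (at z)"
      using F2(1)[of z] dat[OF z] z by (simp add: has_real_derivative_iff_has_vector_derivative)
    moreover have "(F1 has_real_derivative V' z) (at z)"
      by (rule has_field_derivative_transform_within_open[OF dV[OF z], of "{0<..}"]) (use z e1 in auto)
    ultimately show ?thesis by (rule DERIV_unique)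
  qed
  \<comment> \<open>\<open>F2\<close> is identified with \<open>V'\<close> only for positive
    \<open>z\<close>; at the singular point the equation follows by continuity of all its
    terms.\<close>
  define dd where "dd z = G z * F2 z + k * F1 z + Q z * F z - K * exp (- sqrt 2 * F z)" for z
  have ddz: "dd z = 0" if z: "z > 0" for z
  proof -
    have "\<gamma> z * g z (F z) = K * exp (- sqrt 2 * F z) - Q z * F z" using gF[of z] \<gamma>pos[of z] z by simp
    then show ?thesis using ode[OF z] e1[of z] e2[OF z] z by (simp add: dd_def)
  qed
  have cdd: "continuous_on ?I dd" unfolding dd_def
    by (intro continuous_intros F(1) cQ Cw_continuous[OF G(1)[of 0]] Cw_continuous[OF F1(2)[of 0]] Cw_continuous[OF F2(2)[of 0]])
  have "(dd \<longlongrightarrow> dd 0) (at_right 0)"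
    using cdd unfolding continuous_on_def by (auto intro: tendsto_within_subset)
  moreover have "(dd \<longlongrightarrow> 0) (at_right 0)"
    by (rule tendsto_eventually) (use ddz in \<open>auto simp: eventually_at_filter\<close>)
  ultimately have dd0: "dd 0 = 0" by (rule tendsto_unique[OF trivial_limit_at_right_real])
  have fin: "dd z = 0" if "z \<ge> 0" for z using ddz[of z] dd0 that by (cases "z = 0") auto
  show thesis
  proof (rule that[of F F1 F2])
    show "Cw j ?I F" for j by (rule CF)
    show "(F has_vector_derivative F1 z) (at z within ?I)" "(F1 has_vector_derivative F2 z) (at z within ?I)" if "z \<ge> 0" for z
      using F1(1) F2(1) that by auto
    show "G z * F2 z + k * F1 z + Q z * F z = K * exp (- sqrt 2 * F z)" if "z \<ge> 0" for z
      using fin[OF that] by (simp add: dd_def)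
  qed
qed

section \<open>Radial solutions\<close>

text \<open>\<open>tangent_space\<close> wants curves defined for all times; outside
  \<open>J\<close> the curve is parked at its base point, which leaves the derivative there
  unchanged.\<close>

lemma curve_tangent:
  assumes "open J" "x0 \<in> J" "\<And>x. x \<in> J \<Longrightarrow> s x \<in> S" "(s has_vector_derivative v) (at (x0::real))"
  shows "v \<in> tangent_space S (s x0)"
proof -
  define \<gamma> where "\<gamma> t = s (if x0 + t \<in> J then x0 + t else x0)" for t
  have "((\<lambda>t. s (x0 + t)) has_vector_derivative v) (at 0)"
  proof -
    have "((\<lambda>t. x0 + t) has_vector_derivative 1) (at 0)" by (auto intro!: derivative_eq_intros)
    moreover have "(s has_vector_derivative v) (at (x0 + 0))" using assms(4) by simp
    ultimately have "(s \<circ> (\<lambda>t. x0 + t) has_vector_derivative 1 *\<^sub>R v) (at 0)" by (rule vector_diff_chain_at)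
    then show ?thesis by (simp add: o_def)
  qed
  moreover have "open ((\<lambda>t. x0 + t) -` J)" by (intro open_vimage assms(1) continuous_intros)
  ultimately have "(\<gamma> has_vector_derivative v) (at 0)"
    by (rule has_vector_derivative_transform_within_open) (use assms(2) in \<open>auto simp: \<gamma>_def\<close>)
  moreover have "\<gamma> t \<in> S" for t using assms(2,3) by (auto simp: \<gamma>_def)
  moreover have "\<gamma> 0 = s x0" by (simp add: \<gamma>_def)
  ultimately show ?thesis unfolding tangent_space_def by blast
qed

context radial_minimal
begin

definition "profile_point H = (THE q. q \<in> profile \<and> q \<bullet> q = H)"

lemma profile_point: "H \<ge> 1 \<Longrightarrow> profile_point H \<in> profile \<and> profile_point H \<bullet> profile_point H = H" and profile_point_eq: "q \<in> profile \<Longrightarrow> profile_point (q \<bullet> q) = q"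
proof -
  show 1: "profile_point H \<in> profile \<and> profile_point H \<bullet> profile_point H = H" if "H \<ge> 1" for H
    unfolding profile_point_def by (rule theI'[OF slice_levels(1)[OF that]])
  show "profile_point (q \<bullet> q) = q" if q: "q \<in> profile"
  proof -
    have h: "q \<bullet> q \<ge> 1" using infdist_facts(2) profile_pl(2)[OF q] by blast
    then show ?thesis using slice_levels(1)[OF h] 1[OF h] q by blast
  qed
qed

text \<open>The value of \<open>gradient_sq\<close> is the squared length of the gradient of \<open>|p|\<^sup>2\<close> along \<open>S\<close>.\<close>

definition "curvature_sq H = (second_fundamental_form_norm S (profile_point H))\<^sup>2"
definition "gradient_sq H = 4 * (H - (profile_point H \<bullet> (SOME \<nu>. unit_normal S (profile_point H) \<nu>))\<^sup>2)"

text \<open>A product of reflections preserving \<open>S\<close> carries \<open>hat q\<close> to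
  \<open>q\<close>, and both quantities are unchanged by such an isometry and by the sign of the
  normal.\<close>

lemma curvature_sq_eq: "q \<in> S \<Longrightarrow> curvature_sq (q \<bullet> q) = (second_fundamental_form_norm S q)\<^sup>2"
  and gradient_sq_eq: "q \<in> S \<Longrightarrow> unit_normal S q \<nu> \<Longrightarrow> gradient_sq (q \<bullet> q) = 4 * (q \<bullet> q - (q \<bullet> \<nu>)\<^sup>2)"
proof -
  assume q: "q \<in> S"
  have ph: "profile_point (q \<bullet> q) = hat q" using profile_point_eq[OF hat_profile[OF q]] by (simp only: hat_norm)
  have hS: "hat q \<in> S" using q by (simp only: hat_mem)
  obtain T T' where T: "orthogonal_transformation T" "orthogonal_transformation T'" "\<And>x. T (T' x) = x" "\<And>x. T' (T x) = x"
    "T (hat q) = q" "\<And>W x. radial_set W \<Longrightarrow> x \<in> W \<Longrightarrow> T x \<in> W" "\<And>W x. radial_set W \<Longrightarrow> x \<in> W \<Longrightarrow> T' x \<in> W"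
  proof (rule radial_transport[OF hat_norm(1)[of q] hat_norm(2)[of q]])
  qed (rule that; assumption)
  have inv: "\<And>x. x \<in> S \<Longrightarrow> T x \<in> S" "\<And>x. x \<in> S \<Longrightarrow> T' x \<in> S" using T(6,7) radial by blast+
  show "curvature_sq (q \<bullet> q) = (second_fundamental_form_norm S q)\<^sup>2"
    using second_fundamental_form_norm_isometry[OF hyper hS T(1-4) inv] by (simp add: curvature_sq_def ph T(5))
  define \<nu>' where "\<nu>' = (SOME \<nu>. unit_normal S (hat q) \<nu>)"
  have \<nu>': "unit_normal S (hat q) \<nu>'"
    unfolding \<nu>'_def using unit_normal_exists[OF hyper hS] by (metis someI)
  have "unit_normal S (T (hat q)) (T \<nu>')" by (rule unit_normal_isometry[OF hyper hS T(1-4) inv hS \<nu>'])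
  then have u: "unit_normal S q (T \<nu>')" by (simp only: T(5))
  assume "unit_normal S q \<nu>"
  then have "(q \<bullet> \<nu>)\<^sup>2 = (q \<bullet> T \<nu>')\<^sup>2" using unit_normal_square_unique[OF hyper q u] by blast
  also have "q \<bullet> T \<nu>' = T (hat q) \<bullet> T \<nu>'" by (simp only: T(5))
  also have "\<dots> = hat q \<bullet> \<nu>'" using T(1) by (simp add: orthogonal_transformation_def)
  finally show "gradient_sq (q \<bullet> q) = 4 * (q \<bullet> q - (q \<bullet> \<nu>)\<^sup>2)" by (simp add: gradient_sq_def ph \<nu>'_def)
qed

text \<open>Along any smooth curve in \<open>S\<close> near \<open>p\<close> the invariants are
  compositions with smooth ambient functions. This serves both for the curve parametrised by level
  and for the graph across the axis.\<close>

lemma invariants_along_curve: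
  assumes "p \<in> S"
  obtains U where "open U" "p \<in> U"
    "\<And>J s. (\<And>k. Cw k J s) \<Longrightarrow> s ` J \<subseteq> S \<inter> U \<Longrightarrow> (\<forall>k. Cw k J (\<lambda>x. curvature_sq (s x \<bullet> s x)) \<and> Cw k J (\<lambda>x. gradient_sq (s x \<bullet> s x)))"
proof -
  obtain U and A R :: "'a \<Rightarrow> real" where U: "open U" "p \<in> U" "\<And>k. Ck_on k U A" "\<And>k. Ck_on k U R"
    "\<And>q. q \<in> S \<inter> U \<Longrightarrow> (second_fundamental_form_norm S q)\<^sup>2 = A q"
    "\<And>q \<nu>. q \<in> S \<inter> U \<Longrightarrow> unit_normal S q \<nu> \<Longrightarrow> (q \<bullet> \<nu>)\<^sup>2 = R q"
  proof (rule curvature_locally_smooth[OF hyper assms])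
  qed (rule that; assumption)
  have G: "gradient_sq (q \<bullet> q) = 4 * (q \<bullet> q - R q)" if q: "q \<in> S \<inter> U" for q
  proof -
    obtain \<nu> where \<nu>: "unit_normal S q \<nu>" using unit_normal_exists[OF hyper] q by blast
    show ?thesis using gradient_sq_eq[OF _ \<nu>] U(6)[OF q \<nu>] q by simp
  qed
  have Q: "curvature_sq (q \<bullet> q) = A q" if q: "q \<in> S \<inter> U" for q using curvature_sq_eq[of q] U(5)[OF q] q by simp
  show thesis
  proof (rule that[OF U(1,2)], intro allI conjI)
    fix J k and s :: "real \<Rightarrow> 'a" assume s: "\<And>k. Cw k J s" "s ` J \<subseteq> S \<inter> U"
    have sU: "s ` J \<subseteq> U" using s(2) by blast
    have "Cw k J (\<lambda>x. A (s x))" by (rule Cw_compose_Ck[OF U(3) s(1) sU])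
    then show "Cw k J (\<lambda>x. curvature_sq (s x \<bullet> s x))" using Cw_cong[of J "\<lambda>x. curvature_sq (s x \<bullet> s x)" "\<lambda>x. A (s x)" k] Q s(2) by blast
    have "Cw k J (\<lambda>x. 4 * (s x \<bullet> s x - R (s x)))"
      by (intro Cw_mult Cw_const Cw_diff Cw_inner s(1) Cw_compose_Ck[OF U(4) s(1) sU])
    then show "Cw k J (\<lambda>x. gradient_sq (s x \<bullet> s x))" using Cw_cong[of J "\<lambda>x. gradient_sq (s x \<bullet> s x)" "\<lambda>x. 4 * (s x \<bullet> s x - R (s x))" k] G s(2) by blast
  qed
qed

lemma not_critical:
  assumes q: "p \<in> profile" "p \<bullet> p > 1" and ch: "a\<^sup>2 + b\<^sup>2 = 1" "unit_normal S p (pl a b)" "chart p (pl b (- a)) (pl a b) \<epsilon> \<delta> \<phi>"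
      "P1 p = 0 \<Longrightarrow> a = 0 \<and> b = 1" "p \<bullet> pl b (- a) \<ge> 0"
  shows "p \<bullet> pl b (- a) \<noteq> 0"
proof
  assume z: "p \<bullet> pl b (- a) = 0"
  obtain d where d: "d > 0" "\<And>H. p \<bullet> p < H \<Longrightarrow> H < p \<bullet> p + d \<Longrightarrow> \<exists>q q'. q \<noteq> q' \<and> q \<in> profile \<and> q' \<in> profile \<and> q \<bullet> q = H \<and> q' \<bullet> q' = H"
    using critical_two_levels[OF q(1) ch z slice_levels(2)[OF q] open_UNIV] by blast
  obtain x x' where "x \<noteq> x'" "x \<in> profile" "x' \<in> profile" "x \<bullet> x = p \<bullet> p + d/2" "x' \<bullet> x' = p \<bullet> p + d/2"
    using d(2)[of "p \<bullet> p + d/2"] d(1) by auto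
  then show False using slice_levels(1)[of "p \<bullet> p + d/2"] q(2) d(1) by auto
qed

lemma regular_level:
  assumes H: "H > 1"
  shows "gradient_sq H > 0" "\<exists>J. open J \<and> H \<in> J \<and> (\<forall>k. Cw k J curvature_sq \<and> Cw k J gradient_sq)"
proof -
  define p where "p = profile_point H"
  have p: "p \<in> profile" "p \<bullet> p = H" "p \<bullet> p > 1" using profile_point[of H] H by (auto simp: p_def)
  obtain a b \<epsilon> \<delta> \<phi> where ch: "a\<^sup>2 + b\<^sup>2 = 1" "unit_normal S p (pl a b)" "chart p (pl b (- a)) (pl a b) \<epsilon> \<delta> \<phi>"
      "P1 p = 0 \<Longrightarrow> a = 0 \<and> b = 1" "p \<bullet> pl b (- a) \<ge> 0" using chart_at[OF p(1)] by metis
  note nz = not_critical[OF p(1,3) ch]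
  define u v where "u = norm (P1 p)" and "v = norm (P2 p)"
  have ppl: "p = pl u v" using profile_pl(1)[OF p(1)] by (simp add: u_def v_def)
  have "gradient_sq H = 4 * (p \<bullet> p - (p \<bullet> pl a b)\<^sup>2)" using gradient_sq_eq[OF profile_pl(2)[OF p(1)] ch(2)] p(2) by simp
  \<comment> \<open>Pythagoras in the plane: the normal and tangent directions form an orthonormal
    basis of it.\<close>
  also have "p \<bullet> p - (p \<bullet> pl a b)\<^sup>2 = (p \<bullet> pl b (- a))\<^sup>2"
  proof -
    have "(u * u + v * v) * (a\<^sup>2 + b\<^sup>2) - (u * a + v * b)\<^sup>2 = (u * b + v * - a)\<^sup>2" by algebra
    then show ?thesis by (simp add: ppl pl_inner ch(1))
  qed
  finally show "gradient_sq H > 0" using nz by simp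
  obtain U where U: "open U" "p \<in> U"
    "\<And>J s. (\<And>k. Cw k J s) \<Longrightarrow> s ` J \<subseteq> S \<inter> U \<Longrightarrow> (\<forall>k. Cw k J (\<lambda>x. curvature_sq (s x \<bullet> s x)) \<and> Cw k J (\<lambda>x. gradient_sq (s x \<bullet> s x)))"
    using invariants_along_curve[OF profile_pl(2)[OF p(1)]] by metis
  obtain N e1 and g :: "real \<Rightarrow> 'a" where g: "e1 > 0" "\<And>k. Cw k {p \<bullet> p - e1<..<p \<bullet> p + e1} g"
    "\<And>H. \<bar>H - p \<bullet> p\<bar> < e1 \<Longrightarrow> g H \<in> profile \<and> g H \<in> N \<and> g H \<bullet> g H = H"
    using regular_local[OF p(1) ch nz] by metis
  let ?I = "{p \<bullet> p - e1<..<p \<bullet> p + e1}"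
  have gI: "g x \<in> profile" "g x \<bullet> g x = x" if "x \<in> ?I" for x using g(3)[of x] that by auto
  have HI: "H \<in> ?I" using p(2) g(1) by simp
  have gH: "g H = p" using profile_point_eq[OF gI(1)[OF HI]] gI(2)[OF HI] by (simp add: p_def)
  define J where "J = ?I \<inter> g -` U"
  have "open J" unfolding J_def by (rule continuous_open_preimage[OF Cw_continuous[OF g(2)] _ U(1)]) simp
  moreover have "H \<in> J" using HI U(2) by (simp add: J_def gH)
  moreover have "\<forall>k. Cw k J curvature_sq \<and> Cw k J gradient_sq"
  proof -
    have "Cw k J g" for k by (rule Cw_subset[OF g(2)]) (simp add: J_def)
    moreover have "g ` J \<subseteq> S \<inter> U" using gI profile_pl(2) by (auto simp: J_def)
    ultimately have "\<forall>k. Cw k J (\<lambda>x. curvature_sq (g x \<bullet> g x)) \<and> Cw k J (\<lambda>x. gradient_sq (g x \<bullet> g x))" by (rule U(3))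
    moreover have "Cw k J (\<lambda>x. curvature_sq (g x \<bullet> g x)) = Cw k J curvature_sq" "Cw k J (\<lambda>x. gradient_sq (g x \<bullet> g x)) = Cw k J gradient_sq" for k
      by (rule Cw_cong, simp add: J_def gI)+
    ultimately show ?thesis by simp
  qed
  ultimately show "\<exists>J. open J \<and> H \<in> J \<and> (\<forall>k. Cw k J curvature_sq \<and> Cw k J gradient_sq)" by blast
qed

text \<open>Near the axis the profile curve is a graph over \<open>x = |P1 q|\<close>, and the smooth coordinate on the
  orbit space is \<open>x\<^sup>2\<close>: invariance makes all functions of \<open>x\<close> even.\<close>

lemma axis_data:
  obtains N b \<rho> and hh :: "real \<Rightarrow> real" where "open N" "\<And>q. q \<in> S \<Longrightarrow> q \<bullet> q = 1 \<Longrightarrow> q \<in> N" "b > 0" "\<And>k. Cw k {0..<b} hh" "\<And>a. a \<in> {0..<b} \<Longrightarrow> hh a \<ge> 1"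
    "\<And>q. q \<in> N \<Longrightarrow> P1 q \<bullet> P1 q \<in> {0..<b}" "\<And>q. q \<in> S \<Longrightarrow> q \<in> N \<Longrightarrow> q \<bullet> q = hh (P1 q \<bullet> P1 q)"
    "\<rho> > 1" "\<And>k. Cw k {1..\<rho>} curvature_sq" "\<And>k. Cw k {1..\<rho>} gradient_sq" "gradient_sq 1 = 0" "(gradient_sq has_real_derivative 4 * (m1 + m2 - 1) / m1) (at 1 within {1..})"
proof -
  define p where "p = profile_point 1"
  have p: "p \<in> profile" "p \<bullet> p = 1" using profile_point[of 1] by (auto simp: p_def)
  have P1p: "P1 p = 0" by (rule slice_levels(3)[OF p])
  note pS = profile_pl(2)[OF p(1)]
  have pl_ef: "pl 1 (- 0) = e" "pl 0 1 = f" by (simp_all add: pl_def)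
  obtain \<epsilon> \<delta> \<phi> where ch: "unit_normal S p f" "chart p e f \<epsilon> \<delta> \<phi>"
  proof -
    obtain a b \<epsilon> \<delta> \<phi> where c: "a\<^sup>2 + b\<^sup>2 = 1" "unit_normal S p (pl a b)" "chart p (pl b (- a)) (pl a b) \<epsilon> \<delta> \<phi>"
      "P1 p = 0 \<Longrightarrow> a = 0 \<and> b = 1" "p \<bullet> pl b (- a) \<ge> 0" using chart_at[OF p(1)] by metis
    have "a = 0" "b = 1" using c(4) P1p by auto
    then show thesis using c(2,3) that by (simp only: pl_ef)
  qed
  note eps = chartD(1)[OF ch(2)]
  define s where "s = sig p e f \<phi>"
  define et where "et = eta p e f \<phi>"
  have et: "et x = s x \<bullet> s x" for x by (simp add: et_def s_def eta_def)
  have pe: "p = pl 0 1"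
  proof -
    have q: "p = pl 0 (norm (P2 p))" using profile_pl(1)[OF p(1)] P1p by simp
    have "(norm (P2 p))\<^sup>2 = 1" using norm_split[of p] p(2) P1p by simp
    then have "norm (P2 p) = 1" by (simp add: power2_eq_1_iff) (use norm_ge_zero[of "P2 p"] in linarith)
    then show ?thesis using q by simp
  qed
  have s_pl: "s x = pl x (1 + \<phi> x)" for x by (simp add: s_def sig_def pe pl_def algebra_simps)
  have et_eq: "et x = x\<^sup>2 + (1 + \<phi> x)\<^sup>2" for x by (simp add: et s_pl pl_inner power2_eq_square)
  have sS: "s x \<in> S" if "\<bar>x\<bar> < \<epsilon>" for x unfolding s_def by (rule chart_point[OF ch(2) that])
  \<comment> \<open>The mirror image of a curve point lies on the same orbit, hence in
    \<open>S\<close>, and the graph has only one point over \<open>- x\<close>.\<close>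
  have even_phi: "\<phi> (- x) = \<phi> x" if x: "\<bar>x\<bar> < \<epsilon>" for x
  proof -
    have "pl (- x) (1 + \<phi> x) \<in> S"
    proof -
      have "hat (pl (- x) (1 + \<phi> x)) = hat (s x)" by (simp add: hat_pl s_pl)
      then show ?thesis using sS[OF x] hat_mem by metis
    qed
    then have "p + (- x) *\<^sub>R e + \<phi> x *\<^sub>R f \<in> S" by (simp add: pe pl_def algebra_simps)
    then show ?thesis using chartD(6)[OF ch(2), of "- x" "\<phi> x"] chartD(7)[OF ch(2) x] x by simp
  qed
  have even_et: "et (- x) = et x" if "\<bar>x\<bar> < \<epsilon>" for x by (simp add: et_eq even_phi[OF that])
  have Cs: "Cw k {-\<epsilon><..<\<epsilon>} s" and Cet: "Cw k {-\<epsilon><..<\<epsilon>} et" for k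
    unfolding s_def et_def by (rule Cw_sig[OF ch(2)])+
  have s0: "s 0 = p" by (simp add: s_pl pe chartD(4)[OF ch(2)])
  obtain U where U: "open U" "p \<in> U"
    "\<And>J s. (\<And>k. Cw k J s) \<Longrightarrow> s ` J \<subseteq> S \<inter> U \<Longrightarrow> (\<forall>k. Cw k J (\<lambda>x. curvature_sq (s x \<bullet> s x)) \<and> Cw k J (\<lambda>x. gradient_sq (s x \<bullet> s x)))"
    using invariants_along_curve[OF pS] by metis
  obtain r where r: "0 < r" "r \<le> \<epsilon>" "\<And>x. \<bar>x\<bar> < r \<Longrightarrow> s x \<in> U" "\<And>x. \<bar>x\<bar> < r \<Longrightarrow> \<phi> x > -1"
  proof -
    have "open ({-\<epsilon><..<\<epsilon>} \<inter> s -` U)" by (rule continuous_open_preimage[OF Cw_continuous[OF Cs] _ U(1)]) simp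
    moreover have "open ({-\<epsilon><..<\<epsilon>} \<inter> \<phi> -` {-1<..})" by (rule continuous_open_preimage[OF Cw_continuous[OF chartD(3)[OF ch(2)]]]) auto
    ultimately have "open ({-\<epsilon><..<\<epsilon>} \<inter> s -` U \<inter> ({-\<epsilon><..<\<epsilon>} \<inter> \<phi> -` {-1<..}))" by (rule open_Int)
    moreover have "0 \<in> {-\<epsilon><..<\<epsilon>} \<inter> s -` U \<inter> ({-\<epsilon><..<\<epsilon>} \<inter> \<phi> -` {-1<..})"
      using eps U(2) by (simp add: s0 chartD(4)[OF ch(2)])
    ultimately obtain r where "r > 0" "ball 0 r \<subseteq> {-\<epsilon><..<\<epsilon>} \<inter> s -` U \<inter> ({-\<epsilon><..<\<epsilon>} \<inter> \<phi> -` {-1<..})"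
      using open_contains_ball by metis
    then show thesis by (intro that[of "min r \<epsilon>"]) (use eps in \<open>auto simp: subset_iff dist_real_def\<close>)
  qed
  let ?I = "{-r<..<r}"
  have I: "x \<in> ?I \<longleftrightarrow> \<bar>x\<bar> < r" for x by auto
  have Is: "?I \<subseteq> {-\<epsilon><..<\<epsilon>}" using r(2) by auto
  have sI: "s ` ?I \<subseteq> S \<inter> U" using r(2,3) sS by (auto simp: abs_less_iff)
  have inv: "\<forall>k. Cw k ?I (\<lambda>x. curvature_sq (et x)) \<and> Cw k ?I (\<lambda>x. gradient_sq (et x))"
    unfolding et by (rule U(3)[OF Cw_subset[OF Cs Is] sI])
  \<comment> \<open>The squared distance as a function of \<open>a = |P1 q|^2\<close>. It is smooth
    up to \<open>a = 0\<close> because \<open>et\<close> is even.\<close>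
  define hh where "hh a = et (sqrt a)" for a
  have ev: "\<forall>x\<in>?I. et (- x) = et x" using even_et r(2) by auto
  have Chh: "Cw k {0..<r\<^sup>2} hh" for k unfolding hh_def[abs_def]
    by (rule even_Cw_sqrt[OF r(1)]) (use Cw_subset[OF Cet Is] ev in auto)
  have CQ: "Cw k {0..<r\<^sup>2} (\<lambda>a. curvature_sq (hh a))" for k unfolding hh_def[abs_def]
    by (rule even_Cw_sqrt[OF r(1), of "\<lambda>x. curvature_sq (et x)"]) (use inv ev in simp_all)
  have CG: "Cw k {0..<r\<^sup>2} (\<lambda>a. gradient_sq (hh a))" for k unfolding hh_def[abs_def]
    by (rule even_Cw_sqrt[OF r(1), of "\<lambda>x. gradient_sq (et x)"]) (use inv ev in simp_all)
  have sq: "sqrt a \<in> ?I \<and> 0 \<le> sqrt a" if "a \<in> {0..<r\<^sup>2}" for a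
    using that r(1) by (auto intro: real_less_lsqrt order.strict_trans2[of _ 0])
  have hh_sq: "hh (x\<^sup>2) = et x" if "x \<ge> 0" for x using that by (simp add: hh_def)
  have hh1: "hh a \<ge> 1" if "a \<in> {0..<r\<^sup>2}" for a
    unfolding hh_def et using infdist_facts(2) sI sq[OF that] by blast
  have hh0: "hh 0 = 1" by (simp add: hh_def et s0 p(2))
  obtain h1 h2 where h: "\<And>x. \<bar>x\<bar> < \<epsilon> \<Longrightarrow> (et has_real_derivative h1 x) (at x)"
    "\<And>k. Cw k {-\<epsilon><..<\<epsilon>} h1" "h1 0 = 2 * (p \<bullet> e)" "(h1 has_real_derivative h2) (at 0)"
  proof (rule chart_derivatives[OF ch(2), folded et_def])
  qed (rule that; assumption)
  have h10: "h1 0 = 0" using h(3) by (simp add: pe pl_def inner_add_left ef)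
  have h2: "h2 = 2 * (m1 + m2 - 1) / m1"
    by (rule axis_point_second_derivative[OF p(1) P1p ch, folded et_def, OF h(1) h10 h(4)])
  have h2p: "h2 > 0" using h2 m1(2) m2(2) by simp
  have lim_h1: "((\<lambda>x. h1 x / x) \<longlongrightarrow> h2) (at_right 0)"
    using h(4) h10 by (auto simp: has_field_derivative_iff intro: tendsto_within_subset)
  have r2: "r\<^sup>2 > 0" using r(1) by simp
  have nbot: "at x within {0..<r\<^sup>2} \<noteq> bot" if "x \<in> {0..<r\<^sup>2}" for x
  proof (rule interval_at_within_neq_bot[of _ 0 "r\<^sup>2 / 2"])
  qed (use that r2 in auto)
  obtain hh' where hh': "\<And>a. a \<in> {0..<r\<^sup>2} \<Longrightarrow> (hh has_vector_derivative hh' a) (at a within {0..<r\<^sup>2})" "\<And>k. Cw k {0..<r\<^sup>2} hh'"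
    using Cw_all_derivative[OF Chh nbot] by blast
  have sq_lim: "filterlim (\<lambda>x. x\<^sup>2) (at 0 within {0..<r\<^sup>2}) (at_right (0::real))"
  proof -
    have "((\<lambda>x::real. x\<^sup>2) \<longlongrightarrow> 0\<^sup>2) (at_right 0)" by (intro tendsto_intros)
    moreover have "\<forall>\<^sub>F x in at_right (0::real). x\<^sup>2 \<in> {0..<r\<^sup>2} \<and> x\<^sup>2 \<noteq> 0"
      unfolding eventually_at_right_field
      by (rule exI[of _ r]) (use r(1) in \<open>auto intro: power_strict_mono\<close>)
    ultimately show ?thesis by (auto simp: filterlim_at)
  qed
  \<comment> \<open>The chain rule for \<open>et x = hh (x\<^sup>2)\<close>. Letting
    \<open>x\<close> tend to 0 gives \<open>2 * hh' 0 = h2\<close>, which is positive, so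
    \<open>hh\<close> is invertible near 0.\<close>
  have h1_eq: "\<forall>\<^sub>F x in at_right 0. h1 x / x = 2 * hh' (x\<^sup>2)"
    unfolding eventually_at_right_field
  proof (intro exI[of _ r] conjI allI impI)
    fix x assume x: "0 < x" "x < r"
    have x2: "x\<^sup>2 \<in> {0<..<r\<^sup>2}" using x by (auto intro: power_strict_mono)
    then have "at (x\<^sup>2) within {0..<r\<^sup>2} = at (x\<^sup>2)" by (intro at_within_interior) simp
    then have "(hh has_real_derivative hh' (x\<^sup>2)) (at (x\<^sup>2))"
      using hh'(1)[of "x\<^sup>2"] x2 by (simp add: has_real_derivative_iff_has_vector_derivative)
    then have "((\<lambda>x. hh (x\<^sup>2)) has_real_derivative hh' (x\<^sup>2) * (2 * x)) (at x)"
      by (rule DERIV_cong[OF DERIV_chain2[OF _ DERIV_power[OF DERIV_ident]]]) simp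
    then have "(et has_real_derivative hh' (x\<^sup>2) * (2 * x)) (at x)"
      by (rule has_field_derivative_transform_within_open[of _ _ _ "{0<..}"]) (use x hh_sq in auto)
    moreover have "(et has_real_derivative h1 x) (at x)" by (rule h(1)) (use x r(2) in simp)
    ultimately have "h1 x = hh' (x\<^sup>2) * (2 * x)" by (metis DERIV_unique)
    then show "h1 x / x = 2 * hh' (x\<^sup>2)" using x by simp
  qed (rule r(1))
  have "(hh' \<longlongrightarrow> hh' 0) (at 0 within {0..<r\<^sup>2})" using Cw_continuous[OF hh'(2)] r2 unfolding continuous_on_def by simp
  from filterlim_compose[OF this sq_lim] have "((\<lambda>x. 2 * hh' (x\<^sup>2)) \<longlongrightarrow> 2 * hh' 0) (at_right 0)" by (intro tendsto_intros)
  then have "((\<lambda>x. h1 x / x) \<longlongrightarrow> 2 * hh' 0) (at_right 0)" by (rule Lim_transform_eventually) (use h1_eq in \<open>auto elim: eventually_mono\<close>)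
  then have hh'0: "2 * hh' 0 = h2" by (rule tendsto_unique[OF trivial_limit_at_right_real _ lim_h1])
  obtain b where b: "0 < b" "b < r\<^sup>2" "\<And>a. a \<in> {0..b} \<Longrightarrow> hh' a > 0"
  proof -
    have "hh' 0 > 0" using hh'0 h2p by simp
    then obtain d where d: "d > 0" "\<And>a. a \<in> {0..<r\<^sup>2} \<Longrightarrow> dist a 0 < d \<Longrightarrow> dist (hh' a) (hh' 0) < hh' 0"
      using Cw_continuous[OF hh'(2)[of 0]] r2 unfolding continuous_on_iff by (metis atLeastLessThan_iff order_refl)
    have "hh' a > 0" if "a \<in> {0..min (d/2) (r\<^sup>2/2)}" for a
    proof -
      have a: "0 \<le> a" "a \<le> d/2" "a \<le> r\<^sup>2/2" using that by auto
      have "dist (hh' a) (hh' 0) < hh' 0"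
      proof (rule d(2))
        have "a < r\<^sup>2" using a(3) r2 by linarith
        then show "a \<in> {0..<r\<^sup>2}" using a(1) by simp
      qed (use a d(1) in simp)
      then show ?thesis by (simp add: dist_real_def abs_less_iff)
    qed
    moreover have "min (d/2) (r\<^sup>2/2) < r\<^sup>2" using r2 by linarith
    ultimately show thesis by (intro that[of "min (d/2) (r\<^sup>2/2)"]) (use d(1) r2 in auto)
  qed
  have bs: "{0..b} \<subseteq> {0..<r\<^sup>2}" using b(2) by auto
  obtain y where y: "\<And>k. Cw k {hh 0..hh b} y" "\<And>H. H \<in> {hh 0..hh b} \<Longrightarrow> y H \<in> {0..b} \<and> hh (y H) = H"
    "\<And>x. x \<in> {0..b} \<Longrightarrow> y (hh x) = x \<and> hh x \<in> {hh 0..hh b}" "hh 0 < hh b"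
  proof (rule smooth_inverse_interval[OF b(1), of hh hh'])
    show "(hh has_real_derivative hh' x) (at x within {0..b})" if "x \<in> {0..b}" for x
      using has_vector_derivative_within_subset[OF hh'(1) bs] that bs by (auto simp: has_real_derivative_iff_has_vector_derivative)
    show "Cw k {0..b} hh'" for k by (rule Cw_subset[OF hh'(2) bs])
  qed (use b(3) in auto)
  note y = y[unfolded hh0]
  \<comment> \<open>The smooth inverse \<open>y\<close> of \<open>hh\<close> converts smoothness in
    \<open>a\<close> into smoothness in the level.\<close>
  have glue: "Cw k {1..hh b} X" if X: "\<And>k. Cw k {0..<r\<^sup>2} (\<lambda>a. X (hh a))" for X :: "real \<Rightarrow> real" and k
  proof -
    have "Cw k {1..hh b} (\<lambda>H. X (hh (y H)))"
      by (rule Cw_compose_real[OF X y(1)]) (use y(2) bs in blast)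
    then show ?thesis using Cw_cong[of "{1..hh b}" "\<lambda>H. X (hh (y H))" X k] y(2) by simp
  qed
  have CGG: "Cw k {1..hh b} gradient_sq" for k by (rule glue[OF CG])
  have GG1: "gradient_sq 1 = 0" using gradient_sq_eq[OF pS ch(1)] p(2) by (simp add: pe pl_def inner_add_left ef)
  obtain \<phi>' where \<phi>': "\<And>x. x \<in> ?I \<Longrightarrow> (\<phi> has_real_derivative \<phi>' x) (at x)" "\<And>k. Cw k ?I \<phi>'" "\<phi>' 0 = 0"
  proof -
    have nb: "at x within ?I = at x" if "x \<in> ?I" for x by (rule at_within_open[OF that]) simp
    then have nb': "at x within ?I \<noteq> bot" if "x \<in> ?I" for x using that by simp
    obtain \<phi>' where \<phi>': "\<And>x. x \<in> ?I \<Longrightarrow> (\<phi> has_vector_derivative \<phi>' x) (at x within ?I)" "\<And>k. Cw k ?I \<phi>'"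
      using Cw_all_derivative[OF Cw_subset[OF chartD(3)[OF ch(2)] Is] nb'] by blast
    have d: "(\<phi> has_real_derivative \<phi>' x) (at x)" if "x \<in> ?I" for x
      using \<phi>'(1)[OF that] nb[OF that] by (simp add: has_real_derivative_iff_has_vector_derivative)
    have "\<phi>' 0 = 0" by (rule DERIV_unique[OF d chartD(5)[OF ch(2)]]) (use r(1) in simp)
    with d \<phi>'(2) show thesis by (rule that)
  qed
  \<comment> \<open>By invariance the gradient of \<open>|.|^2\<close> along \<open>S\<close> is
    tangent to the curve, so its length is the derivative \<open>h1 x\<close> divided by the speed
    of the parametrisation.\<close>
  have GGx: "gradient_sq (et x) = (h1 x)\<^sup>2 / (1 + (\<phi>' x)\<^sup>2)" if x: "0 < x" "x < r" for x
  proof -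
    have xI: "x \<in> ?I" using x by simp
    have "s x \<in> S" using sI xI by blast
    moreover have "1 + \<phi> x > 0" using r(4)[of x] x by simp
    ultimately have sG: "s x \<in> profile" unfolding s_pl by (intro pl_profile) (use x in auto)
    obtain \<nu> where \<nu>: "unit_normal S (s x) \<nu>" using unit_normal_exists[OF hyper \<open>s x \<in> S\<close>] by blast
    obtain a' b' where ab: "\<nu> = pl a' b'" "a'\<^sup>2 + b'\<^sup>2 = 1" using normal_in_plane[OF sG \<nu>] by metis
    have "(s has_vector_derivative pl 1 (\<phi>' x)) (at x)"
    proof -
      have p': "(\<phi> has_vector_derivative \<phi>' x) (at x)" using \<phi>'(1)[OF xI] by (simp add: has_real_derivative_iff_has_vector_derivative)
      have "((\<lambda>x. x *\<^sub>R e + (1 + \<phi> x) *\<^sub>R f) has_vector_derivative 1 *\<^sub>R e + (0 + \<phi>' x) *\<^sub>R f) (at x)"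
        by (intro has_vector_derivative_add bounded_linear.has_vector_derivative[OF bounded_linear_scaleR_left] has_vector_derivative_id has_vector_derivative_const p')
      moreover have "s = (\<lambda>x. x *\<^sub>R e + (1 + \<phi> x) *\<^sub>R f)" by (simp add: fun_eq_iff s_pl pl_def)
      ultimately show ?thesis by (simp add: pl_def)
    qed
    then have "pl 1 (\<phi>' x) \<in> tangent_space S (s x)"
      by (rule curve_tangent[of ?I, rotated 3]) (use xI sI in auto)
    then have "\<nu> \<bullet> pl 1 (\<phi>' x) = 0" using \<nu> by (simp add: unit_normal_def)
    then have a': "a' = - (b' * \<phi>' x)" by (simp add: ab(1) pl_inner)
    have "b'\<^sup>2 * (1 + (\<phi>' x)\<^sup>2) = 1" using ab(2) a' by (simp add: algebra_simps power2_eq_square)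
    moreover have pos: "1 + (\<phi>' x)\<^sup>2 > 0" by (simp add: add_pos_nonneg)
    ultimately have b': "b'\<^sup>2 = 1 / (1 + (\<phi>' x)\<^sup>2)" by (simp add: field_simps)
    have "(et has_real_derivative 2 * x + 2 * ((1 + \<phi> x) * \<phi>' x)) (at x)"
      unfolding et_eq[abs_def]
      by (rule DERIV_cong[OF DERIV_add[OF DERIV_power[OF DERIV_ident] DERIV_power[OF DERIV_add[OF DERIV_const \<phi>'(1)[OF xI]]]]]) simp
    then have h1x: "h1 x = 2 * (x + (1 + \<phi> x) * \<phi>' x)" using DERIV_unique[OF h(1)[of x]] x r(2) by fastforce
    have "gradient_sq (et x) = 4 * (x\<^sup>2 + (1 + \<phi> x)\<^sup>2 - (x * a' + (1 + \<phi> x) * b')\<^sup>2)"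
      using gradient_sq_eq[OF \<open>s x \<in> S\<close> \<nu>] by (simp add: et[symmetric] et_eq) (simp add: s_pl ab(1) pl_inner)
    also have "(x * a' + (1 + \<phi> x) * b')\<^sup>2 = b'\<^sup>2 * (1 + \<phi> x - x * \<phi>' x)\<^sup>2" unfolding a' by algebra
    also have "4 * (x\<^sup>2 + (1 + \<phi> x)\<^sup>2 - b'\<^sup>2 * (1 + \<phi> x - x * \<phi>' x)\<^sup>2) = (h1 x)\<^sup>2 / (1 + (\<phi>' x)\<^sup>2)"
    proof -
      have "4 * ((x\<^sup>2 + (1 + \<phi> x)\<^sup>2) * (1 + (\<phi>' x)\<^sup>2) - (1 + \<phi> x - x * \<phi>' x)\<^sup>2) = (h1 x)\<^sup>2" unfolding h1x by algebra
      then show ?thesis unfolding b' using pos by (simp add: field_simps)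
    qed
    finally show ?thesis .
  qed
  obtain g where g: "(gradient_sq has_real_derivative g) (at 1 within {1..hh b})"
  proof -
    have "\<exists>G'. \<forall>x\<in>{1..hh b}. (gradient_sq has_vector_derivative G' x) (at x within {1..hh b})" using CGG[of "Suc 0"] by auto
    then obtain G' where G': "\<And>x. x \<in> {1..hh b} \<Longrightarrow> (gradient_sq has_vector_derivative G' x) (at x within {1..hh b})" by blast
    then show thesis using y(4) by (intro that[of "G' 1"]) (simp add: has_real_derivative_iff_has_vector_derivative)
  qed
  \<comment> \<open>Two computations of the limit of \<open>gradient_sq / a\<close> at the axis: the
    chain rule in \<open>a\<close> gives \<open>hh' 0 * g\<close>, and \<open>GGx\<close> with
    \<open>a = x\<^sup>2\<close> gives \<open>h2\<^sup>2\<close>. Since \<open>hh' 0\<close> is half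
    of \<open>h2\<close>, the slope is \<open>2 * h2\<close>.\<close>
  have "g = 2 * h2"
  proof -
    have "(gradient_sq \<circ> hh has_vector_derivative hh' 0 *\<^sub>R g) (at 0 within {0..b})"
    proof (rule vector_diff_chain_within)
      show "(hh has_vector_derivative hh' 0) (at 0 within {0..b})"
        by (rule has_vector_derivative_within_subset[OF hh'(1) bs]) (use r2 in simp)
      show "(gradient_sq has_vector_derivative g) (at (hh 0) within hh ` {0..b})"
        unfolding hh0 by (rule has_vector_derivative_within_subset[of _ _ _ "{1..hh b}"])
          (use g y(3) in \<open>auto simp: has_real_derivative_iff_has_vector_derivative\<close>)
    qed
    then have "((\<lambda>a. gradient_sq (hh a)) has_real_derivative hh' 0 * g) (at 0 within {0..b})"
      by (simp add: has_real_derivative_iff_has_vector_derivative o_def)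
    then have l: "((\<lambda>a. gradient_sq (hh a) / a) \<longlongrightarrow> hh' 0 * g) (at 0 within {0..b})"
      by (simp add: has_field_derivative_iff hh0 GG1)
    have "at 0 within {0..b} = at 0 within {0..<r\<^sup>2}"
      by (rule at_within_nhd[of 0 "{-1<..<b}"]) (use b in auto)
    then have "((\<lambda>a. gradient_sq (hh a) / a) \<longlongrightarrow> hh' 0 * g) (at 0 within {0..<r\<^sup>2})" using l by simp
    from filterlim_compose[OF this sq_lim] have l1: "((\<lambda>x. gradient_sq (hh (x\<^sup>2)) / x\<^sup>2) \<longlongrightarrow> hh' 0 * g) (at_right 0)" .
    have "(\<phi>' \<longlongrightarrow> \<phi>' 0) (at 0)"
      using Cw_continuous[OF \<phi>'(2)[of 0]] r(1) by (auto simp: continuous_on_eq_continuous_at isCont_def)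
    then have "(\<phi>' \<longlongrightarrow> 0) (at_right 0)" using \<phi>'(3) by (auto intro: tendsto_within_subset)
    then have "((\<lambda>x. (h1 x / x)\<^sup>2 / (1 + (\<phi>' x)\<^sup>2)) \<longlongrightarrow> h2\<^sup>2 / (1 + 0\<^sup>2)) (at_right 0)"
      by (intro tendsto_intros lim_h1) auto
    moreover have "\<forall>\<^sub>F x in at_right 0. (h1 x / x)\<^sup>2 / (1 + (\<phi>' x)\<^sup>2) = gradient_sq (hh (x\<^sup>2)) / x\<^sup>2"
      unfolding eventually_at_right_field
      by (rule exI[of _ r]) (use r(1) hh_sq GGx in \<open>auto simp: power_divide\<close>)
    ultimately have "((\<lambda>x. gradient_sq (hh (x\<^sup>2)) / x\<^sup>2) \<longlongrightarrow> h2\<^sup>2 / (1 + 0\<^sup>2)) (at_right 0)" by (rule Lim_transform_eventually)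
    then have "hh' 0 * g = h2\<^sup>2 / (1 + 0\<^sup>2)" by (rule tendsto_unique[OF trivial_limit_at_right_real l1])
    moreover have "h2 * g = 2 * (hh' 0 * g)" using hh'0 by simp
    ultimately have "h2 * g = h2 * (2 * h2)" by (simp only: power2_eq_square) simp
    then show ?thesis using h2p by simp
  qed
  moreover have "at 1 within {1..hh b} = at 1 within {1..}"
    by (rule at_within_nhd[of 1 "{..<hh b}"]) (use y(4) in auto)
  ultimately have gg: "(gradient_sq has_real_derivative 4 * (m1 + m2 - 1) / m1) (at 1 within {1..})" using g h2 by simp
  define N where "N = {q. \<bar>(hat q - p) \<bullet> e\<bar> < r \<and> \<bar>(hat q - p) \<bullet> f\<bar> < \<delta>}"
  have x: "(hat q - p) \<bullet> e = norm (P1 q)" for q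
    unfolding hat_def pe pl_diff by (subst pl_ef(1)[symmetric]) (simp add: pl_inner)
  have PP: "P1 q \<bullet> P1 q = (norm (P1 q))\<^sup>2" for q by (simp add: dot_square_norm)
  show thesis
  proof (rule that[of N "r\<^sup>2" hh "hh b"])
    show "open N" unfolding N_def by (rule open_chart_nbhd)
    show "P1 q \<bullet> P1 q \<in> {0..<r\<^sup>2}" if "q \<in> N" for q
      using that unfolding PP by (auto simp: N_def x intro: power_strict_mono)
    show "q \<in> N" if q: "q \<in> S" "q \<bullet> q = 1" for q
    proof -
      have "hat q = p" using profile_point_eq[OF hat_profile[OF q(1)]] q(2) by (simp add: hat_norm p_def)
      then show ?thesis using r(1) chartD(2)[OF ch(2)] by (simp add: N_def)
    qed
    show "q \<bullet> q = hh (P1 q \<bullet> P1 q)" if q: "q \<in> S" "q \<in> N" for q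
    proof -
      have "hat q = s ((hat q - p) \<bullet> e)" unfolding s_def
        by (rule chart_hat[OF ch(2) pe pl_ef(2)[symmetric] pl_ef(1)[symmetric] _ q(1)]) (use q(2) r(2) in \<open>auto simp: N_def\<close>)
      then have "hat q = s (norm (P1 q))" by (simp only: x)
      then have "q \<bullet> q = et (norm (P1 q))" using hat_norm(3)[of q] by (simp add: et)
      then show ?thesis unfolding PP by (simp add: hh_sq)
    qed
  qed (use r2 Chh hh1 y(4) glue[OF CQ] CGG GG1 gg in auto)
qed

lemma radial_solution:
  assumes K: "K > 0"
  shows "\<exists>F. smooth_fun_on S (\<lambda>q. F (q \<bullet> q)) \<and>
    (\<forall>p\<in>S. laplace_beltrami S (\<lambda>q. F (q \<bullet> q)) p + (second_fundamental_form_norm S p)\<^sup>2 * F (p \<bullet> p) = K * exp (- sqrt 2 * F (p \<bullet> p)))"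
proof -
  obtain N b \<rho> and hh :: "real \<Rightarrow> real" where ad: "open N" "\<And>q. q \<in> S \<Longrightarrow> q \<bullet> q = 1 \<Longrightarrow> q \<in> N" "b > 0" "\<And>k. Cw k {0..<b} hh" "\<And>a. a \<in> {0..<b} \<Longrightarrow> hh a \<ge> 1"
    "\<And>q. q \<in> N \<Longrightarrow> P1 q \<bullet> P1 q \<in> {0..<b}" "\<And>q. q \<in> S \<Longrightarrow> q \<in> N \<Longrightarrow> q \<bullet> q = hh (P1 q \<bullet> P1 q)"
    "\<rho> > 1" "\<And>k. Cw k {1..\<rho>} curvature_sq" "\<And>k. Cw k {1..\<rho>} gradient_sq" "gradient_sq 1 = 0" "(gradient_sq has_real_derivative 4 * (m1 + m2 - 1) / m1) (at 1 within {1..})"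
  proof (rule axis_data)
  qed (rule that; assumption)
  have loc: "\<exists>J. open J \<and> H \<in> J \<and> (\<forall>k. Cw k ({1..} \<inter> J) curvature_sq \<and> Cw k ({1..} \<inter> J) gradient_sq)" if "H \<in> {1..}" for H
  proof (cases "H = 1")
    case True
    have "{1..} \<inter> {..<\<rho>} \<subseteq> {1..\<rho>}" by auto
    then show ?thesis using True ad(8) Cw_subset[OF ad(9)] Cw_subset[OF ad(10)] by (intro exI[of _ "{..<\<rho>}"]) auto
  next
    case False
    then have "H > 1" using that by auto
    then obtain J where "open J" "H \<in> J" "\<forall>k. Cw k J curvature_sq \<and> Cw k J gradient_sq" using regular_level(2) by blast
    then show ?thesis using Cw_subset[of _ J _ "{1..} \<inter> J"] by (intro exI[of _ J]) auto
  qed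
  have nb: "at x within {1..} \<noteq> bot" if "x \<in> {1..}" for x :: real
    by (rule interval_at_within_neq_bot[of _ 1 2]) (use that in auto)
  have CQ: "Cw k {1..} curvature_sq" and CG: "Cw k {1..} gradient_sq" for k
    by (rule Cw_locally[OF nb]; use loc in blast)+
  \<comment> \<open>The shift moves the singular level 1 to the origin, where the initial value
    problem was solved.\<close>
  let ?sh = "\<lambda>z::real. 1 + z"
  have sh: "Cw k {0..} ?sh" "?sh ` {0..} \<subseteq> {1..}" for k by (auto intro!: Cw_add)
  obtain F F1 F2 where F: "\<And>j. Cw j {0..} F" "\<And>z. z \<ge> 0 \<Longrightarrow> (F has_vector_derivative F1 z) (at z within {0..})"
    "\<And>z. z \<ge> 0 \<Longrightarrow> (F1 has_vector_derivative F2 z) (at z within {0..})"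
    "\<And>z. z \<ge> 0 \<Longrightarrow> gradient_sq (1 + z) * F2 z + 2 * (m1 + m2 - 1) * F1 z + curvature_sq (1 + z) * F z = K * exp (- sqrt 2 * F z)"
  proof (rule singular_exponential_ode[where G = "\<lambda>z. gradient_sq (1 + z)" and Q = "\<lambda>z. curvature_sq (1 + z)" and k = "2 * (m1 + m2 - 1)" and ?g0.0 = "4 * (m1 + m2 - 1) / m1" and K = K])
    show "Cw j {0..} (\<lambda>z. gradient_sq (1 + z))" "Cw j {0..} (\<lambda>z. curvature_sq (1 + z))" for j
      by (rule Cw_compose_real[OF CG sh(1,2)], rule Cw_compose_real[OF CQ sh(1,2)])
    show "gradient_sq (1 + 0) = 0" using ad(11) by simp
    show "gradient_sq (1 + z) > 0" if "z > 0" for z using regular_level(1)[of "1 + z"] that by simp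
    show "((\<lambda>z. gradient_sq (1 + z)) has_real_derivative 4 * (m1 + m2 - 1) / m1) (at 0 within {0..})"
    proof -
      have "(\<lambda>z. 1 + z) ` {0..} = {1::real..}"
      proof -
        have "x \<in> (\<lambda>z. 1 + z) ` {0..}" if "x \<ge> 1" for x :: real using that by (intro image_eqI[of _ _ "x - 1"]) auto
        then show ?thesis by auto
      qed
      then have "(gradient_sq has_real_derivative 4 * (m1 + m2 - 1) / m1) (at (1 + 0) within (\<lambda>z. 1 + z) ` {0..})" using ad(12) by simp
      moreover have "((\<lambda>z::real. 1 + z) has_real_derivative 1) (at 0 within {0..})" by (auto intro!: derivative_eq_intros)
      ultimately show ?thesis using DERIV_image_chain[of gradient_sq _ "\<lambda>z. 1 + z" 0 "{0..}" 1] by (simp add: o_def)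
    qed
    show "0 < 4 * (m1 + m2 - 1) / m1" using m1(2) m2(2) by simp
    \<comment> \<open>This is \<open>m1 > 2\<close>: damping stronger than the slope of
      \<open>G\<close> at the singular point.\<close>
    show "4 * (m1 + m2 - 1) / m1 < 2 * (m1 + m2 - 1)" 
    proof -
      have "4 * (m1 + m2 - 1) < 2 * (m1 + m2 - 1) * m1"
        using mult_strict_left_mono[of 2 m1 "2 * (m1 + m2 - 1)"] m1(2) m2(2) by simp
      then show ?thesis using m1(2) by (simp add: divide_less_eq)
    qed
    show "K > 0" by (rule K)
  qed (rule that; assumption)
  let ?F = "\<lambda>H. F (H - 1)"
  have CF: "Cw k {1..} ?F" for k
    by (rule Cw_compose_real[OF F(1)]) (auto intro!: Cw_diff)
  have dsh: "((\<lambda>H. f (H - 1)) has_vector_derivative f' (H - 1)) (at H within {1..})"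
    if "\<And>z. z \<ge> 0 \<Longrightarrow> (f has_vector_derivative f' z) (at z within {0..})" "H \<in> {1..}" for f f' :: "real \<Rightarrow> real" and H
  proof -
    have "(f has_vector_derivative f' (H - 1)) (at (H - 1) within (\<lambda>H. H - 1) ` {1..})"
      by (rule has_vector_derivative_within_subset[OF that(1)]) (use that(2) in auto)
    moreover have "((\<lambda>H. H - 1) has_vector_derivative 1) (at H within {1..})"
      by (auto intro!: derivative_eq_intros)
    ultimately show ?thesis using vector_diff_chain_within[of "\<lambda>H. H - 1" 1 H "{1..}" f] by (simp add: o_def)
  qed
  show ?thesis
  proof (intro exI[of _ ?F] conjI ballI)
    fix p assume p: "p \<in> S"
    have p1: "p \<bullet> p \<ge> 1" using infdist_facts(2)[OF p] .
    obtain \<nu> where \<nu>: "unit_normal S p \<nu>" using unit_normal_exists[OF hyper p] by blast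
    have "laplace_beltrami S (\<lambda>q. ?F (q \<bullet> q)) p = 4 * (p \<bullet> p - (p \<bullet> \<nu>)\<^sup>2) * F2 (p \<bullet> p - 1) + 2 * (real DIM('a) - 1) * F1 (p \<bullet> p - 1)"
      by (rule laplace_beltrami_radial[OF minimal p \<nu>, of "{1..}"]) (use infdist_facts(2) dsh[OF F(2)] dsh[OF F(3)] in auto)
    also have "4 * (p \<bullet> p - (p \<bullet> \<nu>)\<^sup>2) = gradient_sq (p \<bullet> p)" by (rule gradient_sq_eq[OF p \<nu>, symmetric])
    finally show "laplace_beltrami S (\<lambda>q. ?F (q \<bullet> q)) p + (second_fundamental_form_norm S p)\<^sup>2 * ?F (p \<bullet> p) = K * exp (- sqrt 2 * ?F (p \<bullet> p))"
      using F(4)[of "p \<bullet> p - 1"] p1 by (simp add: dim curvature_sq_eq[OF p, symmetric])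
  next
    show "smooth_fun_on S (\<lambda>q. ?F (q \<bullet> q))"
      unfolding smooth_fun_on_def
    proof
      fix p assume p: "p \<in> S"
      have "1 \<le> p \<bullet> p" by (rule infdist_facts(2)[OF p])
      then consider "p \<bullet> p > 1" | "p \<bullet> p = 1" by linarith
      then show "\<exists>U g. open U \<and> p \<in> U \<and> (\<forall>k. Ck_on k U g) \<and> (\<forall>q\<in>S \<inter> U. ?F (q \<bullet> q) = g q)"
      proof cases
        case 1
        have o: "open {q::'a. 1 < q \<bullet> q}" by (intro open_Collect_less continuous_intros)
        have "Ck_on k {q::'a. 1 < q \<bullet> q} (\<lambda>q. ?F (q \<bullet> q))" for k
          by (rule Ck_compose_Cw[OF o CF Ck_on_inner[OF o Ck_on_linear[OF o bounded_linear_ident] Ck_on_linear[OF o bounded_linear_ident]]]) auto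
        then show ?thesis using o 1 by (intro exI[of _ "{q::'a. 1 < q \<bullet> q}"] exI[of _ "\<lambda>q. ?F (q \<bullet> q)"]) auto
      next
        case 2
        \<comment> \<open>Ambient points near the axis may have \<open>q \<bullet> q < 1\<close>,
          where \<open>?F\<close> is not controlled. The extension therefore uses
          \<open>hh (P1 q \<bullet> P1 q)\<close>, which is at least 1 on all of \<open>N\<close>
          and equals \<open>q \<bullet> q\<close> on \<open>S\<close>.\<close>
        have c: "Cw k {0..<b} (\<lambda>a. ?F (hh a))" for k
          by (rule Cw_compose_real[OF CF ad(4)]) (use ad(5) in auto)
        have "Ck_on k N (\<lambda>q. ?F (hh (P1 q \<bullet> P1 q)))" for k
          by (rule Ck_compose_Cw[OF ad(1) c Ck_on_inner[OF ad(1) Ck_on_linear[OF ad(1) bl(1)] Ck_on_linear[OF ad(1) bl(1)]]]) (use ad(6) in auto)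
        then show ?thesis using ad(1) ad(2)[OF p 2] ad(7)
          by (intro exI[of _ N] exI[of _ "\<lambda>q. ?F (hh (P1 q \<bullet> P1 q))"]) auto
      qed
    qed
  qed
qed

end


section \<open>The two Lawson hypersurfaces as instances\<close>

lemma trace_fst: "(\<Sum>b\<in>Basis. ((fst b, 0) :: (real^'m) \<times> (real^'n)) \<bullet> b) = real CARD('m)"
  and trace_snd: "(\<Sum>b\<in>Basis. ((0, snd b) :: (real^'m) \<times> (real^'n)) \<bullet> b) = real CARD('n)"
proof -
  have B: "(\<Sum>b\<in>(Basis :: ((real^'m) \<times> (real^'n)) set). h b) = (\<Sum>u\<in>Basis. h (u, 0)) + (\<Sum>v\<in>Basis. h (0, v))"
    for h :: "(real^'m) \<times> (real^'n) \<Rightarrow> real"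
  proof -
    have "(\<Sum>b\<in>(\<lambda>u. (u, 0)) ` (Basis :: (real^'m) set) \<union> (\<lambda>v. (0, v)) ` (Basis :: (real^'n) set). h b) =
        (\<Sum>b\<in>(\<lambda>u. (u, 0)) ` (Basis :: (real^'m) set). h b) + (\<Sum>b\<in>(\<lambda>v. (0, v)) ` (Basis :: (real^'n) set). h b)"
      by (rule sum.union_disjoint) auto
    also have "(\<Sum>b\<in>(\<lambda>u. (u, 0)) ` (Basis :: (real^'m) set). h b) = (\<Sum>u\<in>Basis. h (u, 0))"
      by (subst sum.reindex) (simp_all add: inj_on_def)
    also have "(\<Sum>b\<in>(\<lambda>v. (0, v)) ` (Basis :: (real^'n) set). h b) = (\<Sum>v\<in>Basis. h (0, v))"
      by (subst sum.reindex) (simp_all add: inj_on_def)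
    finally show ?thesis by (simp only: Basis_prod_def)
  qed
  show "(\<Sum>b\<in>Basis. ((fst b, 0) :: (real^'m) \<times> (real^'n)) \<bullet> b) = real CARD('m)"
    by (subst B) simp
  show "(\<Sum>b\<in>Basis. ((0, snd b) :: (real^'m) \<times> (real^'n)) \<bullet> b) = real CARD('n)"
    by (subst B) simp
qed

lemma projections_Pair:
  "projections (\<lambda>z :: 'a::euclidean_space \<times> 'b::euclidean_space. (fst z, 0)) (\<lambda>z. (0, snd z))"
  by standard (auto intro!: linearI simp: prod_eq_iff)

text \<open>A pair of reflections exchanging the components of \<open>p\<close> with those of
  \<open>q\<close> belongs to the group.\<close>

lemma O_invariant_set_radial:
  fixes S :: "((real^'m) \<times> (real^'n)) set"
  assumes "O_invariant_set S" "p \<in> S" "norm (fst q) = norm (fst p)" "norm (snd q) = norm (snd p)"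
  shows "q \<in> S"
proof -
  let ?f = "reflect (fst p - fst q)" and ?g = "reflect (snd p - snd q)"
  have "map_prod ?f ?g ` S = S"
    by (rule assms(1)[unfolded O_invariant_set_def, rule_format, OF reflect_orthogonal reflect_orthogonal])
  moreover have "map_prod ?f ?g p = q"
    using reflect_swap[of "fst p" "fst q"] reflect_swap[of "snd p" "snd q"] assms(3,4) by (simp add: prod_eq_iff)
  ultimately show ?thesis using assms(2) by (metis imageI)
qed

lemma lawson_plus_radial_minimal:
  fixes S :: "((real^'m) \<times> (real^'n)) set"
  assumes "CARD('m) \<ge> 3" "CARD('n) \<ge> 3" "lawson_hypersurface lawson_plus S"
  shows "radial_minimal (\<lambda>z. (fst z, 0)) (\<lambda>z. (0, snd z)) S (axis undefined 1, 0) (0, axis undefined 1)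
    (real CARD('m)) (real CARD('n)) ((real CARD('m) - 1) / (real CARD('n) - 1))"
proof -
  interpret pr: projections "\<lambda>z :: (real^'m) \<times> (real^'n). (fst z, 0)" "\<lambda>z. (0, snd z)" by (rule projections_Pair)
  have l: "minimal_hypersurface S" "S \<subseteq> lawson_plus" "asymptotic_at_infinity S lawson_cone" "infdist 0 S = 1" "O_invariant_set S"
    using assms(3) by (auto simp: lawson_hypersurface_def)
  have C: "{p :: (real^'m) \<times> (real^'n). (norm (fst p, 0 :: real^'n))\<^sup>2 = (real CARD('m) - 1) / (real CARD('n) - 1) * (norm (0 :: real^'m, snd p))\<^sup>2} = lawson_cone"
    by (auto simp: lawson_cone_def)
  show ?thesis
  proof unfold_locales
    show "pr.radial_set S" unfolding pr.radial_set_def using O_invariant_set_radial[OF l(5)] by auto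
    fix p assume "p \<in> S"
    then have "p \<in> lawson_plus" using l(2) by blast
    then show "(norm (fst p, 0 :: real^'n))\<^sup>2 < (real CARD('m) - 1) / (real CARD('n) - 1) * (norm (0 :: real^'m, snd p))\<^sup>2"
      by (simp add: lawson_plus_def case_prod_unfold)
  next
    show "asymptotic_at_infinity S {p. (norm (fst p, 0 :: real^'n))\<^sup>2 = (real CARD('m) - 1) / (real CARD('n) - 1) * (norm (0 :: real^'m, snd p))\<^sup>2}"
      unfolding C by (rule l(3))
  qed (use assms l trace_fst trace_snd in auto)
qed

lemma lawson_minus_radial_minimal:
  fixes S :: "((real^'m) \<times> (real^'n)) set"
  assumes "CARD('m) \<ge> 3" "CARD('n) \<ge> 3" "lawson_hypersurface lawson_minus S"
  shows "radial_minimal (\<lambda>z. (0, snd z)) (\<lambda>z. (fst z, 0)) S (0, axis undefined 1) (axis undefined 1, 0)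
    (real CARD('n)) (real CARD('m)) ((real CARD('n) - 1) / (real CARD('m) - 1))"
proof -
  interpret pr: projections "\<lambda>z :: (real^'m) \<times> (real^'n). (0, snd z)" "\<lambda>z. (fst z, 0)"
    by (rule projections.swapped[OF projections_Pair])
  have l: "minimal_hypersurface S" "S \<subseteq> lawson_minus" "asymptotic_at_infinity S lawson_cone" "infdist 0 S = 1" "O_invariant_set S"
    using assms(3) by (auto simp: lawson_hypersurface_def)
  have C: "{p :: (real^'m) \<times> (real^'n). (norm (0 :: real^'m, snd p))\<^sup>2 = (real CARD('n) - 1) / (real CARD('m) - 1) * (norm (fst p, 0 :: real^'n))\<^sup>2} = lawson_cone"
    using assms(1,2) by (auto simp: lawson_cone_def field_simps)
  show ?thesis
  proof unfold_locales
    show "pr.radial_set S" unfolding pr.radial_set_def using O_invariant_set_radial[OF l(5)] by auto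
    fix p assume "p \<in> S"
    then have "p \<in> lawson_minus" using l(2) by blast
    then show "(norm (0 :: real^'m, snd p))\<^sup>2 < (real CARD('n) - 1) / (real CARD('m) - 1) * (norm (fst p, 0 :: real^'n))\<^sup>2"
      using assms(1,2) by (simp add: lawson_minus_def case_prod_unfold field_simps)
  next
    show "asymptotic_at_infinity S {p. (norm (0 :: real^'m, snd p))\<^sup>2 = (real CARD('n) - 1) / (real CARD('m) - 1) * (norm (fst p, 0 :: real^'n))\<^sup>2}"
      unfolding C by (rule l(3))
  qed (use assms l trace_fst trace_snd in auto)
qed

theorem theorem1p2:
  fixes S :: "((real^'m::finite) \<times> (real^'n::finite)) set" and a :: real
  assumes "CARD('m) \<ge> 3" and "CARD('n) \<ge> 3" and "CARD('m) + CARD('n) \<ge> 8"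
    and "a > 0"
    and "lawson_hypersurface lawson_plus S \<or> lawson_hypersurface lawson_minus S"
  shows "\<exists>\<delta>0>0. \<forall>\<delta>. 0 < \<delta> \<and> \<delta> \<le> \<delta>0 \<longrightarrow>
    (\<exists>w :: (real^'m) \<times> (real^'n) \<Rightarrow> real.
       smooth_fun_on S w \<and> O_invariant_fun_on S w \<and>
       (\<forall>p\<in>S. \<delta> * (laplace_beltrami S w p + (second_fundamental_form_norm S p)\<^sup>2 * w p)
                = 2 * a * exp (- sqrt 2 * w p)))"
\<comment> \<open>The witness 1 is arbitrary: \<open>radial_solution\<close> is applied with
  \<open>K = 2 * a / \<delta>\<close> for whatever positive \<open>\<delta>\<close> is
  given.\<close>
proof (intro exI[of _ 1] conjI allI impI)
  fix \<delta> :: real assume "0 < \<delta> \<and> \<delta> \<le> 1"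
  then have \<delta>: "\<delta> > 0" and K: "2 * a / \<delta> > 0" using assms(4) by auto
  have "\<exists>F. smooth_fun_on S (\<lambda>q. F (q \<bullet> q)) \<and>
    (\<forall>p\<in>S. laplace_beltrami S (\<lambda>q. F (q \<bullet> q)) p + (second_fundamental_form_norm S p)\<^sup>2 * F (p \<bullet> p) = 2 * a / \<delta> * exp (- sqrt 2 * F (p \<bullet> p)))"
    using assms(5) radial_minimal.radial_solution[OF lawson_plus_radial_minimal[OF assms(1,2)] K]
      radial_minimal.radial_solution[OF lawson_minus_radial_minimal[OF assms(1,2)] K] by blast
  then obtain F where F: "smooth_fun_on S (\<lambda>q. F (q \<bullet> q))"
    "\<And>p. p \<in> S \<Longrightarrow> laplace_beltrami S (\<lambda>q. F (q \<bullet> q)) p + (second_fundamental_form_norm S p)\<^sup>2 * F (p \<bullet> p) = 2 * a / \<delta> * exp (- sqrt 2 * F (p \<bullet> p))"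
    by blast
  show "\<exists>w :: (real^'m) \<times> (real^'n) \<Rightarrow> real. smooth_fun_on S w \<and> O_invariant_fun_on S w \<and>
       (\<forall>p\<in>S. \<delta> * (laplace_beltrami S w p + (second_fundamental_form_norm S p)\<^sup>2 * w p) = 2 * a * exp (- sqrt 2 * w p))"
  proof (intro exI[of _ "\<lambda>q. F (q \<bullet> q)"] conjI ballI F(1))
    show "O_invariant_fun_on S (\<lambda>q. F (q \<bullet> q))"
      by (auto simp: O_invariant_fun_on_def orthogonal_transformation_def)
  qed (use F(2) \<delta> in simp)
qed simp

end
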